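(* Let $$G(x,y,a,b,c)=(x^2+y^3+ax+by+cy^2,\; xy)$$ be the topologically $\mathcal{A}_e$-versal unfolding, with parameters $(a,b,c)\in\mathbb{R}^3$, of the map-germ $I_{2,3}:(x,y)\mapsto(x^2+y^3,xy)$. Then the bifurcation diagram $\mathcal{B}_G$ consists of three components corresponding to the types beaks/lips, swallowtail and cusp+fold. Each stratum is explicitly parametrized as follows. 1. Sharksfin: the $c$-axis with $c>0$. 2. Deltoid: the $c$-axis with $c<0$. 3. Beaks/Lips: the surface with $A_3$-singularity at the origin whose double point curve is the locus of sharksfin; parametrized by $$(a,b,c)=\bigl(\pm 4y\sqrt{c+3y},\; -y(4c+9y),\; c\bigr).$$ 4. Goose: the cuspidal edge of the beaks/lips locus, parametrized by $$\Bigl(\pm\tfrac{8}{9\sqrt3}\,c^{3/2},\;\tfrac49 c^2,\; c\Bigr)\quad\text{with } c>0.$$ 5. Swallowtail: the surface which contains the $a$-axis and the sharksfin locus; parametrized by $$(a,b,c)=\bigl(\pm y(4c+15y)(c+4y)^{-1/2},\; -2y(2c+5y),\; c\bigr).$$ 6. Butterfly: the cuspidal edge of the swallowtail locus, parametrized by $$\Bigl(\pm\tfrac{1}{\sqrt5}\,c^{3/2},\;\tfrac25 c^2,\; c\Bigr)\quad\text{with } c>0.$$ 7. Cusp+Fold: the surface with $A_3$-singularity at the origin whose cuspidal edge is the butterfly locus; parametrized by $$(a,b,c)=\Bigl(\pm\tfrac12\sqrt{-y}\,(3c+5y),\;\tfrac14(c^2-6cy-15y^2),\; c\Bigr)\quad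 (y<0).$$
   Context: Two $C^\infty$ map-germs $f,g:(\mathbb{R}^2,0)\to(\mathbb{R}^2,0)$ are $\mathcal{A}$-equivalent if $g=\tau\circ f\circ\sigma^{-1}$ for diffeomorphism-germs $\sigma,\tau$ of source and target; similarly for multi-germs. For parameters $(a,b,c)$ near the origin put $G_{a,b,c}=G(\cdot,\cdot,a,b,c)$, a map from a small neighbourhood of the origin in $\mathbb{R}^2$ to $\mathbb{R}^2$. The map $G_{a,b,c}$ is stable if its only singularities are folds, cusps and double folds (bi-germs). The bifurcation diagram $\mathcal{B}_G\subset\mathbb{R}^3$ is the set of parameters $(a,b,c)$ for which $G_{a,b,c}$ has an unstable mono- or multi-singularity at some points. The germ $I_{2,3}$ belongs to an $\mathcal{A}$-moduli stratum $(x^2+y^3+\alpha xy^2+\beta y^4+\cdots,xy)$ which is open and dense in its $\mathcal{K}$-orbit and has a unique topological $\mathcal{A}$-type; $G$ corresponds to a normal slice to this stratum, and this is the sense in which it is topologically $\mathcal{A}_e$-versal. Corank one types. For $f=(f_1,f_2)$ let $\lambda=\partial(f_1,f_2)/\partial(x,y)$ be the Jacobian determinant, $\eta$ a non-vanishing vector field spanning $\ker df$ at every singular point ($\lambda=0$), $\eta^k\lambda$ the iterated derivatives, $H_\lambda$ the Hessian matrix of $\lambda$, and, when $\operatorname{rank}H_\lambda(0)=1$, $\theta$ a vector field with $\theta(0)$ spanning $\ker H_\lambda(0)$. At the singular point $0$: - fold: $\eta\lambda\ne0$; - cusp: $d\lambda\neq0$, $\eta\lambda=0$, $\eta^2\lambda\ne0$;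 - swallowtail: $d\lambda\ne0$, $\eta\lambda=\eta^2\lambda=0$, $\eta^3\lambda\neq0$; - lips: $d\lambda=0$, $\det H_\lambda>0$; - beaks: $d\lambda=0$, $\det H_\lambda<0$, $\eta^2\lambda\ne0$; - butterfly: $d\lambda\ne0$, $\eta\lambda=\eta^2\lambda=\eta^3\lambda=0$, $\eta^4\lambda\ne0$; - goose: $d\lambda=0$, $\operatorname{rank}H_\lambda=1$, $\eta^2\lambda\ne0$, $\theta^3\lambda\neq0$. Corank two types (differential zero at the point), up to $\mathcal{A}$-equivalence: sharksfin $(x^2+y^3,\,y^2+x^3)$; deltoid $(x^2-y^2+x^3,\,xy)$. Cusp+fold is the bi-germ formed by a cusp point and a fold point with the same image. An $A_3$-singularity of a surface at a point means that the surface germ there is diffeomorphic to the standard swallowtail surface, the image of $(u,v)\mapsto(3u^4+u^2v,\,4u^3+2uv,\,v)$ at $0$.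
   Formalization: The bifurcation diagram is the three surfaces together with the deltoid half-axis (c<0), which lies on none of them; surfaces are closures of strata and of parametrized images, and each open stratum is its surface minus lower strata (including the beaks+fold curve c=-7y). *)

theory Defs
  imports "HOL-Analysis.Analysis"
begin

section \<open>Smooth maps on open sets\<close>

text \<open>\<open>Ck_on k S f\<close>: all iterated directional derivatives of order at most \<open>k\<close> exist on \<open>S\<close>
  (as Frechet derivatives) and are continuous. It is used only for open \<open>S\<close>.\<close>

fun Ck_on :: "nat \<Rightarrow> 'a::euclidean_space set \<Rightarrow> ('a \<Rightarrow> 'b::euclidean_space) \<Rightarrow> bool" where
  "Ck_on 0 S f \<longleftrightarrow> continuous_on S f"
| "Ck_on (Suc k) S f \<longleftrightarrow>
     (\<forall>x\<in>S. f differentiable (at x)) \<and> (\<forall>v. Ck_on k S (\<lambda>x. frechet_derivative f (at x) v))"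

definition smooth_on :: "'a::euclidean_space set \<Rightarrow> ('a \<Rightarrow> 'b::euclidean_space) \<Rightarrow> bool" where
  "smooth_on S f \<longleftrightarrow> (\<forall>k. Ck_on k S f)"

definition diffeo ::
    "'a::euclidean_space set \<Rightarrow> 'b::euclidean_space set \<Rightarrow> ('a \<Rightarrow> 'b) \<Rightarrow> ('b \<Rightarrow> 'a) \<Rightarrow> bool" where
  "diffeo M N \<phi> \<psi> \<longleftrightarrow> open M \<and> open N \<and> homeomorphism M N \<phi> \<psi> \<and> smooth_on M \<phi> \<and> smooth_on N \<psi>"

type_synonym plane = "real \<times> real"
type_synonym space = "real \<times> real \<times> real"

text \<open>The germ of \<open>f\<close> at \<open>p\<close> and the germ of \<open>g\<close> at \<open>q\<close>: \<open>g = \<tau> \<circ> f \<circ> \<sigma>\<^sup>-\<^sup>1\<close> near \<open>q\<close>.\<close>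

definition A_equivalent :: "(plane \<Rightarrow> plane) \<Rightarrow> plane \<Rightarrow> (plane \<Rightarrow> plane) \<Rightarrow> plane \<Rightarrow> bool" where
  "A_equivalent f p g q \<longleftrightarrow>
     (\<exists>N N' \<sigma> \<sigma>' M M' \<tau> \<tau>'.
        diffeo N N' \<sigma> \<sigma>' \<and> p \<in> N \<and> \<sigma> p = q \<and>
        diffeo M M' \<tau> \<tau>' \<and> f ` N \<subseteq> M \<and> \<tau> (f p) = g q \<and>
        (\<forall>z\<in>N'. g z = \<tau> (f (\<sigma>' z))))"

section \<open>Singularities of maps from the plane to the plane\<close>

definition dx :: "(plane \<Rightarrow> 'b::real_normed_vector) \<Rightarrow> plane \<Rightarrow> 'b" where
  "dx g p = frechet_derivative g (at p) (1, 0)"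

definition dy :: "(plane \<Rightarrow> 'b::real_normed_vector) \<Rightarrow> plane \<Rightarrow> 'b" where
  "dy g p = frechet_derivative g (at p) (0, 1)"

definition jac :: "(plane \<Rightarrow> plane) \<Rightarrow> plane \<Rightarrow> real" where
  "jac f p = det (vector [vector [fst (dx f p), fst (dy f p)],
                          vector [snd (dx f p), snd (dy f p)]] :: real^2^2)"

definition hessian :: "(plane \<Rightarrow> real) \<Rightarrow> plane \<Rightarrow> real^2^2" where
  "hessian g p = vector [vector [dx (dx g) p, dy (dx g) p],
                         vector [dx (dy g) p, dy (dy g) p]]"

text \<open>The derivative \<open>\<xi>g\<close> of a function \<open>g\<close> along a vector field \<open>\<xi>\<close>; the iterated derivative
  \<open>\<xi>\<^sup>k g\<close> is \<open>(along \<xi> ^^ k) g\<close>.\<close>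

definition along :: "(plane \<Rightarrow> plane) \<Rightarrow> (plane \<Rightarrow> real) \<Rightarrow> plane \<Rightarrow> real" where
  "along \<xi> g = (\<lambda>q. frechet_derivative g (at q) (\<xi> q))"

definition critical :: "(plane \<Rightarrow> real) \<Rightarrow> plane \<Rightarrow> bool" where
  "critical g p \<longleftrightarrow> frechet_derivative g (at p) = (\<lambda>v. 0)"

text \<open>Near a singular point \<open>p\<close>, \<open>\<eta>\<close> is nowhere zero and spans the kernel of \<open>df\<close> at every
  singular point. For a singular \<open>p\<close> the existence of such an \<open>\<eta>\<close> forces \<open>f\<close> to have corank one
  at \<open>p\<close>, so the types below defined through \<open>\<eta>\<close> are corank one types.\<close>

definition null_field :: "(plane \<Rightarrow> plane) \<Rightarrow> plane \<Rightarrow> (plane \<Rightarrow> plane) \<Rightarrow> bool" where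
  "null_field f p \<eta> \<longleftrightarrow> jac f p = 0 \<and>
     (\<exists>N. open N \<and> p \<in> N \<and> smooth_on N \<eta> \<and> (\<forall>q\<in>N. \<eta> q \<noteq> 0) \<and>
        (\<forall>q\<in>N. jac f q = 0 \<longrightarrow> span {\<eta> q} = {v. frechet_derivative f (at q) v = 0}))"

definition fold_pt :: "(plane \<Rightarrow> plane) \<Rightarrow> plane \<Rightarrow> bool" where
  "fold_pt f p \<longleftrightarrow> (\<exists>\<eta>. null_field f p \<eta> \<and> along \<eta> (jac f) p \<noteq> 0)"

definition cusp_pt :: "(plane \<Rightarrow> plane) \<Rightarrow> plane \<Rightarrow> bool" where
  "cusp_pt f p \<longleftrightarrow> (\<exists>\<eta>. null_field f p \<eta> \<and> \<not> critical (jac f) p \<and>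
     along \<eta> (jac f) p = 0 \<and> (along \<eta> ^^ 2) (jac f) p \<noteq> 0)"

definition swallowtail_pt :: "(plane \<Rightarrow> plane) \<Rightarrow> plane \<Rightarrow> bool" where
  "swallowtail_pt f p \<longleftrightarrow> (\<exists>\<eta>. null_field f p \<eta> \<and> \<not> critical (jac f) p \<and>
     along \<eta> (jac f) p = 0 \<and> (along \<eta> ^^ 2) (jac f) p = 0 \<and> (along \<eta> ^^ 3) (jac f) p \<noteq> 0)"

definition butterfly_pt :: "(plane \<Rightarrow> plane) \<Rightarrow> plane \<Rightarrow> bool" where
  "butterfly_pt f p \<longleftrightarrow> (\<exists>\<eta>. null_field f p \<eta> \<and> \<not> critical (jac f) p \<and>
     along \<eta> (jac f) p = 0 \<and> (along \<eta> ^^ 2) (jac f) p = 0 \<and>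
     (along \<eta> ^^ 3) (jac f) p = 0 \<and> (along \<eta> ^^ 4) (jac f) p \<noteq> 0)"

definition lips_pt :: "(plane \<Rightarrow> plane) \<Rightarrow> plane \<Rightarrow> bool" where
  "lips_pt f p \<longleftrightarrow> (\<exists>\<eta>. null_field f p \<eta> \<and> critical (jac f) p \<and> det (hessian (jac f) p) > 0)"

definition beaks_pt :: "(plane \<Rightarrow> plane) \<Rightarrow> plane \<Rightarrow> bool" where
  "beaks_pt f p \<longleftrightarrow> (\<exists>\<eta>. null_field f p \<eta> \<and> critical (jac f) p \<and> det (hessian (jac f) p) < 0 \<and>
     (along \<eta> ^^ 2) (jac f) p \<noteq> 0)"

definition goose_pt :: "(plane \<Rightarrow> plane) \<Rightarrow> plane \<Rightarrow> bool" where
  "goose_pt f p \<longleftrightarrow> (\<exists>\<eta> \<theta> N. null_field f p \<eta> \<and> critical (jac f) p \<and>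
     rank (hessian (jac f) p) = 1 \<and> (along \<eta> ^^ 2) (jac f) p \<noteq> 0 \<and>
     open N \<and> p \<in> N \<and> smooth_on N \<theta> \<and>
     span {vector [fst (\<theta> p), snd (\<theta> p)]} = {v. hessian (jac f) p *v v = 0} \<and>
     (along \<theta> ^^ 3) (jac f) p \<noteq> 0)"

definition sharksfin_pt :: "(plane \<Rightarrow> plane) \<Rightarrow> plane \<Rightarrow> bool" where
  "sharksfin_pt f p \<longleftrightarrow> A_equivalent f p (\<lambda>(x, y). (x^2 + y^3, y^2 + x^3)) (0, 0)"

definition deltoid_pt :: "(plane \<Rightarrow> plane) \<Rightarrow> plane \<Rightarrow> bool" where
  "deltoid_pt f p \<longleftrightarrow> A_equivalent f p (\<lambda>(x, y). (x^2 - y^2 + x^3, x * y)) (0, 0)"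

text \<open>Two fold points with the same image at which the two branches of the critical value set
  (the tangent line of a branch being the range of the differential) cross transversely.\<close>

definition double_fold :: "(plane \<Rightarrow> plane) \<Rightarrow> plane \<Rightarrow> plane \<Rightarrow> bool" where
  "double_fold f p q \<longleftrightarrow> p \<noteq> q \<and> f p = f q \<and> fold_pt f p \<and> fold_pt f q \<and>
     range (frechet_derivative f (at p)) \<noteq> range (frechet_derivative f (at q))"

text \<open>The multi-germ of \<open>f\<close> at a finite set \<open>S\<close> of singular points with common image.
  Mono-germs are the case of a singleton \<open>S\<close>.\<close>

definition multi_singularity :: "(plane \<Rightarrow> plane) \<Rightarrow> plane set \<Rightarrow> bool" where
  "multi_singularity f S \<longleftrightarrow> finite S \<and> S \<noteq> {} \<and> (\<forall>p\<in>S. jac f p = 0) \<and> (\<forall>p\<in>S. \<forall>q\<in>S. f p = f q)"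

definition stable_singularity :: "(plane \<Rightarrow> plane) \<Rightarrow> plane set \<Rightarrow> bool" where
  "stable_singularity f S \<longleftrightarrow>
     (\<exists>p. S = {p} \<and> (fold_pt f p \<or> cusp_pt f p)) \<or> (\<exists>p q. S = {p, q} \<and> double_fold f p q)"

section \<open>The family and its bifurcation diagram\<close>

definition G :: "real \<Rightarrow> real \<Rightarrow> real \<Rightarrow> plane \<Rightarrow> plane" where
  "G a b c = (\<lambda>(x, y). (x^2 + y^3 + a*x + b*y + c*y^2, x*y))"

text \<open>In all loci, \<open>U\<close> is the domain in the source plane to which the maps are restricted.\<close>

definition bifurcation_diagram :: "plane set \<Rightarrow> space set" where
  "bifurcation_diagram U =
     {(a, b, c). \<exists>S\<subseteq>U. multi_singularity (G a b c) S \<and> \<not> stable_singularity (G a b c) S}"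

definition locus :: "((plane \<Rightarrow> plane) \<Rightarrow> plane \<Rightarrow> bool) \<Rightarrow> plane set \<Rightarrow> space set" where
  "locus T U = {(a, b, c). \<exists>p\<in>U. T (G a b c) p}"

definition bi_locus ::
    "((plane \<Rightarrow> plane) \<Rightarrow> plane \<Rightarrow> bool) \<Rightarrow> ((plane \<Rightarrow> plane) \<Rightarrow> plane \<Rightarrow> bool) \<Rightarrow> plane set \<Rightarrow> space set" where
  "bi_locus T1 T2 U = {(a, b, c). \<exists>p\<in>U. \<exists>q\<in>U.
     p \<noteq> q \<and> G a b c p = G a b c q \<and> T1 (G a b c) p \<and> T2 (G a b c) q}"

abbreviation "sharksfin_locus \<equiv> locus sharksfin_pt"
abbreviation "deltoid_locus \<equiv> locus deltoid_pt"
abbreviation "beaks_lips_locus \<equiv> locus (\<lambda>f p. beaks_pt f p \<or> lips_pt f p)"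
abbreviation "goose_locus \<equiv> locus goose_pt"
abbreviation "swallowtail_locus \<equiv> locus swallowtail_pt"
abbreviation "butterfly_locus \<equiv> locus butterfly_pt"
abbreviation "cusp_fold_locus \<equiv> bi_locus cusp_pt fold_pt"
abbreviation "beaks_fold_locus \<equiv> bi_locus beaks_pt fold_pt"

text \<open>The images of the parametrizations of the two-dimensional strata, with the parameters
  ranging over all values for which the formulas make sense (and \<open>y < 0\<close> in the last one).\<close>

definition beaks_lips_param :: "space set" where
  "beaks_lips_param =
     {(\<epsilon> * (4 * y * sqrt (c + 3*y)), - y * (4*c + 9*y), c) | \<epsilon> y c.
        \<epsilon> \<in> {1, -1} \<and> c + 3*y \<ge> 0}"

definition swallowtail_param :: "space set" where
  "swallowtail_param =
     {(\<epsilon> * (y * (4*c + 15*y) * (c + 4*y) powr (-1/2)), - 2 * y * (2*c + 5*y), c) | \<epsilon> y c.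
        \<epsilon> \<in> {1, -1} \<and> c + 4*y > 0}"

definition cusp_fold_param :: "space set" where
  "cusp_fold_param =
     {(\<epsilon> * (1/2 * sqrt (- y) * (3*c + 5*y)), 1/4 * (c^2 - 6*c*y - 15*y^2), c) | \<epsilon> y c.
        \<epsilon> \<in> {1, -1} \<and> y < 0}"

section \<open>Germs of surfaces in space\<close>

definition germ_diffeomorphic :: "space set \<Rightarrow> space \<Rightarrow> space set \<Rightarrow> space \<Rightarrow> bool" where
  "germ_diffeomorphic S p T q \<longleftrightarrow>
     (\<exists>W W' \<phi> \<psi>. diffeo W W' \<phi> \<psi> \<and> p \<in> W \<and> \<phi> p = q \<and> \<phi> ` (S \<inter> W) = T \<inter> W')"

text \<open>The standard swallowtail and cuspidal edge are closed and only \<open>(u, v) = (0, 0)\<close> is mapped to the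
  origin, so their set germs at \<open>0\<close> are the images of the corresponding map germs.\<close>

definition has_A3_singularity :: "space set \<Rightarrow> space \<Rightarrow> bool" where
  "has_A3_singularity S p \<longleftrightarrow>
     germ_diffeomorphic S p {(3 * u^4 + u^2 * v, 4 * u^3 + 2 * u * v, v) | u v. True} 0"

definition cuspidal_edge :: "space set \<Rightarrow> space set" where
  "cuspidal_edge S = {p. germ_diffeomorphic S p {(u^2, u^3, v) | u v. True} 0}"

definition double_point_curve :: "space set \<Rightarrow> space set" where
  "double_point_curve S = {p. germ_diffeomorphic S p {(x, y, z). x * y = 0} 0}"

end

theory Submission
  imports Defs
begin

text \<open>The types do not depend on the choice of the null field, and outside the origin \<open>(x, - y)\<close> is a null
  field of \<open>G a b c\<close>, so each corank one type is a system of polynomial equations and inequalities in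
  \<open>(x, y, a, b, c)\<close>. In terms of \<open>r = - x / y\<close> or \<open>r = x / y\<close> the systems are solved rationally; for
  cusp+fold the parameter is the square root \<open>s\<close> of minus the \<open>y\<close>-coordinate of the cusp. Quadratic coordinate
  changes of the parameter space take the beaks/lips and the cusp+fold surface to the standard swallowtail,
  the set of quartics with a real double root. Its cuspidal edge and double point curve, and the cuspidal
  edge of the swallowtail component, are delimited from above by the velocities of curves in the
  surface, and realized by explicit local diffeomorphisms.

  On the \<open>c\<close>-axis the germ at the origin has corank two. For \<open>c < 0\<close> a linear change of coordinates
  gives the deltoid. For \<open>c > 0\<close> explicit changes of coordinates make the two branches of the critical set and
  of the critical values agree with those of the sharksfin germ, and the remaining difference is removed
  by a change of the source obtained from the implicit function theorem.\<close>

section \<open>Smooth calculus\<close>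

text \<open>Off the origin \<open>(x, - y)\<close> spans the kernel of the differential of the
  second component \<open>x * y\<close>, so it is tangent to the curves \<open>x * y = v\<close>.
  Substituting \<open>x = v / y\<close> turns the fibre over \<open>(u, v)\<close>,
  \<open>v \<noteq> 0\<close>, into roots of the quintic
  \<open>t^5 + c t^4 + b t^3 - u t^2 + a v t + v^2\<close>: a singular point is a multiple root, a
  singular point that is no fold a root of multiplicity at least three. This is why cusp+fold is
  rational, the quintic being \<open>(t - p)^3 (t - q)^2\<close>, and why three folds cannot meet.
  Two null fields are proportional on the critical curve only, so their orders have to be compared
  through derivatives tangent to that curve. The relevant singular points tend to the origin with
  the parameters; hence for small parameters they all lie in \<open>U\<close>, and the loci are cut
  out of global algebraic surfaces. The parametrization of the swallowtail component has the
  denominator \<open>r\<close> and misses the a-axis, which costs a separate proof of closedness and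
  separate charts.\<close>

lemma frechet_derivative_eqI:
  "(f has_derivative f') (at x) \<Longrightarrow> frechet_derivative f (at x) = f'"
  using frechet_derivative_at by metis

lemma Ck_on_transform:
  assumes "open S" "Ck_on k S f" "\<And>x. x \<in> S \<Longrightarrow> f x = g x"
  shows "Ck_on k S g"
  using assms(2,3)
proof (induction k arbitrary: f g)
  case 0
  then show ?case using continuous_on_eq by auto
next
  case (Suc k)
  have D: "(g has_derivative frechet_derivative f (at x)) (at x)" if "x \<in> S" for x
  proof -
    have "(f has_derivative frechet_derivative f (at x)) (at x)"
      using Suc.prems(1) that by (simp add: frechet_derivative_works)
    then show ?thesis
      by (rule has_derivative_transform_within_open[OF _ assms(1) that]) (use Suc.prems in auto)
  qed
  have "Ck_on k S (\<lambda>x. frechet_derivative g (at x) v)" for v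
  proof (rule Suc.IH)
    show "Ck_on k S (\<lambda>x. frechet_derivative f (at x) v)"
      using Suc.prems(1) by simp
  qed (simp add: frechet_derivative_eqI[OF D])
  then show ?case using D by (auto simp: differentiable_def)
qed

lemma Ck_on_subset: "Ck_on k S f \<Longrightarrow> T \<subseteq> S \<Longrightarrow> Ck_on k T f"
  by (induction k arbitrary: f) (auto intro: continuous_on_subset)

text \<open>Lets an explicit formula for the derivative replace \<open>frechet_derivative\<close>,
  so that inductions on the order can differentiate by rule.\<close>

lemma Ck_on_SucI:
  assumes "open S" "\<And>x. x \<in> S \<Longrightarrow> (f has_derivative D x) (at x)" "\<And>v. Ck_on k S (\<lambda>x. D x v)"
  shows "Ck_on (Suc k) S f"
  unfolding Ck_on.simps
proof (intro conjI ballI allI)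
  fix v
  show "Ck_on k S (\<lambda>x. frechet_derivative f (at x) v)"
    by (rule Ck_on_transform[OF assms(1) assms(3)[of v]]) (simp add: frechet_derivative_eqI[OF assms(2)])
qed (use assms(2) in \<open>auto simp: differentiable_def\<close>)

lemma Ck_on_SucD:
  assumes "Ck_on (Suc k) S f"
  shows "x \<in> S \<Longrightarrow> (f has_derivative frechet_derivative f (at x)) (at x)"
    and "Ck_on k S (\<lambda>x. frechet_derivative f (at x) v)"
  using assms by (auto simp: frechet_derivative_works)

lemma Ck_on_Suc_lower: "Ck_on (Suc k) S f \<Longrightarrow> Ck_on k S f"
proof (induction k arbitrary: f)
  case 0
  then show ?case
    by (auto intro!: continuous_at_imp_continuous_on differentiable_imp_continuous_within)
qed auto

lemma Ck_on_imp_continuous_on: "Ck_on k S f \<Longrightarrow> continuous_on S f"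
proof (induction k)
  case (Suc k)
  then show ?case using Ck_on_Suc_lower by blast
qed simp

lemma Ck_on_const: "Ck_on k S (\<lambda>x. c)"
  by (induction k arbitrary: c) auto

lemma Ck_on_add:
  assumes "open S" "Ck_on k S f" "Ck_on k S g"
  shows "Ck_on k S (\<lambda>x. f x + g x)"
  using assms(2,3)
proof (induction k arbitrary: f g)
  case (Suc k)
  show ?case
    by (rule Ck_on_SucI[OF assms(1)], rule has_derivative_add)
      (use Suc.prems in \<open>auto intro: Ck_on_SucD Suc.IH\<close>)
qed (auto intro: continuous_intros)

lemma Ck_on_linear:
  assumes "open S" "bounded_linear L" "Ck_on k S f"
  shows "Ck_on k S (\<lambda>x. L (f x))"
  using assms(3)
proof (induction k arbitrary: f)
  case 0
  then show ?case using bounded_linear.continuous_on[OF assms(2)] by auto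
next
  case (Suc k)
  show ?case
    by (rule Ck_on_SucI[OF assms(1)], rule bounded_linear.has_derivative[OF assms(2)])
      (use Suc.prems in \<open>auto intro: Ck_on_SucD Suc.IH\<close>)
qed

lemma Ck_on_bilinear:
  assumes "open S" "bounded_bilinear B" "Ck_on k S f" "Ck_on k S g"
  shows "Ck_on k S (\<lambda>x. B (f x) (g x))"
  using assms(3,4)
proof (induction k arbitrary: f g)
  case 0
  then show ?case using bounded_bilinear.continuous_on[OF assms(2)] by auto
next
  case (Suc k)
  note D = Suc.prems[THEN Ck_on_SucD(2)] and L = Suc.prems[THEN Ck_on_Suc_lower]
  show ?case
    by (rule Ck_on_SucI[OF assms(1)], rule bounded_bilinear.FDERIV[OF assms(2)])
      (auto intro!: Ck_on_add[OF assms(1)] Suc.IH D L Ck_on_SucD(1)[OF Suc.prems(1)] Ck_on_SucD(1)[OF Suc.prems(2)])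
qed

lemma Ck_on_sum:
  assumes "open S" "\<And>i. i \<in> I \<Longrightarrow> Ck_on k S (f i)"
  shows "Ck_on k S (\<lambda>x. \<Sum>i\<in>I. f i x)"
  using assms(2)
  by (induction I rule: infinite_finite_induct)
    (auto intro: Ck_on_const Ck_on_add[OF assms(1)])

lemma linear_eq_sum_Basis:
  fixes L :: "'a::euclidean_space \<Rightarrow> 'b::real_vector"
  assumes "linear L"
  shows "L v = (\<Sum>b\<in>Basis. (v \<bullet> b) *\<^sub>R L b)"
proof -
  have "L v = L (\<Sum>b\<in>Basis. (v \<bullet> b) *\<^sub>R b)" by (simp add: euclidean_representation)
  then show ?thesis by (simp add: linear_sum[OF assms] linear_scale[OF assms])
qed

text \<open>Orders of smoothness are tested on derivatives in fixed directions, but the chain rule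
  applies the derivative of \<open>g\<close> to the moving direction
  \<open>frechet_derivative f (at x) v\<close>. Expanding that direction in \<open>Basis\<close>
  leaves sums of products of functions of order \<open>k\<close>, to which the induction hypothesis
  applies.\<close>

lemma Ck_on_compose:
  assumes "open S" "open T" "Ck_on k S f" "Ck_on k T g" "f ` S \<subseteq> T"
  shows "Ck_on k S (\<lambda>x. g (f x))"
  using assms(3-5)
proof (induction k arbitrary: f g)
  case 0
  then show ?case by (auto intro: continuous_on_compose2)
next
  case (Suc k)
  let ?D = "\<lambda>x v. \<Sum>b\<in>Basis. (frechet_derivative f (at x) v \<bullet> b) *\<^sub>R frechet_derivative g (at (f x)) b"
  show ?case
  proof (rule Ck_on_SucI[OF assms(1)])
    fix x assume "x \<in> S"
    then have "(g has_derivative frechet_derivative g (at (f x))) (at (f x))"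
      using Suc.prems by (intro Ck_on_SucD(1)) auto
    moreover from this have "frechet_derivative g (at (f x)) (frechet_derivative f (at x) v) = ?D x v" for v
      by (rule linear_eq_sum_Basis[OF has_derivative_linear])
    ultimately show "((\<lambda>x. g (f x)) has_derivative ?D x) (at x)"
      using has_derivative_compose[OF Ck_on_SucD(1)[OF Suc.prems(1) \<open>x \<in> S\<close>], of g
          "frechet_derivative g (at (f x))"] by simp
  next
    fix v
    show "Ck_on k S (\<lambda>x. ?D x v)"
    proof (intro Ck_on_sum Ck_on_bilinear[OF assms(1) bounded_bilinear_scaleR]
        Ck_on_linear[OF assms(1) bounded_linear_inner_left] assms(1))
      show "Ck_on k S (\<lambda>x. frechet_derivative g (at (f x)) b)" for b
        using Suc.prems by (intro Suc.IH[of f "\<lambda>y. frechet_derivative g (at y) b"])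
          (auto intro: Ck_on_SucD(2) Ck_on_Suc_lower)
    qed (use Suc.prems in simp)
  qed
qed

section \<open>Closure properties of smooth functions\<close>

lemma smooth_on_subset: "smooth_on S f \<Longrightarrow> T \<subseteq> S \<Longrightarrow> smooth_on T f"
  unfolding smooth_on_def using Ck_on_subset by blast

lemma smooth_on_transform:
  "open S \<Longrightarrow> smooth_on S f \<Longrightarrow> (\<And>x. x \<in> S \<Longrightarrow> f x = g x) \<Longrightarrow> smooth_on S g"
  unfolding smooth_on_def using Ck_on_transform[of S _ f g] by simp

lemma smooth_on_imp_has_derivative:
  "smooth_on S f \<Longrightarrow> x \<in> S \<Longrightarrow> (f has_derivative frechet_derivative f (at x)) (at x)"
  unfolding smooth_on_def using Ck_on_SucD(1) by blast

lemma smooth_on_imp_continuous_on: "smooth_on S f \<Longrightarrow> continuous_on S f"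
  unfolding smooth_on_def by (metis Ck_on.simps(1))

lemma smooth_on_frechet: "smooth_on S f \<Longrightarrow> smooth_on S (\<lambda>x. frechet_derivative f (at x) v)"
  unfolding smooth_on_def by (metis Ck_on.simps(2))

named_theorems smooth_intros

lemma smooth_on_const [smooth_intros]: "smooth_on S (\<lambda>x. c)"
  unfolding smooth_on_def using Ck_on_const by blast

lemma smooth_on_linear: "open S \<Longrightarrow> bounded_linear L \<Longrightarrow> smooth_on S f \<Longrightarrow> smooth_on S (\<lambda>x. L (f x))"
  by (simp add: smooth_on_def Ck_on_linear)

lemma smooth_on_ident [smooth_intros]: "smooth_on S (\<lambda>x. x)"
proof -
  have "Ck_on k S (\<lambda>x. x)" for k by (cases k) (auto intro: Ck_on_const simp: differentiable_ident)
  then show ?thesis unfolding smooth_on_def by blast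
qed

lemma smooth_on_bilinear:
  "open S \<Longrightarrow> bounded_bilinear B \<Longrightarrow> smooth_on S f \<Longrightarrow> smooth_on S g \<Longrightarrow> smooth_on S (\<lambda>x. B (f x) (g x))"
  by (simp add: smooth_on_def Ck_on_bilinear)

lemma smooth_on_add [smooth_intros]:
  "open S \<Longrightarrow> smooth_on S f \<Longrightarrow> smooth_on S g \<Longrightarrow> smooth_on S (\<lambda>x. f x + g x)"
  by (simp add: smooth_on_def Ck_on_add)

lemma smooth_on_sum [smooth_intros]:
  "open S \<Longrightarrow> (\<And>i. i \<in> I \<Longrightarrow> smooth_on S (f i)) \<Longrightarrow> smooth_on S (\<lambda>x. \<Sum>i\<in>I. f i x)"
  by (simp add: smooth_on_def Ck_on_sum)

lemma smooth_on_uminus [smooth_intros]: "open S \<Longrightarrow> smooth_on S f \<Longrightarrow> smooth_on S (\<lambda>x. - f x)"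
  by (rule smooth_on_linear[OF _ bounded_linear_minus[OF bounded_linear_ident]])

lemma smooth_on_diff [smooth_intros]:
  "open S \<Longrightarrow> smooth_on S f \<Longrightarrow> smooth_on S g \<Longrightarrow> smooth_on S (\<lambda>x. f x - g x)"
  using smooth_on_add[of S f "\<lambda>x. - g x"] smooth_on_uminus[of S g] by simp

lemma smooth_on_mult [smooth_intros]:
  fixes f g :: "'a::euclidean_space \<Rightarrow> real"
  shows "open S \<Longrightarrow> smooth_on S f \<Longrightarrow> smooth_on S g \<Longrightarrow> smooth_on S (\<lambda>x. f x * g x)"
  by (rule smooth_on_bilinear[OF _ bounded_bilinear_mult])

lemma smooth_on_scaleR [smooth_intros]:
  "open S \<Longrightarrow> smooth_on S f \<Longrightarrow> smooth_on S g \<Longrightarrow> smooth_on S (\<lambda>x. f x *\<^sub>R g x)"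
  by (rule smooth_on_bilinear[OF _ bounded_bilinear_scaleR])

lemma smooth_on_inner [smooth_intros]:
  "open S \<Longrightarrow> smooth_on S f \<Longrightarrow> smooth_on S g \<Longrightarrow> smooth_on S (\<lambda>x. f x \<bullet> g x)"
  by (rule smooth_on_bilinear[OF _ bounded_bilinear_inner])

lemma smooth_on_power [smooth_intros]:
  fixes f :: "'a::euclidean_space \<Rightarrow> real"
  assumes "open S" "smooth_on S f"
  shows "smooth_on S (\<lambda>x. f x ^ n)"
  by (induction n) (auto intro: smooth_intros assms)

lemma smooth_on_fst [smooth_intros]: "open S \<Longrightarrow> smooth_on S f \<Longrightarrow> smooth_on S (\<lambda>x. fst (f x))"
  by (rule smooth_on_linear[OF _ bounded_linear_fst])

lemma smooth_on_snd [smooth_intros]: "open S \<Longrightarrow> smooth_on S f \<Longrightarrow> smooth_on S (\<lambda>x. snd (f x))"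
  by (rule smooth_on_linear[OF _ bounded_linear_snd])

lemma smooth_on_Pair [smooth_intros]:
  fixes f :: "'a::euclidean_space \<Rightarrow> 'b::euclidean_space" and g :: "'a \<Rightarrow> 'c::euclidean_space"
  assumes "open S" "smooth_on S f" "smooth_on S g"
  shows "smooth_on S (\<lambda>x. (f x, g x))"
proof -
  have "bounded_linear (\<lambda>u::'b. (u, 0::'c))" "bounded_linear (\<lambda>u::'c. (0::'b, u))"
    by (auto intro!: bounded_linear_Pair bounded_linear_ident bounded_linear_zero)
  then have "smooth_on S (\<lambda>x. (f x, 0::'c) + (0::'b, g x))"
    by (intro smooth_on_add[OF assms(1)] smooth_on_linear[OF assms(1) _ assms(2)] smooth_on_linear[OF assms(1) _ assms(3)])
  then show ?thesis by simp
qed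

lemma smooth_on_compose:
  "open S \<Longrightarrow> open T \<Longrightarrow> smooth_on S f \<Longrightarrow> smooth_on T g \<Longrightarrow> f ` S \<subseteq> T \<Longrightarrow> smooth_on S (\<lambda>x. g (f x))"
  unfolding smooth_on_def using Ck_on_compose[of S T _ f g] by simp

text \<open>The derivative of \<open>inverse\<close> is, up to constants, a product of two copies of
  \<open>inverse\<close>, so each order yields the next.\<close>

lemma smooth_on_inverse [smooth_intros]:
  fixes f :: "'a::euclidean_space \<Rightarrow> real"
  assumes "open S" "smooth_on S f" "\<And>x. x \<in> S \<Longrightarrow> f x \<noteq> 0"
  shows "smooth_on S (\<lambda>x. inverse (f x))"
proof -
  have o: "open (- {0::real})" by (simp add: open_Compl)
  have "Ck_on k (- {0}) (inverse :: real \<Rightarrow> real)" for k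
  proof (induction k)
    case (Suc k)
    show ?case
    proof (rule Ck_on_SucI[OF o])
      show "(inverse has_derivative (\<lambda>h. - (inverse x * h * inverse x))) (at x)" if "x \<in> - {0}" for x :: real
        using that by (auto intro!: derivative_eq_intros)
      show "Ck_on k (- {0}) (\<lambda>x. - (inverse x * v * inverse x))" for v :: real
        by (rule Ck_on_linear[OF o bounded_linear_minus[OF bounded_linear_ident]])
          (intro Ck_on_bilinear[OF o bounded_bilinear_mult] Suc Ck_on_const)
    qed
  qed (auto intro!: continuous_intros)
  then have "smooth_on (- {0}) (inverse :: real \<Rightarrow> real)" unfolding smooth_on_def by blast
  then show ?thesis by (rule smooth_on_compose[OF assms(1) o assms(2)]) (use assms(3) in auto)
qed

lemma smooth_on_divide [smooth_intros]:
  fixes f g :: "'a::euclidean_space \<Rightarrow> real"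
  assumes "open S" "smooth_on S f" "smooth_on S g" "\<And>x. x \<in> S \<Longrightarrow> g x \<noteq> 0"
  shows "smooth_on S (\<lambda>x. f x / g x)"
  unfolding divide_inverse by (intro smooth_intros assms)

text \<open>The derivative of \<open>sqrt\<close> is half of \<open>inverse\<close> after
  \<open>sqrt\<close>, so order \<open>k\<close> of \<open>sqrt\<close> gives order
  \<open>k + 1\<close>.\<close>

lemma smooth_on_sqrt [smooth_intros]:
  fixes f :: "'a::euclidean_space \<Rightarrow> real"
  assumes "open S" "smooth_on S f" "\<And>x. x \<in> S \<Longrightarrow> f x > 0"
  shows "smooth_on S (\<lambda>x. sqrt (f x))"
proof -
  have o: "open {0::real<..}" by simp
  have "Ck_on k {0<..} sqrt" for k
  proof (induction k)
    case (Suc k)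
    show ?case
    proof (rule Ck_on_SucI[OF o])
      show "(sqrt has_derivative (\<lambda>h. h * (inverse (sqrt x) / 2))) (at x)" if "x \<in> {0<..}" for x :: real
        using that by (auto intro!: derivative_eq_intros simp: field_simps)
      have i: "Ck_on k (- {0::real}) inverse"
        using smooth_on_inverse[of "- {0::real}" "\<lambda>x. x"] smooth_on_ident by (auto simp: smooth_on_def)
      have "Ck_on k {0<..} (\<lambda>x. inverse (sqrt x))"
        by (rule Ck_on_compose[OF o _ Suc i]) auto
      then show "Ck_on k {0<..} (\<lambda>x. v * (inverse (sqrt x) / 2))" for v :: real
        using Ck_on_linear[OF o bounded_linear_mult_right[of "v / 2"]] by (force simp: field_simps)
    qed
  qed (auto intro!: continuous_intros)
  then have "smooth_on {0<..} sqrt" unfolding smooth_on_def by blast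
  then show ?thesis by (rule smooth_on_compose[OF assms(1) o assms(2)]) (use assms(3) in auto)
qed

lemma smooth_on_frechet_apply [smooth_intros]:
  assumes "open S" "smooth_on S f" "smooth_on S w"
  shows "smooth_on S (\<lambda>x. frechet_derivative f (at x) (w x))"
proof (rule smooth_on_transform[OF assms(1)])
  show "smooth_on S (\<lambda>x. \<Sum>b\<in>Basis. (w x \<bullet> b) *\<^sub>R frechet_derivative f (at x) b)"
    by (intro smooth_intros assms smooth_on_frechet)
  show "(\<Sum>b\<in>Basis. (w x \<bullet> b) *\<^sub>R frechet_derivative f (at x) b) = frechet_derivative f (at x) (w x)"
    if "x \<in> S" for x
    using linear_eq_sum_Basis[OF has_derivative_linear[OF smooth_on_imp_has_derivative[OF assms(2) that]]]
    by metis
qed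

text \<open>A product rule for a scalar factor that vanishes at the point: continuity of the other
  factor is then enough. It serves to differentiate an inverse matrix of which only continuity is
  known so far.\<close>

lemma has_derivative_vanishing_scaleR:
  fixes \<psi> :: "'a::real_normed_vector \<Rightarrow> real" and \<beta> :: "'a \<Rightarrow> 'b::real_normed_vector"
  assumes "(\<psi> has_derivative \<psi>') (at x0)" "\<psi> x0 = 0" "isCont \<beta> x0"
  shows "((\<lambda>x. \<psi> x *\<^sub>R \<beta> x) has_derivative (\<lambda>h. \<psi>' h *\<^sub>R \<beta> x0)) (at x0)"
proof -
  have 1: "((\<lambda>x. \<psi> x *\<^sub>R \<beta> x0) has_derivative (\<lambda>h. \<psi>' h *\<^sub>R \<beta> x0)) (at x0)"
    by (rule has_derivative_scaleR_left[OF assms(1)])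
  \<comment> \<open>This remainder is small of higher order: \<open>\<psi> y / norm (y - x0)\<close>
    stays bounded by \<open>1 + K\<close>, and \<open>\<beta> y - \<beta> x0\<close> tends to
    0.\<close>
  have 2: "((\<lambda>x. \<psi> x *\<^sub>R (\<beta> x - \<beta> x0)) has_derivative (\<lambda>h. 0)) (at x0)"
    unfolding has_derivative_at_within
  proof (intro conjI)
    obtain K where K: "K > 0" "\<And>h. norm (\<psi>' h) \<le> norm h * K"
      using has_derivative_bounded_linear[OF assms(1)] bounded_linear.pos_bounded by blast
    have lim: "((\<lambda>y. (\<psi> y - \<psi> x0 - \<psi>' (y - x0)) /\<^sub>R norm (y - x0)) \<longlongrightarrow> 0) (at x0)"
      using assms(1) by (simp add: has_derivative_at_within)
    then have bd: "eventually (\<lambda>y. norm ((\<psi> y - \<psi> x0 - \<psi>' (y - x0)) /\<^sub>R norm (y - x0)) < 1) (at x0)"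
      using tendstoD[OF lim, of 1] by simp
    have b2: "eventually (\<lambda>y. norm (\<psi> y / norm (y - x0)) \<le> 1 + K) (at x0)"
      using bd
    proof (rule eventually_elim2[OF _ eventually_neq_at_within[of x0]])
      fix y assume a: "norm ((\<psi> y - \<psi> x0 - \<psi>' (y - x0)) /\<^sub>R norm (y - x0)) < 1" and ne: "y \<noteq> x0"
      let ?A = "(\<psi> y - \<psi> x0 - \<psi>' (y - x0)) /\<^sub>R norm (y - x0)" and ?B = "\<psi>' (y - x0) / norm (y - x0)"
      have "\<psi> y / norm (y - x0) = ?A + ?B"
        using assms(2) by (simp add: divide_simps)
      moreover have "norm ?B \<le> K"
        using K(2)[of "y - x0"] ne by (simp add: divide_simps mult.commute)
      ultimately show "norm (\<psi> y / norm (y - x0)) \<le> 1 + K"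
        using a norm_triangle_ineq[of ?A ?B] by (simp only:)
    qed
    have "((\<lambda>y. \<beta> y - \<beta> x0) \<longlongrightarrow> 0) (at x0)"
      using assms(3) by (simp add: LIM_zero isCont_def)
    then have "((\<lambda>y. (1 + K) * norm (\<beta> y - \<beta> x0)) \<longlongrightarrow> 0) (at x0)"
      by (auto intro: tendsto_mult_right_zero tendsto_norm_zero)
    then have "((\<lambda>y. (\<psi> y / norm (y - x0)) *\<^sub>R (\<beta> y - \<beta> x0)) \<longlongrightarrow> 0) (at x0)"
    proof (rule Lim_null_comparison[rotated])
      show "eventually (\<lambda>y. norm ((\<psi> y / norm (y - x0)) *\<^sub>R (\<beta> y - \<beta> x0)) \<le> (1 + K) * norm (\<beta> y - \<beta> x0)) (at x0)"
        using b2 by eventually_elim (simp only: norm_scaleR real_norm_def mult_right_mono norm_ge_zero)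
    qed
    then show "((\<lambda>y. (\<psi> y *\<^sub>R (\<beta> y - \<beta> x0) - \<psi> x0 *\<^sub>R (\<beta> x0 - \<beta> x0) - 0) /\<^sub>R norm (y - x0)) \<longlongrightarrow> 0) (at x0)"
      by (simp add: divide_inverse_commute)
  qed simp
  from has_derivative_add[OF 1 2] show ?thesis by (simp add: scaleR_diff_right)
qed

text \<open>Continuity follows from a perturbation estimate. For the derivative at \<open>x0\<close>
  put \<open>u = B x0 w\<close>; then \<open>B x w = u + B x (w - A x u)\<close>, and the argument
  \<open>w - A x u\<close> vanishes at \<open>x0\<close>, so continuity of \<open>B\<close> suffices
  to differentiate. The resulting derivative, minus \<open>B\<close> times the derivative of
  \<open>A\<close> times \<open>B\<close>, is built from functions of order
  \<open>k\<close>.\<close>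

lemma Ck_on_linear_inverse:
  fixes A :: "'a::euclidean_space \<Rightarrow> 'b::euclidean_space \<Rightarrow> 'c::euclidean_space"
  assumes S: "open S" and lA: "\<And>x. x \<in> S \<Longrightarrow> linear (A x)" and lB: "\<And>x. x \<in> S \<Longrightarrow> linear (B x)"
    and BA: "\<And>x v. x \<in> S \<Longrightarrow> B x (A x v) = v" and AB: "\<And>x w. x \<in> S \<Longrightarrow> A x (B x w) = w"
    and "\<And>v. Ck_on k S (\<lambda>x. A x v)"
  shows "Ck_on k S (\<lambda>x. B x w)"
proof -
  have cont: "continuous_on S (\<lambda>x. B x w)" if cA: "\<And>v. continuous_on S (\<lambda>x. A x v)" for w
    unfolding continuous_on_eq_continuous_at[OF S]
  proof
    fix x0 assume x0: "x0 \<in> S"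
    obtain K where K: "K > 0" "\<And>h. norm (B x0 h) \<le> norm h * K"
      using lB[OF x0] bounded_linear.pos_bounded[of "B x0"] by (auto simp: linear_conv_bounded_linear)
    define s where "s x = (\<Sum>b\<in>Basis. norm (A x b - A x0 b))" for x
    have cA': "isCont (\<lambda>x. A x v) x0" for v
      using cA x0 S by (simp add: continuous_on_eq_continuous_at)
    have "isCont s x0" unfolding s_def by (intro continuous_intros cA')
    moreover have "s x0 = 0" by (simp add: s_def)
    ultimately have "s \<midarrow>x0\<rightarrow> 0" by (metis isCont_def)
    then have "eventually (\<lambda>x. s x < 1 / (2 * K)) (at x0)"
      by (rule order_tendstoD(2)) (use K(1) in simp)
    then have ev: "eventually (\<lambda>x. x \<in> S \<and> s x < 1 / (2 * K)) (at x0)"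
      by (intro eventually_conj eventually_at_in_open'[OF S x0])
    \<comment> \<open>\<open>K\<close> bounds the inverse at \<open>x0\<close>. As long as
      \<open>A x\<close> is within \<open>1 / (2 * K)\<close> of \<open>A x0\<close>, half of the
      lower bound for \<open>A x0\<close> survives.\<close>
    have bd: "norm v \<le> 2 * K * norm (A x v)" if "x \<in> S" "s x < 1 / (2 * K)" for x v
    proof -
      have "linear (\<lambda>v. A x v - A x0 v)"
        using lA that(1) x0 by (intro linear_compose_sub) auto
      from linear_eq_sum_Basis[OF this, of v]
      have "norm (A x v - A x0 v) = norm (\<Sum>b\<in>Basis. (v \<bullet> b) *\<^sub>R (A x b - A x0 b))"
        by simp
      also have "\<dots> \<le> (\<Sum>b\<in>Basis. norm v * norm (A x b - A x0 b))"
        by (rule sum_norm_le) (auto intro!: mult_right_mono simp: Basis_le_norm)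
      also have "\<dots> = norm v * s x" by (simp add: s_def sum_distrib_left)
      also have "\<dots> \<le> norm v * (1 / (2 * K))" using that by (intro mult_left_mono) auto
      finally have 1: "norm (A x v - A x0 v) \<le> norm v / (2 * K)" by simp
      have "norm v = norm (B x0 (A x0 v))" using BA x0 by simp
      also have "\<dots> \<le> norm (A x0 v) * K" by (rule K)
      also have "norm (A x0 v) \<le> norm (A x v) + norm (A x v - A x0 v)"
        by (metis norm_minus_commute norm_triangle_sub)
      finally have "norm v \<le> (norm (A x v) + norm v / (2 * K)) * K"
        using 1 K(1) by (smt (verit, best) mult_right_mono)
      then show ?thesis using K(1) by (simp add: field_simps)
    qed
    have "((\<lambda>x. B x w - B x0 w) \<longlongrightarrow> 0) (at x0)"
    proof (rule Lim_null_comparison)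
      show "eventually (\<lambda>x. norm (B x w - B x0 w) \<le> 2 * K * norm (w - A x (B x0 w))) (at x0)"
        using ev
      proof eventually_elim
        case (elim x)
        have "A x (B x w - B x0 w) = w - A x (B x0 w)"
          using elim by (simp add: linear_diff[OF lA] AB)
        then show ?case using bd[of x "B x w - B x0 w"] elim by simp
      qed
      have "((\<lambda>x. A x (B x0 w)) \<longlongrightarrow> w) (at x0)"
        using cA'[of "B x0 w"] AB[OF x0] by (simp add: isCont_def)
      then show "((\<lambda>x. 2 * K * norm (w - A x (B x0 w))) \<longlongrightarrow> 0) (at x0)"
        by (auto intro!: tendsto_eq_intros)
    qed
    then show "isCont (\<lambda>x. B x w) x0" by (simp add: LIM_zero_iff isCont_def)
  qed
  show ?thesis
    using assms(6)
  proof (induction k arbitrary: w)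
    case 0
    then show ?case using cont by simp
  next
    case (Suc k)
    have IH: "Ck_on k S (\<lambda>x. B x w)" for w
      by (rule Suc.IH) (use Suc.prems Ck_on_Suc_lower in blast)
    define DA where "DA v x = frechet_derivative (\<lambda>x. A x v) (at x)" for v x
    have DA: "((\<lambda>x. A x v) has_derivative DA v x) (at x)" if "x \<in> S" for x v
      unfolding DA_def by (rule Ck_on_SucD(1)[OF Suc.prems that])
    \<comment> \<open>The derivative of the inverse in coordinates, because \<open>A\<close> is
      differentiated on fixed vectors only.\<close>
    let ?D = "\<lambda>x h. - (\<Sum>b\<in>Basis. ((\<Sum>j\<in>Basis. (B x w \<bullet> j) *\<^sub>R DA j x h) \<bullet> b) *\<^sub>R B x b)"
    show ?case
    proof (rule Ck_on_SucI[OF S])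
      fix x0 assume x0: "x0 \<in> S"
      define u where "u = B x0 w"
      have "continuous_on S (\<lambda>x. A x v)" for v
        by (rule Ck_on_imp_continuous_on[OF Suc.prems])
      then have cB: "isCont (\<lambda>x. B x b) x0" for b
        using cont x0 S by (simp add: continuous_on_eq_continuous_at)
      have d1: "((\<lambda>x. \<Sum>j\<in>Basis. (u \<bullet> j) *\<^sub>R A x j) has_derivative (\<lambda>h. \<Sum>j\<in>Basis. (u \<bullet> j) *\<^sub>R DA j x0 h)) (at x0)"
        by (intro has_derivative_sum has_derivative_scaleR_right DA x0)
      let ?\<psi> = "\<lambda>b x. (w - (\<Sum>j\<in>Basis. (u \<bullet> j) *\<^sub>R A x j)) \<bullet> b"
      have eq: "(\<Sum>j\<in>Basis. (u \<bullet> j) *\<^sub>R A x j) = A x u" if "x \<in> S" for x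
        using linear_eq_sum_Basis[OF lA[OF that], of u] by simp
      have d2: "(?\<psi> b has_derivative (\<lambda>h. (0 - (\<Sum>j\<in>Basis. (u \<bullet> j) *\<^sub>R DA j x0 h)) \<bullet> b)) (at x0)" for b
        by (intro has_derivative_inner_left has_derivative_diff d1 has_derivative_const)
      have d3: "((\<lambda>x. \<Sum>b\<in>Basis. ?\<psi> b x *\<^sub>R B x b) has_derivative
          (\<lambda>h. \<Sum>b\<in>Basis. ((0 - (\<Sum>j\<in>Basis. (u \<bullet> j) *\<^sub>R DA j x0 h)) \<bullet> b) *\<^sub>R B x0 b)) (at x0)"
        by (intro has_derivative_sum has_derivative_vanishing_scaleR d2 cB) (simp add: eq x0, simp add: AB x0 u_def)
      have "((\<lambda>x. u + (\<Sum>b\<in>Basis. ?\<psi> b x *\<^sub>R B x b)) has_derivative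
          (\<lambda>h. 0 + (\<Sum>b\<in>Basis. ((0 - (\<Sum>j\<in>Basis. (u \<bullet> j) *\<^sub>R DA j x0 h)) \<bullet> b) *\<^sub>R B x0 b))) (at x0)"
        by (rule has_derivative_add[OF has_derivative_const d3])
      also have "(\<lambda>h. 0 + (\<Sum>b\<in>Basis. ((0 - (\<Sum>j\<in>Basis. (u \<bullet> j) *\<^sub>R DA j x0 h)) \<bullet> b) *\<^sub>R B x0 b)) = ?D x0"
        by (simp add: u_def inner_minus_left sum_negf)
      finally show "((\<lambda>x. B x w) has_derivative ?D x0) (at x0)"
      proof (rule has_derivative_transform_within_open[OF _ S x0])
        fix x assume x: "x \<in> S"
        have "(\<Sum>b\<in>Basis. ?\<psi> b x *\<^sub>R B x b) = B x (w - A x u)"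
          using linear_eq_sum_Basis[OF lB[OF x], of "w - A x u"] by (simp add: eq[OF x])
        also have "\<dots> = B x w - u" by (simp add: linear_diff[OF lB[OF x]] BA[OF x])
        finally show "u + (\<Sum>b\<in>Basis. ?\<psi> b x *\<^sub>R B x b) = B x w" by simp
      qed
    next
      fix v
      have "Ck_on k S (\<lambda>x. \<Sum>b\<in>Basis. ((\<Sum>j\<in>Basis. (B x w \<bullet> j) *\<^sub>R DA j x v) \<bullet> b) *\<^sub>R B x b)"
        unfolding DA_def
        by (intro Ck_on_sum[OF S] Ck_on_bilinear[OF S bounded_bilinear_scaleR] IH
            Ck_on_linear[OF S bounded_linear_inner_left] Ck_on_SucD(2)[OF Suc.prems])
      then show "Ck_on k S (\<lambda>x. ?D x v)"
        by (rule Ck_on_linear[OF S bounded_linear_minus[OF bounded_linear_ident]])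
    qed
  qed
qed

text \<open>The inverse function theorem gives a differentiable \<open>g\<close> whose derivative
  inverts that of \<open>f\<close> at \<open>g y\<close>. Smoothness is bootstrapped: if
  \<open>g\<close> has order \<open>k\<close>, so has the family of derivatives of \<open>f\<close>
  at \<open>g y\<close>, hence the inverse family \<open>g'\<close>, hence \<open>g\<close> has
  order \<open>k + 1\<close>. Injectivity of the derivative suffices since the dimensions
  agree.\<close>

lemma smooth_inverse_function:
  fixes f :: "'a::euclidean_space \<Rightarrow> 'a"
  assumes S: "open S" "smooth_on S f" "x0 \<in> S"
    and inj: "\<And>v. frechet_derivative f (at x0) v = 0 \<Longrightarrow> v = 0"
  obtains M N g where "diffeo M N f g" "x0 \<in> M" "M \<subseteq> S"
proof -
  define f' where "f' x = Blinfun (frechet_derivative f (at x))" for x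
  have bl: "bounded_linear (frechet_derivative f (at x))" if "x \<in> S" for x
    using smooth_on_imp_has_derivative[OF S(2) that] has_derivative_bounded_linear by blast
  have f': "blinfun_apply (f' x) = frechet_derivative f (at x)" if "x \<in> S" for x
    using bl[OF that] by (simp add: f'_def bounded_linear_Blinfun_apply)
  have 1: "(f has_derivative blinfun_apply (f' x)) (at x)" if "x \<in> S" for x
    using smooth_on_imp_has_derivative[OF S(2) that] f'[OF that] by simp
  have "continuous_on S (\<lambda>x. blinfun_apply (f' x) i)" for i
    using smooth_on_imp_continuous_on[OF smooth_on_frechet[OF S(2), of i]]
    by (rule continuous_on_eq) (simp add: f')
  then have 2: "continuous_on S f'"
    by (simp add: continuous_on_eq_continuous_at[OF S(1)] continuous_blinfun_componentwiseI)
  have lin: "linear (frechet_derivative f (at x0))"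
    by (rule bounded_linear.linear[OF bl[OF S(3)]])
  then have "inj (frechet_derivative f (at x0))"
    using inj by (simp add: linear_injective_0)
  then obtain h where h: "linear h" "h \<circ> frechet_derivative f (at x0) = id"
    using linear_injective_left_inverse[OF lin] by blast
  have 3: "Blinfun h o\<^sub>L f' x0 = id_blinfun"
    using h by (intro blinfun_eqI)
      (auto simp: f'[OF S(3)] bounded_linear_Blinfun_apply linear_conv_bounded_linear[symmetric] fun_eq_iff)
  obtain U V g g' where U: "open U" "U \<subseteq> S" "x0 \<in> U" "open V" "homeomorphism U V f g"
    and g': "\<And>y. y \<in> V \<Longrightarrow> (g has_derivative (g' y)) (at y)"
      "\<And>y. y \<in> V \<Longrightarrow> g' y = inv (blinfun_apply (f' (g y)))"
      "\<And>y. y \<in> V \<Longrightarrow> bij (blinfun_apply (f' (g y)))"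
    using inverse_function_theorem[OF S(1) 1 2 S(3) 3] by metis
  have gV: "g ` V = U" "\<And>y. y \<in> V \<Longrightarrow> g y \<in> S"
    using U unfolding homeomorphism_def by auto
  have "Ck_on k V g" for k
  proof (induction k)
    case 0
    then show ?case using U(5) by (simp add: homeomorphism_def)
  next
    case (Suc k)
    have A: "Ck_on k V (\<lambda>y. frechet_derivative f (at (g y)) v)" for v
      by (rule Ck_on_compose[OF U(4) S(1) Suc, of "\<lambda>x. frechet_derivative f (at x) v"])
        (use smooth_on_frechet[OF S(2), of v] gV in \<open>auto simp: smooth_on_def\<close>)
    have "Ck_on k V (\<lambda>y. g' y w)" for w
    proof (rule Ck_on_linear_inverse[OF U(4) _ _ _ _ A])
      fix y assume y: "y \<in> V"
      note eq = f'[OF gV(2)[OF y]]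
      show "linear (frechet_derivative f (at (g y)))"
        by (rule bounded_linear.linear[OF bl[OF gV(2)[OF y]]])
      show "linear (g' y)" using g'(1)[OF y] has_derivative_linear by blast
      show "g' y (frechet_derivative f (at (g y)) v) = v" for v
        using g'(2,3)[OF y] eq by (simp add: bij_is_inj)
      show "frechet_derivative f (at (g y)) (g' y v) = v" for v
        using g'(2,3)[OF y] eq by (simp add: bij_is_surj surj_f_inv_f)
    qed
    with g'(1) show ?case by (rule Ck_on_SucI[OF U(4)])
  qed
  then have "diffeo U V f g"
    using U smooth_on_subset[OF S(2) U(2)] by (auto simp: diffeo_def smooth_on_def)
  then show thesis using that U by blast
qed

section \<open>Diffeomorphisms and their derivatives\<close>

lemma diffeo_sym: "diffeo M N \<phi> \<psi> \<Longrightarrow> diffeo N M \<psi> \<phi>"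
  by (auto simp: diffeo_def homeomorphism_def)

lemma diffeo_subset:
  assumes "diffeo M N \<phi> \<psi>" "open B" "B \<subseteq> M"
  shows "diffeo B (\<phi> ` B) \<phi> \<psi>"
proof -
  have h: "homeomorphism M N \<phi> \<psi>" using assms(1) by (simp add: diffeo_def)
  have sub: "\<phi> ` B \<subseteq> N" using h assms(3) by (auto simp: homeomorphism_def)
  have "\<phi> ` B = N \<inter> \<psi> -` B"
  proof (intro equalityI subsetI)
    fix y assume "y \<in> N \<inter> \<psi> -` B"
    then have "\<phi> (\<psi> y) = y" "\<psi> y \<in> B" using h by (auto simp: homeomorphism_def)
    then show "y \<in> \<phi> ` B" by (metis imageI)
  next
    fix y assume "y \<in> \<phi> ` B"
    then obtain x where x: "x \<in> B" "y = \<phi> x" by blast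
    then have "\<psi> y = x" using h assms(3) by (auto simp: homeomorphism_def)
    then show "y \<in> N \<inter> \<psi> -` B" using x sub by auto
  qed
  moreover have "open (N \<inter> \<psi> -` B)"
    using h assms(1,2) by (auto simp: homeomorphism_def diffeo_def intro: continuous_open_preimage)
  moreover have "homeomorphism B (\<phi> ` B) \<phi> \<psi>"
    by (rule homeomorphism_of_subsets[OF h assms(3) _ refl]) (use sub in auto)
  ultimately show ?thesis
    using assms sub by (auto simp: diffeo_def intro: smooth_on_subset)
qed

lemma diffeo_compose:
  assumes "diffeo M N \<phi> \<psi>" "diffeo N P \<phi>' \<psi>'"
  shows "diffeo M P (\<phi>' \<circ> \<phi>) (\<psi> \<circ> \<psi>')"
  unfolding diffeo_def
proof (intro conjI)
  show "homeomorphism M P (\<phi>' \<circ> \<phi>) (\<psi> \<circ> \<psi>')"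
    using assms by (auto simp: diffeo_def intro: homeomorphism_compose)
  have "\<phi> ` M = N" "\<psi>' ` P = N" using assms by (auto simp: diffeo_def homeomorphism_def)
  then show "smooth_on M (\<phi>' \<circ> \<phi>)" "smooth_on P (\<psi> \<circ> \<psi>')"
    unfolding o_def using assms by (auto simp: diffeo_def intro!: smooth_on_compose[of _ N])
qed (use assms in \<open>auto simp: diffeo_def\<close>)

lemma diffeo_open: "diffeo M N \<phi> \<psi> \<Longrightarrow> open M" "diffeo M N \<phi> \<psi> \<Longrightarrow> open N"
  by (auto simp: diffeo_def)

lemma diffeo_apply:
  assumes "diffeo M N \<phi> \<psi>" "x \<in> M"
  shows "\<phi> x \<in> N" "\<psi> (\<phi> x) = x"
  using assms by (auto simp: diffeo_def homeomorphism_def)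

lemma diffeo_image: "diffeo M N \<phi> \<psi> \<Longrightarrow> \<phi> ` M = N"
  by (auto simp: diffeo_def homeomorphism_def)

lemma diffeo_has_derivative:
  assumes "diffeo M N \<phi> \<psi>" "x \<in> M"
  shows "(\<phi> has_derivative frechet_derivative \<phi> (at x)) (at x)"
  using assms smooth_on_imp_has_derivative by (auto simp: diffeo_def)

lemma diffeo_derivative_inverse:
  assumes "diffeo M N \<phi> \<psi>" "x \<in> M"
  shows "frechet_derivative \<psi> (at (\<phi> x)) (frechet_derivative \<phi> (at x) v) = v"
proof -
  have "(\<psi> has_derivative frechet_derivative \<psi> (at (\<phi> x))) (at (\<phi> x))"
    by (rule diffeo_has_derivative[OF diffeo_sym[OF assms(1)] diffeo_apply(1)[OF assms]])
  from has_derivative_compose[OF diffeo_has_derivative[OF assms] this]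
  have "((\<lambda>x. x) has_derivative (\<lambda>v. frechet_derivative \<psi> (at (\<phi> x)) (frechet_derivative \<phi> (at x) v))) (at x)"
    by (rule has_derivative_transform_within_open[OF _ diffeo_open(1)[OF assms(1)] assms(2)])
      (rule diffeo_apply(2)[OF assms(1)])
  then show ?thesis
    using has_derivative_unique[OF has_derivative_ident, of "\<lambda>v. frechet_derivative \<psi> (at (\<phi> x)) (frechet_derivative \<phi> (at x) v)" x]
    by (simp add: fun_eq_iff)
qed

lemma diffeo_derivative_nonzero:
  assumes "diffeo M N \<phi> \<psi>" "x \<in> M" "v \<noteq> 0"
  shows "frechet_derivative \<phi> (at x) v \<noteq> 0"
proof
  assume "frechet_derivative \<phi> (at x) v = 0"
  then show False
    using diffeo_derivative_inverse[OF assms(1,2), of v] assms(3)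
      linear_0[OF has_derivative_linear[OF diffeo_has_derivative[OF diffeo_sym[OF assms(1)] diffeo_apply(1)[OF assms(1,2)]]]]
    by simp
qed

text \<open>Differentiation under the integral sign replaces \<open>g\<close> by its derivatives
  \<open>D v\<close> in the directions \<open>(v, 0)\<close>, which are smooth on the same set;
  hence the induction varies \<open>g\<close>.\<close>

lemma Ck_on_integral:
  fixes g :: "'a::euclidean_space \<times> real \<Rightarrow> 'b::euclidean_space"
  assumes "open S" "convex S" "S \<times> {0..1} \<subseteq> O1" "smooth_on O1 g"
  shows "Ck_on k S (\<lambda>x. integral {0..1} (\<lambda>t. g (x, t)))"
  using assms(4)
proof (induction k arbitrary: g)
  case 0
  have "continuous_on (S \<times> cbox 0 1) (\<lambda>(x, t). g (x, t))"
    using continuous_on_subset[OF smooth_on_imp_continuous_on[OF 0], of "S \<times> cbox 0 1"] assms(3) by auto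
  then show ?case using integral_continuous_on_param[of S 0 1 "\<lambda>x t. g (x, t)"] by simp
next
  case (Suc k)
  define D where "D v z = frechet_derivative g (at z) (v, 0)" for v z
  have D: "smooth_on O1 (D v)" for v
    unfolding D_def using smooth_on_frechet[OF Suc.prems] by simp
  have cg: "continuous_on (S \<times> {0..1}) g" and cD: "continuous_on (S \<times> {0..1}) (D v)" for v
    using smooth_on_imp_continuous_on[OF Suc.prems] smooth_on_imp_continuous_on[OF D] assms(3)
    by (auto intro: continuous_on_subset)
  have slice: "continuous_on {0..1} (\<lambda>t. h (x, t))" if "continuous_on (S \<times> {0..1}) h" "x \<in> S"
    for h :: "'a \<times> real \<Rightarrow> 'b" and x
    by (rule continuous_on_compose2[OF that(1)]) (use that(2) in \<open>auto intro!: continuous_intros\<close>)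
  have dg: "((\<lambda>x. g (x, t)) has_derivative (\<lambda>v. D v (x, t))) (at x)" if "x \<in> S" "t \<in> {0..1}" for x t
  proof -
    have "(g has_derivative frechet_derivative g (at (x, t))) (at (x, t))"
      using smooth_on_imp_has_derivative[OF Suc.prems] that assms(3) by blast
    then show ?thesis unfolding D_def
      by (rule has_derivative_compose[rotated]) (auto intro!: derivative_eq_intros)
  qed
  define fx where "fx x t = Blinfun (\<lambda>v. D v (x, t))" for x t
  have fx: "blinfun_apply (fx x t) = (\<lambda>v. D v (x, t))" if "x \<in> S" "t \<in> {0..1}" for x t
    unfolding fx_def using has_derivative_bounded_linear[OF dg[OF that]]
    by (simp add: bounded_linear_Blinfun_apply)
  have cfx: "continuous_on (S \<times> {0..1}) (\<lambda>(x, t). fx x t)"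
  proof (rule continuous_on_blinfun_componentwise)
    fix i :: 'a
    show "continuous_on (S \<times> {0..1}) (\<lambda>z. blinfun_apply (case z of (x, t) \<Rightarrow> fx x t) i)"
      by (rule continuous_on_eq[OF cD[of i]]) (auto simp: fx)
  qed
  show ?case
  proof (rule Ck_on_SucI[OF assms(1)])
    fix x assume x: "x \<in> S"
    have *: "((\<lambda>x. integral (cbox 0 1) (\<lambda>t. g (x, t))) has_derivative integral (cbox 0 1) (fx x)) (at x within S)"
    proof (rule leibniz_rule[OF _ _ _ x assms(2)])
      show "((\<lambda>x. g (x, t)) has_derivative blinfun_apply (fx x t)) (at x within S)"
        if "x \<in> S" "t \<in> cbox 0 1" for x and t :: real
        using dg[of x t] fx[of x t] that by (auto intro: has_derivative_at_withinI)
      show "(\<lambda>t. g (x, t)) integrable_on cbox 0 1" if "x \<in> S" for x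
        using slice[OF cg that] by (intro integrable_continuous) simp
      show "continuous_on (S \<times> cbox 0 1) (\<lambda>(x, t). fx x t)" using cfx by simp
    qed
    have eq: "blinfun_apply (integral (cbox 0 1) (fx x)) v = integral {0..1} (\<lambda>t. D v (x, t))" for v
    proof -
      have "continuous_on {0..1} (\<lambda>t. fx x t)"
        using continuous_on_compose2[OF cfx, of "{0..1}" "Pair x"] x
        by (auto simp: continuous_on_Pair)
      then have "fx x integrable_on cbox 0 1" by (intro integrable_continuous) simp
      from blinfun_apply_integral[OF this, of v]
      have "blinfun_apply (integral (cbox 0 1) (fx x)) v = integral (cbox 0 1) (\<lambda>t. blinfun_apply (fx x t) v)" .
      also have "\<dots> = integral {0..1} (\<lambda>t. D v (x, t))"
        by (simp, rule integral_cong) (simp add: fx x)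
      finally show ?thesis .
    qed
    have "blinfun_apply (integral (cbox 0 1) (fx x)) = (\<lambda>v. integral {0..1} (\<lambda>t. D v (x, t)))"
      using eq by (rule ext)
    with * show "((\<lambda>x. integral {0..1} (\<lambda>t. g (x, t))) has_derivative
        (\<lambda>v. integral {0..1} (\<lambda>t. D v (x, t)))) (at x)"
      by (simp add: at_within_open[OF x assms(1)])
  next
    show "Ck_on k S (\<lambda>x. integral {0..1} (\<lambda>t. D v (x, t)))" for v
      by (rule Suc.IH[OF D])
  qed
qed

text \<open>The fundamental theorem of calculus on the segment from \<open>(x, 0)\<close> to
  \<open>(x, y)\<close>: the derivative of \<open>f (x, t * y)\<close> in \<open>t\<close> is
  \<open>y\<close> times the partial derivative in the second variable, and the quotient
  \<open>h\<close> is the integral of the latter.\<close>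

lemma hadamard_division:
  fixes f :: "'a::euclidean_space \<times> real \<Rightarrow> 'b::euclidean_space"
  assumes "open A" "convex A" "smooth_on (A \<times> {-e<..<e}) f" "\<And>x. x \<in> A \<Longrightarrow> f (x, 0) = 0"
  shows "\<exists>h. smooth_on (A \<times> {-e<..<e}) h \<and> (\<forall>x\<in>A. \<forall>y\<in>{-e<..<e}. f (x, y) = y *\<^sub>R h (x, y))"
proof -
  let ?S = "A \<times> {-e<..<e}"
  define f2 where "f2 z = frechet_derivative f (at z) (0, 1)" for z
  define g where "g w = f2 (fst (fst w), snd w * snd (fst w))" for w :: "('a \<times> real) \<times> real"
  \<comment> \<open>All \<open>((x, y), t)\<close> with \<open>(x, t * y)\<close> in the domain: an
    open set containing the closed range of \<open>t\<close>, so that the integrand is smooth up to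
    the end points.\<close>
  define O1 where "O1 = {w :: ('a \<times> real) \<times> real. (fst (fst w), snd w * snd (fst w)) \<in> ?S}"
  have S: "open ?S" "convex ?S" using assms(1,2) by (auto intro: open_Times convex_Times)
  have "O1 = (\<lambda>w. (fst (fst w), snd w * snd (fst w))) -` ?S" by (auto simp: O1_def)
  moreover have "continuous_on UNIV (\<lambda>w :: ('a \<times> real) \<times> real. (fst (fst w), snd w * snd (fst w)))"
    by (intro continuous_intros)
  ultimately have O1: "open O1" using S(1) by (simp add: open_vimage)
  have sg: "smooth_on O1 g"
    unfolding g_def
  proof (rule smooth_on_compose[OF O1 S(1)])
    show "smooth_on O1 (\<lambda>w. (fst (fst w), snd w * snd (fst w)))"
      by (intro smooth_intros O1)
    show "smooth_on ?S f2" unfolding f2_def by (rule smooth_on_frechet[OF assms(3)])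
  qed (auto simp: O1_def)
  have in_S: "(x, t * y) \<in> ?S" if "x \<in> A" "y \<in> {-e<..<e}" "t \<in> {0..1}" for x and t y :: real
  proof -
    have "\<bar>t * y\<bar> \<le> 1 * \<bar>y\<bar>" unfolding abs_mult using that(3) by (intro mult_right_mono) auto
    then show ?thesis using that by auto
  qed
  have "?S \<times> {0..1} \<subseteq> O1" using in_S by (auto simp: O1_def)
  then have "smooth_on ?S (\<lambda>z. integral {0..1} (\<lambda>t. g (z, t)))"
    unfolding smooth_on_def using Ck_on_integral[OF S _ sg] by blast
  moreover have "f (x, y) = y *\<^sub>R integral {0..1} (\<lambda>t. g ((x, y), t))" if xy: "x \<in> A" "y \<in> {-e<..<e}" for x y
  proof -
    have "((\<lambda>t. y *\<^sub>R g ((x, y), t)) has_integral f (x, 1 * y) - f (x, 0 * y)) {0..1}"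
    proof (rule fundamental_theorem_of_calculus)
      fix t :: real assume t: "t \<in> {0..1}"
      have D: "(f has_derivative frechet_derivative f (at (x, t * y))) (at (x, t * y))"
        by (rule smooth_on_imp_has_derivative[OF assms(3) in_S[OF xy t]])
      have "((\<lambda>t. (x, t * y)) has_derivative (\<lambda>k. (0, k * y))) (at t)"
        by (auto intro!: derivative_eq_intros)
      from has_derivative_compose[OF this D]
      have "((\<lambda>t. f (x, t * y)) has_derivative (\<lambda>k. frechet_derivative f (at (x, t * y)) (0, k * y))) (at t)" .
      also have "(\<lambda>k. frechet_derivative f (at (x, t * y)) (0, k * y)) = (\<lambda>k. k *\<^sub>R (y *\<^sub>R g ((x, y), t)))"
      proof
        fix k
        have "(0, k * y) = (k * y) *\<^sub>R (0 :: 'a, 1 :: real)" by simp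
        then show "frechet_derivative f (at (x, t * y)) (0, k * y) = k *\<^sub>R (y *\<^sub>R g ((x, y), t))"
          using linear_scale[OF has_derivative_linear[OF D], of "k * y" "(0, 1)"] by (simp add: g_def f2_def)
      qed
      finally show "((\<lambda>t. f (x, t * y)) has_vector_derivative y *\<^sub>R g ((x, y), t)) (at t within {0..1})"
        unfolding has_vector_derivative_def by (rule has_derivative_at_withinI)
    qed simp
    from integral_unique[OF this] show ?thesis
      using assms(4)[OF xy(1)] by simp
  qed
  ultimately show ?thesis by blast
qed

section \<open>Germs of surfaces\<close>

lemma germ_diffeomorphic_local:
  assumes "open V" "p \<in> V" "S \<inter> V = S' \<inter> V" "germ_diffeomorphic S p T q"
  shows "germ_diffeomorphic S' p T q"
proof -
  obtain W W' \<phi> \<psi> where d: "diffeo W W' \<phi> \<psi>" "p \<in> W" "\<phi> p = q" "\<phi> ` (S \<inter> W) = T \<inter> W'"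
    using assms(4) unfolding germ_diffeomorphic_def by blast
  have o: "open (W \<inter> V)" using diffeo_open(1)[OF d(1)] assms(1) by (rule open_Int)
  have d': "diffeo (W \<inter> V) (\<phi> ` (W \<inter> V)) \<phi> \<psi>" by (rule diffeo_subset[OF d(1) o]) auto
  have "\<phi> ` (S' \<inter> (W \<inter> V)) = T \<inter> \<phi> ` (W \<inter> V)"
  proof (intro equalityI subsetI)
    fix y assume "y \<in> \<phi> ` (S' \<inter> (W \<inter> V))"
    then obtain x where "x \<in> S'" "x \<in> W" "x \<in> V" "y = \<phi> x" by blast
    moreover from this have "x \<in> S" using assms(3) by blast
    ultimately show "y \<in> T \<inter> \<phi> ` (W \<inter> V)" using d(4) by blast
  next
    fix y assume "y \<in> T \<inter> \<phi> ` (W \<inter> V)"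
    then obtain x where x: "x \<in> W" "x \<in> V" "y = \<phi> x" "y \<in> T" by blast
    then have "y \<in> \<phi> ` (S \<inter> W)" using d(4) diffeo_image[OF d(1)] by blast
    then obtain x' where "x' \<in> S" "x' \<in> W" "y = \<phi> x'" by blast
    then have "x \<in> S" using x diffeo_apply(2)[OF d(1)] by metis
    then show "y \<in> \<phi> ` (S' \<inter> (W \<inter> V))" using x assms(3) by blast
  qed
  then show ?thesis
    unfolding germ_diffeomorphic_def using d' d(2,3) assms(2) by blast
qed

lemma germ_diffeomorphic_cong:
  assumes "open V" "p \<in> V" "S \<inter> V = S' \<inter> V"
  shows "germ_diffeomorphic S p T q \<longleftrightarrow> germ_diffeomorphic S' p T q"
  using germ_diffeomorphic_local[OF assms] germ_diffeomorphic_local[OF assms(1,2) assms(3)[symmetric]] by blast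

lemma germ_diffeomorphic_preimage:
  assumes "diffeo UNIV UNIV \<Phi> \<Phi>'" "germ_diffeomorphic S (\<Phi> p) T q"
  shows "germ_diffeomorphic (\<Phi> -` S) p T q"
proof -
  obtain W W' \<phi> \<psi> where d: "diffeo W W' \<phi> \<psi>" "\<Phi> p \<in> W" "\<phi> (\<Phi> p) = q" "\<phi> ` (S \<inter> W) = T \<inter> W'"
    using assms(2) unfolding germ_diffeomorphic_def by blast
  have inv: "\<Phi> (\<Phi>' x) = x" "\<Phi>' (\<Phi> x) = x" for x
    using diffeo_apply(2)[OF assms(1), of x] diffeo_apply(2)[OF diffeo_sym[OF assms(1)], of x] by auto
  have im: "\<Phi>' ` A = \<Phi> -` A" for A
    by (auto simp: inv) (metis imageI inv(2))
  have 1: "diffeo (\<Phi> -` W) W \<Phi> \<Phi>'"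
    using diffeo_sym[OF diffeo_subset[OF diffeo_sym[OF assms(1)] diffeo_open(1)[OF d(1)]]] by (simp add: im)
  have "(\<phi> \<circ> \<Phi>) ` (\<Phi> -` S \<inter> \<Phi> -` W) = \<phi> ` (S \<inter> W)"
  proof -
    have "\<Phi> ` (\<Phi> -` S \<inter> \<Phi> -` W) = S \<inter> W"
      by (simp only: vimage_Int[symmetric] image_vimage_eq diffeo_image[OF assms(1)] Int_UNIV_right)
    then show ?thesis by (simp only: image_comp[symmetric])
  qed
  then show ?thesis
    unfolding germ_diffeomorphic_def using diffeo_compose[OF 1 d(1)] d(2-4)
    by (intro exI[of _ "\<Phi> -` W"] exI[of _ W'] exI[of _ "\<phi> \<circ> \<Phi>"] exI[of _ "\<Phi>' \<circ> \<psi>"]) auto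
qed

lemma germ_diffeomorphic_preimage_iff:
  assumes "diffeo UNIV UNIV \<Phi> \<Phi>'"
  shows "germ_diffeomorphic (\<Phi> -` S) p T q \<longleftrightarrow> germ_diffeomorphic S (\<Phi> p) T q"
proof
  have inv: "\<Phi> (\<Phi>' x) = x" "\<Phi>' (\<Phi> x) = x" for x
    using diffeo_apply(2)[OF assms(1), of x] diffeo_apply(2)[OF diffeo_sym[OF assms(1)], of x] by auto
  assume "germ_diffeomorphic (\<Phi> -` S) p T q"
  then have "germ_diffeomorphic (\<Phi>' -` (\<Phi> -` S)) (\<Phi> p) T q"
    by (intro germ_diffeomorphic_preimage[OF diffeo_sym[OF assms]]) (simp add: inv)
  then show "germ_diffeomorphic S (\<Phi> p) T q" by (simp add: vimage_def inv)
qed (rule germ_diffeomorphic_preimage[OF assms])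

text \<open>A two-sided velocity \<open>w\<close> of a curve in \<open>S\<close> through
  \<open>p\<close>, the curve being differentiable at time 0. Derivatives of diffeomorphisms
  transport such velocities, so they restrict the normal forms a set germ can have. The weak
  regularity admits curves through the swallowtail point on which the parameter is a cube root of
  time.\<close>

definition curve_in :: "space set \<Rightarrow> space \<Rightarrow> space \<Rightarrow> bool" where
  "curve_in S p w \<longleftrightarrow> (\<exists>\<gamma>. \<gamma> 0 = p \<and> (\<gamma> has_derivative (\<lambda>t. t *\<^sub>R w)) (at (0::real)) \<and>
     eventually (\<lambda>t. \<gamma> t \<in> S) (at 0))"

lemma curve_in_germ_diffeomorphic:
  assumes "diffeo W W' \<phi> \<psi>" "p \<in> W" "\<phi> ` (S \<inter> W) = T \<inter> W'" "curve_in S p w"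
  shows "curve_in T (\<phi> p) (frechet_derivative \<phi> (at p) w)"
proof -
  obtain \<gamma> where \<gamma>: "\<gamma> 0 = p" "(\<gamma> has_derivative (\<lambda>t. t *\<^sub>R w)) (at 0)" "eventually (\<lambda>t. \<gamma> t \<in> S) (at 0)"
    using assms(4) unfolding curve_in_def by blast
  have D: "(\<phi> has_derivative frechet_derivative \<phi> (at p)) (at (\<gamma> 0))"
    using diffeo_has_derivative[OF assms(1,2)] \<gamma>(1) by simp
  have "((\<lambda>t. \<phi> (\<gamma> t)) has_derivative (\<lambda>t. t *\<^sub>R frechet_derivative \<phi> (at p) w)) (at 0)"
    using has_derivative_compose[OF \<gamma>(2) D] linear_scale[OF has_derivative_linear[OF D]] by simp
  moreover have "isCont \<gamma> 0" using \<gamma>(2) by (rule has_derivative_continuous)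
  then have "\<gamma> \<midarrow>0\<rightarrow> p" using \<gamma>(1) by (simp add: isCont_def)
  then have "eventually (\<lambda>t. \<gamma> t \<in> W) (at 0)"
    by (rule topological_tendstoD[OF _ diffeo_open(1)[OF assms(1)] assms(2)])
  with \<gamma>(3) have "eventually (\<lambda>t. \<phi> (\<gamma> t) \<in> T) (at 0)"
    by eventually_elim (use assms(3) in blast)
  ultimately show ?thesis unfolding curve_in_def using \<gamma>(1) by (intro exI[of _ "\<lambda>t. \<phi> (\<gamma> t)"]) auto
qed

lemma has_derivative_times_imp_DERIV:
  "(f has_derivative (\<lambda>t. t * w)) (at (x::real)) \<Longrightarrow> (f has_field_derivative w) (at x)"
proof -
  have "(\<lambda>t. t * w) = times w" by (auto simp: mult.commute)
  then show "(f has_derivative (\<lambda>t. t * w)) (at x) \<Longrightarrow> (f has_field_derivative w) (at x)"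
    by (simp add: has_field_derivative_def)
qed

lemma nonneg_derivative_zero:
  fixes f :: "real \<Rightarrow> real"
  assumes "(f has_derivative (\<lambda>t. t * w)) (at 0)" "f 0 = 0" "eventually (\<lambda>t. f t \<ge> 0) (at 0)"
  shows "w = 0"
proof -
  have "(f has_field_derivative w) (at 0)"
    using assms(1) by (rule has_derivative_times_imp_DERIV)
  moreover obtain d where "d > 0" "\<And>t. t \<noteq> 0 \<Longrightarrow> \<bar>t\<bar> < d \<Longrightarrow> f t \<ge> 0"
    using assms(3) by (auto simp: eventually_at dist_real_def)
  then have "\<And>t. \<bar>0 - t\<bar> < d \<Longrightarrow> f 0 \<le> f t" by (metis abs_minus_commute assms(2) diff_zero order_refl)
  ultimately show "w = 0" using \<open>d > 0\<close> DERIV_local_min by blast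
qed

lemma small_square_derivative_zero:
  fixes f g :: "real \<Rightarrow> real"
  assumes f: "(f has_derivative (\<lambda>t. t * w)) (at 0)" "f 0 = 0" and g: "(g has_derivative (\<lambda>t. t * 0)) (at 0)" "g 0 = 0"
    and le: "eventually (\<lambda>t. (f t)\<^sup>2 \<le> K * g t ^ 2) (at 0)"
  shows "w = 0"
proof -
  have "((\<lambda>t. f t / t) \<longlongrightarrow> w) (at 0)"
    using has_derivative_times_imp_DERIV[OF f(1)] f(2) by (simp add: DERIV_def)
  then have "((\<lambda>t. (f t / t)\<^sup>2) \<longlongrightarrow> w\<^sup>2) (at 0)" by (intro tendsto_power)
  moreover have "((\<lambda>t. g t / t) \<longlongrightarrow> 0) (at 0)"
    using has_derivative_times_imp_DERIV[OF g(1)] g(2) by (simp add: DERIV_def)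
  then have "((\<lambda>t. K * (g t / t)\<^sup>2) \<longlongrightarrow> K * 0\<^sup>2) (at 0)" by (intro tendsto_mult tendsto_const tendsto_power)
  moreover have "eventually (\<lambda>t. (f t / t)\<^sup>2 \<le> K * (g t / t)\<^sup>2) (at 0)"
    using le by eventually_elim (simp add: power_divide divide_right_mono)
  ultimately have "w\<^sup>2 \<le> K * 0\<^sup>2"
    by (intro tendsto_le[of "at (0::real)"]) auto
  then show "w = 0" by simp
qed

section \<open>Velocities at cuspidal edges and at transverse crossings\<close>

definition standard_cuspidal_edge :: "space set" where
  "standard_cuspidal_edge = {(u\<^sup>2, u^3, v) | u v. True}"

lemma cuspidal_edge_iff: "p \<in> cuspidal_edge S \<longleftrightarrow> germ_diffeomorphic S p standard_cuspidal_edge 0"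
  by (simp add: cuspidal_edge_def standard_cuspidal_edge_def)

text \<open>The first coordinate is a square and vanishes at time 0, so its derivative is 0. The
  square of the second coordinate is the cube of the first, so for small times the second is
  dominated by the first.\<close>

lemma curve_in_cuspidal_edge:
  assumes "curve_in standard_cuspidal_edge 0 w"
  shows "\<exists>z. w = (0, 0, z)"
proof -
  obtain w1 w2 w3 where w: "w = (w1, w2, w3)" by (cases w)
  obtain \<gamma> where \<gamma>: "\<gamma> 0 = 0" "(\<gamma> has_derivative (\<lambda>t. t *\<^sub>R w)) (at 0)"
    "eventually (\<lambda>t. \<gamma> t \<in> {(u\<^sup>2, u^3, v) | u v. True}) (at 0)"
    using assms unfolding curve_in_def standard_cuspidal_edge_def by blast
  define f where "f t = fst (\<gamma> t)" for t
  define g where "g t = fst (snd (\<gamma> t))" for t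
  have f: "(f has_derivative (\<lambda>t. t * w1)) (at 0)" "f 0 = 0"
    using has_derivative_fst[OF \<gamma>(2)] \<gamma>(1) by (simp_all add: f_def[abs_def] w)
  have g: "(g has_derivative (\<lambda>t. t * w2)) (at 0)" "g 0 = 0"
    using has_derivative_fst[OF has_derivative_snd[OF \<gamma>(2)]] \<gamma>(1) by (simp_all add: g_def[abs_def] w)
  have e: "eventually (\<lambda>t. f t \<ge> 0 \<and> (g t)\<^sup>2 = f t ^ 3) (at 0)"
    using \<gamma>(3) by eventually_elim (auto simp: f_def g_def power_mult[symmetric])
  have 1: "w1 = 0"
    by (rule nonneg_derivative_zero[OF f]) (use e in \<open>auto elim: eventually_mono\<close>)
  have "isCont f 0" using f(1) by (rule has_derivative_continuous)
  then have "f \<midarrow>0\<rightarrow> 0" using f(2) by (simp add: isCont_def)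
  then have "eventually (\<lambda>t. f t < 1) (at 0)" by (rule order_tendstoD) simp
  with e have "eventually (\<lambda>t. (g t)\<^sup>2 \<le> 1 * f t ^ 2) (at 0)"
    by eventually_elim (simp add: power_decreasing)
  then have "w2 = 0" using f g 1 by (intro small_square_derivative_zero[OF g, of f 1]) auto
  then show ?thesis using 1 w by simp
qed

text \<open>An obstruction: velocities at a cuspidal edge point lie on one line, so a point with two
  independent velocities is excluded.\<close>

lemma curves_in_cuspidal_edge_dependent:
  assumes "p \<in> cuspidal_edge S" "curve_in S p v" "curve_in S p w"
  shows "\<exists>r s. (r, s) \<noteq> (0, 0) \<and> r *\<^sub>R v + s *\<^sub>R w = 0"
proof -
  obtain W W' \<phi> \<psi> where d: "diffeo W W' \<phi> \<psi>" "p \<in> W" "\<phi> p = 0" "\<phi> ` (S \<inter> W) = standard_cuspidal_edge \<inter> W'"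
    using assms(1) unfolding cuspidal_edge_iff germ_diffeomorphic_def by blast
  let ?D = "frechet_derivative \<phi> (at p)"
  obtain z1 where z1: "?D v = (0, 0, z1)"
    using curve_in_germ_diffeomorphic[OF d(1,2,4) assms(2)] curve_in_cuspidal_edge unfolding d(3) by blast
  obtain z2 where z2: "?D w = (0, 0, z2)"
    using curve_in_germ_diffeomorphic[OF d(1,2,4) assms(3)] curve_in_cuspidal_edge unfolding d(3) by blast
  note z = z1 z2
  have lin: "linear ?D" by (rule has_derivative_linear[OF diffeo_has_derivative[OF d(1,2)]])
  have zero: "u = 0" if "?D u = 0" for u
    using that diffeo_derivative_nonzero[OF d(1,2), of u] by auto
  show ?thesis
  proof (cases "z1 = 0")
    case True
    then have "v = 0" by - (rule zero[of v], simp only: z(1) zero_prod_def)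
    then show ?thesis by (intro exI[of _ 1] exI[of _ 0]) simp
  next
    case False
    have "?D (z2 *\<^sub>R v + (- z1) *\<^sub>R w) = 0"
      by (simp only: linear_add[OF lin] linear_scale[OF lin] z) (simp add: zero_prod_def)
    then have "z2 *\<^sub>R v + (- z1) *\<^sub>R w = 0" by (rule zero)
    then show ?thesis using False by (intro exI[of _ z2] exI[of _ "- z1"]) auto
  qed
qed

text \<open>The union of two coordinate planes contains the three axes, so there are velocities
  spanning the space. The dual form is convenient because at all other points of the swallowtail the
  velocities will satisfy one linear equation.\<close>

lemma double_point_curve_curves:
  assumes "p \<in> double_point_curve S"
  obtains v1 v2 v3 where "curve_in S p v1" "curve_in S p v2" "curve_in S p v3"
    "\<And>L :: space \<Rightarrow> real. linear L \<Longrightarrow> L v1 = 0 \<Longrightarrow> L v2 = 0 \<Longrightarrow> L v3 = 0 \<Longrightarrow> L = (\<lambda>x. 0)"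
proof -
  let ?X = "{(x, y, z). x * y = 0} :: space set"
  obtain W W' \<phi> \<psi> where d: "diffeo W W' \<phi> \<psi>" "p \<in> W" "\<phi> p = 0" "\<phi> ` (S \<inter> W) = ?X \<inter> W'"
    using assms unfolding double_point_curve_def germ_diffeomorphic_def by blast
  note d' = diffeo_sym[OF d(1)]
  have 0: "0 \<in> W'" "\<psi> 0 = p" using diffeo_apply[OF d(1,2)] d(3) by auto
  have im: "\<psi> ` (?X \<inter> W') = S \<inter> W"
    unfolding d(4)[symmetric] using diffeo_apply(2)[OF d(1)] by (force simp: image_iff)
  let ?D = "frechet_derivative \<psi> (at 0)"
  have c: "curve_in S p (?D e)" if "\<And>t. t *\<^sub>R e \<in> ?X" for e
  proof -
    have "curve_in ?X 0 e"
      unfolding curve_in_def using that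
      by (intro exI[of _ "\<lambda>t. t *\<^sub>R e"]) (auto intro!: derivative_eq_intros)
    from curve_in_germ_diffeomorphic[OF d' 0(1) im this] show ?thesis using 0(2) by simp
  qed
  have linD: "linear ?D" by (rule has_derivative_linear[OF diffeo_has_derivative[OF d' 0(1)]])
  have surj: "\<exists>u. v = ?D u" for v
    using diffeo_derivative_inverse[OF d(1,2), of v] d(3) by metis
  show thesis
  proof (rule that[of "?D (1, 0, 0)" "?D (0, 1, 0)" "?D (0, 0, 1)"])
    fix L :: "space \<Rightarrow> real"
    assume L: "linear L" "L (?D (1, 0, 0)) = 0" "L (?D (0, 1, 0)) = 0" "L (?D (0, 0, 1)) = 0"
    have "L (?D u) = 0" for u
    proof -
      obtain a b c where "u = (a, b, c)" by (cases u)
      then have "u = a *\<^sub>R (1, 0, 0) + b *\<^sub>R (0, 1, 0) + c *\<^sub>R (0, 0, 1)" by simp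
      then show ?thesis
        using L by (simp only: linear_add[OF linD] linear_scale[OF linD] linear_add[OF L(1)] linear_scale[OF L(1)]) simp
    qed
    then show "L = (\<lambda>x. 0)" using surj by (metis ext)
  qed (rule c; simp)+
qed

section \<open>Independence of the null vector field\<close>

lemma smooth_on_along [smooth_intros]:
  "open N \<Longrightarrow> smooth_on N g \<Longrightarrow> smooth_on N \<xi> \<Longrightarrow> smooth_on N (along \<xi> g)"
  unfolding along_def by (rule smooth_on_frechet_apply)

lemma smooth_on_along_funpow:
  "open N \<Longrightarrow> smooth_on N g \<Longrightarrow> smooth_on N \<xi> \<Longrightarrow> smooth_on N ((along \<xi> ^^ j) g)"
  by (induction j) (auto intro: smooth_on_along)

lemma along_cong:
  assumes "open N" "q \<in> N" "smooth_on N f" "\<And>z. z \<in> N \<Longrightarrow> f z = g z"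
  shows "along \<xi> f q = along \<xi> g q"
proof -
  have "(g has_derivative frechet_derivative f (at q)) (at q)"
    by (rule has_derivative_transform_within_open[OF smooth_on_imp_has_derivative[OF assms(3,2)] assms(1,2,4)])
  then show ?thesis by (simp add: along_def frechet_derivative_eqI)
qed

lemma along_mult:
  assumes "q \<in> N" "smooth_on N f" "smooth_on N g"
  shows "along \<xi> (\<lambda>z. f z * g z) q = f q * along \<xi> g q + along \<xi> f q * g q"
  using frechet_derivative_eqI[OF has_derivative_mult[OF smooth_on_imp_has_derivative[OF assms(2,1)]
        smooth_on_imp_has_derivative[OF assms(3,1)]]]
  by (simp add: along_def)

lemma along_sum:
  assumes "q \<in> N" "\<And>j. j \<in> J \<Longrightarrow> smooth_on N (f j)"
  shows "along \<xi> (\<lambda>z. \<Sum>j\<in>J. f j z) q = (\<Sum>j\<in>J. along \<xi> (f j) q)"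
proof -
  have "((\<lambda>z. \<Sum>j\<in>J. f j z) has_derivative (\<lambda>v. \<Sum>j\<in>J. frechet_derivative (f j) (at q) v)) (at q)"
    by (intro has_derivative_sum smooth_on_imp_has_derivative[OF assms(2,1)])
  then show ?thesis by (simp add: along_def frechet_derivative_eqI)
qed

lemma along_field:
  assumes "q \<in> N" "smooth_on N g" "\<xi> q = a *\<^sub>R v q + b *\<^sub>R w q"
  shows "along \<xi> g q = a * along v g q + b * along w g q"
proof -
  have "linear (frechet_derivative g (at q))"
    by (rule has_derivative_linear[OF smooth_on_imp_has_derivative[OF assms(2,1)]])
  then show ?thesis by (simp add: along_def assms(3) linear_add linear_scale)
qed

text \<open>\<open>comb N F n g\<close>: on \<open>N\<close>, \<open>g\<close> lies in the ideal generated by \<open>F 0, \<dots>, F (n - 1)\<close>.\<close>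

definition comb :: "plane set \<Rightarrow> (nat \<Rightarrow> plane \<Rightarrow> real) \<Rightarrow> nat \<Rightarrow> (plane \<Rightarrow> real) \<Rightarrow> bool" where
  "comb N F n g \<longleftrightarrow> (\<exists>c. (\<forall>j. smooth_on N (c j)) \<and> (\<forall>q\<in>N. g q = (\<Sum>j<n. c j q * F j q)))"

lemma comb_self: "j < n \<Longrightarrow> comb N F n (F j)"
  unfolding comb_def
  by (rule exI[of _ "\<lambda>i q. if i = j then 1 else 0"])
    (auto intro: smooth_on_const simp: if_distrib[of "\<lambda>x. x * _"] cong: if_cong)

lemma comb_add:
  assumes "open N" "comb N F n f" "comb N F n g"
  shows "comb N F n (\<lambda>q. f q + g q)"
proof -
  obtain c where c: "\<forall>j. smooth_on N (c j)" "\<forall>q\<in>N. f q = (\<Sum>j<n. c j q * F j q)"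
    using assms(2) unfolding comb_def by blast
  obtain d where d: "\<forall>j. smooth_on N (d j)" "\<forall>q\<in>N. g q = (\<Sum>j<n. d j q * F j q)"
    using assms(3) unfolding comb_def by blast
  show ?thesis using c d
    unfolding comb_def
    by (intro exI[of _ "\<lambda>j q. c j q + d j q"])
      (auto intro: smooth_on_add assms(1) simp: sum.distrib distrib_right)
qed

lemma comb_mult:
  assumes "open N" "smooth_on N a" "comb N F n g"
  shows "comb N F n (\<lambda>q. a q * g q)"
proof -
  obtain d where "\<forall>j. smooth_on N (d j)" "\<forall>q\<in>N. g q = (\<Sum>j<n. d j q * F j q)"
    using assms(3) unfolding comb_def by blast
  then show ?thesis
    unfolding comb_def
    by (intro exI[of _ "\<lambda>j q. a q * d j q"])
      (auto intro: smooth_on_mult assms simp: sum_distrib_left mult.assoc)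
qed

lemma comb_cong: "comb N F n f \<Longrightarrow> (\<And>q. q \<in> N \<Longrightarrow> f q = g q) \<Longrightarrow> comb N F n g"
  unfolding comb_def by auto

lemma comb_mono:
  assumes "comb N F n g" "n \<le> m"
  shows "comb N F m g"
proof -
  obtain d where d: "\<forall>j. smooth_on N (d j)" "\<forall>q\<in>N. g q = (\<Sum>j<n. d j q * F j q)"
    using assms(1) unfolding comb_def by blast
  have "(\<Sum>j<m. (if j < n then d j q else 0) * F j q) = (\<Sum>j<n. d j q * F j q)" for q
    using assms(2) by (intro sum.mono_neutral_cong_right) auto
  moreover have "smooth_on N (\<lambda>q. if j < n then d j q else 0)" for j
    using d(1) by (cases "j < n") (auto intro: smooth_on_const)
  ultimately show ?thesis
    unfolding comb_def using d(2)
    by (intro exI[of _ "\<lambda>j q. if j < n then d j q else 0"]) simp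
qed

lemma comb_sum:
  assumes "open N" "\<And>j. j \<in> J \<Longrightarrow> comb N F n (f j)"
  shows "comb N F n (\<lambda>q. \<Sum>j\<in>J. f j q)"
proof -
  have "comb N F n (\<lambda>q. 0)"
    unfolding comb_def by (intro exI[of _ "\<lambda>j q. 0"]) (auto intro: smooth_on_const)
  then show ?thesis
    using assms(2) by (induction J rule: infinite_finite_induct) (auto intro: comb_add[OF assms(1)])
qed

lemma comb_zero: "comb N F n g \<Longrightarrow> p \<in> N \<Longrightarrow> (\<And>j. j < n \<Longrightarrow> F j p = 0) \<Longrightarrow> g p = 0"
  unfolding comb_def by auto

text \<open>If \<open>\<xi>\<close> maps each generator \<open>F j\<close> into the ideal of
  \<open>F 0, ..., F (j + 1)\<close>, then by the Leibniz rule it moves the filtration by these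
  ideals up by at most one step.\<close>

lemma comb_along:
  assumes N: "open N" and F: "\<And>j. smooth_on N (F j)" and \<xi>: "smooth_on N \<xi>"
    and step: "\<And>j. comb N F (j + 2) (along \<xi> (F j))" and g: "comb N F n g"
  shows "comb N F (Suc n) (along \<xi> g)"
proof -
  obtain c where c: "\<And>j. smooth_on N (c j)" "\<And>q. q \<in> N \<Longrightarrow> g q = (\<Sum>j<n. c j q * F j q)"
    using g unfolding comb_def by blast
  have eq: "along \<xi> g q = (\<Sum>j<n. c j q * along \<xi> (F j) q + along \<xi> (c j) q * F j q)" if q: "q \<in> N" for q
  proof -
    have "along \<xi> (\<lambda>q. \<Sum>j<n. c j q * F j q) q = along \<xi> g q"
      by (rule along_cong[OF N q]) (auto intro!: smooth_intros N c(1) F simp: c(2))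
    moreover have "along \<xi> (\<lambda>q. \<Sum>j<n. c j q * F j q) q = (\<Sum>j<n. along \<xi> (\<lambda>q. c j q * F j q) q)"
      by (rule along_sum[OF q]) (auto intro!: smooth_intros N c(1) F)
    ultimately show ?thesis by (simp add: along_mult[OF q c(1) F])
  qed
  have "comb N F (Suc n) (\<lambda>q. \<Sum>j<n. c j q * along \<xi> (F j) q + along \<xi> (c j) q * F j q)"
  proof (rule comb_sum[OF N])
    fix j assume "j \<in> {..<n}"
    then show "comb N F (Suc n) (\<lambda>q. c j q * along \<xi> (F j) q + along \<xi> (c j) q * F j q)"
      by (intro comb_add[OF N] comb_mult[OF N] c(1) smooth_on_along N \<xi> comb_mono[OF step[of j]] comb_self) auto
  qed
  then show ?thesis by (rule comb_cong) (simp add: eq)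
qed

lemma comb_along_funpow:
  assumes "open N" "\<And>j. smooth_on N (F j)" "smooth_on N \<xi>"
    and "\<And>j. comb N F (j + 2) (along \<xi> (F j))" "comb N F 1 g"
  shows "comb N F (Suc j) ((along \<xi> ^^ j) g)"
proof (induction j)
  case (Suc j)
  show ?case using comb_along[OF assms(1-4) Suc] by simp
qed (use assms(5) in simp)

section \<open>Comparison of two null fields along the critical curve\<close>

definition gradient :: "(plane \<Rightarrow> real) \<Rightarrow> plane \<Rightarrow> plane" where
  "gradient l q = (dx l q, dy l q)"

text \<open>The gradient turned by a right angle, tangent to the level curves of
  \<open>l\<close>.\<close>

definition tangent_field :: "(plane \<Rightarrow> real) \<Rightarrow> plane \<Rightarrow> plane" where
  "tangent_field l q = (- dy l q, dx l q)"

lemma linear_plane_apply: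
  assumes "linear (L :: plane \<Rightarrow> 'b::real_vector)"
  shows "L v = fst v *\<^sub>R L (1, 0) + snd v *\<^sub>R L (0, 1)"
proof -
  have "v = fst v *\<^sub>R (1, 0) + snd v *\<^sub>R (0, 1)" by (cases v) auto
  then have "L v = L (fst v *\<^sub>R (1, 0) + snd v *\<^sub>R (0, 1))" by (rule arg_cong)
  then show ?thesis by (simp only: linear_add[OF assms] linear_scale[OF assms])
qed

lemma frechet_derivative_gradient:
  assumes "q \<in> N" "smooth_on N l"
  shows "frechet_derivative l (at q) v = gradient l q \<bullet> v"
  using linear_plane_apply[OF has_derivative_linear[OF smooth_on_imp_has_derivative[OF assms(2,1)]], of v]
  by (simp add: gradient_def dx_def dy_def inner_prod_def mult.commute)

lemma smooth_on_gradient: "open N \<Longrightarrow> smooth_on N l \<Longrightarrow> smooth_on N (gradient l)"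
  unfolding gradient_def dx_def dy_def by (intro smooth_intros smooth_on_frechet)

lemma smooth_on_tangent_field: "open N \<Longrightarrow> smooth_on N l \<Longrightarrow> smooth_on N (tangent_field l)"
  unfolding tangent_field_def dx_def dy_def by (intro smooth_intros smooth_on_frechet)

text \<open>Near a regular point \<open>l\<close> and \<open>T \<bullet> z\<close> are coordinates,
  so \<open>l = 0\<close> is a curve with some velocity \<open>u\<close>. Along it \<open>m\<close>
  vanishes, and \<open>T\<close> is a multiple of \<open>u\<close>.\<close>

lemma along_tangent_field_vanishing:
  assumes N: "open N" and l: "smooth_on N l" and m: "smooth_on N m"
    and van: "\<And>q. q \<in> N \<Longrightarrow> l q = 0 \<Longrightarrow> m q = 0"
    and q: "q \<in> N" "l q = 0" and reg: "gradient l q \<noteq> 0"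
  shows "along (tangent_field l) m q = 0"
proof -
  define T where "T = tangent_field l q"
  define \<Psi> where "\<Psi> z = (l z, T \<bullet> z)" for z
  have T: "T = (- snd (gradient l q), fst (gradient l q))"
    by (simp add: T_def tangent_field_def gradient_def)
  have orth: "v = 0" if "gradient l q \<bullet> v = 0" "T \<bullet> v = 0" for v
  proof -
    obtain g1 g2 v1 v2 where [simp]: "gradient l q = (g1, g2)" "v = (v1, v2)" by fastforce
    have e: "g1 * v1 + g2 * v2 = 0" "- g2 * v1 + g1 * v2 = 0" using that T by auto
    have n: "g1\<^sup>2 + g2\<^sup>2 \<noteq> 0" using reg by (auto simp: sum_power2_eq_zero_iff zero_prod_def)
    have "(g1\<^sup>2 + g2\<^sup>2) * v1 = g1 * (g1 * v1 + g2 * v2) - g2 * (- g2 * v1 + g1 * v2)"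
      "(g1\<^sup>2 + g2\<^sup>2) * v2 = g2 * (g1 * v1 + g2 * v2) + g1 * (- g2 * v1 + g1 * v2)"
      by (simp_all add: algebra_simps power2_eq_square)
    then have "(g1\<^sup>2 + g2\<^sup>2) * v1 = 0" "(g1\<^sup>2 + g2\<^sup>2) * v2 = 0" by (simp_all only: e)
    then show "v = 0" using n by (simp only: mult_eq_0_iff) (simp add: zero_prod_def)
  qed
  have s\<Psi>: "smooth_on N \<Psi>" unfolding \<Psi>_def by (intro smooth_intros N l)
  have D\<Psi>: "(\<Psi> has_derivative (\<lambda>v. (frechet_derivative l (at q) v, T \<bullet> v))) (at q)"
    unfolding \<Psi>_def by (intro has_derivative_Pair smooth_on_imp_has_derivative[OF l q(1)]
        has_derivative_inner_right has_derivative_ident)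
  note gl = frechet_derivative_gradient[OF q(1) l]
  obtain M M' g where g: "diffeo M M' \<Psi> g" "q \<in> M" "M \<subseteq> N"
  proof (rule smooth_inverse_function[OF N s\<Psi> q(1)])
    show "v = 0" if "frechet_derivative \<Psi> (at q) v = 0" for v
      using that orth[of v] by (simp add: frechet_derivative_eqI[OF D\<Psi>] gl zero_prod_def)
  qed
  define u where "u = frechet_derivative g (at (\<Psi> q)) (0, 1)"
  have dg: "(g has_derivative frechet_derivative g (at (\<Psi> q))) (at (\<Psi> q))"
    by (rule diffeo_has_derivative[OF diffeo_sym[OF g(1)] diffeo_apply(1)[OF g(1,2)]])
  have "frechet_derivative \<Psi> (at (g (\<Psi> q))) u = (0, 1)"
    unfolding u_def by (rule diffeo_derivative_inverse[OF diffeo_sym[OF g(1)] diffeo_apply(1)[OF g(1,2)]])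
  then have u: "gradient l q \<bullet> u = 0" "T \<bullet> u = 1"
    using diffeo_apply(2)[OF g(1,2)] by (simp_all add: frechet_derivative_eqI[OF D\<Psi>] gl)
  let ?c = "\<lambda>s::real. \<Psi> q + s *\<^sub>R (0, 1)"
  have dc: "((\<lambda>s. g (?c s)) has_derivative (\<lambda>s. s *\<^sub>R u)) (at 0)"
  proof -
    have "(?c has_derivative (\<lambda>s. s *\<^sub>R (0, 1))) (at 0)"
      by (auto intro!: derivative_eq_intros)
    moreover have "(g has_derivative frechet_derivative g (at (\<Psi> q))) (at (?c 0))"
      using dg by (simp add: zero_prod_def[symmetric])
    ultimately have "((\<lambda>s. g (?c s)) has_derivative (\<lambda>s. frechet_derivative g (at (\<Psi> q)) (s *\<^sub>R (0, 1)))) (at 0)"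
      by (rule has_derivative_compose)
    then show ?thesis
      by (simp only: linear_scale[OF has_derivative_linear[OF dg]] u_def)
  qed
  have g0: "g (?c 0) = q" using diffeo_apply(2)[OF g(1,2)] by (simp add: zero_prod_def[symmetric])
  have "(m has_derivative frechet_derivative m (at q)) (at (g (?c 0)))"
    using smooth_on_imp_has_derivative[OF m q(1)] g0 by simp
  from has_derivative_compose[OF dc this]
  have dm: "((\<lambda>s. m (g (?c s))) has_derivative (\<lambda>s. frechet_derivative m (at q) (s *\<^sub>R u))) (at 0)" .
  have "open M'" using diffeo_open(2)[OF g(1)] .
  moreover have "continuous_on UNIV ?c" by (intro continuous_intros)
  ultimately have "open (?c -` M')" by (simp add: open_vimage)
  moreover have "0 \<in> ?c -` M'" using diffeo_apply(1)[OF g(1,2)] by (simp add: zero_prod_def[symmetric])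
  ultimately have "((\<lambda>s. 0) has_derivative (\<lambda>s. frechet_derivative m (at q) (s *\<^sub>R u))) (at 0)"
  proof (rule has_derivative_transform_within_open[OF dm])
    fix s assume "s \<in> ?c -` M'"
    then have "g (?c s) \<in> M" "\<Psi> (g (?c s)) = ?c s"
      using diffeo_apply[OF diffeo_sym[OF g(1)], of "?c s"] by auto
    then show "m (g (?c s)) = 0"
      using van[of "g (?c s)"] g(3) q(2) by (auto simp: \<Psi>_def)
  qed
  then have "(\<lambda>s. frechet_derivative m (at q) (s *\<^sub>R u)) = (\<lambda>s. 0)"
    using has_derivative_unique has_derivative_const by blast
  then have "frechet_derivative m (at q) (1 *\<^sub>R u) = 0" by meson
  then have mu: "frechet_derivative m (at q) u = 0" by simp
  have TT: "T \<bullet> T \<noteq> 0" using u(2) by force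
  \<comment> \<open>The vector is orthogonal to the gradient and to \<open>T\<close>, which span the
    plane.\<close>
  have "T - (T \<bullet> T) *\<^sub>R u = 0"
  proof (rule orth)
    have "gradient l q \<bullet> T = 0" by (simp add: T inner_prod_def)
    then show "gradient l q \<bullet> (T - (T \<bullet> T) *\<^sub>R u) = 0" by (simp add: inner_diff_right u)
  qed (simp add: inner_diff_right u)
  then have "T = (T \<bullet> T) *\<^sub>R u" by simp
  then have "frechet_derivative m (at q) T = (T \<bullet> T) *\<^sub>R frechet_derivative m (at q) u"
    using linear_scale[OF has_derivative_linear[OF smooth_on_imp_has_derivative[OF m q(1)]]] by metis
  then show ?thesis by (simp add: along_def T_def mu)
qed

text \<open>In the orthogonal frame of \<open>T\<close> and the gradient one has
  \<open>\<eta> = \<alpha> T + H S\<close>, since the gradient component of \<open>\<eta>\<close> is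
  measured by its derivative \<open>H\<close> of \<open>l\<close>. Modulo \<open>H\<close> the two
  fields are proportional, so the derivatives of \<open>H\<close> along \<open>T\<close> and along
  \<open>\<eta>\<close> generate the same ideals wherever \<open>\<alpha>\<close> does not
  vanish.\<close>

lemma tangent_order_to_null_order:
  assumes N: "open N" "p \<in> N" and l: "smooth_on N l" and \<eta>: "smooth_on N \<eta>"
    and reg: "\<And>q. q \<in> N \<Longrightarrow> gradient l q \<noteq> 0" and nz: "\<eta> p \<noteq> 0"
  defines "H \<equiv> along \<eta> l" and "T \<equiv> tangent_field l"
  shows "(\<forall>j<n. (along T ^^ j) H p = 0) \<longleftrightarrow> (\<forall>j<n. (along \<eta> ^^ j) H p = 0)"
proof -
  let ?G = "gradient l"
  define \<alpha> where "\<alpha> q = (\<eta> q \<bullet> T q) / (?G q \<bullet> ?G q)" for q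
  define S where "S q = (1 / (?G q \<bullet> ?G q)) *\<^sub>R ?G q" for q
  have G: "smooth_on N ?G" and T: "smooth_on N T"
    unfolding T_def by (auto intro: smooth_on_gradient smooth_on_tangent_field N l)
  have \<alpha>: "smooth_on N \<alpha>" and S: "smooth_on N S"
    unfolding \<alpha>_def S_def using reg by (auto intro!: smooth_intros N G T \<eta>)
  have H: "smooth_on N H" unfolding H_def by (intro smooth_on_along N l \<eta>)
  have dec: "along \<eta> g q = \<alpha> q * along T g q + H q * along S g q" if "smooth_on N g" "q \<in> N" for g q
  proof (rule along_field[OF that(2,1)])
    obtain g1 g2 v1 v2 where e [simp]: "?G q = (g1, g2)" "\<eta> q = (v1, v2)" by fastforce
    obtain D where D: "D = g1 * g1 + g2 * g2" by blast
    have n: "D \<noteq> 0" using reg[OF that(2)] by (auto simp: D sum_squares_eq_zero_iff zero_prod_def)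
    have "T q = (- g2, g1)" using e(1) by (simp add: T_def tangent_field_def gradient_def)
    then have a: "\<alpha> q = (v2 * g1 - v1 * g2) / D" by (simp add: \<alpha>_def D)
    have h: "H q = g1 * v1 + g2 * v2"
      by (simp add: H_def along_def frechet_derivative_gradient[OF that(2) l])
    have "v1 * D = (v2 * g1 - v1 * g2) * - g2 + (g1 * v1 + g2 * v2) * g1"
      "v2 * D = (v2 * g1 - v1 * g2) * g1 + (g1 * v1 + g2 * v2) * g2"
      unfolding D by algebra+
    then have "v1 = (v2 * g1 - v1 * g2) / D * - g2 + (g1 * v1 + g2 * v2) * (g1 / D)"
      "v2 = (v2 * g1 - v1 * g2) / D * g1 + (g1 * v1 + g2 * v2) * (g2 / D)"
      using n by (simp_all add: divide_simps)
    moreover have "S q = (g1 / D, g2 / D)" by (simp add: S_def D)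
    ultimately show "\<eta> q = \<alpha> q *\<^sub>R T q + H q *\<^sub>R S q"
      using \<open>T q = _\<close> by (simp only: a h e(2)) simp
  qed
  show ?thesis
  proof
    assume z: "\<forall>j<n. (along T ^^ j) H p = 0"
    have c: "comb N (\<lambda>j. (along T ^^ j) H) (Suc j) ((along \<eta> ^^ j) H)" for j
    proof (rule comb_along_funpow[OF N(1) smooth_on_along_funpow[OF N(1) H T] \<eta>])
      fix j
      have "comb N (\<lambda>j. (along T ^^ j) H) (j + 2)
          (\<lambda>q. \<alpha> q * (along T ^^ Suc j) H q + along S ((along T ^^ j) H) q * (along T ^^ 0) H q)"
        by (intro comb_add[OF N(1)] comb_mult[OF N(1)] \<alpha> smooth_on_along smooth_on_along_funpow N(1) H T S
            comb_self[where F = "\<lambda>j. (along T ^^ j) H"]) auto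
      then show "comb N (\<lambda>j. (along T ^^ j) H) (j + 2) (along \<eta> ((along T ^^ j) H))"
        by (rule comb_cong) (simp add: dec[OF smooth_on_along_funpow[OF N(1) H T]])
    qed (use comb_self[of 0 1 N "\<lambda>j. (along T ^^ j) H"] in simp)
    show "\<forall>j<n. (along \<eta> ^^ j) H p = 0"
    proof (intro allI impI)
      fix j assume "j < n"
      then show "(along \<eta> ^^ j) H p = 0" using z by (intro comb_zero[OF c N(2)]) auto
    qed
  next
    assume z: "\<forall>j<n. (along \<eta> ^^ j) H p = 0"
    show "\<forall>j<n. (along T ^^ j) H p = 0"
    proof (cases n)
      case (Suc n')
      then have "(along \<eta> ^^ 0) H p = 0" using z by blast
      then have H0: "H p = 0" by simp
      \<comment> \<open>\<open>H p = 0\<close> says that \<open>\<eta> p\<close> is tangent to the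
        level curve. As \<open>\<eta> p \<noteq> 0\<close>, its tangential coefficient
        \<open>\<alpha>\<close> is non-zero at \<open>p\<close> and can be inverted nearby.\<close>
      define N' where "N' = N \<inter> {q \<in> N. \<alpha> q \<noteq> 0}"
      have "continuous_on N \<alpha>" using \<alpha> smooth_on_imp_continuous_on by blast
      then have "open (N \<inter> \<alpha> -` (- {0}))"
        using N(1) by (intro continuous_open_preimage) auto
      moreover have "N' = N \<inter> \<alpha> -` (- {0})" by (auto simp: N'_def)
      ultimately have N': "open N'" "N' \<subseteq> N" by (auto simp: N'_def)
      show ?thesis
      proof (cases "\<alpha> p = 0")
        case True
        have dot: "\<eta> p \<bullet> T p = 0" using True reg[OF N(2)] by (simp add: \<alpha>_def)
        have "\<eta> p = 0"
        proof -
          obtain g1 g2 v1 v2 where e [simp]: "?G p = (g1, g2)" "\<eta> p = (v1, v2)" by fastforce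
          have n: "g1 * g1 + g2 * g2 \<noteq> 0" using reg[OF N(2)] by (auto simp: sum_squares_eq_zero_iff zero_prod_def)
          have "T p = (- g2, g1)" using e(1) by (simp add: T_def tangent_field_def gradient_def)
          then have e1: "g1 * v2 - g2 * v1 = 0" using dot by (simp add: algebra_simps)
          have e2: "g1 * v1 + g2 * v2 = 0"
            using H0 by (simp add: H_def along_def frechet_derivative_gradient[OF N(2) l])
          have "(g1 * g1 + g2 * g2) * v1 = g1 * (g1 * v1 + g2 * v2) - g2 * (g1 * v2 - g2 * v1)"
            "(g1 * g1 + g2 * g2) * v2 = g2 * (g1 * v1 + g2 * v2) + g1 * (g1 * v2 - g2 * v1)"
            by (simp_all add: algebra_simps)
          then have "(g1 * g1 + g2 * g2) * v1 = 0" "(g1 * g1 + g2 * g2) * v2 = 0" by (simp_all only: e1 e2)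
          then show ?thesis using n by (simp only: mult_eq_0_iff) (simp add: zero_prod_def)
        qed
        with nz show ?thesis by simp
      next
        case False
        then have p: "p \<in> N'" using N(2) by (simp add: N'_def)
        note sub = smooth_on_subset[OF _ N'(2)]
        let ?F = "\<lambda>j. (along \<eta> ^^ j) H"
        have F: "smooth_on N' (?F j)" for j by (rule sub[OF smooth_on_along_funpow[OF N(1) H \<eta>]])
        have i\<alpha>: "smooth_on N' (\<lambda>q. 1 / \<alpha> q)"
          by (intro smooth_intros N' sub[OF \<alpha>]) (auto simp: N'_def)
        have c: "comb N' ?F (Suc j) ((along T ^^ j) H)" for j
        proof (rule comb_along_funpow[OF N'(1) F sub[OF T]])
          fix j
          have "comb N' ?F (j + 2) (\<lambda>q. (1 / \<alpha> q) * (?F (Suc j) q + (- along S (?F j) q) * ?F 0 q))"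
            by (intro comb_add[OF N'(1)] comb_mult[OF N'(1)] i\<alpha> smooth_on_along smooth_on_uminus N'(1) F sub[OF S]
                comb_self[where F = ?F]) auto
          then show "comb N' ?F (j + 2) (along T (?F j))"
            by (rule comb_cong)
              (use dec[OF smooth_on_along_funpow[OF N(1) H \<eta>]] in \<open>auto simp: N'_def field_simps\<close>)
        qed (use comb_self[of 0 1 N' ?F] in simp)
        show ?thesis
        proof (intro allI impI)
          fix j assume "j < n"
          then show "(along T ^^ j) H p = 0" using z by (intro comb_zero[OF c p]) auto
        qed
      qed
    qed simp
  qed
qed

lemma along_diff:
  assumes "q \<in> N" "smooth_on N f" "smooth_on N g"
  shows "along \<xi> (\<lambda>z. f z - g z) q = along \<xi> f q - along \<xi> g q"
  using frechet_derivative_eqI[OF has_derivative_diff[OF smooth_on_imp_has_derivative[OF assms(2,1)]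
        smooth_on_imp_has_derivative[OF assms(3,1)]]]
  by (simp add: along_def)

text \<open>The derivatives of \<open>l\<close> along \<open>\<eta>\<close> and along
  \<open>\<eta>0\<close> agree up to the factor \<open>k\<close> on the curve \<open>l = 0\<close>
  only. Derivatives tangent to the curve do not see the difference elsewhere, so the vanishing is
  carried over in three steps: from \<open>\<eta>0\<close> to \<open>T\<close>, from
  \<open>H0\<close> to \<open>H\<close>, and from \<open>T\<close> to \<open>\<eta>\<close>.\<close>

lemma null_order_transfer:
  assumes N: "open N" "p \<in> N" and l: "smooth_on N l" and s: "smooth_on N \<eta>" "smooth_on N \<eta>0"
    and nz: "\<And>q. q \<in> N \<Longrightarrow> \<eta> q \<noteq> 0" "\<And>q. q \<in> N \<Longrightarrow> \<eta>0 q \<noteq> 0"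
    and sp: "\<And>q. q \<in> N \<Longrightarrow> l q = 0 \<Longrightarrow> span {\<eta> q} = span {\<eta>0 q}"
    and p: "l p = 0" and reg: "\<And>q. q \<in> N \<Longrightarrow> gradient l q \<noteq> 0"
    and van: "\<forall>j<n. (along \<eta>0 ^^ j) (along \<eta>0 l) p = 0"
  shows "\<forall>j<n. (along \<eta> ^^ j) (along \<eta> l) p = 0"
proof -
  define T where "T = tangent_field l"
  define H where "H = along \<eta> l"
  define H0 where "H0 = along \<eta>0 l"
  define k where "k q = (\<eta> q \<bullet> \<eta>0 q) / (\<eta>0 q \<bullet> \<eta>0 q)" for q
  have T: "smooth_on N T" unfolding T_def by (rule smooth_on_tangent_field[OF N(1) l])
  have H: "smooth_on N H" and H0: "smooth_on N H0"
    unfolding H_def H0_def by (intro smooth_on_along N l s)+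
  have k: "smooth_on N k" unfolding k_def using nz by (auto intro!: smooth_intros N s)
  have kH0: "smooth_on N (\<lambda>q. k q * H0 q)" by (intro smooth_intros N k H0)
  have m0: "H q = k q * H0 q" if q: "q \<in> N" "l q = 0" for q
  proof -
    have "\<eta> q \<in> span {\<eta>0 q}" using sp[OF q] span_base by blast
    then obtain r where r: "\<eta> q = r *\<^sub>R \<eta>0 q" by (auto simp: span_singleton)
    then have "k q = r" using nz(2)[OF q(1)] by (simp add: k_def)
    moreover have "linear (frechet_derivative l (at q))"
      by (rule has_derivative_linear[OF smooth_on_imp_has_derivative[OF l q(1)]])
    ultimately show ?thesis by (simp add: H_def H0_def along_def r linear_scale)
  qed
  have m: "(along T ^^ j) H q = (along T ^^ j) (\<lambda>q. k q * H0 q) q" if "q \<in> N" "l q = 0" for j q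
    using that
  proof (induction j arbitrary: q)
    case (Suc j)
    note sm = smooth_on_along_funpow[OF N(1) H T, of j] smooth_on_along_funpow[OF N(1) kH0 T, of j]
    have "along T (\<lambda>q. (along T ^^ j) H q - (along T ^^ j) (\<lambda>q. k q * H0 q) q) q = 0"
      unfolding T_def
      by (rule along_tangent_field_vanishing[OF N(1) l smooth_on_diff[OF N(1) sm, unfolded T_def] _ Suc.prems
            reg[OF Suc.prems(1)]]) (simp add: Suc.IH[unfolded T_def])
    then show ?case by (simp add: along_diff[OF Suc.prems(1) sm])
  qed (simp add: m0)
  have z: "\<forall>j<n. (along T ^^ j) H0 p = 0"
    using tangent_order_to_null_order[OF N l s(2) reg nz(2)[OF N(2)], of n] van by (simp add: T_def H0_def)
  let ?F = "\<lambda>j. (along T ^^ j) H0"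
  have F: "smooth_on N (?F j)" for j by (rule smooth_on_along_funpow[OF N(1) H0 T])
  have c: "comb N ?F (Suc j) ((along T ^^ j) (\<lambda>q. k q * H0 q))" for j
  proof (rule comb_along_funpow[OF N(1) F T])
    show "comb N ?F (j + 2) (along T (?F j))" for j
      using comb_self[of "Suc j" "j + 2" N ?F] by simp
    show "comb N ?F 1 (\<lambda>q. k q * H0 q)"
      using comb_mult[OF N(1) k comb_self[of 0 1 N ?F]] by simp
  qed
  have "\<forall>j<n. (along T ^^ j) H p = 0"
  proof (intro allI impI)
    fix j assume "j < n"
    then show "(along T ^^ j) H p = 0"
      using z unfolding m[OF N(2) p] by (intro comb_zero[OF c N(2)]) auto
  qed
  then show ?thesis
    using tangent_order_to_null_order[OF N l s(1) reg nz(1)[OF N(2)], of n] by (simp add: T_def H_def)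
qed

lemma null_order_unique:
  assumes N: "open N" "p \<in> N" and l: "smooth_on N l" and s: "smooth_on N \<eta>" "smooth_on N \<eta>0"
    and nz: "\<And>q. q \<in> N \<Longrightarrow> \<eta> q \<noteq> 0" "\<And>q. q \<in> N \<Longrightarrow> \<eta>0 q \<noteq> 0"
    and sp: "\<And>q. q \<in> N \<Longrightarrow> l q = 0 \<Longrightarrow> span {\<eta> q} = span {\<eta>0 q}"
    and p: "l p = 0" and reg: "\<not> critical l p"
  shows "(\<forall>j<n. (along \<eta> ^^ Suc j) l p = 0) \<longleftrightarrow> (\<forall>j<n. (along \<eta>0 ^^ Suc j) l p = 0)"
proof -
  define M where "M = N \<inter> gradient l -` (- {0})"
  have g: "gradient l p \<noteq> 0"
  proof
    assume "gradient l p = 0"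
    then have "frechet_derivative l (at p) = (\<lambda>v. 0)"
      by (simp add: fun_eq_iff frechet_derivative_gradient[OF N(2) l])
    then show False using reg by (simp add: critical_def)
  qed
  have M: "open M" "p \<in> M" "M \<subseteq> N"
    using continuous_open_preimage[OF smooth_on_imp_continuous_on[OF smooth_on_gradient[OF N(1) l]] N(1), of "- {0}"] g N(2)
    by (auto simp: M_def)
  note sub = smooth_on_subset[OF _ M(3)]
  have reg: "gradient l q \<noteq> 0" if "q \<in> M" for q using that by (simp add: M_def)
  have sp': "span {\<eta> q} = span {\<eta>0 q}" if "q \<in> M" "l q = 0" for q using sp that M(3) by blast
  have nz': "\<eta> q \<noteq> 0" "\<eta>0 q \<noteq> 0" if "q \<in> M" for q using nz that M(3) by blast+
  have "(\<forall>j<n. (along \<eta> ^^ j) (along \<eta> l) p = 0) \<longleftrightarrow> (\<forall>j<n. (along \<eta>0 ^^ j) (along \<eta>0 l) p = 0)"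
    using null_order_transfer[OF M(1,2) sub[OF l] sub[OF s(1)] sub[OF s(2)] nz' sp' p reg, of n]
      null_order_transfer[OF M(1,2) sub[OF l] sub[OF s(2)] sub[OF s(1)] nz'(2,1) sp'[symmetric] p reg, of n]
    by blast
  then show ?thesis by (simp add: funpow_swap1)
qed

section \<open>The singularities of the family\<close>

text \<open>The Jacobian of the family and all its derivatives along \<open>(x, - y)\<close> have
  this shape. With the five coefficients as arguments, iterated derivatives become a matter of
  rewriting.\<close>

definition cubic :: "real \<Rightarrow> real \<Rightarrow> real \<Rightarrow> real \<Rightarrow> real \<Rightarrow> plane \<Rightarrow> real" where
  "cubic A B C D E = (\<lambda>(x, y). A * x\<^sup>2 + B * x + C * y^3 + D * y\<^sup>2 + E * y)"

lemma cubic_has_derivative: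
  "(cubic A B C D E has_derivative
     (\<lambda>v. (2 * A * fst p + B) * fst v + (3 * C * (snd p)\<^sup>2 + 2 * D * snd p + E) * snd v)) (at p)"
  unfolding cubic_def case_prod_beta
  by (auto intro!: derivative_eq_intros simp: fun_eq_iff algebra_simps power2_eq_square)

lemma smooth_on_cubic: "open S \<Longrightarrow> smooth_on S (cubic A B C D E)"
  unfolding cubic_def case_prod_beta by (intro smooth_intros)

lemma along_cubic:
  "along \<xi> (cubic A B C D E) p =
     (2 * A * fst p + B) * fst (\<xi> p) + (3 * C * (snd p)\<^sup>2 + 2 * D * snd p + E) * snd (\<xi> p)"
  by (simp add: along_def frechet_derivative_eqI[OF cubic_has_derivative])

lemma G_has_derivative:
  "(G a b c has_derivative
     (\<lambda>v. ((2 * fst p + a) * fst v + (3 * (snd p)\<^sup>2 + 2 * c * snd p + b) * snd v,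
           snd p * fst v + fst p * snd v))) (at p)"
  unfolding G_def case_prod_beta
  by (auto intro!: derivative_eq_intros simp: fun_eq_iff algebra_simps power2_eq_square)

lemma frechet_derivative_G:
  "frechet_derivative (G a b c) (at p) v =
     ((2 * fst p + a) * fst v + (3 * (snd p)\<^sup>2 + 2 * c * snd p + b) * snd v,
      snd p * fst v + fst p * snd v)"
  by (simp add: frechet_derivative_eqI[OF G_has_derivative])

lemma jac_G: "jac (G a b c) = cubic 2 a (-3) (- 2 * c) (- b)"
  by (auto simp: fun_eq_iff jac_def dx_def dy_def frechet_derivative_G det_2 cubic_def
      power2_eq_square power3_eq_cube algebra_simps)

lemma jac_G_apply: "jac (G a b c) (x, y) = 2 * x\<^sup>2 + a * x - 3 * y^3 - 2 * c * y\<^sup>2 - b * y"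
  by (simp add: jac_G cubic_def)

lemma critical_jac_G:
  "critical (jac (G a b c)) (x, y) \<longleftrightarrow> 4 * x + a = 0 \<and> 9 * y\<^sup>2 + 4 * c * y + b = 0"
proof
  assume "critical (jac (G a b c)) (x, y)"
  then have "\<And>v. (4 * x + a) * fst v + (- 9 * y\<^sup>2 - 4 * c * y - b) * snd v = 0"
    by (simp add: critical_def jac_G frechet_derivative_eqI[OF cubic_has_derivative] fun_eq_iff)
  from this[of "(1, 0)"] this[of "(0, 1)"] show "4 * x + a = 0 \<and> 9 * y\<^sup>2 + 4 * c * y + b = 0"
    by (simp add: algebra_simps)
next
  assume "4 * x + a = 0 \<and> 9 * y\<^sup>2 + 4 * c * y + b = 0"
  then show "critical (jac (G a b c)) (x, y)"
    by (auto simp: critical_def jac_G frechet_derivative_eqI[OF cubic_has_derivative] fun_eq_iff)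
qed

lemma span_kernel:
  fixes r s :: real
  assumes "(r, s) \<noteq> (0, 0)"
  shows "span {(s, - r)} = {v. r * fst v + s * snd v = 0}"
proof (intro equalityI subsetI)
  fix v assume "v \<in> {v. r * fst v + s * snd v = 0}"
  then obtain h k where v: "v = (h, k)" "r * h + s * k = 0" by (cases v) auto
  obtain D where D: "D = r * r + s * s" by blast
  have n: "D \<noteq> 0" using assms by (auto simp: D sum_squares_eq_zero_iff)
  have "h * D = (s * h - r * k) * s + r * (r * h + s * k)" "k * D = (s * h - r * k) * - r + s * (r * h + s * k)"
    unfolding D by algebra+
  then have "v = ((s * h - r * k) / D) *\<^sub>R (s, - r)"
    using n v by (simp add: divide_simps)
  then show "v \<in> span {(s, - r)}" unfolding span_singleton by blast
qed (auto simp: span_singleton)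

definition euler_field :: "plane \<Rightarrow> plane" where
  "euler_field = (\<lambda>(x, y). (x, - y))"

definition gradient_field :: "real \<Rightarrow> real \<Rightarrow> real \<Rightarrow> plane \<Rightarrow> plane" where
  "gradient_field a b c = (\<lambda>(x, y). (3 * y\<^sup>2 + 2 * c * y + b, - (2 * x + a)))"

text \<open>Off the origin the second row \<open>(y, x)\<close> of the differential is non-zero with
  kernel spanned by \<open>(x, - y)\<close>; on the singular set the first row is dependent on
  it.\<close>

lemma null_field_euler:
  assumes "p \<noteq> (0, 0)" "jac (G a b c) p = 0"
  shows "null_field (G a b c) p euler_field"
  unfolding null_field_def
proof (intro conjI exI[of _ "- {(0, 0)}"] ballI impI)
  show o: "open (- {(0, 0) :: plane})" by (simp add: open_Compl)
  show "smooth_on (- {(0, 0)}) euler_field"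
    unfolding euler_field_def case_prod_beta by (intro smooth_intros o)
  fix q :: plane assume q: "q \<in> - {(0, 0)}"
  obtain x y where xy: "q = (x, y)" by fastforce
  show "euler_field q \<noteq> 0" using q by (auto simp: euler_field_def xy zero_prod_def)
  assume "jac (G a b c) q = 0"
  then have l: "2 * x\<^sup>2 + a * x - 3 * y^3 - 2 * c * y\<^sup>2 - b * y = 0" by (simp add: xy jac_G_apply)
  have "span {(x, - y)} = {v. y * fst v + x * snd v = 0}"
    using q by (intro span_kernel) (auto simp: xy)
  also have "\<dots> = {v. frechet_derivative (G a b c) (at q) v = 0}"
  proof (intro Collect_cong iffI)
    fix v :: plane assume v: "y * fst v + x * snd v = 0"
    then have "v \<in> span {(x, - y)}" using \<open>span _ = _\<close> by blast
    then obtain t where "v = t *\<^sub>R (x, - y)" by (auto simp: span_singleton)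
    moreover have "(2 * x + a) * (t * x) + (3 * y\<^sup>2 + 2 * c * y + b) * (t * - y)
        = t * (2 * x\<^sup>2 + a * x - 3 * y^3 - 2 * c * y\<^sup>2 - b * y)"
      by algebra
    ultimately show "frechet_derivative (G a b c) (at q) v = 0"
      using v l by (simp add: frechet_derivative_G xy zero_prod_def)
  qed (simp add: frechet_derivative_G xy zero_prod_def)
  finally show "span {euler_field q} = {v. frechet_derivative (G a b c) (at q) v = 0}"
    by (simp add: euler_field_def xy)
qed (use assms in auto)

text \<open>At the origin the second row of the differential vanishes, so the kernel of the first
  row has to serve. That row is \<open>(a, b)\<close> at the origin and stays non-zero
  nearby.\<close>

lemma null_field_gradient:
  assumes "(a, b) \<noteq> (0, 0)"
  shows "null_field (G a b c) (0, 0) (gradient_field a b c)"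
proof -
  have s: "smooth_on UNIV (gradient_field a b c)"
    unfolding gradient_field_def case_prod_beta by (intro smooth_intros open_UNIV)
  define N where "N = gradient_field a b c -` (- {0})"
  have N: "open N"
    unfolding N_def by (rule open_vimage) (auto intro: smooth_on_imp_continuous_on[OF s])
  show ?thesis
    unfolding null_field_def
  proof (intro conjI exI[of _ N] ballI impI N)
    show "smooth_on N (gradient_field a b c)" by (rule smooth_on_subset[OF s]) simp
    show "jac (G a b c) (0, 0) = 0" by (simp add: jac_G_apply)
    show "(0, 0) \<in> N" using assms by (auto simp: N_def gradient_field_def zero_prod_def)
    fix q assume q: "q \<in> N"
    then show "gradient_field a b c q \<noteq> 0" by (simp add: N_def)
    obtain x y where xy: "q = (x, y)" by fastforce
    let ?r = "2 * x + a" and ?s = "3 * y\<^sup>2 + 2 * c * y + b"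
    assume "jac (G a b c) q = 0"
    then have l: "2 * x\<^sup>2 + a * x - 3 * y^3 - 2 * c * y\<^sup>2 - b * y = 0" by (simp add: xy jac_G_apply)
    have "span {(?s, - ?r)} = {v. ?r * fst v + ?s * snd v = 0}"
      using q by (intro span_kernel) (auto simp: N_def gradient_field_def xy zero_prod_def)
    also have "\<dots> = {v. frechet_derivative (G a b c) (at q) v = 0}"
    proof (intro Collect_cong iffI)
      fix v :: plane assume v: "?r * fst v + ?s * snd v = 0"
      then have "v \<in> span {(?s, - ?r)}" using \<open>span _ = _\<close> by blast
      then obtain t where "v = t *\<^sub>R (?s, - ?r)" by (auto simp: span_singleton)
      moreover have "y * (t * ?s) + x * (t * - ?r) = - t * (2 * x\<^sup>2 + a * x - 3 * y^3 - 2 * c * y\<^sup>2 - b * y)"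
        by algebra
      ultimately show "frechet_derivative (G a b c) (at q) v = 0"
        using v l by (simp add: frechet_derivative_G xy zero_prod_def)
    qed (simp add: frechet_derivative_G xy zero_prod_def)
    finally show "span {gradient_field a b c q} = {v. frechet_derivative (G a b c) (at q) v = 0}"
      by (simp add: gradient_field_def xy)
  qed
qed

lemma null_field_span:
  "null_field f p \<eta> \<Longrightarrow> span {\<eta> p} = {v. frechet_derivative f (at p) v = 0}"
  "null_field f p \<eta> \<Longrightarrow> \<eta> p \<noteq> 0" "null_field f p \<eta> \<Longrightarrow> jac f p = 0"
  unfolding null_field_def by auto

text \<open>For \<open>a = b = 0\<close> the differential at the origin is zero, and its
  two-dimensional kernel is not spanned by one vector.\<close>

lemma null_field_corank_one:
  assumes "null_field (G a b c) (x, y) \<eta>"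
  shows "(x, y) \<noteq> (0, 0) \<or> (a, b) \<noteq> (0, 0)"
proof (rule ccontr)
  assume "\<not> ?thesis"
  then have "span {\<eta> (x, y)} = (UNIV :: plane set)"
    using null_field_span(1)[OF assms] by (simp add: frechet_derivative_G zero_prod_def)
  then have "dim (UNIV :: plane set) \<le> 1"
    by (metis One_nat_def card.empty card_insert_le_m1 dim_le_card dim_span finite.emptyI finite.insertI
        card.insert empty_iff span_superset)
  then show False by simp
qed

lemma null_field_order:
  assumes "null_field f p \<eta>" "null_field f p \<eta>0" "smooth_on UNIV (jac f)" "\<not> critical (jac f) p"
  shows "(\<forall>j<n. (along \<eta> ^^ Suc j) (jac f) p = 0) \<longleftrightarrow> (\<forall>j<n. (along \<eta>0 ^^ Suc j) (jac f) p = 0)"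
proof -
  obtain N where N: "open N" "p \<in> N" "smooth_on N \<eta>" "\<forall>q\<in>N. \<eta> q \<noteq> 0"
    "\<forall>q\<in>N. jac f q = 0 \<longrightarrow> span {\<eta> q} = {v. frechet_derivative f (at q) v = 0}"
    using assms(1) unfolding null_field_def by blast
  obtain M where M: "open M" "p \<in> M" "smooth_on M \<eta>0" "\<forall>q\<in>M. \<eta>0 q \<noteq> 0"
    "\<forall>q\<in>M. jac f q = 0 \<longrightarrow> span {\<eta>0 q} = {v. frechet_derivative f (at q) v = 0}"
    using assms(2) unfolding null_field_def by blast
  show ?thesis
  proof (rule null_order_unique[of "N \<inter> M"])
    show "smooth_on (N \<inter> M) \<eta>" "smooth_on (N \<inter> M) \<eta>0" "smooth_on (N \<inter> M) (jac f)"
      using N(3) M(3) assms(3) by (auto intro: smooth_on_subset)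
  qed (use N M null_field_span(3)[OF assms(1)] assms(4) in auto)
qed

text \<open>The definition asks for some null field; by the comparison of orders any given one
  decides. A non-zero derivative of the Jacobian already makes the point regular for it.\<close>

lemma fold_pt_iff:
  assumes "null_field f p \<eta>0" "smooth_on UNIV (jac f)"
  shows "fold_pt f p \<longleftrightarrow> along \<eta>0 (jac f) p \<noteq> 0"
proof
  assume "fold_pt f p"
  then obtain \<eta> where \<eta>: "null_field f p \<eta>" "along \<eta> (jac f) p \<noteq> 0" unfolding fold_pt_def by blast
  then have "\<not> critical (jac f) p" by (auto simp: critical_def along_def)
  from null_field_order[OF \<eta>(1) assms this, of 1]
  have "along \<eta> (jac f) p = 0 \<longleftrightarrow> along \<eta>0 (jac f) p = 0" by simp
  with \<eta>(2) show "along \<eta>0 (jac f) p \<noteq> 0" by simp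
qed (use assms in \<open>auto simp: fold_pt_def\<close>)

lemma all_less_numeral: "(\<forall>j<Suc n. P j) \<longleftrightarrow> (\<forall>j<n. P j) \<and> P n"
  using less_Suc_eq by auto

lemma cusp_pt_iff:
  assumes "null_field f p \<eta>0" "smooth_on UNIV (jac f)"
  shows "cusp_pt f p \<longleftrightarrow> \<not> critical (jac f) p \<and> along \<eta>0 (jac f) p = 0 \<and> (along \<eta>0 ^^ 2) (jac f) p \<noteq> 0"
proof
  assume "cusp_pt f p"
  then obtain \<eta> where \<eta>: "null_field f p \<eta>" "\<not> critical (jac f) p" "along \<eta> (jac f) p = 0"
    "(along \<eta> ^^ 2) (jac f) p \<noteq> 0" unfolding cusp_pt_def by blast
  note o = null_field_order[OF \<eta>(1) assms \<eta>(2)]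
  show "\<not> critical (jac f) p \<and> along \<eta>0 (jac f) p = 0 \<and> (along \<eta>0 ^^ 2) (jac f) p \<noteq> 0"
    using o[of 1] o[of 2] \<eta> by (auto simp: all_less_numeral numeral_2_eq_2)
qed (use assms in \<open>auto simp: cusp_pt_def\<close>)

lemma swallowtail_pt_iff:
  assumes "null_field f p \<eta>0" "smooth_on UNIV (jac f)"
  shows "swallowtail_pt f p \<longleftrightarrow> \<not> critical (jac f) p \<and> along \<eta>0 (jac f) p = 0 \<and>
    (along \<eta>0 ^^ 2) (jac f) p = 0 \<and> (along \<eta>0 ^^ 3) (jac f) p \<noteq> 0"
proof
  assume "swallowtail_pt f p"
  then obtain \<eta> where \<eta>: "null_field f p \<eta>" "\<not> critical (jac f) p" "along \<eta> (jac f) p = 0"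
    "(along \<eta> ^^ 2) (jac f) p = 0" "(along \<eta> ^^ 3) (jac f) p \<noteq> 0" unfolding swallowtail_pt_def by blast
  note o = null_field_order[OF \<eta>(1) assms \<eta>(2)]
  show "\<not> critical (jac f) p \<and> along \<eta>0 (jac f) p = 0 \<and>
    (along \<eta>0 ^^ 2) (jac f) p = 0 \<and> (along \<eta>0 ^^ 3) (jac f) p \<noteq> 0"
    using o[of 2] o[of 3] \<eta> by (auto simp: all_less_numeral numeral_2_eq_2 numeral_3_eq_3)
qed (use assms in \<open>auto simp: swallowtail_pt_def\<close>)

lemma butterfly_pt_iff:
  assumes "null_field f p \<eta>0" "smooth_on UNIV (jac f)"
  shows "butterfly_pt f p \<longleftrightarrow> \<not> critical (jac f) p \<and> along \<eta>0 (jac f) p = 0 \<and>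
    (along \<eta>0 ^^ 2) (jac f) p = 0 \<and> (along \<eta>0 ^^ 3) (jac f) p = 0 \<and> (along \<eta>0 ^^ 4) (jac f) p \<noteq> 0"
proof
  assume "butterfly_pt f p"
  then obtain \<eta> where \<eta>: "null_field f p \<eta>" "\<not> critical (jac f) p" "along \<eta> (jac f) p = 0"
    "(along \<eta> ^^ 2) (jac f) p = 0" "(along \<eta> ^^ 3) (jac f) p = 0" "(along \<eta> ^^ 4) (jac f) p \<noteq> 0"
    unfolding butterfly_pt_def by blast
  have 4: "(4 :: nat) = Suc (Suc (Suc (Suc 0)))" by simp
  note o = null_field_order[OF \<eta>(1) assms \<eta>(2)]
  show "\<not> critical (jac f) p \<and> along \<eta>0 (jac f) p = 0 \<and>
    (along \<eta>0 ^^ 2) (jac f) p = 0 \<and> (along \<eta>0 ^^ 3) (jac f) p = 0 \<and> (along \<eta>0 ^^ 4) (jac f) p \<noteq> 0"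
    using o[of 3] o[of 4] \<eta> by (auto simp: all_less_numeral numeral_2_eq_2 numeral_3_eq_3 4)
qed (use assms in \<open>auto simp: butterfly_pt_def\<close>)

lemma smooth_jac_G: "smooth_on UNIV (jac (G a b c))"
  unfolding jac_G by (rule smooth_on_cubic) simp

text \<open>A monomial \<open>x^i y^j\<close> is an eigenvector of the Euler field with eigenvalue
  \<open>i - j\<close>; the five coefficients are multiplied by 2, 1, -3, -2 and -1.\<close>

lemma along_euler_cubic: "along euler_field (cubic A B C D E) = cubic (2 * A) B (- 3 * C) (- 2 * D) (- E)"
proof
  fix p
  show "along euler_field (cubic A B C D E) p = cubic (2 * A) B (- 3 * C) (- 2 * D) (- E) p"
    unfolding along_cubic
    by (cases p) (simp add: euler_field_def cubic_def power2_eq_square power3_eq_cube algebra_simps)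
qed

lemma euler_derivatives:
  "along euler_field (jac (G a b c)) (x, y) = 4 * x\<^sup>2 + a * x + 9 * y^3 + 4 * c * y\<^sup>2 + b * y"
  "(along euler_field ^^ 2) (jac (G a b c)) (x, y) = 8 * x\<^sup>2 + a * x - 27 * y^3 - 8 * c * y\<^sup>2 - b * y"
  "(along euler_field ^^ 3) (jac (G a b c)) (x, y) = 16 * x\<^sup>2 + a * x + 81 * y^3 + 16 * c * y\<^sup>2 + b * y"
  "(along euler_field ^^ 4) (jac (G a b c)) (x, y) = 32 * x\<^sup>2 + a * x - 243 * y^3 - 32 * c * y\<^sup>2 - b * y"
proof -
  have 4: "(4 :: nat) = Suc (Suc (Suc (Suc 0)))" by simp
  show "along euler_field (jac (G a b c)) (x, y) = 4 * x\<^sup>2 + a * x + 9 * y^3 + 4 * c * y\<^sup>2 + b * y"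
  "(along euler_field ^^ 2) (jac (G a b c)) (x, y) = 8 * x\<^sup>2 + a * x - 27 * y^3 - 8 * c * y\<^sup>2 - b * y"
  "(along euler_field ^^ 3) (jac (G a b c)) (x, y) = 16 * x\<^sup>2 + a * x + 81 * y^3 + 16 * c * y\<^sup>2 + b * y"
  "(along euler_field ^^ 4) (jac (G a b c)) (x, y) = 32 * x\<^sup>2 + a * x - 243 * y^3 - 32 * c * y\<^sup>2 - b * y"
    unfolding numeral_2_eq_2 numeral_3_eq_3 4
    by (simp_all add: jac_G along_euler_cubic, simp_all add: cubic_def power2_eq_square power3_eq_cube)
qed

text \<open>The null field at the origin only matters where one of \<open>a\<close>, \<open>b\<close> vanishes.\<close>

lemma gradient_field_first:
  "along (gradient_field a b c) (jac (G a b c)) =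
    (\<lambda>(x, y). (4 * x + a) * (3 * y\<^sup>2 + 2 * c * y + b) + (9 * y\<^sup>2 + 4 * c * y + b) * (2 * x + a))"
  by (auto simp: fun_eq_iff jac_G along_cubic gradient_field_def algebra_simps)

lemma gradient_field_second:
  "(along (gradient_field a b c) ^^ 2) (jac (G a b c)) =
    (\<lambda>(x, y). (4 * (3 * y\<^sup>2 + 2 * c * y + b) + 2 * (9 * y\<^sup>2 + 4 * c * y + b)) * (3 * y\<^sup>2 + 2 * c * y + b)
      - ((4 * x + a) * (6 * y + 2 * c) + (18 * y + 4 * c) * (2 * x + a)) * (2 * x + a))"
proof -
  have "((\<lambda>(x, y). (4 * x + a) * (3 * y\<^sup>2 + 2 * c * y + b) + (9 * y\<^sup>2 + 4 * c * y + b) * (2 * x + a))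
    has_derivative (\<lambda>v. (4 * (3 * (snd p)\<^sup>2 + 2 * c * snd p + b) + 2 * (9 * (snd p)\<^sup>2 + 4 * c * snd p + b)) * fst v
      + ((4 * fst p + a) * (6 * snd p + 2 * c) + (18 * snd p + 4 * c) * (2 * fst p + a)) * snd v)) (at p)" for p
    unfolding case_prod_beta
    by (auto intro!: derivative_eq_intros simp: fun_eq_iff algebra_simps)
  note D = frechet_derivative_eqI[OF this]
  have 2: "(along \<eta> ^^ 2) l = along \<eta> (along \<eta> l)" for \<eta> l by (simp add: numeral_2_eq_2)
  show ?thesis
    unfolding 2 gradient_field_first
  proof
    fix p :: plane
    show "along (gradient_field a b c)
        (\<lambda>(x, y). (4 * x + a) * (3 * y\<^sup>2 + 2 * c * y + b) + (9 * y\<^sup>2 + 4 * c * y + b) * (2 * x + a)) p =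
      (case p of (x, y) \<Rightarrow> (4 * (3 * y\<^sup>2 + 2 * c * y + b) + 2 * (9 * y\<^sup>2 + 4 * c * y + b)) * (3 * y\<^sup>2 + 2 * c * y + b)
      - ((4 * x + a) * (6 * y + 2 * c) + (18 * y + 4 * c) * (2 * x + a)) * (2 * x + a))"
      unfolding along_def D by (simp add: gradient_field_def case_prod_beta algebra_simps)
  qed
qed

text \<open>At the origin the first two derivatives are \<open>2 * a * b\<close> and
  \<open>6 * b^2 - 6 * a^2 * c\<close>. With \<open>(a, b) \<noteq> (0, 0)\<close> both vanish only
  for \<open>b = c = 0\<close>, so the third one matters in this case.\<close>

lemma gradient_field_third:
  "(along (gradient_field a 0 0) ^^ 3) (jac (G a 0 0)) (0, 0) = 24 * a^3"
proof -
  have "((\<lambda>(x, y). (4 * (3 * y\<^sup>2) + 2 * (9 * y\<^sup>2)) * (3 * y\<^sup>2)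
      - ((4 * x + a) * (6 * y) + (18 * y) * (2 * x + a)) * (2 * x + a))
      has_derivative (\<lambda>v. - 24 * a\<^sup>2 * snd v)) (at (0, 0))"
    unfolding case_prod_beta
    by (auto intro!: derivative_eq_intros simp: fun_eq_iff algebra_simps power2_eq_square)
  from frechet_derivative_eqI[OF this] have d: "along (gradient_field a 0 0)
      (\<lambda>(x, y). (4 * (3 * y\<^sup>2) + 2 * (9 * y\<^sup>2)) * (3 * y\<^sup>2)
        - ((4 * x + a) * (6 * y) + (18 * y) * (2 * x + a)) * (2 * x + a)) (0, 0) = 24 * a^3"
    by (simp add: along_def gradient_field_def power2_eq_square power3_eq_cube)
  have "(along (gradient_field a 0 0) ^^ 2) (jac (G a 0 0)) =
      (\<lambda>(x, y). (4 * (3 * y\<^sup>2) + 2 * (9 * y\<^sup>2)) * (3 * y\<^sup>2)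
        - ((4 * x + a) * (6 * y) + (18 * y) * (2 * x + a)) * (2 * x + a))"
    using gradient_field_second[of a 0 0] by simp
  moreover have "(along (gradient_field a 0 0) ^^ 3) (jac (G a 0 0)) =
      along (gradient_field a 0 0) ((along (gradient_field a 0 0) ^^ 2) (jac (G a 0 0)))"
    by (simp add: numeral_2_eq_2 numeral_3_eq_3)
  ultimately show ?thesis using d by simp
qed

section \<open>Polynomial conditions for the corank one types\<close>

lemma fold_pt_G:
  assumes "(x, y) \<noteq> (0, 0)"
  shows "fold_pt (G a b c) (x, y) \<longleftrightarrow> 2 * x\<^sup>2 + a * x - 3 * y^3 - 2 * c * y\<^sup>2 - b * y = 0 \<and>
    4 * x\<^sup>2 + a * x + 9 * y^3 + 4 * c * y\<^sup>2 + b * y \<noteq> 0"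
proof (cases "jac (G a b c) (x, y) = 0")
  case True
  then show ?thesis
    using fold_pt_iff[OF null_field_euler[OF assms True] smooth_jac_G]
    by (simp only: euler_derivatives jac_G_apply) simp
next
  case False
  then have "\<not> fold_pt (G a b c) (x, y)" using null_field_span(3) unfolding fold_pt_def by blast
  with False show ?thesis by (simp add: jac_G_apply)
qed

lemma cusp_pt_G:
  assumes "(x, y) \<noteq> (0, 0)"
  shows "cusp_pt (G a b c) (x, y) \<longleftrightarrow> 2 * x\<^sup>2 + a * x - 3 * y^3 - 2 * c * y\<^sup>2 - b * y = 0 \<and>
    4 * x\<^sup>2 + a * x + 9 * y^3 + 4 * c * y\<^sup>2 + b * y = 0 \<and>
    8 * x\<^sup>2 + a * x - 27 * y^3 - 8 * c * y\<^sup>2 - b * y \<noteq> 0 \<and>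
    \<not> (4 * x + a = 0 \<and> 9 * y\<^sup>2 + 4 * c * y + b = 0)"
proof (cases "jac (G a b c) (x, y) = 0")
  case True
  then show ?thesis
    using cusp_pt_iff[OF null_field_euler[OF assms True] smooth_jac_G]
    by (simp only: euler_derivatives jac_G_apply critical_jac_G) blast
next
  case False
  then have "\<not> cusp_pt (G a b c) (x, y)" using null_field_span(3) unfolding cusp_pt_def by blast
  with False show ?thesis by (simp add: jac_G_apply)
qed

lemma swallowtail_pt_G:
  assumes "(x, y) \<noteq> (0, 0)"
  shows "swallowtail_pt (G a b c) (x, y) \<longleftrightarrow> 2 * x\<^sup>2 + a * x - 3 * y^3 - 2 * c * y\<^sup>2 - b * y = 0 \<and>
    4 * x\<^sup>2 + a * x + 9 * y^3 + 4 * c * y\<^sup>2 + b * y = 0 \<and>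
    8 * x\<^sup>2 + a * x - 27 * y^3 - 8 * c * y\<^sup>2 - b * y = 0 \<and>
    16 * x\<^sup>2 + a * x + 81 * y^3 + 16 * c * y\<^sup>2 + b * y \<noteq> 0 \<and>
    \<not> (4 * x + a = 0 \<and> 9 * y\<^sup>2 + 4 * c * y + b = 0)"
proof (cases "jac (G a b c) (x, y) = 0")
  case True
  then show ?thesis
    using swallowtail_pt_iff[OF null_field_euler[OF assms True] smooth_jac_G]
    by (simp only: euler_derivatives jac_G_apply critical_jac_G) blast
next
  case False
  then have "\<not> swallowtail_pt (G a b c) (x, y)"
    using null_field_span(3) unfolding swallowtail_pt_def by blast
  with False show ?thesis by (simp add: jac_G_apply)
qed

lemma butterfly_pt_G:
  assumes "(x, y) \<noteq> (0, 0)"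
  shows "butterfly_pt (G a b c) (x, y) \<longleftrightarrow> 2 * x\<^sup>2 + a * x - 3 * y^3 - 2 * c * y\<^sup>2 - b * y = 0 \<and>
    4 * x\<^sup>2 + a * x + 9 * y^3 + 4 * c * y\<^sup>2 + b * y = 0 \<and>
    8 * x\<^sup>2 + a * x - 27 * y^3 - 8 * c * y\<^sup>2 - b * y = 0 \<and>
    16 * x\<^sup>2 + a * x + 81 * y^3 + 16 * c * y\<^sup>2 + b * y = 0 \<and>
    32 * x\<^sup>2 + a * x - 243 * y^3 - 32 * c * y\<^sup>2 - b * y \<noteq> 0 \<and>
    \<not> (4 * x + a = 0 \<and> 9 * y\<^sup>2 + 4 * c * y + b = 0)"
proof (cases "jac (G a b c) (x, y) = 0")
  case True
  then show ?thesis
    using butterfly_pt_iff[OF null_field_euler[OF assms True] smooth_jac_G]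
    by (simp only: euler_derivatives jac_G_apply critical_jac_G) blast
next
  case False
  then have "\<not> butterfly_pt (G a b c) (x, y)"
    using null_field_span(3) unfolding butterfly_pt_def by blast
  with False show ?thesis by (simp add: jac_G_apply)
qed

lemma corank_two_no_null_field: "\<not> null_field (G 0 0 c) (0, 0) \<eta>"
  using null_field_corank_one by blast

lemma fold_pt_G_origin: "fold_pt (G a b c) (0, 0) \<longleftrightarrow> a * b \<noteq> 0"
proof (cases "(a, b) = (0, 0)")
  case True
  then show ?thesis using corank_two_no_null_field by (auto simp: fold_pt_def)
next
  case False
  show ?thesis
    using fold_pt_iff[OF null_field_gradient[OF False] smooth_jac_G]
    by (simp add: gradient_field_first)
qed

lemma critical_jac_G_origin: "critical (jac (G a b c)) (0, 0) \<longleftrightarrow> (a, b) = (0, 0)"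
  using critical_jac_G[of a b c 0 0] by simp

lemma cusp_pt_G_origin: "cusp_pt (G a b c) (0, 0) \<longleftrightarrow> (a = 0 \<and> b \<noteq> 0) \<or> (b = 0 \<and> a \<noteq> 0 \<and> c \<noteq> 0)"
proof (cases "(a, b) = (0, 0)")
  case True
  then show ?thesis using corank_two_no_null_field by (auto simp: cusp_pt_def)
next
  case False
  show ?thesis
    using cusp_pt_iff[OF null_field_gradient[OF False] smooth_jac_G, of c] False
    by (auto simp: gradient_field_first gradient_field_second critical_jac_G_origin)
qed

text \<open>The source of the a-axis in the swallowtail component, which the parametrization by
  \<open>r = x / y\<close> misses.\<close>

lemma swallowtail_pt_G_origin: "swallowtail_pt (G a b c) (0, 0) \<longleftrightarrow> b = 0 \<and> c = 0 \<and> a \<noteq> 0"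
proof (cases "(a, b) = (0, 0)")
  case True
  then show ?thesis using corank_two_no_null_field by (auto simp: swallowtail_pt_def)
next
  case False
  show ?thesis
    using swallowtail_pt_iff[OF null_field_gradient[OF False] smooth_jac_G, of c] False gradient_field_third[of a]
    by (auto simp: gradient_field_first gradient_field_second critical_jac_G_origin)
qed

lemma butterfly_pt_G_origin: "\<not> butterfly_pt (G a b c) (0, 0)"
proof (cases "(a, b) = (0, 0)")
  case True
  then show ?thesis using corank_two_no_null_field by (auto simp: butterfly_pt_def)
next
  case False
  show ?thesis
    using butterfly_pt_iff[OF null_field_gradient[OF False] smooth_jac_G, of c] False gradient_field_third[of a]
    by (auto simp: gradient_field_first gradient_field_second critical_jac_G_origin)
qed

text \<open>As the gradient vanishes at \<open>p\<close>, derivatives of \<open>\<eta>\<close> drop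
  out of the product rule, and the Hessian form of \<open>l\<close> on the single vector
  \<open>\<eta> p\<close> remains.\<close>

lemma second_derivative_critical:
  assumes s: "smooth_on UNIV l" and \<eta>: "null_field f p \<eta>" and cr: "critical l p"
  shows "(along \<eta> ^^ 2) l p = frechet_derivative (dx l) (at p) (\<eta> p) * fst (\<eta> p)
    + frechet_derivative (dy l) (at p) (\<eta> p) * snd (\<eta> p)"
proof -
  obtain N where N: "open N" "p \<in> N" "smooth_on N \<eta>" using \<eta> unfolding null_field_def by blast
  have eq: "along \<eta> l = (\<lambda>q. dx l q * fst (\<eta> q) + dy l q * snd (\<eta> q))"
  proof
    fix q
    have "linear (frechet_derivative l (at q))"
      using has_derivative_linear[OF smooth_on_imp_has_derivative[OF s UNIV_I]] .
    from linear_plane_apply[OF this, of "\<eta> q"]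
    show "along \<eta> l q = dx l q * fst (\<eta> q) + dy l q * snd (\<eta> q)"
      by (simp add: along_def dx_def dy_def mult.commute)
  qed
  have z: "dx l p = 0" "dy l p = 0" using cr by (simp_all add: critical_def dx_def dy_def)
  have D: "(dx l has_derivative frechet_derivative (dx l) (at p)) (at p)"
    "(dy l has_derivative frechet_derivative (dy l) (at p)) (at p)"
    using smooth_on_imp_has_derivative[OF smooth_on_frechet[OF s] UNIV_I] by (simp_all add: dx_def[abs_def] dy_def[abs_def])
  note D\<eta> = smooth_on_imp_has_derivative[OF N(3,2)]
  have "((\<lambda>q. dx l q * fst (\<eta> q) + dy l q * snd (\<eta> q)) has_derivative
     (\<lambda>v. frechet_derivative (dx l) (at p) v * fst (\<eta> p) + frechet_derivative (dy l) (at p) v * snd (\<eta> p))) (at p)"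
    using has_derivative_add[OF has_derivative_mult[OF D(1) has_derivative_fst[OF D\<eta>]]
        has_derivative_mult[OF D(2) has_derivative_snd[OF D\<eta>]]] by (simp add: z)
  from frechet_derivative_eqI[OF this] show ?thesis
    by (simp add: numeral_2_eq_2 eq) (simp add: along_def)
qed

lemma dx_jac_G: "dx (jac (G a b c)) = (\<lambda>q. 4 * fst q + a)"
  by (simp add: fun_eq_iff dx_def jac_G frechet_derivative_eqI[OF cubic_has_derivative])

lemma dy_jac_G: "dy (jac (G a b c)) = (\<lambda>q. - 9 * (snd q)\<^sup>2 - 4 * c * snd q - b)"
  by (simp add: fun_eq_iff dy_def jac_G frechet_derivative_eqI[OF cubic_has_derivative])

lemma frechet_dx_jac_G: "frechet_derivative (dx (jac (G a b c))) (at p) v = 4 * fst v"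
proof -
  have "((\<lambda>q. 4 * fst q + a) has_derivative (\<lambda>v. 4 * fst v)) (at p)" for p :: plane
    by (auto intro!: derivative_eq_intros)
  from frechet_derivative_eqI[OF this] show ?thesis by (simp add: dx_jac_G)
qed

lemma frechet_dy_jac_G: "frechet_derivative (dy (jac (G a b c))) (at p) v = - (18 * snd p + 4 * c) * snd v"
proof -
  have "((\<lambda>q. - 9 * (snd q)\<^sup>2 - 4 * c * snd q - b) has_derivative (\<lambda>v. - (18 * snd p + 4 * c) * snd v)) (at p)"
    for p :: plane
    by (auto intro!: derivative_eq_intros simp: fun_eq_iff algebra_simps)
  from frechet_derivative_eqI[OF this] show ?thesis by (simp add: dy_jac_G)
qed

lemma hessian_jac_G:
  "hessian (jac (G a b c)) p = vector [vector [4, 0], vector [0, - (18 * snd p + 4 * c)]]"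
  by (simp add: hessian_def dx_def[of "dx _"] dx_def[of "dy _"] dy_def[of "dx _"] dy_def[of "dy _"]
      frechet_dx_jac_G frechet_dy_jac_G)

lemma det_hessian_jac_G: "det (hessian (jac (G a b c)) (x, y)) = - 4 * (18 * y + 4 * c)"
  by (simp add: hessian_jac_G det_2)

lemma null_field_G_iff:
  "(\<exists>\<eta>. null_field (G a b c) (x, y) \<eta>) \<longleftrightarrow> jac (G a b c) (x, y) = 0 \<and> ((x, y) \<noteq> (0, 0) \<or> (a, b) \<noteq> (0, 0))"
  using null_field_corank_one null_field_span(3) null_field_euler null_field_gradient by metis

text \<open>The vector \<open>\<eta> (x, y)\<close> is a multiple of \<open>(x, - y)\<close>, and
  the Hessian of the Jacobian is diagonal with entries \<open>4\<close> and
  \<open>- (18 * y + 4 * c)\<close>; one value of the quadratic form thus decides for all null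
  fields.\<close>

lemma critical_second_derivative_G:
  assumes "null_field (G a b c) (x, y) \<eta>" "critical (jac (G a b c)) (x, y)"
  shows "(x, y) \<noteq> (0, 0)"
    and "(along \<eta> ^^ 2) (jac (G a b c)) (x, y) \<noteq> 0 \<longleftrightarrow> 4 * x\<^sup>2 - (18 * y + 4 * c) * y\<^sup>2 \<noteq> 0"
proof -
  show n: "(x, y) \<noteq> (0, 0)"
    using null_field_corank_one[OF assms(1)] assms(2) critical_jac_G_origin by auto
  have "span {euler_field (x, y)} = span {\<eta> (x, y)}"
    using null_field_span(1)[OF assms(1)] null_field_span(1)[OF null_field_euler[OF n null_field_span(3)[OF assms(1)]]]
    by simp
  then have "\<eta> (x, y) \<in> span {euler_field (x, y)}" using span_base[of "\<eta> (x, y)"] by blast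
  then obtain r where r: "\<eta> (x, y) = (r * x, - r * y)" by (auto simp: span_singleton euler_field_def)
  then have "r \<noteq> 0" using null_field_span(2)[OF assms(1)] by (auto simp: zero_prod_def)
  moreover have "(along \<eta> ^^ 2) (jac (G a b c)) (x, y) = r\<^sup>2 * (4 * x\<^sup>2 - (18 * y + 4 * c) * y\<^sup>2)"
    using second_derivative_critical[OF smooth_jac_G assms]
    by (simp add: frechet_dx_jac_G frechet_dy_jac_G r power2_eq_square algebra_simps)
  ultimately show "(along \<eta> ^^ 2) (jac (G a b c)) (x, y) \<noteq> 0 \<longleftrightarrow> 4 * x\<^sup>2 - (18 * y + 4 * c) * y\<^sup>2 \<noteq> 0" by simp
qed

lemma beaks_lips_pt_G:
  "lips_pt (G a b c) (x, y) \<longleftrightarrow> (x, y) \<noteq> (0, 0) \<and> 2 * x\<^sup>2 + a * x - 3 * y^3 - 2 * c * y\<^sup>2 - b * y = 0 \<and>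
     4 * x + a = 0 \<and> 9 * y\<^sup>2 + 4 * c * y + b = 0 \<and> 9 * y + 2 * c < 0"
  "beaks_pt (G a b c) (x, y) \<longleftrightarrow> (x, y) \<noteq> (0, 0) \<and> 2 * x\<^sup>2 + a * x - 3 * y^3 - 2 * c * y\<^sup>2 - b * y = 0 \<and>
     4 * x + a = 0 \<and> 9 * y\<^sup>2 + 4 * c * y + b = 0 \<and> 9 * y + 2 * c > 0 \<and> 4 * x\<^sup>2 - (18 * y + 4 * c) * y\<^sup>2 \<noteq> 0"
proof -
  have e: "(\<exists>\<eta>. null_field (G a b c) (x, y) \<eta>) \<and> critical (jac (G a b c)) (x, y) \<longleftrightarrow>
      (x, y) \<noteq> (0, 0) \<and> jac (G a b c) (x, y) = 0 \<and> critical (jac (G a b c)) (x, y)"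
    using null_field_G_iff critical_second_derivative_G(1) by metis
  have "lips_pt (G a b c) (x, y) \<longleftrightarrow> ((\<exists>\<eta>. null_field (G a b c) (x, y) \<eta>) \<and> critical (jac (G a b c)) (x, y)) \<and>
     9 * y + 2 * c < 0"
    unfolding lips_pt_def det_hessian_jac_G by auto
  then show "lips_pt (G a b c) (x, y) \<longleftrightarrow> (x, y) \<noteq> (0, 0) \<and> 2 * x\<^sup>2 + a * x - 3 * y^3 - 2 * c * y\<^sup>2 - b * y = 0 \<and>
     4 * x + a = 0 \<and> 9 * y\<^sup>2 + 4 * c * y + b = 0 \<and> 9 * y + 2 * c < 0"
    unfolding e by (auto simp: critical_jac_G jac_G_apply)
  have "beaks_pt (G a b c) (x, y) \<longleftrightarrow> ((\<exists>\<eta>. null_field (G a b c) (x, y) \<eta>) \<and> critical (jac (G a b c)) (x, y)) \<and>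
     9 * y + 2 * c > 0 \<and> 4 * x\<^sup>2 - (18 * y + 4 * c) * y\<^sup>2 \<noteq> 0"
    unfolding beaks_pt_def det_hessian_jac_G using critical_second_derivative_G(2) by auto
  then show "beaks_pt (G a b c) (x, y) \<longleftrightarrow> (x, y) \<noteq> (0, 0) \<and> 2 * x\<^sup>2 + a * x - 3 * y^3 - 2 * c * y\<^sup>2 - b * y = 0 \<and>
     4 * x + a = 0 \<and> 9 * y\<^sup>2 + 4 * c * y + b = 0 \<and> 9 * y + 2 * c > 0 \<and> 4 * x\<^sup>2 - (18 * y + 4 * c) * y\<^sup>2 \<noteq> 0"
    unfolding e by (auto simp: critical_jac_G jac_G_apply)
qed

lemma matrix_diag_mult: "(vector [vector [r, 0], vector [0, s]] :: real^2^2) *v w = vector [r * w $ 1, s * w $ 2]"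
  by (simp add: vec_eq_iff forall_2 matrix_vector_mult_def sum_2)

lemma rank_diag: "rank (vector [vector [4, 0], vector [0, s]] :: real^2^2) = 1 \<longleftrightarrow> s = 0"
proof
  let ?A = "vector [vector [4, 0], vector [0, s]] :: real^2^2"
  assume r: "rank ?A = 1"
  show "s = 0"
  proof (rule ccontr)
    assume "s \<noteq> 0"
    then have "inj ((*v) ?A)"
      by (auto simp: inj_def matrix_diag_mult vec_eq_iff forall_2)
    then have "rank ?A = CARD(2)" using full_rank_injective by blast
    then show False using r by simp
  qed
next
  assume s: "s = 0"
  have "range ((*v) (vector [vector [4, 0], vector [0, s]] :: real^2^2)) = span {vector [1, 0]}"
  proof (intro equalityI subsetI)
    fix v :: "real^2" assume "v \<in> span {vector [1, 0]}"
    then obtain k where "v = k *\<^sub>R vector [1, 0]" by (auto simp: span_singleton)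
    then have "v = vector [vector [4, 0], vector [0, s]] *v (vector [k / 4, 0] :: real^2)"
      unfolding matrix_diag_mult s by (simp add: vec_eq_iff forall_2)
    then show "v \<in> range ((*v) (vector [vector [4, 0], vector [0, s]] :: real^2^2))" by blast
  next
    fix v assume "v \<in> range ((*v) (vector [vector [4, 0], vector [0, s]] :: real^2^2))"
    then obtain w :: "real^2" where "v = vector [4 * w $ 1, 0]" by (auto simp: matrix_diag_mult s)
    then have "v = (4 * w $ 1) *\<^sub>R vector [1, 0]" by (simp add: vec_eq_iff forall_2)
    then show "v \<in> span {vector [1, 0]}" by (auto simp: span_singleton)
  qed
  moreover have "(vector [1, 0] :: real^2) \<noteq> 0" by (simp add: vec_eq_iff forall_2)
  ultimately show "rank (vector [vector [4, 0], vector [0, s]] :: real^2^2) = 1"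
    by (simp add: rank_dim_range)
qed

text \<open>When the Hessian degenerates its kernel is the y-direction, so the constant field
  \<open>(0, 1)\<close> can be taken as \<open>\<theta>\<close>; the third derivative along it is
  the constant \<open>- 18\<close>. The second derivative along the null field reduces to a multiple
  of \<open>x^2\<close>.\<close>

lemma goose_pt_G:
  "goose_pt (G a b c) (x, y) \<longleftrightarrow> (x, y) \<noteq> (0, 0) \<and> 2 * x\<^sup>2 + a * x - 3 * y^3 - 2 * c * y\<^sup>2 - b * y = 0 \<and>
     4 * x + a = 0 \<and> 9 * y\<^sup>2 + 4 * c * y + b = 0 \<and> 9 * y + 2 * c = 0 \<and> x \<noteq> 0"
proof
  have r: "rank (hessian (jac (G a b c)) (x, y)) = 1 \<longleftrightarrow> 9 * y + 2 * c = 0"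
    unfolding hessian_jac_G rank_diag by auto
  {
    assume "goose_pt (G a b c) (x, y)"
    then obtain \<eta> where \<eta>: "null_field (G a b c) (x, y) \<eta>" "critical (jac (G a b c)) (x, y)"
      "rank (hessian (jac (G a b c)) (x, y)) = 1" "(along \<eta> ^^ 2) (jac (G a b c)) (x, y) \<noteq> 0"
      unfolding goose_pt_def by blast
    have 1: "9 * y + 2 * c = 0" using \<eta>(3) r by simp
    then have "18 * y + 4 * c = 0" by simp
    then have "x \<noteq> 0" using \<eta>(4) critical_second_derivative_G(2)[OF \<eta>(1,2)] by simp
    then show "(x, y) \<noteq> (0, 0) \<and> 2 * x\<^sup>2 + a * x - 3 * y^3 - 2 * c * y\<^sup>2 - b * y = 0 \<and>
     4 * x + a = 0 \<and> 9 * y\<^sup>2 + 4 * c * y + b = 0 \<and> 9 * y + 2 * c = 0 \<and> x \<noteq> 0"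
      using 1 \<eta>(2) null_field_span(3)[OF \<eta>(1)] by (simp add: critical_jac_G jac_G_apply)
  next
    assume A: "(x, y) \<noteq> (0, 0) \<and> 2 * x\<^sup>2 + a * x - 3 * y^3 - 2 * c * y\<^sup>2 - b * y = 0 \<and>
     4 * x + a = 0 \<and> 9 * y\<^sup>2 + 4 * c * y + b = 0 \<and> 9 * y + 2 * c = 0 \<and> x \<noteq> 0"
    then have nf: "null_field (G a b c) (x, y) euler_field"
      by (intro null_field_euler) (auto simp: jac_G_apply)
    have cr: "critical (jac (G a b c)) (x, y)" using A by (simp add: critical_jac_G)
    have s0: "18 * y + 4 * c = 0" using A by simp
    then have e2: "(along euler_field ^^ 2) (jac (G a b c)) (x, y) \<noteq> 0"
      unfolding critical_second_derivative_G(2)[OF nf cr] s0 using A by simp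
    let ?\<theta> = "\<lambda>q. (0, 1) :: plane"
    have 1: "along ?\<theta> (jac (G a b c)) = (\<lambda>q. - 9 * (snd q)\<^sup>2 - 4 * c * snd q - b)"
      by (simp add: fun_eq_iff jac_G along_cubic)
    have 2: "along ?\<theta> (\<lambda>q. - 9 * (snd q)\<^sup>2 - 4 * c * snd q - b) = (\<lambda>q. - (18 * snd q + 4 * c))"
      using frechet_dy_jac_G[of a b c] by (simp add: dy_jac_G along_def)
    have "((\<lambda>q. - (18 * snd q + 4 * c)) has_derivative (\<lambda>v. - 18 * snd v)) (at p)" for p :: plane
      by (auto intro!: derivative_eq_intros)
    from frechet_derivative_eqI[OF this]
    have 3: "along ?\<theta> (\<lambda>q. - (18 * snd q + 4 * c)) = (\<lambda>q. - 18)" by (simp add: along_def)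
    have th: "(along ?\<theta> ^^ 3) (jac (G a b c)) (x, y) = - 18"
      unfolding numeral_3_eq_3 by (simp only: funpow.simps o_apply id_apply 1 2 3)
    have sp: "span {vector [fst (0, 1), snd (0, 1)]} = {v. hessian (jac (G a b c)) (x, y) *v v = 0}"
      using s0 unfolding hessian_jac_G matrix_diag_mult
      by (auto simp: span_singleton vec_eq_iff forall_2 image_iff)
    show "goose_pt (G a b c) (x, y)"
      unfolding goose_pt_def
    proof (intro exI conjI)
      show "rank (hessian (jac (G a b c)) (x, y)) = 1" using r A by simp
      show "smooth_on UNIV ?\<theta>" by (rule smooth_on_const)
      show "(along ?\<theta> ^^ 3) (jac (G a b c)) (x, y) \<noteq> 0" by (simp add: th)
    qed (rule nf cr e2 sp open_UNIV UNIV_I)+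
  }
qed

section \<open>Parametrizations of the strata\<close>

text \<open>\<open>(r^2 - c) / 3\<close> is the y-coordinate of the critical point of the Jacobian,
  and \<open>r\<close> is a signed square root of \<open>c + 3 * y\<close>: one polynomial map
  covers both signs of the parametrization.\<close>

definition bl_surface :: "real \<Rightarrow> real \<Rightarrow> space" where
  "bl_surface r c = (4 * ((r\<^sup>2 - c) / 3) * r, - ((r\<^sup>2 - c) / 3) * (4 * c + 9 * ((r\<^sup>2 - c) / 3)), c)"

text \<open>Here \<open>r\<close> is a signed square root of \<open>c + 4 * y\<close> and
  \<open>x = y * r\<close>. Division by \<open>r = 0\<close> would yield the first coordinate 0, so
  the map is used for \<open>r \<noteq> 0\<close>.\<close>

definition sw_surface :: "real \<Rightarrow> real \<Rightarrow> space" where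
  "sw_surface r c = (- ((r\<^sup>2 - c) / 4) * (4 * c + 15 * ((r\<^sup>2 - c) / 4)) / r,
     - 2 * ((r\<^sup>2 - c) / 4) * (2 * c + 5 * ((r\<^sup>2 - c) / 4)), c)"

text \<open>\<open>s\<close> is a signed square root of minus the y-coordinate of the cusp; in terms
  of the y-coordinate \<open>q\<close> of the fold, \<open>c = 3 s^2 - 2 q\<close>.\<close>

definition cf_surface :: "real \<Rightarrow> real \<Rightarrow> space" where
  "cf_surface s c = (1/2 * s * (3 * c - 5 * s\<^sup>2), 1/4 * (c\<^sup>2 + 6 * c * s\<^sup>2 - 15 * s^4), c)"

lemma critical_point_param:
  assumes "(x, y) \<noteq> (0, 0)" "2 * x\<^sup>2 + a * x - 3 * y^3 - 2 * c * y\<^sup>2 - b * y = 0"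
    "4 * x + a = 0" "9 * y\<^sup>2 + 4 * c * y + b = 0"
  obtains r where "y \<noteq> 0" "y = (r\<^sup>2 - c) / 3" "x = - y * r" "(a, b, c) = bl_surface r c"
proof -
  have ab: "a = - 4 * x" "b = - 9 * y\<^sup>2 - 4 * c * y" using assms by auto
  \<comment> \<open>After elimination of \<open>a\<close> and \<open>b\<close> the ratio
    \<open>- x / y\<close> is a square root of \<open>c + 3 * y\<close>.\<close>
  have x2: "x\<^sup>2 = y\<^sup>2 * (c + 3 * y)" using assms(2) unfolding ab by algebra
  have y: "y \<noteq> 0" using x2 assms(1) by auto
  define r where "r = - x / y"
  have r: "x = - y * r" "r\<^sup>2 = c + 3 * y" using y x2 by (simp_all add: r_def power_divide field_simps)
  then have "y = (r\<^sup>2 - c) / 3" by simp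
  moreover from this have "(a, b, c) = bl_surface r c"
    unfolding bl_surface_def by (simp flip: \<open>y = (r\<^sup>2 - c) / 3\<close> add: ab r(1)) algebra
  ultimately show thesis using that y r(1) by blast
qed

lemma bl_surface_point:
  assumes "(a, b, c) = bl_surface r c" "y = (r\<^sup>2 - c) / 3" "x = - y * r"
  shows "2 * x\<^sup>2 + a * x - 3 * y^3 - 2 * c * y\<^sup>2 - b * y = 0"
    "4 * x + a = 0" "9 * y\<^sup>2 + 4 * c * y + b = 0" "4 * x\<^sup>2 - (18 * y + 4 * c) * y\<^sup>2 = - 6 * y^3"
proof -
  have r: "r\<^sup>2 = c + 3 * y" using assms(2) by simp
  have ab: "a = 4 * y * r" "b = - y * (4 * c + 9 * y)" using assms(1) by (simp_all add: bl_surface_def assms(2))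
  show "4 * x + a = 0" "9 * y\<^sup>2 + 4 * c * y + b = 0"
    unfolding ab assms(3) by (auto simp: algebra_simps power2_eq_square)
  show "2 * x\<^sup>2 + a * x - 3 * y^3 - 2 * c * y\<^sup>2 - b * y = 0" "4 * x\<^sup>2 - (18 * y + 4 * c) * y\<^sup>2 = - 6 * y^3"
    unfolding ab assms(3) using r by algebra+
qed

lemma beaks_or_lips_G_iff:
  "beaks_pt (G a b c) (x, y) \<or> lips_pt (G a b c) (x, y) \<longleftrightarrow>
    (\<exists>r. y = (r\<^sup>2 - c) / 3 \<and> x = - y * r \<and> (a, b, c) = bl_surface r c \<and> r\<^sup>2 \<noteq> c \<and> 3 * r\<^sup>2 \<noteq> c)"
  (is "?L \<longleftrightarrow> ?R")
proof
  assume L: ?L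
  then have a: "(x, y) \<noteq> (0, 0)" "2 * x\<^sup>2 + a * x - 3 * y^3 - 2 * c * y\<^sup>2 - b * y = 0"
    "4 * x + a = 0" "9 * y\<^sup>2 + 4 * c * y + b = 0" "9 * y + 2 * c \<noteq> 0"
    by (auto simp: beaks_lips_pt_G)
  obtain r where r: "y \<noteq> 0" "y = (r\<^sup>2 - c) / 3" "x = - y * r" "(a, b, c) = bl_surface r c"
    using critical_point_param[OF a(1-4)] by blast
  then show ?R using a(5) by (intro exI[of _ r]) auto
next
  assume ?R
  then obtain r where r: "y = (r\<^sup>2 - c) / 3" "x = - y * r" "(a, b, c) = bl_surface r c" "r\<^sup>2 \<noteq> c" "3 * r\<^sup>2 \<noteq> c" by blast
  then have "y \<noteq> 0" "9 * y + 2 * c \<noteq> 0" by auto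
  then show ?L
    using bl_surface_point[OF r(3,1,2)] by (simp add: beaks_lips_pt_G) linarith
qed

lemma goose_G_iff:
  "goose_pt (G a b c) (x, y) \<longleftrightarrow>
    (\<exists>r. y = (r\<^sup>2 - c) / 3 \<and> x = - y * r \<and> (a, b, c) = bl_surface r c \<and> r \<noteq> 0 \<and> 3 * r\<^sup>2 = c)"
  (is "?L \<longleftrightarrow> ?R")
proof
  assume ?L
  then have a: "(x, y) \<noteq> (0, 0)" "2 * x\<^sup>2 + a * x - 3 * y^3 - 2 * c * y\<^sup>2 - b * y = 0"
    "4 * x + a = 0" "9 * y\<^sup>2 + 4 * c * y + b = 0" "9 * y + 2 * c = 0" "x \<noteq> 0"
    by (auto simp: goose_pt_G)
  obtain r where r: "y \<noteq> 0" "y = (r\<^sup>2 - c) / 3" "x = - y * r" "(a, b, c) = bl_surface r c"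
    using critical_point_param[OF a(1-4)] by blast
  then show ?R using a(5,6) by (intro exI[of _ r]) auto
next
  assume ?R
  then obtain r where r: "y = (r\<^sup>2 - c) / 3" "x = - y * r" "(a, b, c) = bl_surface r c" "r \<noteq> 0" "3 * r\<^sup>2 = c" by blast
  then have "y \<noteq> 0" "9 * y + 2 * c = 0" by auto
  then show ?L
    using bl_surface_point[OF r(3,1,2)] r(2,4) by (simp add: goose_pt_G)
qed

text \<open>The Jacobian and its first two derivatives are linear in \<open>x^2\<close>,
  \<open>a * x\<close> and \<open>b * y\<close>; solving the system gives all three as
  \<open>y^2\<close> times affine functions of \<open>c\<close> and \<open>y\<close>.\<close>

lemma triple_contact_param:
  assumes "(x, y) \<noteq> (0, 0)" "2 * x\<^sup>2 + a * x - 3 * y^3 - 2 * c * y\<^sup>2 - b * y = 0"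
    "4 * x\<^sup>2 + a * x + 9 * y^3 + 4 * c * y\<^sup>2 + b * y = 0"
    "8 * x\<^sup>2 + a * x - 27 * y^3 - 8 * c * y\<^sup>2 - b * y = 0"
  obtains r where "r \<noteq> 0" "y \<noteq> 0" "y = (r\<^sup>2 - c) / 4" "x = y * r" "(a, b, c) = sw_surface r c"
proof -
  have 1: "x\<^sup>2 = y\<^sup>2 * (c + 4 * y)" "a * x = - (y\<^sup>2 * (4 * c + 15 * y))" "b * y = (- 2 * y * (2 * c + 5 * y)) * y"
    using assms(2-4) by algebra+
  have y: "y \<noteq> 0" using 1(1) assms(1) by auto
  then have b: "b = - 2 * y * (2 * c + 5 * y)" using 1(3) mult_right_cancel by blast
  have x: "x \<noteq> 0"
  proof
    assume "x = 0"
    then have "c + 4 * y = 0" "4 * c + 15 * y = 0" using 1(1,2) y by auto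
    then show False using y by simp
  qed
  define r where "r = x / y"
  have r: "r \<noteq> 0" "x = y * r" "r\<^sup>2 = c + 4 * y" using x y 1(1) by (simp_all add: r_def power_divide)
  then have yr: "y = (r\<^sup>2 - c) / 4" by simp
  have "a * r * y = - y * (4 * c + 15 * y) * y" using 1(2) unfolding r(2) by algebra
  then have "a * r = - y * (4 * c + 15 * y)" using y mult_right_cancel by blast
  then have "a = - y * (4 * c + 15 * y) / r" using nonzero_eq_divide_eq[OF r(1)] by blast
  then have "(a, b, c) = sw_surface r c" unfolding sw_surface_def yr[symmetric] b by simp
  then show thesis using that y r(1,2) yr by blast
qed

text \<open>The fifth equation shows that the fourth derivative is \<open>- 120 * y^3\<close>, so
  nothing worse than a butterfly occurs for \<open>y \<noteq> 0\<close>. The sixth shows that the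
  Jacobian is regular there, and the last confines the point.\<close>

lemma sw_surface_point:
  assumes "(a, b, c) = sw_surface r c" "r \<noteq> 0" "y = (r\<^sup>2 - c) / 4" "x = y * r"
  shows "2 * x\<^sup>2 + a * x - 3 * y^3 - 2 * c * y\<^sup>2 - b * y = 0"
    "4 * x\<^sup>2 + a * x + 9 * y^3 + 4 * c * y\<^sup>2 + b * y = 0"
    "8 * x\<^sup>2 + a * x - 27 * y^3 - 8 * c * y\<^sup>2 - b * y = 0"
    "16 * x\<^sup>2 + a * x + 81 * y^3 + 16 * c * y\<^sup>2 + b * y = 6 * y\<^sup>2 * (5 * r\<^sup>2 - c)"
    "32 * x\<^sup>2 + a * x - 243 * y^3 - 32 * c * y\<^sup>2 - b * y = - 120 * y^3 + 24 * y\<^sup>2 * (c + 5 * y) * 0"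
    "(4 * x + a) * x = y^3" "10 * y\<^sup>2 + 4 * c * y + b = 0"
proof -
  have r: "r\<^sup>2 = c + 4 * y" using assms(3) by simp
  have b: "b = - 2 * y * (2 * c + 5 * y)" using assms(1) by (simp add: sw_surface_def assms(3))
  have "a = - y * (4 * c + 15 * y) / r" using assms(1) by (simp add: sw_surface_def assms(3))
  then have "a * r = - y * (4 * c + 15 * y)" using assms(2) by simp
  then have ax: "a * x = - (y\<^sup>2 * (4 * c + 15 * y))" unfolding assms(4) by algebra
  have x: "x\<^sup>2 = y\<^sup>2 * (c + 4 * y)" using r unfolding assms(4) by algebra
  show "2 * x\<^sup>2 + a * x - 3 * y^3 - 2 * c * y\<^sup>2 - b * y = 0"
    "4 * x\<^sup>2 + a * x + 9 * y^3 + 4 * c * y\<^sup>2 + b * y = 0"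
    "8 * x\<^sup>2 + a * x - 27 * y^3 - 8 * c * y\<^sup>2 - b * y = 0"
    "16 * x\<^sup>2 + a * x + 81 * y^3 + 16 * c * y\<^sup>2 + b * y = 6 * y\<^sup>2 * (5 * r\<^sup>2 - c)"
    "32 * x\<^sup>2 + a * x - 243 * y^3 - 32 * c * y\<^sup>2 - b * y = - 120 * y^3 + 24 * y\<^sup>2 * (c + 5 * y) * 0"
    "(4 * x + a) * x = y^3"
    using ax x r unfolding b by algebra+
  show "10 * y\<^sup>2 + 4 * c * y + b = 0" unfolding b by algebra
qed

lemma swallowtail_G_iff:
  assumes "(x, y) \<noteq> (0, 0)"
  shows "swallowtail_pt (G a b c) (x, y) \<longleftrightarrow>
    (\<exists>r. r \<noteq> 0 \<and> y = (r\<^sup>2 - c) / 4 \<and> x = y * r \<and> (a, b, c) = sw_surface r c \<and> r\<^sup>2 \<noteq> c \<and> 5 * r\<^sup>2 \<noteq> c)"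
  (is "?L \<longleftrightarrow> ?R")
proof
  assume L: ?L
  note L' = L[unfolded swallowtail_pt_G[OF assms]]
  obtain r where r: "r \<noteq> 0" "y \<noteq> 0" "y = (r\<^sup>2 - c) / 4" "x = y * r" "(a, b, c) = sw_surface r c"
    using triple_contact_param[OF assms, of a c b] L' by blast
  have "6 * y\<^sup>2 * (5 * r\<^sup>2 - c) \<noteq> 0"
    using L unfolding swallowtail_pt_G[OF assms] sw_surface_point(4)[OF r(5,1,3,4)] by blast
  then show ?R using r by (intro exI[of _ r]) auto
next
  assume ?R
  then obtain r where r: "r \<noteq> 0" "y = (r\<^sup>2 - c) / 4" "x = y * r" "(a, b, c) = sw_surface r c" "r\<^sup>2 \<noteq> c" "5 * r\<^sup>2 \<noteq> c"
    by blast
  note p = sw_surface_point[OF r(4,1,2,3)]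
  have "y \<noteq> 0" using r by auto
  then have "4 * x + a \<noteq> 0" "6 * y\<^sup>2 * (5 * r\<^sup>2 - c) \<noteq> 0" using p(6) r(6) by auto
  then show ?L unfolding swallowtail_pt_G[OF assms] p(1-4) by simp
qed

lemma butterfly_G_iff:
  "butterfly_pt (G a b c) (x, y) \<longleftrightarrow>
    (\<exists>r. r \<noteq> 0 \<and> y = (r\<^sup>2 - c) / 4 \<and> x = y * r \<and> (a, b, c) = sw_surface r c \<and> 5 * r\<^sup>2 = c)"
  (is "?L \<longleftrightarrow> ?R")
proof
  assume L: ?L
  then have n: "(x, y) \<noteq> (0, 0)" using butterfly_pt_G_origin by metis
  obtain r where r: "r \<noteq> 0" "y \<noteq> 0" "y = (r\<^sup>2 - c) / 4" "x = y * r" "(a, b, c) = sw_surface r c"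
    using triple_contact_param[OF n, of a c b] L[unfolded butterfly_pt_G[OF n]] by blast
  have "6 * y\<^sup>2 * (5 * r\<^sup>2 - c) = 0"
    using L unfolding butterfly_pt_G[OF n] sw_surface_point(4)[OF r(5,1,3,4)] by blast
  then show ?R using r by (intro exI[of _ r]) auto
next
  assume ?R
  then obtain r where r: "r \<noteq> 0" "y = (r\<^sup>2 - c) / 4" "x = y * r" "(a, b, c) = sw_surface r c" "5 * r\<^sup>2 = c"
    by blast
  note p = sw_surface_point[OF r(4,1,2,3)]
  have y: "y \<noteq> 0" using r by auto
  then have n: "(x, y) \<noteq> (0, 0)" by simp
  have "4 * x + a \<noteq> 0" using p(6) y by auto
  then show ?L unfolding butterfly_pt_G[OF n] p(1-5) using y r(5) by simp
qed

text \<open>The quintic of the fibre through both points is \<open>(t + s^2)^3 (t - q)^2\<close>;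
  comparing coefficients expresses \<open>a\<close>, \<open>b\<close>, \<open>c\<close> by
  \<open>s\<close> and \<open>q\<close>. The equations then say that \<open>(s * q, - s^2)\<close>
  is singular without being a fold, that \<open>(- s^3, q)\<close> is singular, and where each of
  them degenerates.\<close>

lemma cf_surface_points:
  assumes "(a, b, c) = cf_surface s c" "q = - (c - 3 * s\<^sup>2) / 2"
  shows "G a b c (s * q, - s\<^sup>2) = G a b c (- (s^3), q)"
    "2 * (s * q)\<^sup>2 + a * (s * q) - 3 * (- s\<^sup>2)^3 - 2 * c * (- s\<^sup>2)\<^sup>2 - b * (- s\<^sup>2) = 0"
    "4 * (s * q)\<^sup>2 + a * (s * q) + 9 * (- s\<^sup>2)^3 + 4 * c * (- s\<^sup>2)\<^sup>2 + b * (- s\<^sup>2) = 0"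
    "8 * (s * q)\<^sup>2 + a * (s * q) - 27 * (- s\<^sup>2)^3 - 8 * c * (- s\<^sup>2)\<^sup>2 - b * (- s\<^sup>2) = 3/2 * s\<^sup>2 * (c - 5 * s\<^sup>2)\<^sup>2"
    "4 * (s * q) + a = 1/2 * s * (7 * s\<^sup>2 - c)"
    "9 * (- s\<^sup>2)\<^sup>2 + 4 * c * (- s\<^sup>2) + b = 1/4 * (c - 3 * s\<^sup>2) * (c - 7 * s\<^sup>2)"
    "2 * (- (s^3))\<^sup>2 + a * - (s^3) - 3 * q^3 - 2 * c * q\<^sup>2 - b * q = 0"
    "4 * (- (s^3))\<^sup>2 + a * - (s^3) + 9 * q^3 + 4 * c * q\<^sup>2 + b * q = 2 * (q + s\<^sup>2)^3"
    "15 * (- s\<^sup>2)\<^sup>2 + 6 * c * (- s\<^sup>2) + 4 * b - c\<^sup>2 = 0" "5 * q\<^sup>2 + 2 * c * q + 3 * b - c\<^sup>2 = 0"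
    "(s * q, - s\<^sup>2) = (- (s^3), q) \<longleftrightarrow> c = 5 * s\<^sup>2"
proof -
  have c: "c = 3 * s\<^sup>2 - 2 * q" using assms(2) by simp
  have "2 * a = s * (3 * c - 5 * s\<^sup>2)" "4 * b = c\<^sup>2 + 6 * c * s\<^sup>2 - 15 * s^4" using assms(1) by (simp_all add: cf_surface_def)
  then have ab: "a = 2 * s^3 - 3 * s * q" "b = q\<^sup>2 - 6 * s\<^sup>2 * q + 3 * s^4" unfolding c by algebra+
  show "2 * (s * q)\<^sup>2 + a * (s * q) - 3 * (- s\<^sup>2)^3 - 2 * c * (- s\<^sup>2)\<^sup>2 - b * (- s\<^sup>2) = 0"
    "4 * (s * q)\<^sup>2 + a * (s * q) + 9 * (- s\<^sup>2)^3 + 4 * c * (- s\<^sup>2)\<^sup>2 + b * (- s\<^sup>2) = 0"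
    "8 * (s * q)\<^sup>2 + a * (s * q) - 27 * (- s\<^sup>2)^3 - 8 * c * (- s\<^sup>2)\<^sup>2 - b * (- s\<^sup>2) = 3/2 * s\<^sup>2 * (c - 5 * s\<^sup>2)\<^sup>2"
    "4 * (s * q) + a = 1/2 * s * (7 * s\<^sup>2 - c)"
    "9 * (- s\<^sup>2)\<^sup>2 + 4 * c * (- s\<^sup>2) + b = 1/4 * (c - 3 * s\<^sup>2) * (c - 7 * s\<^sup>2)"
    "2 * (- (s^3))\<^sup>2 + a * - (s^3) - 3 * q^3 - 2 * c * q\<^sup>2 - b * q = 0"
    "4 * (- (s^3))\<^sup>2 + a * - (s^3) + 9 * q^3 + 4 * c * q\<^sup>2 + b * q = 2 * (q + s\<^sup>2)^3"
    "15 * (- s\<^sup>2)\<^sup>2 + 6 * c * (- s\<^sup>2) + 4 * b - c\<^sup>2 = 0" "5 * q\<^sup>2 + 2 * c * q + 3 * b - c\<^sup>2 = 0"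
    unfolding ab c by (simp_all add: field_simps) algebra+
  have "(s * q)\<^sup>2 + (- s\<^sup>2)^3 + a * (s * q) + b * (- s\<^sup>2) + c * (- s\<^sup>2)\<^sup>2 = (- (s^3))\<^sup>2 + q^3 + a * - (s^3) + b * q + c * q\<^sup>2"
    unfolding ab c by algebra
  moreover have "s * q * - s\<^sup>2 = - (s^3) * q" by algebra
  ultimately show "G a b c (s * q, - s\<^sup>2) = G a b c (- (s^3), q)" by (simp add: G_def)
  show "(s * q, - s\<^sup>2) = (- (s^3), q) \<longleftrightarrow> c = 5 * s\<^sup>2"
  proof -
    have "s * q = - (s^3)" if "q = - s\<^sup>2" unfolding that by algebra
    then have "(s * q, - s\<^sup>2) = (- (s^3), q) \<longleftrightarrow> q = - s\<^sup>2" by auto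
    then show ?thesis unfolding c by auto
  qed
qed

text \<open>For \<open>v \<noteq> 0\<close> the number \<open>p\<close> is at least a triple root
  and \<open>q\<close> at least a double root of the quintic, which determines all its coefficients.
  For \<open>v = 0\<close> the coordinate \<open>x\<close> cannot be recovered from
  \<open>y\<close>, and the points are found on the axes.\<close>

lemma cusp_contact_pair_nonzero:
  assumes n: "(x1, p) \<noteq> (0, 0)" "(x1, p) \<noteq> (x2, q)"
    and 1: "2 * x1\<^sup>2 + a * x1 - 3 * p^3 - 2 * c * p\<^sup>2 - b * p = 0" "4 * x1\<^sup>2 + a * x1 + 9 * p^3 + 4 * c * p\<^sup>2 + b * p = 0"
    and 2: "2 * x2\<^sup>2 + a * x2 - 3 * q^3 - 2 * c * q\<^sup>2 - b * q = 0"
    and v: "x1 * p = x2 * q" and u: "x1\<^sup>2 + p^3 + a * x1 + b * p + c * p\<^sup>2 = x2\<^sup>2 + q^3 + a * x2 + b * q + c * q\<^sup>2"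
  shows "\<exists>s. (a, b, c) = cf_surface s c \<and> (x1, p) = (s * - (c - 3 * s\<^sup>2) / 2, - s\<^sup>2) \<and>
    (x2, q) = (- (s^3), - (c - 3 * s\<^sup>2) / 2)"
proof -
  have A: "a * x1 = - 3 * x1\<^sup>2 - 3 * p^3 - c * p\<^sup>2" using 1 by algebra
  have B: "b * p = - (x1\<^sup>2) - 6 * p^3 - 3 * c * p\<^sup>2" using 1 by algebra
  show ?thesis
  proof (cases "x1 * p = 0")
    case False
    then have nz: "x1 \<noteq> 0" "p \<noteq> 0" "x2 \<noteq> 0" "q \<noteq> 0" using v by auto
    have pq: "p \<noteq> q" using v n nz by auto
    have X: "x1\<^sup>2 = - p * (6 * p\<^sup>2 + 3 * c * p + b)" using B by algebra
    \<comment> \<open>The value of the quintic at \<open>q\<close>, with the triple root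
      \<open>p\<close> split off.\<close>
    have "(q - p)^3 * (q\<^sup>2 + (c + 3 * p) * q + 6 * p\<^sup>2 + 3 * c * p + b) = 0"
    proof -
      have "(x1 * p)\<^sup>2 + q^5 + (a * x1) * p * q + b * q^3 + c * q^4 - (x1\<^sup>2 + p^3 + a * x1 + b * p + c * p\<^sup>2) * q\<^sup>2 = 0"
        using u v by algebra
      then show ?thesis unfolding A using X by algebra
    qed
    then have Q: "q\<^sup>2 + (c + 3 * p) * q + 6 * p\<^sup>2 + 3 * c * p + b = 0" using pq by simp
    \<comment> \<open>The derivative of the quadratic cofactor vanishes at \<open>q\<close> as well,
      since \<open>q\<close> is a double root.\<close>
    have "(q - p)^3 * (q * (2 * q + c + 3 * p)) = 0"
    proof -
      have "2 * (x1 * p)\<^sup>2 + (a * x1) * p * q - 3 * q^5 - 2 * c * q^4 - b * q^3 = 0"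
        using 2 v by algebra
      then have "2 * x1\<^sup>2 * p\<^sup>2 + (- 3 * x1\<^sup>2 - 3 * p^3 - c * p\<^sup>2) * p * q - 3 * q^5 - 2 * c * q^4 - b * q^3 = 0"
        unfolding A by algebra
      then show ?thesis unfolding X using Q by algebra
    qed
    then have q: "c = - 2 * q - 3 * p" using pq nz by auto
    have b: "b = q\<^sup>2 + 6 * p * q + 3 * p\<^sup>2" using Q unfolding q by algebra
    have Xq: "x1\<^sup>2 = - p * q\<^sup>2" using X unfolding q b by algebra
    define s where "s = x1 / q"
    have s: "x1 = s * q" "p = - s\<^sup>2" using nz Xq by (simp_all add: s_def power_divide)
    have "x2 * q = - (s^3) * q" using v unfolding s by algebra
    then have x2: "x2 = - (s^3)" using nz mult_right_cancel by blast
    have "a * (s * q) = (2 * s^3 - 3 * s * q) * (s * q)" using A unfolding q s by algebra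
    then have a: "a = 2 * s^3 - 3 * s * q" using nz s by simp
    have "(a, b, c) = cf_surface s c"
      unfolding cf_surface_def by (simp add: a b q s) algebra
    moreover have "- (c - 3 * s\<^sup>2) / 2 = q" unfolding q s by simp
    ultimately show ?thesis using s x2 by (intro exI[of _ s]) simp
  next
    case True
    have x1: "x1 = 0"
    proof (rule ccontr)
      assume "x1 \<noteq> 0"
      with True have "p = 0" by simp
      with B have "x1\<^sup>2 = 0" by simp
      with \<open>x1 \<noteq> 0\<close> show False by simp
    qed
    then have p: "p \<noteq> 0" using n by simp
    have "p * (p * (3 * p + c)) = 0" using A x1 by algebra
    then have c: "c = - 3 * p" using p by simp
    have "p * b = p * (3 * p\<^sup>2)" using B x1 c by algebra
    then have b: "b = 3 * p\<^sup>2" using p by simp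
    have q: "q = 0"
    proof (rule ccontr)
      assume "q \<noteq> 0"
      then have "x2 = 0" using v x1 by simp
      with 2 have "3 * q * (q - p)\<^sup>2 = 0" unfolding b c by algebra
      then show False using \<open>q \<noteq> 0\<close> \<open>x2 = 0\<close> n x1 by simp
    qed
    have "x2 \<noteq> 0"
    proof
      assume "x2 = 0"
      then have "p^3 = 0" using u x1 q b c by algebra
      then show False using p by simp
    qed
    then have a: "a = - 2 * x2" using 2 q by (simp add: power2_eq_square) algebra
    have X: "x2\<^sup>2 = - (p^3)" 
      using u by (simp add: x1 q a b c power2_eq_square power3_eq_cube)
    define s where "s = x2 / p"
    have s: "p = - s\<^sup>2" "x2 = - (s^3)"
    proof -
      have "s\<^sup>2 = - p" using X p by (simp add: s_def power_divide power2_eq_square power3_eq_cube)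
      then show ps: "p = - s\<^sup>2" by simp
      have "x2 = s * p" using p by (simp add: s_def)
      then show "x2 = - (s^3)" using ps by algebra
    qed
    show ?thesis
      using q x1 unfolding cf_surface_def a b c s
      by (intro exI[of _ s]) (simp add: power2_eq_square power3_eq_cube power4_eq_xxxx)
  qed
qed

text \<open>A cusp at the origin corresponds to \<open>s = 0\<close>.\<close>

lemma origin_contact_pair:
  assumes n: "(x2, q) \<noteq> (0, 0)" "(a, b) \<noteq> (0, 0)" "a * b = 0"
    and 2: "2 * x2\<^sup>2 + a * x2 - 3 * q^3 - 2 * c * q\<^sup>2 - b * q = 0"
    and v: "0 = x2 * q" and u: "0 = x2\<^sup>2 + q^3 + a * x2 + b * q + c * q\<^sup>2"
  shows "\<exists>s. (a, b, c) = cf_surface s c \<and> (0, 0) = (s * - (c - 3 * s\<^sup>2) / 2, - s\<^sup>2) \<and>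
    (x2, q) = (- (s^3), - (c - 3 * s\<^sup>2) / 2)"
proof -
  have x2: "x2 = 0"
  proof (rule ccontr)
    assume x: "x2 \<noteq> 0"
    then have "q = 0" using v by simp
    then have "x2 * (2 * x2 + a) = 0" "x2 * (x2 + a) = 0" using 2 u by algebra+
    then show False using x by simp
  qed
  then have q: "q \<noteq> 0" using n by simp
  have "q * (3 * q\<^sup>2 + 2 * c * q + b) = 0" "q * (q\<^sup>2 + c * q + b) = 0" using 2 u x2 by algebra+
  then have e: "3 * q\<^sup>2 + 2 * c * q + b = 0" "q\<^sup>2 + c * q + b = 0" using q by simp_all
  then have "q * (2 * q + c) = 0" by algebra
  then have c: "c = - 2 * q" using q by simp
  then have b: "b = q\<^sup>2" using e by algebra
  then have "a = 0" using n q by simp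
  then show ?thesis
    using x2 c b unfolding cf_surface_def by (intro exI[of _ 0]) (simp add: power2_eq_square)
qed


text \<open>For \<open>v \<noteq> 0\<close> the range of the differential at a singular point
  \<open>(x, y)\<close> is spanned by \<open>(2 * x + a, y)\<close>. Parallel ranges together with
  \<open>x1 * p = x2 * q\<close> force \<open>a = - 2 * (x1 + x2)\<close>; then the two Jacobian
  equations and the equality of the images give \<open>p * q * (p - q)^3 = 0\<close>. Hence no
  stratum of tangent double folds appears.\<close>

lemma no_tangent_double_fold:
  fixes x1 x2 p q a b c :: real
  assumes n: "(x1, p) \<noteq> (x2, q)" "(a, b) \<noteq> (0, 0)"
    and 1: "2 * x1\<^sup>2 + a * x1 - 3 * p^3 - 2 * c * p\<^sup>2 - b * p = 0" and 2: "2 * x2\<^sup>2 + a * x2 - 3 * q^3 - 2 * c * q\<^sup>2 - b * q = 0"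
    and v: "x1 * p = x2 * q" and u: "x1\<^sup>2 + p^3 + a * x1 + b * p + c * p\<^sup>2 = x2\<^sup>2 + q^3 + a * x2 + b * q + c * q\<^sup>2"
    and t: "(2 * x1 + a) * q = (2 * x2 + a) * p"
    and t1: "(2 * x1 + a) * x2 = (3 * q\<^sup>2 + 2 * c * q + b) * p"
    and t2: "(2 * x2 + a) * x1 = (3 * p\<^sup>2 + 2 * c * p + b) * q"
    and t3: "(3 * p\<^sup>2 + 2 * c * p + b) * x2 = (3 * q\<^sup>2 + 2 * c * q + b) * x1"
    and f: "(x1, p) = (0, 0) \<Longrightarrow> a * b \<noteq> 0" "(x2, q) = (0, 0) \<Longrightarrow> a * b \<noteq> 0"
  shows False
proof (cases "x1 * p = 0")
  case False
  then have nz: "x1 \<noteq> 0" "p \<noteq> 0" "x2 \<noteq> 0" "q \<noteq> 0" using v by auto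
  have pq: "p - q \<noteq> 0" using v n nz by auto
  have "(q - p) * (2 * (x1 + x2) + a) = 0" using t v by algebra
  then have a: "a = - 2 * (x1 + x2)" using pq by simp
  have e1: "- 2 * x1 * x2 = 3 * p^3 + 2 * c * p\<^sup>2 + b * p" "- 2 * x1 * x2 = 3 * q^3 + 2 * c * q\<^sup>2 + b * q"
    using 1 2 unfolding a by algebra+
  then have "(p - q) * (3 * (p\<^sup>2 + p * q + q\<^sup>2) + 2 * c * (p + q) + b) = 0" by algebra
  then have b: "b = - 3 * (p\<^sup>2 + p * q + q\<^sup>2) - 2 * c * (p + q)" using pq by simp
  have "2 * (x1 * x2) = p * q * (3 * (p + q) + 2 * c)" using e1 unfolding b by algebra
  moreover have "p * q * (x2\<^sup>2 - x1\<^sup>2) = (x1 * x2) * (p\<^sup>2 - q\<^sup>2)" using v by algebra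
  moreover have "x2\<^sup>2 - x1\<^sup>2 + (p^3 - q^3) + b * (p - q) + c * (p\<^sup>2 - q\<^sup>2) = 0" using u unfolding a by algebra
  ultimately have "p * q * (p - q)^3 = 0" unfolding b by algebra
  then show False using nz pq by simp
next
  case True
  have *: False if h: "y \<noteq> 0" "3 * y\<^sup>2 + 2 * c * y + b = 0" "y\<^sup>2 + c * y + b / 2 = 0" for y
  proof -
    have "2 * (y\<^sup>2 + c * y + b / 2) = 0" using h(3) by simp
    then have "y\<^sup>2 = 0" using h(2) by algebra
    then show False using h(1) by simp
  qed
  \<comment> \<open>Stated for arbitrary points, so that it also applies with the two points
    exchanged.\<close>
  have axis: False
    if h: "x1 * p = 0" "x1 = 0" "p \<noteq> 0" "x2 * q = 0" "(x1, p) \<noteq> (x2, q)"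
      "2 * x1\<^sup>2 + a * x1 - 3 * p^3 - 2 * c * p\<^sup>2 - b * p = 0" "2 * x2\<^sup>2 + a * x2 - 3 * q^3 - 2 * c * q\<^sup>2 - b * q = 0"
      "x1\<^sup>2 + p^3 + a * x1 + b * p + c * p\<^sup>2 = x2\<^sup>2 + q^3 + a * x2 + b * q + c * q\<^sup>2"
      "(2 * x2 + a) * p = (2 * x1 + a) * q" "(2 * x1 + a) * x2 = (3 * q\<^sup>2 + 2 * c * q + b) * p"
      "(x2, q) = (0, 0) \<Longrightarrow> a * b \<noteq> 0" for x1 p x2 q
  proof -
    have "p * (3 * p\<^sup>2 + 2 * c * p + b) = 0" using h(6) h(2) by algebra
    then have P: "3 * p\<^sup>2 + 2 * c * p + b = 0" using h(3) by simp
    show False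
    proof (cases "x2 = 0")
      case True
      show False
      proof (cases "q = 0")
        case True
        with \<open>x2 = 0\<close> have "a \<noteq> 0" using h(11) by simp
        then show False using h(9) \<open>x2 = 0\<close> \<open>q = 0\<close> h(3) by simp
      next
        case False
        have "q * (3 * q\<^sup>2 + 2 * c * q + b) = 0" using h(7) True by algebra
        then have Q: "3 * q\<^sup>2 + 2 * c * q + b = 0" using False by simp
        have pq: "p - q \<noteq> 0" using h(2,5) True by auto
        have "(p - q) * (3 * (p + q) + 2 * c) = 0" using P Q by algebra
        then have c: "2 * c = - 3 * (p + q)" using pq by simp
        have "(p - q) * (p\<^sup>2 + p * q + q\<^sup>2 + b + c * (p + q)) = 0" using h(8) True h(2) by algebra
        then have "p\<^sup>2 + p * q + q\<^sup>2 + b + c * (p + q) = 0" using pq by simp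
        then have "(p - q)\<^sup>2 = 0" using P c by algebra
        then show False using pq by simp
      qed
    next
      case False
      then have q: "q = 0" using h(4) by simp
      then have "x2 * (2 * x2 + a) = 0" using h(7) by algebra
      then have a: "a = - 2 * x2" using False by simp
      have "- 2 * x2\<^sup>2 = b * p" using h(10) by (simp add: a q h(2) power2_eq_square)
      moreover have "p * (p\<^sup>2 + c * p + b) = - (x2\<^sup>2)"
        using h(8) by (simp add: a q h(2) power2_eq_square power3_eq_cube algebra_simps)
      ultimately have "p * (2 * (p\<^sup>2 + c * p + b) - b) = 0" by algebra
      then have "2 * (p\<^sup>2 + c * p + b) - b = 0" using h(3) by simp
      then have "p\<^sup>2 + c * p + b / 2 = 0" by simp
      then show False using * h(3) P by blast
    qed
  qed
  consider "x1 = 0" "p \<noteq> 0" | "x2 = 0" "q \<noteq> 0" | "p = 0" "q = 0" using True v by fastforce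
  then show False
  proof cases
    case 1
    then show False
      using axis[of x1 p x2 q, OF True _ _ _ _ assms(3,4) u t[symmetric] t1 f(2)] True v n by fastforce
  next
    case 2
    then show False
      using axis[of x2 q x1 p, OF _ _ _ True _ assms(4,3) u[symmetric] t t2 f(1)] True v n by fastforce
  next
    case 3
    then have "x1 * (2 * x1 + a) = 0" "x2 * (2 * x2 + a) = 0" using 1 2 by algebra+
    moreover have "x1\<^sup>2 + a * x1 = x2\<^sup>2 + a * x2" using u 3 by simp
    moreover have "x1 \<noteq> x2" using n 3 by simp
    moreover have "(x1 - x2) * (x1 + x2 + a) = 0" using \<open>x1\<^sup>2 + a * x1 = x2\<^sup>2 + a * x2\<close> by algebra
    ultimately show False by auto
  qed
qed

text \<open>Three double roots contribute six to the number of roots.\<close>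

lemma double_root_count:
  fixes P :: "real poly"
  assumes "P \<noteq> 0" "degree P \<le> 5" "distinct [p, q, r]"
    and "poly P p = 0" "poly P q = 0" "poly P r = 0"
    and "poly (pderiv P) p = 0" "poly (pderiv P) q = 0" "poly (pderiv P) r = 0"
  shows False
proof -
  have 2: "2 \<le> count (proots P) z" if "poly P z = 0" "poly (pderiv P) z = 0" for z
  proof -
    have 0: "order z P \<noteq> 0" using that(1) assms(1) by (simp add: order_root)
    have "pderiv P \<noteq> 0"
    proof
      assume "pderiv P = 0"
      then have "degree P = 0" by (simp add: pderiv_eq_0_iff)
      then obtain k where "P = [:k:]" by (rule degree_eq_zeroE)
      then show False using that(1) assms(1) by simp
    qed
    then have "order z P = Suc (order z (pderiv P))" "order z (pderiv P) \<noteq> 0"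
      using order_pderiv[of P z] 0 that(2) assms(1) by (auto simp: order_root)
    then show ?thesis using assms(1) by simp
  qed
  have "{#p, p, q, q, r, r#} \<subseteq># proots P"
    using 2[OF assms(4,7)] 2[OF assms(5,8)] 2[OF assms(6,9)] assms(3)
    by (intro mset_subset_eqI) auto
  then have "6 \<le> size (proots P)" using size_mset_mono by fastforce
  also have "\<dots> \<le> degree P" by (rule size_proots_le)
  finally show False using assms(2) by simp
qed

text \<open>For \<open>v \<noteq> 0\<close> the three points would be double roots of the fibre
  quintic. For \<open>v = 0\<close> they lie on the coordinate axes, and each of the sets
  \<open>y = 0\<close> and \<open>x = 0\<close>, \<open>y \<noteq> 0\<close> contains at most one of
  them.\<close>

lemma no_triple_fold:
  fixes x1 x2 x3 p q r a b c u v :: real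
  assumes d: "distinct [(x1, p), (x2, q), (x3, r)]" and n: "(a, b) \<noteq> (0, 0)"
    and s: "\<And>x y. (x, y) \<in> {(x1, p), (x2, q), (x3, r)} \<Longrightarrow> 2 * x\<^sup>2 + a * x - 3 * y^3 - 2 * c * y\<^sup>2 - b * y = 0"
    and im: "\<And>x y. (x, y) \<in> {(x1, p), (x2, q), (x3, r)} \<Longrightarrow> x * y = v \<and> x\<^sup>2 + y^3 + a * x + b * y + c * y\<^sup>2 = u"
  shows False
proof (cases "v = 0")
  case False
  let ?P = "[: v\<^sup>2, a * v, - u, b, c, 1 :]"
  have root: "poly ?P y = 0" "poly (pderiv ?P) y = 0" "y \<noteq> 0" "x = v / y"
    if h: "(x, y) \<in> {(x1, p), (x2, q), (x3, r)}" for x y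
  proof -
    have e: "x * y = v" "x\<^sup>2 + y^3 + a * x + b * y + c * y\<^sup>2 = u"
      "2 * x\<^sup>2 + a * x - 3 * y^3 - 2 * c * y\<^sup>2 - b * y = 0" using im[OF h] s[OF h] by blast+
    show y: "y \<noteq> 0" "x = v / y" using e(1) False by auto
    have "poly ?P y = v\<^sup>2 + a * v * y - u * y\<^sup>2 + b * y^3 + c * y^4 + y^5"
      by (simp add: algebra_simps power2_eq_square power3_eq_cube power4_eq_xxxx eval_nat_numeral)
    also have "\<dots> = 0" unfolding e(1,2)[symmetric] by algebra
    finally show "poly ?P y = 0" .
    have "poly (pderiv ?P) y = a * v - 2 * u * y + 3 * b * y\<^sup>2 + 4 * c * y^3 + 5 * y^4"
      by (simp add: pderiv_pCons algebra_simps power2_eq_square power3_eq_cube power4_eq_xxxx)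
    moreover have "y * (a * v - 2 * u * y + 3 * b * y\<^sup>2 + 4 * c * y^3 + 5 * y^4) = 0"
      using e(3) unfolding e(1,2)[symmetric] by algebra
    ultimately show "poly (pderiv ?P) y = 0" using y by simp
  qed
  have "distinct [p, q, r]"
    using d root(4)[of x1 p] root(4)[of x2 q] root(4)[of x3 r] by auto
  then show False
    by (rule double_root_count[of ?P p q r, rotated 2]) (use root in auto)
next
  case True
  have x: "x = 0 \<or> y = 0" if "(x, y) \<in> {(x1, p), (x2, q), (x3, r)}" for x y
    using im[OF that] True by simp
  have Y: "y = y'" if h: "(0, y) \<in> {(x1, p), (x2, q), (x3, r)}" "(0, y') \<in> {(x1, p), (x2, q), (x3, r)}" "y \<noteq> 0" "y' \<noteq> 0" for y y'
  proof (rule ccontr)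
    assume "y \<noteq> y'"
    then have pq: "y - y' \<noteq> 0" by simp
    have "y * (3 * y\<^sup>2 + 2 * c * y + b) = 0" "y' * (3 * y'\<^sup>2 + 2 * c * y' + b) = 0"
      using s[OF h(1)] s[OF h(2)] by (simp_all add: power2_eq_square power3_eq_cube algebra_simps)
    then have e: "3 * y\<^sup>2 + 2 * c * y + b = 0" "3 * y'\<^sup>2 + 2 * c * y' + b = 0" using h by auto
    have "(y - y') * (3 * (y + y') + 2 * c) = 0" using e by algebra
    then have c: "2 * c = - 3 * (y + y')" using pq by simp
    have "y^3 + b * y + c * y\<^sup>2 = y'^3 + b * y' + c * y'\<^sup>2" using im[OF h(1)] im[OF h(2)] by simp
    then have "(y - y') * (y\<^sup>2 + y * y' + y'\<^sup>2 + b + c * (y + y')) = 0" by algebra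
    then have "y\<^sup>2 + y * y' + y'\<^sup>2 + b + c * (y + y') = 0" using pq by simp
    then have "(y - y')\<^sup>2 = 0" using e c by algebra
    then show False using pq by simp
  qed
  have X: "x = x'" if h: "(x, 0) \<in> {(x1, p), (x2, q), (x3, r)}" "(x', 0) \<in> {(x1, p), (x2, q), (x3, r)}" for x x'
  proof -
    have "x * (2 * x + a) = 0" "x' * (2 * x' + a) = 0" 
      using s[OF h(1)] s[OF h(2)] by (simp_all add: power2_eq_square algebra_simps)
    moreover have "x\<^sup>2 + a * x = x'\<^sup>2 + a * x'" using im[OF h(1)] im[OF h(2)] by simp
    then have "(x - x') * (x + x' + a) = 0" by algebra
    ultimately show ?thesis by auto
  qed
  have E: "(x, y) = (x', y')"
    if h: "(x, y) \<in> {(x1, p), (x2, q), (x3, r)}" "(x', y') \<in> {(x1, p), (x2, q), (x3, r)}" "y = 0 \<longleftrightarrow> y' = 0"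
    for x y x' y'
  proof (cases "y = 0")
    case True
    then show ?thesis using X[of x x'] h by simp
  next
    case False
    then have "x = 0" "x' = 0" using x[OF h(1)] x[OF h(2)] h(3) by auto
    moreover have "y = y'" using Y[of y y'] h False calculation by simp
    ultimately show ?thesis by simp
  qed
  have "(p = 0 \<longleftrightarrow> q = 0) \<or> (p = 0 \<longleftrightarrow> r = 0) \<or> (q = 0 \<longleftrightarrow> r = 0)" by blast
  then show False
    using d E[of x1 p x2 q] E[of x1 p x3 r] E[of x2 q x3 r] by (elim disjE) simp_all
qed

text \<open>For parameters in \<open>V\<close> all the singular points occurring in the theorem lie in \<open>U\<close>; their
  \<open>y\<close>-coordinates are roots of one of the four quadratic polynomials.\<close>

definition confines :: "plane set \<Rightarrow> space set \<Rightarrow> bool" where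
  "confines U V \<longleftrightarrow> open V \<and> (0, 0, 0) \<in> V \<and> (\<forall>a b c x y. (a, b, c) \<in> V \<longrightarrow>
     2 * x\<^sup>2 + a * x - 3 * y^3 - 2 * c * y\<^sup>2 - b * y = 0 \<longrightarrow>
     9 * y\<^sup>2 + 4 * c * y + b = 0 \<or> 10 * y\<^sup>2 + 4 * c * y + b = 0 \<or>
     15 * y\<^sup>2 + 6 * c * y + 4 * b - c\<^sup>2 = 0 \<or> 5 * y\<^sup>2 + 2 * c * y + 3 * b - c\<^sup>2 = 0 \<longrightarrow> (x, y) \<in> U)"

text \<open>The y-coordinate is a root of a quadratic with small lower coefficients, hence small,
  and the Jacobian equation then bounds \<open>x\<close>. The four quadratics hold, in this order,
  at critical points of the Jacobian, at swallowtail and butterfly points, and at the cusp and the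
  fold of a cusp+fold.\<close>

lemma confines_exists:
  assumes "open U" "(0, 0) \<in> U"
  obtains V where "confines U V"
proof -
  obtain e0 where e0: "e0 > 0" "ball (0, 0) e0 \<subseteq> U" using assms open_contains_ball by blast
  define e where "e = min 1 (e0 / 2)"
  have e: "e > 0" "e \<le> 1" "2 * e \<le> e0" using e0(1) by (auto simp: e_def)
  have U: "(x, y) \<in> U" if "\<bar>x\<bar> < e" "\<bar>y\<bar> < e" for x y
  proof -
    have "norm (x, y) \<le> norm x + norm y" by (rule norm_Pair_le)
    also have "\<dots> < e0" using that e(3) by simp
    finally have "(x, y) \<in> ball (0, 0) e0" 
      by (simp only: zero_prod_def[symmetric] mem_ball_0)
    then show ?thesis using e0(2) by blast
  qed
  \<comment> \<open>\<open>d\<close> is the bound for \<open>y\<close>: the terms in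
    \<open>y\<close> then contribute at most \<open>6 * d < e^2\<close> to \<open>2 * x^2\<close>.
    The bound \<open>k\<close> for the parameters makes each of the quadratics force
    \<open>\<bar>y\<bar> < d\<close>.\<close>
  define d where "d = e\<^sup>2 / 8"
  have e2: "e\<^sup>2 \<le> e" using e(1,2) by (simp add: power2_eq_square mult_left_le)
  have d: "d > 0" "d \<le> e" "d \<le> 1" using e e2 unfolding d_def by auto
  define k where "k = d\<^sup>2 / 16"
  have k: "k > 0" "k \<le> d / 16" using d unfolding k_def by (auto simp: power2_eq_square mult_left_le)
  define V :: "space set" where "V = {-k<..<k} \<times> {-k<..<k} \<times> {-k<..<k}"
  have "(x, y) \<in> U"
    if h: "(a, b, c) \<in> V" "2 * x\<^sup>2 + a * x - 3 * y^3 - 2 * c * y\<^sup>2 - b * y = 0"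
      "9 * y\<^sup>2 + 4 * c * y + b = 0 \<or> 10 * y\<^sup>2 + 4 * c * y + b = 0 \<or>
       15 * y\<^sup>2 + 6 * c * y + 4 * b - c\<^sup>2 = 0 \<or> 5 * y\<^sup>2 + 2 * c * y + 3 * b - c\<^sup>2 = 0" for a b c x y
  proof -
    have abc: "\<bar>a\<bar> < k" "\<bar>b\<bar> < k" "\<bar>c\<bar> < k" using h(1) by (auto simp: V_def abs_less_iff)
    have k1: "k \<le> 1" using k d by simp
    have c2: "c\<^sup>2 \<le> k"
      using mult_mono[of "\<bar>c\<bar>" k "\<bar>c\<bar>" 1] abc k1 k by (simp add: power2_eq_square abs_mult_self_eq)
    have cy: "\<bar>c * y\<bar> \<le> k * \<bar>y\<bar>" unfolding abs_mult using abc by (intro mult_right_mono) auto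
    have "5 * y\<^sup>2 \<le> 6 * \<bar>c * y\<bar> + 4 * \<bar>b\<bar> + c\<^sup>2" using h(3) zero_le_power2[of y] zero_le_power2[of c] by (elim disjE) linarith+
    then have y2: "5 * y\<^sup>2 \<le> 6 * k * \<bar>y\<bar> + 5 * k" using cy abc c2 by linarith
    have y: "\<bar>y\<bar> < d"
    proof (rule ccontr)
      assume "\<not> \<bar>y\<bar> < d"
      then have yd: "d \<le> \<bar>y\<bar>" by simp
      have "5 * (d * \<bar>y\<bar>) \<le> 5 * y\<^sup>2"
        using mult_right_mono[OF yd, of "\<bar>y\<bar>"] by (simp add: power2_eq_square)
      moreover have "16 * k = d * d" by (simp add: k_def power2_eq_square)
      moreover have "d * d \<le> d * \<bar>y\<bar>" using yd d(1) by (intro mult_left_mono) auto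
      moreover have "16 * (k * \<bar>y\<bar>) \<le> d * \<bar>y\<bar>" using mult_right_mono[OF k(2), of "\<bar>y\<bar>"] by simp
      moreover have "0 < d * \<bar>y\<bar>" using yd d(1) by (intro mult_pos_pos) auto
      ultimately show False using y2 by linarith
    qed
    have y3: "\<bar>y^3\<bar> \<le> d" "\<bar>c * y\<^sup>2\<bar> \<le> d" "\<bar>b * y\<bar> \<le> d"
    proof -
      have y1: "\<bar>y\<bar> \<le> 1" using y d by simp
      have q: "\<bar>y\<^sup>2\<bar> \<le> 1" using y1 by (simp add: abs_square_le_1)
      have "\<bar>y^3\<bar> = \<bar>y\<^sup>2\<bar> * \<bar>y\<bar>" 
        unfolding abs_mult[symmetric] by (simp add: power2_eq_square power3_eq_cube)
      also have "\<dots> \<le> 1 * d" using q y by (intro mult_mono) auto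
      finally show "\<bar>y^3\<bar> \<le> d" by simp
      show "\<bar>c * y\<^sup>2\<bar> \<le> d"
        unfolding abs_mult using mult_mono[of "\<bar>c\<bar>" d "\<bar>y\<^sup>2\<bar>" 1] q abc k d by simp
      show "\<bar>b * y\<bar> \<le> d"
        unfolding abs_mult using mult_mono[of "\<bar>b\<bar>" d "\<bar>y\<bar>" 1] y1 abc k d by simp
    qed
    have "\<bar>x\<bar> < e"
    proof (rule ccontr)
      assume "\<not> \<bar>x\<bar> < e"
      then have xe: "e \<le> \<bar>x\<bar>" by simp
      have ax: "\<bar>a * x\<bar> \<le> d / 16 * \<bar>x\<bar>" unfolding abs_mult using abc k by (intro mult_right_mono) auto
      have "2 * x\<^sup>2 \<le> \<bar>a * x\<bar> + 3 * \<bar>y^3\<bar> + 2 * \<bar>c * y\<^sup>2\<bar> + \<bar>b * y\<bar>" using h(2) by linarith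
      then have "2 * x\<^sup>2 \<le> d / 16 * \<bar>x\<bar> + 6 * d" using ax y3 by linarith
      moreover have "e * \<bar>x\<bar> \<le> x\<^sup>2" using mult_right_mono[OF xe, of "\<bar>x\<bar>"] by (simp add: power2_eq_square)
      moreover have "8 * d = e * e" by (simp add: d_def power2_eq_square)
      moreover have "e * e \<le> e * \<bar>x\<bar>" using xe e(1) by (intro mult_left_mono) auto
      moreover have "d * \<bar>x\<bar> \<le> e * \<bar>x\<bar>" using d(2) by (intro mult_right_mono) auto
      moreover have "0 < e * \<bar>x\<bar>" using xe e(1) by (intro mult_pos_pos) auto
      ultimately show False by linarith
    qed
    then show ?thesis using U y d by simp
  qed
  moreover have "open V" unfolding V_def by (intro open_Times open_greaterThanLessThan)
  moreover have "(0, 0, 0) \<in> V" using k by (simp add: V_def)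
  ultimately have "confines U V" unfolding confines_def by blast
  then show thesis by (rule that)
qed

section \<open>The loci in a small neighbourhood of the origin\<close>

lemma locusE:
  assumes "w \<in> locus T U"
  obtains a b c x y where "w = (a, b, c)" "(x, y) \<in> U" "T (G a b c) (x, y)"
  using assms by (force simp: locus_def)

lemma bi_locusE:
  assumes "w \<in> bi_locus T T' U"
  obtains a b c x1 p x2 q where "w = (a, b, c)" "(x1, p) \<noteq> (x2, q)" "G a b c (x1, p) = G a b c (x2, q)"
    "T (G a b c) (x1, p)" "T' (G a b c) (x2, q)"
proof -
  obtain a b c where w: "w = (a, b, c)" by (cases w)
  then obtain z1 z2 where "z1 \<noteq> z2" "G a b c z1 = G a b c z2" "T (G a b c) z1" "T' (G a b c) z2"
    using assms by (auto simp: bi_locus_def)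
  then show thesis using that[OF w, of "fst z1" "snd z1" "fst z2" "snd z2"] by simp
qed

lemma fold_pt_singular: "fold_pt (G a b c) (x, y) \<Longrightarrow> 2 * x\<^sup>2 + a * x - 3 * y^3 - 2 * c * y\<^sup>2 - b * y = 0"
  using fold_pt_G[of x y] by (cases "(x, y) = (0, 0)") auto

lemma G_eqD:
  assumes "G a b c (x1, p) = G a b c (x2, q)"
  shows "x1 * p = x2 * q" "x1\<^sup>2 + p^3 + a * x1 + b * p + c * p\<^sup>2 = x2\<^sup>2 + q^3 + a * x2 + b * q + c * q\<^sup>2"
  using assms by (simp_all add: G_def)

lemma cf_fold:
  assumes "(a, b, c) = cf_surface s c" "q = - (c - 3 * s\<^sup>2) / 2" "c \<noteq> 5 * s\<^sup>2"
  shows "fold_pt (G a b c) (- (s^3), q)"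
proof -
  have q: "q + s\<^sup>2 \<noteq> 0" using assms(2,3) by simp
  have n: "(- (s^3), q) \<noteq> (0, 0)" using q by auto
  show ?thesis unfolding fold_pt_G[OF n] cf_surface_points(7,8)[OF assms(1,2)] using q by simp
qed

context
  fixes U :: "plane set" and V :: "space set"
  assumes conf: "confines U V"
begin

lemma confined:
  assumes "(a, b, c) \<in> V" "2 * x\<^sup>2 + a * x - 3 * y^3 - 2 * c * y\<^sup>2 - b * y = 0"
    "9 * y\<^sup>2 + 4 * c * y + b = 0 \<or> 10 * y\<^sup>2 + 4 * c * y + b = 0 \<or>
     15 * y\<^sup>2 + 6 * c * y + 4 * b - c\<^sup>2 = 0 \<or> 5 * y\<^sup>2 + 2 * c * y + 3 * b - c\<^sup>2 = 0"
  shows "(x, y) \<in> U"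
  using conf assms unfolding confines_def by blast

lemma origin_confined: "(0, 0) \<in> U"
  using confined[of 0 0 0 0 0] conf by (simp add: confines_def)

lemma beaks_lips_locus_eq:
  "beaks_lips_locus U \<inter> V = {bl_surface r c | r c. r\<^sup>2 \<noteq> c \<and> 3 * r\<^sup>2 \<noteq> c} \<inter> V"
proof (intro equalityI subsetI)
  fix w assume w0: "w \<in> beaks_lips_locus U \<inter> V"
  then have w0: "w \<in> beaks_lips_locus U" and wV: "w \<in> V" by simp_all
  obtain a b c x y where w: "w = (a, b, c)" "(x, y) \<in> U" "beaks_pt (G a b c) (x, y) \<or> lips_pt (G a b c) (x, y)"
    using w0 by (rule locusE)
  note w = w(1) wV w(3)
  then show "w \<in> {bl_surface r c | r c. r\<^sup>2 \<noteq> c \<and> 3 * r\<^sup>2 \<noteq> c} \<inter> V"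
    unfolding beaks_or_lips_G_iff by auto
next
  fix w assume "w \<in> {bl_surface r c | r c. r\<^sup>2 \<noteq> c \<and> 3 * r\<^sup>2 \<noteq> c} \<inter> V"
  then obtain r c where r: "w = bl_surface r c" "r\<^sup>2 \<noteq> c" "3 * r\<^sup>2 \<noteq> c" "w \<in> V" by blast
  obtain a b where w: "w = (a, b, c)" unfolding r(1) bl_surface_def by blast
  define y where "y = (r\<^sup>2 - c) / 3"
  define x where "x = - y * r"
  have "(a, b, c) = bl_surface r c" using r(1) w by simp
  then have "(x, y) \<in> U"
    using confined bl_surface_point[OF _ y_def x_def] r(4) w by blast
  moreover have "beaks_pt (G a b c) (x, y) \<or> lips_pt (G a b c) (x, y)"
    unfolding beaks_or_lips_G_iff using r w y_def x_def by auto
  ultimately show "w \<in> beaks_lips_locus U \<inter> V" using r(4) by (auto simp: locus_def w)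
qed

lemma goose_locus_eq:
  "goose_locus U \<inter> V = {bl_surface r c | r c. r \<noteq> 0 \<and> 3 * r\<^sup>2 = c} \<inter> V"
proof (intro equalityI subsetI)
  fix w assume w0: "w \<in> goose_locus U \<inter> V"
  then have w0: "w \<in> goose_locus U" and wV: "w \<in> V" by simp_all
  obtain a b c x y where w: "w = (a, b, c)" "(x, y) \<in> U" "goose_pt (G a b c) (x, y)"
    using w0 by (rule locusE)
  note w = w(1) wV w(3)
  then show "w \<in> {bl_surface r c | r c. r \<noteq> 0 \<and> 3 * r\<^sup>2 = c} \<inter> V"
    unfolding goose_G_iff by auto
next
  fix w assume "w \<in> {bl_surface r c | r c. r \<noteq> 0 \<and> 3 * r\<^sup>2 = c} \<inter> V"
  then obtain r c where r: "w = bl_surface r c" "r \<noteq> 0" "3 * r\<^sup>2 = c" "w \<in> V" by blast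
  obtain a b where w: "w = (a, b, c)" unfolding r(1) bl_surface_def by blast
  define y where "y = (r\<^sup>2 - c) / 3"
  define x where "x = - y * r"
  have "(a, b, c) = bl_surface r c" using r(1) w by simp
  then have "(x, y) \<in> U"
    using confined bl_surface_point[OF _ y_def x_def] r(4) w by blast
  moreover have "goose_pt (G a b c) (x, y)"
    unfolding goose_G_iff using r w y_def x_def by auto
  ultimately show "w \<in> goose_locus U \<inter> V" using r(4) by (auto simp: locus_def w)
qed

lemma swallowtail_locus_eq:
  "swallowtail_locus U \<inter> V =
    ({sw_surface r c | r c. r \<noteq> 0 \<and> r\<^sup>2 \<noteq> c \<and> 5 * r\<^sup>2 \<noteq> c} \<union> {(a, 0, 0) | a. a \<noteq> 0}) \<inter> V"
proof (intro equalityI subsetI)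
  fix w assume w0: "w \<in> swallowtail_locus U \<inter> V"
  then have w0: "w \<in> swallowtail_locus U" and wV: "w \<in> V" by simp_all
  obtain a b c x y where w: "w = (a, b, c)" "(x, y) \<in> U" "swallowtail_pt (G a b c) (x, y)"
    using w0 by (rule locusE)
  note w = w(1) wV w(3)
  show "w \<in> ({sw_surface r c | r c. r \<noteq> 0 \<and> r\<^sup>2 \<noteq> c \<and> 5 * r\<^sup>2 \<noteq> c} \<union> {(a, 0, 0) | a. a \<noteq> 0}) \<inter> V"
  proof (cases "(x, y) = (0, 0)")
    case True
    then show ?thesis using w by (auto simp: swallowtail_pt_G_origin)
  next
    case False
    then show ?thesis using w(3) unfolding swallowtail_G_iff[OF False] using w(1,2) by auto
  qed
next
  fix w assume w: "w \<in> ({sw_surface r c | r c. r \<noteq> 0 \<and> r\<^sup>2 \<noteq> c \<and> 5 * r\<^sup>2 \<noteq> c} \<union> {(a, 0, 0) | a. a \<noteq> 0}) \<inter> V"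
  then consider r c where "w = sw_surface r c" "r \<noteq> 0" "r\<^sup>2 \<noteq> c" "5 * r\<^sup>2 \<noteq> c" | a where "w = (a, 0, 0)" "a \<noteq> 0" by blast
  then show "w \<in> swallowtail_locus U \<inter> V"
  proof cases
    case (1 r c)
    obtain a b where w': "w = (a, b, c)" unfolding 1(1) sw_surface_def by blast
    define y where "y = (r\<^sup>2 - c) / 4"
    define x where "x = y * r"
    have s: "(a, b, c) = sw_surface r c" using 1(1) w' by simp
    have "(a, b, c) \<in> V" using w w' by simp
    then have "(x, y) \<in> U"
      using confined sw_surface_point(1,7)[OF s 1(2) y_def x_def] by blast
    moreover have "(x, y) \<noteq> (0, 0)" using 1(3) by (simp add: y_def)
    then have "swallowtail_pt (G a b c) (x, y)"
      using swallowtail_G_iff 1 s y_def x_def by blast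
    ultimately show ?thesis using w by (auto simp: locus_def w')
  next
    case (2 a)
    then show ?thesis using w origin_confined swallowtail_pt_G_origin[of a 0 0] by (auto simp: locus_def)
  qed
qed

lemma butterfly_locus_eq:
  "butterfly_locus U \<inter> V = {sw_surface r c | r c. r \<noteq> 0 \<and> 5 * r\<^sup>2 = c} \<inter> V"
proof (intro equalityI subsetI)
  fix w assume w0: "w \<in> butterfly_locus U \<inter> V"
  then have w0: "w \<in> butterfly_locus U" and wV: "w \<in> V" by simp_all
  obtain a b c x y where w: "w = (a, b, c)" "(x, y) \<in> U" "butterfly_pt (G a b c) (x, y)"
    using w0 by (rule locusE)
  note w = w(1) wV w(3)
  then show "w \<in> {sw_surface r c | r c. r \<noteq> 0 \<and> 5 * r\<^sup>2 = c} \<inter> V"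
    unfolding butterfly_G_iff by auto
next
  fix w assume "w \<in> {sw_surface r c | r c. r \<noteq> 0 \<and> 5 * r\<^sup>2 = c} \<inter> V"
  then obtain r c where r: "w = sw_surface r c" "r \<noteq> 0" "5 * r\<^sup>2 = c" "w \<in> V" by blast
  obtain a b where w: "w = (a, b, c)" unfolding r(1) sw_surface_def by blast
  define y where "y = (r\<^sup>2 - c) / 4"
  define x where "x = y * r"
  have s: "(a, b, c) = sw_surface r c" using r(1) w by simp
  then have "(x, y) \<in> U"
    using confined sw_surface_point(1,7)[OF _ r(2) y_def x_def] r(4) w by blast
  moreover have "butterfly_pt (G a b c) (x, y)"
    unfolding butterfly_G_iff using r s y_def x_def by blast
  ultimately show "w \<in> butterfly_locus U \<inter> V" using r(4) by (auto simp: locus_def w)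
qed

lemma cf_points_confined:
  assumes "(a, b, c) \<in> V" "(a, b, c) = cf_surface s c" "q = - (c - 3 * s\<^sup>2) / 2"
  shows "(s * q, - s\<^sup>2) \<in> U" "(- (s^3), q) \<in> U"
  using confined[OF assms(1)] cf_surface_points(2,7,9,10)[OF assms(2,3)] by blast+

text \<open>For \<open>s \<noteq> 0\<close>, the cusp and the fold merge to a butterfly point at
  \<open>c = 5 * s^2\<close>, and at \<open>c = 7 * s^2\<close> the cusp point is a critical point
  of the Jacobian and turns into beaks.\<close>

lemma cusp_fold_locus_eq:
  "cusp_fold_locus U \<inter> V = {cf_surface s c | s c. c \<noteq> 5 * s\<^sup>2 \<and> c \<noteq> 7 * s\<^sup>2} \<inter> V"
proof (intro equalityI subsetI)
  fix w assume "w \<in> cusp_fold_locus U \<inter> V"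
  then have w0: "w \<in> cusp_fold_locus U" and wV: "w \<in> V" by simp_all
  obtain a b c x1 p x2 q where w: "w = (a, b, c)" "(x1, p) \<noteq> (x2, q)"
    "G a b c (x1, p) = G a b c (x2, q)" "cusp_pt (G a b c) (x1, p)" "fold_pt (G a b c) (x2, q)"
    using w0 by (rule bi_locusE)
  note w = w(1) wV w(2-5)
  note s2 = fold_pt_singular[OF w(6)] and im = G_eqD[OF w(4)]
  have "\<exists>s. (a, b, c) = cf_surface s c \<and> (x1, p) = (s * - (c - 3 * s\<^sup>2) / 2, - s\<^sup>2) \<and>
    (x2, q) = (- (s^3), - (c - 3 * s\<^sup>2) / 2)"
  proof (cases "(x1, p) = (0, 0)")
    case True
    then have z: "x1 = 0" "p = 0" by auto
    have "(a, b) \<noteq> (0, 0)" "a * b = 0" "(x2, q) \<noteq> (0, 0)"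
      using w(3,5) True by (auto simp: cusp_pt_G_origin)
    then show ?thesis unfolding z using s2 im z by (intro origin_contact_pair) auto
  next
    case False
    then show ?thesis
      using w(5)[unfolded cusp_pt_G[OF False]] by (intro cusp_contact_pair_nonzero[OF False w(3) _ _ s2 im]) blast+
  qed
  then obtain s where s: "(a, b, c) = cf_surface s c" "(x1, p) = (s * - (c - 3 * s\<^sup>2) / 2, - s\<^sup>2)"
    "(x2, q) = (- (s^3), - (c - 3 * s\<^sup>2) / 2)" by blast
  define q' where "q' = - (c - 3 * s\<^sup>2) / 2"
  have s': "(x1, p) = (s * q', - s\<^sup>2)" "(x2, q) = (- (s^3), q')" using s by (simp_all add: q'_def)
  note P = cf_surface_points[OF s(1) q'_def]
  have 5: "c \<noteq> 5 * s\<^sup>2" using w(3) P(11) unfolding s' by blast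
  have "c \<noteq> 7 * s\<^sup>2"
  proof
    assume c: "c = 7 * s\<^sup>2"
    then have "s \<noteq> 0" using 5 by auto
    then have n: "(x1, p) \<noteq> (0, 0)" using s by auto
    have "4 * x1 + a = 0 \<and> 9 * p\<^sup>2 + 4 * c * p + b = 0" using P(5,6) s'(1) c by simp
    then show False using w(5) cusp_pt_G[OF n] by blast
  qed
  then show "w \<in> {cf_surface s c | s c. c \<noteq> 5 * s\<^sup>2 \<and> c \<noteq> 7 * s\<^sup>2} \<inter> V" using 5 s(1) w(1,2) by blast
next
  fix w assume "w \<in> {cf_surface s c | s c. c \<noteq> 5 * s\<^sup>2 \<and> c \<noteq> 7 * s\<^sup>2} \<inter> V"
  then obtain s c where s: "w = cf_surface s c" "c \<noteq> 5 * s\<^sup>2" "c \<noteq> 7 * s\<^sup>2" "w \<in> V" by blast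
  obtain a b where w: "w = (a, b, c)" unfolding s(1) cf_surface_def by blast
  have s1: "(a, b, c) = cf_surface s c" using s(1) w by simp
  define q where "q = - (c - 3 * s\<^sup>2) / 2"
  note P = cf_surface_points[OF s1 q_def]
  have "cusp_pt (G a b c) (s * q, - s\<^sup>2)"
  proof (cases "s = 0")
    case True
    then have "a = 0" "b \<noteq> 0" using s1 s(2) by (auto simp: cf_surface_def)
    then show ?thesis using True by (simp add: cusp_pt_G_origin)
  next
    case False
    then have n: "(s * q, - s\<^sup>2) \<noteq> (0, 0)" by simp
    show ?thesis unfolding cusp_pt_G[OF n] P(2-6) using False s(2,3) by simp
  qed
  moreover have "fold_pt (G a b c) (- (s^3), q)" by (rule cf_fold[OF s1 q_def s(2)])
  moreover have "(s * q, - s\<^sup>2) \<noteq> (- (s^3), q)" using P(11) s(2) by blast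
  moreover have "(s * q, - s\<^sup>2) \<in> U" "(- (s^3), q) \<in> U"
    using cf_points_confined[OF _ s1 q_def] s(4) w by auto
  ultimately have "w \<in> cusp_fold_locus U"
    unfolding bi_locus_def w using P(1) by blast
  then show "w \<in> cusp_fold_locus U \<inter> V" using s(4) by blast
qed

lemma beaks_fold_locus_eq:
  "beaks_fold_locus U \<inter> V = {cf_surface s c | s c. s \<noteq> 0 \<and> c = 7 * s\<^sup>2} \<inter> V"
proof (intro equalityI subsetI)
  fix w assume "w \<in> beaks_fold_locus U \<inter> V"
  then have w0: "w \<in> beaks_fold_locus U" and wV: "w \<in> V" by simp_all
  obtain a b c x1 p x2 q where w: "w = (a, b, c)" "(x1, p) \<noteq> (x2, q)"
    "G a b c (x1, p) = G a b c (x2, q)" "beaks_pt (G a b c) (x1, p)" "fold_pt (G a b c) (x2, q)"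
    using w0 by (rule bi_locusE)
  note w = w(1) wV w(2-5)
  note s2 = fold_pt_singular[OF w(6)] and im = G_eqD[OF w(4)]
  have b: "(x1, p) \<noteq> (0, 0)" "2 * x1\<^sup>2 + a * x1 - 3 * p^3 - 2 * c * p\<^sup>2 - b * p = 0" "4 * x1 + a = 0"
    "9 * p\<^sup>2 + 4 * c * p + b = 0" using w(5) unfolding beaks_lips_pt_G by blast+
  have "4 * x1\<^sup>2 + a * x1 + 9 * p^3 + 4 * c * p\<^sup>2 + b * p = x1 * (4 * x1 + a) + p * (9 * p\<^sup>2 + 4 * c * p + b)" by algebra
  then have l: "4 * x1\<^sup>2 + a * x1 + 9 * p^3 + 4 * c * p\<^sup>2 + b * p = 0" by (simp add: b)
  obtain s where s: "(a, b, c) = cf_surface s c" "(x1, p) = (s * - (c - 3 * s\<^sup>2) / 2, - s\<^sup>2)"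
    using cusp_contact_pair_nonzero[OF b(1) w(3) b(2) l s2 im] by blast
  define q' where "q' = - (c - 3 * s\<^sup>2) / 2"
  have s': "x1 = s * q'" "p = - s\<^sup>2" using s by (simp_all add: q'_def)
  have "s \<noteq> 0" using b(1) s(2) by auto
  moreover have "1/2 * s * (7 * s\<^sup>2 - c) = 0" using b(3) cf_surface_points(5)[OF s(1) q'_def] unfolding s' by simp
  ultimately show "w \<in> {cf_surface s c | s c. s \<noteq> 0 \<and> c = 7 * s\<^sup>2} \<inter> V" using s(1) w(1,2) by auto
next
  fix w assume "w \<in> {cf_surface s c | s c. s \<noteq> 0 \<and> c = 7 * s\<^sup>2} \<inter> V"
  then obtain s c where s: "w = cf_surface s c" "s \<noteq> 0" "c = 7 * s\<^sup>2" "w \<in> V" by blast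
  obtain a b where w: "w = (a, b, c)" unfolding s(1) cf_surface_def by blast
  have s1: "(a, b, c) = cf_surface s c" using s(1) w by simp
  define q where "q = - (c - 3 * s\<^sup>2) / 2"
  have q: "q = - 2 * s\<^sup>2" by (simp add: q_def s(3))
  note P = cf_surface_points[OF s1 q_def]
  have "4 * (s * q)\<^sup>2 - (18 * - s\<^sup>2 + 4 * c) * (- s\<^sup>2)\<^sup>2 = 6 * s^6" unfolding q s(3) by algebra
  then have "beaks_pt (G a b c) (s * q, - s\<^sup>2)"
    unfolding beaks_lips_pt_G P(2,5,6) using s(2) by (simp add: s(3))
  moreover have c5: "c \<noteq> 5 * s\<^sup>2" using s by simp
  then have "fold_pt (G a b c) (- (s^3), q)" by (rule cf_fold[OF s1 q_def])
  moreover have "(s * q, - s\<^sup>2) \<noteq> (- (s^3), q)" using P(11) c5 by blast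
  moreover have "(s * q, - s\<^sup>2) \<in> U" "(- (s^3), q) \<in> U"
    using cf_points_confined[OF _ s1 q_def] s(4) w by auto
  ultimately have "w \<in> beaks_fold_locus U"
    unfolding bi_locus_def w using P(1) by blast
  then show "w \<in> beaks_fold_locus U \<inter> V" using s(4) by blast
qed

end

section \<open>Sharksfin and deltoid\<close>

text \<open>Changes of source and target transport the kernels of the differential. This is the only
  invariant used to exclude types: the germs are told apart by their rank at the point and by their
  singular sets.\<close>

lemma A_equivalent_kernel:
  assumes eq: "A_equivalent f p g q" and f: "\<And>z. f differentiable (at z)"
  obtains N N' \<sigma> \<sigma>' where "diffeo N N' \<sigma> \<sigma>'" "p \<in> N" "\<sigma> p = q"
    "\<And>z v. z \<in> N' \<Longrightarrow> frechet_derivative g (at z) v = 0 \<longleftrightarrow>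
       frechet_derivative f (at (\<sigma>' z)) (frechet_derivative \<sigma>' (at z) v) = 0"
proof -
  obtain N N' \<sigma> \<sigma>' M M' \<tau> \<tau>' where d: "diffeo N N' \<sigma> \<sigma>'" "p \<in> N" "\<sigma> p = q" "diffeo M M' \<tau> \<tau>'"
    "f ` N \<subseteq> M" "\<And>z. z \<in> N' \<Longrightarrow> g z = \<tau> (f (\<sigma>' z))"
    using eq unfolding A_equivalent_def by auto
  have "frechet_derivative g (at z) v = 0 \<longleftrightarrow>
       frechet_derivative f (at (\<sigma>' z)) (frechet_derivative \<sigma>' (at z) v) = 0" if z: "z \<in> N'" for z v
  proof -
    have z': "\<sigma>' z \<in> N" using diffeo_apply(1)[OF diffeo_sym[OF d(1)] z] .
    then have m: "f (\<sigma>' z) \<in> M" using d(5) by blast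
    have D1: "(\<sigma>' has_derivative frechet_derivative \<sigma>' (at z)) (at z)"
      by (rule diffeo_has_derivative[OF diffeo_sym[OF d(1)] z])
    have D2: "(f has_derivative frechet_derivative f (at (\<sigma>' z))) (at (\<sigma>' z))"
      using f by (simp add: frechet_derivative_works)
    have D3: "(\<tau> has_derivative frechet_derivative \<tau> (at (f (\<sigma>' z)))) (at (f (\<sigma>' z)))"
      by (rule diffeo_has_derivative[OF d(4) m])
    have "((\<lambda>z. \<tau> (f (\<sigma>' z))) has_derivative (\<lambda>v. frechet_derivative \<tau> (at (f (\<sigma>' z)))
        (frechet_derivative f (at (\<sigma>' z)) (frechet_derivative \<sigma>' (at z) v)))) (at z)"
      by (rule has_derivative_compose[OF has_derivative_compose[OF D1 D2] D3])
    then have "(g has_derivative (\<lambda>v. frechet_derivative \<tau> (at (f (\<sigma>' z)))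
        (frechet_derivative f (at (\<sigma>' z)) (frechet_derivative \<sigma>' (at z) v)))) (at z)"
      by (rule has_derivative_transform_within_open[OF _ diffeo_open(2)[OF d(1)] z]) (simp add: d(6))
    note D = frechet_derivative_eqI[OF this]
    have "frechet_derivative \<tau> (at (f (\<sigma>' z))) u = 0 \<longleftrightarrow> u = 0" for u
      using diffeo_derivative_nonzero[OF d(4) m, of u] linear_0[OF has_derivative_linear[OF D3]] by metis
    then show ?thesis unfolding D by simp
  qed
  then show thesis using that d(1-3) by blast
qed

lemma G_differentiable: "G a b c differentiable (at z)"
  using G_has_derivative differentiableI by blast

lemma G_kernel_singular:
  assumes "frechet_derivative (G a b c) (at (x, y)) v = 0" "v \<noteq> 0"
  shows "2 * x\<^sup>2 + a * x - 3 * y^3 - 2 * c * y\<^sup>2 - b * y = 0"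
proof -
  obtain h k where v: "v = (h, k)" by (cases v)
  have e: "(2 * x + a) * h + (3 * y\<^sup>2 + 2 * c * y + b) * k = 0" "y * h + x * k = 0"
    using assms(1) by (simp_all add: v frechet_derivative_G zero_prod_def)
  let ?l = "2 * x\<^sup>2 + a * x - 3 * y^3 - 2 * c * y\<^sup>2 - b * y"
  have "?l * h = 0" "?l * k = 0" using e by algebra+
  then show ?thesis using assms(2) by (auto simp: v zero_prod_def)
qed

lemma corank_two_at_origin:
  assumes eq: "A_equivalent (G a b c) p g (0, 0)" and g: "\<And>v. frechet_derivative g (at (0, 0)) v = 0"
  shows "p = (0, 0)" "a = 0" "b = 0"
proof -
  obtain N N' \<sigma> \<sigma>' where d: "diffeo N N' \<sigma> \<sigma>'" "p \<in> N" "\<sigma> p = (0, 0)"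
    "\<And>z v. z \<in> N' \<Longrightarrow> frechet_derivative g (at z) v = 0 \<longleftrightarrow>
       frechet_derivative (G a b c) (at (\<sigma>' z)) (frechet_derivative \<sigma>' (at z) v) = 0"
    using A_equivalent_kernel[OF eq G_differentiable] by blast
  have z: "(0, 0) \<in> N'" "\<sigma>' (0, 0) = p" using diffeo_apply[OF d(1,2)] d(3) by auto
  have "frechet_derivative (G a b c) (at p) u = 0" for u
  proof -
    have "frechet_derivative \<sigma>' (at (0, 0)) (frechet_derivative \<sigma> (at p) u) = u"
      using diffeo_derivative_inverse[OF d(1,2), of u] d(3) by simp
    then show ?thesis using d(4)[OF z(1), of "frechet_derivative \<sigma> (at p) u"] g z(2) by simp
  qed
  from this[of "(1, 0)"] this[of "(0, 1)"] show "p = (0, 0)" "a = 0" "b = 0"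
    by (cases p; simp add: frechet_derivative_G zero_prod_def)+
qed

abbreviation "sharksfin_germ \<equiv> (\<lambda>(x, y). (x\<^sup>2 + y^3, y\<^sup>2 + x^3)) :: plane \<Rightarrow> plane"
abbreviation "deltoid_germ \<equiv> (\<lambda>(x, y). (x\<^sup>2 - y\<^sup>2 + x^3, x * y)) :: plane \<Rightarrow> plane"

lemma frechet_sharksfin_germ:
  "frechet_derivative sharksfin_germ (at z) v =
    (2 * fst z * fst v + 3 * (snd z)\<^sup>2 * snd v, 2 * snd z * snd v + 3 * (fst z)\<^sup>2 * fst v)"
proof -
  have "(sharksfin_germ has_derivative (\<lambda>v.
    (2 * fst z * fst v + 3 * (snd z)\<^sup>2 * snd v, 2 * snd z * snd v + 3 * (fst z)\<^sup>2 * fst v))) (at z)"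
    unfolding case_prod_beta
    by (auto intro!: derivative_eq_intros simp: fun_eq_iff algebra_simps)
  from frechet_derivative_eqI[OF this] show ?thesis by simp
qed

lemma frechet_deltoid_germ:
  "frechet_derivative deltoid_germ (at z) v =
    ((2 * fst z + 3 * (fst z)\<^sup>2) * fst v - 2 * snd z * snd v, snd z * fst v + fst z * snd v)"
proof -
  have "(deltoid_germ has_derivative (\<lambda>v.
    ((2 * fst z + 3 * (fst z)\<^sup>2) * fst v - 2 * snd z * snd v, snd z * fst v + fst z * snd v))) (at z)"
    unfolding case_prod_beta
    by (auto intro!: derivative_eq_intros simp: fun_eq_iff algebra_simps)
  from frechet_derivative_eqI[OF this] show ?thesis by simp
qed

text \<open>The singular set of the sharksfin germ contains the axis \<open>y = 0\<close>, a regular curve; for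
  \<open>c \<le> 0\<close> the singular set \<open>2 x\<^sup>2 = y\<^sup>2 (2 c + 3 y)\<close> contains no regular curve through the origin.\<close>

lemma sharksfin_pt_imp:
  assumes "sharksfin_pt (G a b c) p"
  shows "p = (0, 0)" "a = 0" "b = 0" "c > 0"
proof -
  note eq = assms[unfolded sharksfin_pt_def]
  note 0 = corank_two_at_origin[OF eq, unfolded frechet_sharksfin_germ, simplified, folded zero_prod_def]
  show p0: "p = (0, 0)" and a0: "a = 0" and b0: "b = 0" using 0 by (simp_all add: zero_prod_def)
  obtain N N' \<sigma> \<sigma>' where d: "diffeo N N' \<sigma> \<sigma>'" "p \<in> N" "\<sigma> p = (0, 0)"
    "\<And>z v. z \<in> N' \<Longrightarrow> frechet_derivative sharksfin_germ (at z) v = 0 \<longleftrightarrow>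
       frechet_derivative (G a b c) (at (\<sigma>' z)) (frechet_derivative \<sigma>' (at z) v) = 0"
    using A_equivalent_kernel[OF eq G_differentiable] by blast
  note d' = diffeo_sym[OF d(1)]
  have z: "(0, 0) \<in> N'" "\<sigma>' (0, 0) = (0, 0)" using diffeo_apply[OF d(1,2)] d(3) p0 by auto
  show "c > 0"
  proof (rule ccontr)
    assume "\<not> c > 0"
    then have c: "c \<le> 0" by simp
    define w where "w = frechet_derivative \<sigma>' (at (0, 0)) (1, 0)"
    have w: "w \<noteq> 0" unfolding w_def by (rule diffeo_derivative_nonzero[OF d' z(1)]) (simp add: zero_prod_def)
    define f1 where "f1 t = fst (\<sigma>' (t, 0))" for t
    define f2 where "f2 t = snd (\<sigma>' (t, 0))" for t
    have D: "((\<lambda>t. \<sigma>' (t, 0)) has_derivative (\<lambda>t. t *\<^sub>R w)) (at 0)"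
    proof -
      have 1: "((\<lambda>t::real. (t, 0::real)) has_derivative (\<lambda>t. (t, 0))) (at 0)"
        by (auto intro!: derivative_eq_intros)
      note 2 = diffeo_has_derivative[OF d' z(1)]
      have "frechet_derivative \<sigma>' (at (0, 0)) (t, 0) = t *\<^sub>R w" for t
        using linear_scale[OF has_derivative_linear[OF 2], of t "(1, 0)"] by (simp add: w_def)
      then show ?thesis using has_derivative_compose[OF 1 2] by simp
    qed
    have "continuous_on UNIV (\<lambda>t::real. (t, 0::real))" by (intro continuous_intros)
    then have "open ((\<lambda>t. (t, 0)) -` N')" using diffeo_open(2)[OF d(1)] by (simp add: open_vimage)
    then have "eventually (\<lambda>t. (t, 0) \<in> N') (at 0)" using z(1) eventually_at_in_open' by fastforce
    then have ev: "eventually (\<lambda>t. 2 * (f1 t)\<^sup>2 = 3 * f2 t ^ 3 + 2 * c * (f2 t)\<^sup>2) (at 0)"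
    proof eventually_elim
      case (elim t)
      \<comment> \<open>Each point of the axis \<open>y = 0\<close> is singular with kernel vector
        \<open>(0, 1)\<close>, hence so is its image under \<open>\<sigma>'\<close>. It will follow
        that the image of the axis has velocity 0, which is impossible for a diffeomorphism.\<close>
      have "frechet_derivative sharksfin_germ (at (t, 0)) (0, 1) = 0"
        by (simp add: frechet_sharksfin_germ zero_prod_def)
      then have "frechet_derivative (G a b c) (at (f1 t, f2 t)) (frechet_derivative \<sigma>' (at (t, 0)) (0, 1)) = 0"
        using d(4)[OF elim] by (simp add: f1_def f2_def)
      from G_kernel_singular[OF this diffeo_derivative_nonzero[OF d' elim]]
      show ?case by (simp add: a0 b0 zero_prod_def)
    qed
    have F1: "(f1 has_derivative (\<lambda>t. t * fst w)) (at 0)" "f1 0 = 0"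
      using has_derivative_fst[OF D] z(2) by (simp_all add: f1_def[abs_def])
    have F2: "(f2 has_derivative (\<lambda>t. t * snd w)) (at 0)" "f2 0 = 0"
      using has_derivative_snd[OF D] z(2) by (simp_all add: f2_def[abs_def])
    have ev2: "eventually (\<lambda>t. 2 * (f1 t)\<^sup>2 \<le> 3 * f2 t ^ 3) (at 0)"
      using ev by eventually_elim (use c in \<open>auto simp: mult_nonpos_nonneg\<close>)
    then have "eventually (\<lambda>t. f2 t \<ge> 0) (at 0)"
    proof eventually_elim
      case (elim t)
      then have "0 \<le> f2 t ^ 3" using zero_le_power2[of "f1 t"] by linarith
      then show ?case by (simp add: zero_le_power_eq)
    qed
    then have w2: "snd w = 0" by (rule nonneg_derivative_zero[OF F2])
    have "isCont f2 0" using F2(1) by (rule has_derivative_continuous)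
    then have "f2 \<midarrow>0\<rightarrow> 0" using F2(2) by (simp add: isCont_def)
    then have "eventually (\<lambda>t. f2 t < 1) (at 0)" by (rule order_tendstoD) simp
    with ev2 \<open>eventually (\<lambda>t. f2 t \<ge> 0) (at 0)\<close>
    have "eventually (\<lambda>t. (f1 t)\<^sup>2 \<le> 2 * f2 t ^ 2) (at 0)"
    proof eventually_elim
      case (elim t)
      have "f2 t ^ 3 \<le> f2 t ^ 2" using elim by (intro power_decreasing) auto
      then show ?case using elim(1) zero_le_power2[of "f2 t"] by linarith
    qed
    then have "fst w = 0" using F1 F2 w2 by (intro small_square_derivative_zero[OF F1, of f2 2]) auto
    then show False using w w2 by (simp add: prod_eq_iff)
  qed
qed

text \<open>Near the origin the deltoid germ is singular at the origin only, since
  \<open>2 X^2 + 3 X^3 + 2 Y^2 > 0\<close> at other points with \<open>X > - 1/3\<close>. For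
  \<open>c \<ge> 0\<close>, however, the singular set of \<open>G 0 0 c\<close> contains the arc
  \<open>x = y * sqrt (c + 3/2 * y)\<close>, \<open>y > 0\<close>, which ends at the origin.\<close>

lemma deltoid_pt_imp:
  assumes "deltoid_pt (G a b c) p"
  shows "p = (0, 0)" "a = 0" "b = 0" "c < 0"
proof -
  note eq = assms[unfolded deltoid_pt_def]
  note 0 = corank_two_at_origin[OF eq, unfolded frechet_deltoid_germ, simplified, folded zero_prod_def]
  show p0: "p = (0, 0)" and a0: "a = 0" and b0: "b = 0" using 0 by (simp_all add: zero_prod_def)
  obtain N N' \<sigma> \<sigma>' where d: "diffeo N N' \<sigma> \<sigma>'" "p \<in> N" "\<sigma> p = (0, 0)"
    "\<And>z v. z \<in> N' \<Longrightarrow> frechet_derivative deltoid_germ (at z) v = 0 \<longleftrightarrow>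
       frechet_derivative (G a b c) (at (\<sigma>' z)) (frechet_derivative \<sigma>' (at z) v) = 0"
    using A_equivalent_kernel[OF eq G_differentiable] by blast
  note d' = diffeo_sym[OF d(1)]
  show "c < 0"
  proof (rule ccontr)
    assume "\<not> c < 0"
    then have c: "c \<ge> 0" by simp
    define P where "P y = (y * sqrt (c + 3/2 * y), y)" for y :: real
    have "(P \<longlongrightarrow> (0 * sqrt (c + 3/2 * 0), 0)) (at_right 0)"
      unfolding P_def by (intro tendsto_intros)
    then have P: "(P \<longlongrightarrow> (0, 0)) (at_right 0)" by simp
    have "continuous_on N (\<lambda>z. fst (\<sigma> z))"
      using d(1) by (auto simp: diffeo_def homeomorphism_def intro: continuous_intros)
    then have "open (N \<inter> (\<lambda>z. fst (\<sigma> z)) -` {- 1/3<..<1/3})"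
      using diffeo_open(1)[OF d(1)] by (intro continuous_open_preimage) auto
    moreover have "(0, 0) \<in> N \<inter> (\<lambda>z. fst (\<sigma> z)) -` {- 1/3<..<1/3}" using d(2,3) p0 by simp
    ultimately have "eventually (\<lambda>y. P y \<in> N \<inter> (\<lambda>z. fst (\<sigma> z)) -` {- 1/3<..<1/3}) (at_right 0)"
      using topological_tendstoD[OF P] by blast
    moreover have "eventually (\<lambda>y. y > 0) (at_right (0::real))" by (rule eventually_at_right_less)
    ultimately have "eventually (\<lambda>y. P y \<in> N \<inter> (\<lambda>z. fst (\<sigma> z)) -` {- 1/3<..<1/3} \<and> y > 0) (at_right 0)"
      by (rule eventually_conj)
    then obtain y where y: "P y \<in> N" "fst (\<sigma> (P y)) \<in> {- 1/3<..<1/3}" "y > 0"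
      using eventually_happens'[OF trivial_limit_at_right_real] by blast
    define x where "x = y * sqrt (c + 3/2 * y)"
    have Py: "P y = (x, y)" by (simp add: P_def x_def)
    have x2: "x\<^sup>2 = y\<^sup>2 * (c + 3/2 * y)" using c y(3) by (simp add: x_def power_mult_distrib)
    have "frechet_derivative (G a b c) (at (x, y)) (x, - y) = 0"
    proof -
      have "2 * x * x + (3 * y\<^sup>2 + 2 * c * y) * - y = 0" using x2 by algebra
      then show ?thesis by (simp add: frechet_derivative_G a0 b0 zero_prod_def)
    qed
    define v where "v = frechet_derivative \<sigma> (at (P y)) (x, - y)"
    have v: "v \<noteq> 0" unfolding v_def
      by (rule diffeo_derivative_nonzero[OF d(1) y(1)]) (use y(3) in \<open>simp add: zero_prod_def\<close>)
    have z: "\<sigma> (P y) \<in> N'" "\<sigma>' (\<sigma> (P y)) = (x, y)" using diffeo_apply[OF d(1) y(1)] Py by auto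
    have "frechet_derivative \<sigma>' (at (\<sigma> (P y))) v = (x, - y)"
      unfolding v_def by (rule diffeo_derivative_inverse[OF d(1) y(1)])
    then have "frechet_derivative deltoid_germ (at (\<sigma> (P y))) v = 0"
      using d(4)[OF z(1)] z(2) \<open>frechet_derivative (G a b c) (at (x, y)) (x, - y) = 0\<close> by simp
    moreover obtain X Y h k where e: "\<sigma> (P y) = (X, Y)" "v = (h, k)" by fastforce
    ultimately have "(2 * X + 3 * X\<^sup>2) * h - 2 * Y * k = 0" "Y * h + X * k = 0"
      by (simp_all add: frechet_deltoid_germ zero_prod_def)
    then have "(2 * X\<^sup>2 + 3 * X^3 + 2 * Y\<^sup>2) * h = 0" "(2 * X\<^sup>2 + 3 * X^3 + 2 * Y\<^sup>2) * k = 0" by algebra+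
    then have s: "2 * X\<^sup>2 + 3 * X^3 + 2 * Y\<^sup>2 = 0" using v by (auto simp: e zero_prod_def)
    have "- 1/3 < X" using y(2) e by simp
    then have "X\<^sup>2 * (2 + 3 * X) \<ge> X\<^sup>2 * 1" by (intro mult_left_mono) auto
    moreover have "X\<^sup>2 * (2 + 3 * X) + 2 * Y\<^sup>2 = 0" using s by algebra
    ultimately have "X\<^sup>2 = 0" "Y\<^sup>2 = 0" using zero_le_power2[of X] zero_le_power2[of Y] by linarith+
    then have "\<sigma> (P y) = (0, 0)" using e by simp
    then have "\<sigma>' (\<sigma> (P y)) = (0, 0)" using diffeo_apply(2)[OF d(1,2)] d(3) p0 by simp
    then show False using z(2) y(3) by simp
  qed
qed

section \<open>Normal forms of the corank two germs\<close>

lemma diffeo_UNIVI: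
  assumes "smooth_on UNIV \<phi>" "smooth_on UNIV \<psi>" "\<And>x. \<psi> (\<phi> x) = x" "\<And>y. \<phi> (\<psi> y) = y"
  shows "diffeo UNIV UNIV \<phi> \<psi>"
proof -
  have "range \<phi> = UNIV" "range \<psi> = UNIV" using assms(3,4) by (metis surj_def)+
  then show ?thesis
    using assms smooth_on_imp_continuous_on[OF assms(1)] smooth_on_imp_continuous_on[OF assms(2)]
    by (simp add: diffeo_def homeomorphism_def)
qed

text \<open>Substituting \<open>x = \<beta> Y\<close>, \<open>y = c X\<close> gives
  \<open>x^2 + c y^2 + y^3 = \<beta>^2 Y^2 + c^3 (X^2 + X^3)\<close>. With
  \<open>\<beta>^2 = - c^3\<close>, which is possible for \<open>c < 0\<close>, this is
  \<open>- \<beta>^2\<close> times the first component of the deltoid.\<close>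

lemma deltoid_pt_G:
  assumes "c < 0"
  shows "deltoid_pt (G 0 0 c) (0, 0)"
proof -
  define \<beta> where "\<beta> = sqrt (- (c^3))"
  have b2: "\<beta>\<^sup>2 = - (c^3)" using assms by (simp add: \<beta>_def power_less_zero_eq less_imp_le)
  have b: "\<beta> \<noteq> 0" using assms by (simp add: \<beta>_def)
  have s: "diffeo UNIV UNIV (\<lambda>z. (snd z / c, fst z / \<beta>)) (\<lambda>z. (\<beta> * snd z, c * fst z))"
    using assms b by (intro diffeo_UNIVI smooth_intros open_UNIV) auto
  have t: "diffeo UNIV UNIV (\<lambda>z. (- fst z / \<beta>\<^sup>2, snd z / (c * \<beta>))) (\<lambda>z. (- \<beta>\<^sup>2 * fst z, c * \<beta> * snd z))"
    using assms b by (intro diffeo_UNIVI smooth_intros open_UNIV) auto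
  have e: "deltoid_germ z = (- fst (G 0 0 c (\<beta> * snd z, c * fst z)) / \<beta>\<^sup>2, snd (G 0 0 c (\<beta> * snd z, c * fst z)) / (c * \<beta>))" for z
  proof -
    obtain x y where z: "z = (x, y)" by (cases z)
    have "- ((\<beta> * y)\<^sup>2 + (c * x)^3 + c * (c * x)\<^sup>2) = (x\<^sup>2 - y\<^sup>2 + x^3) * \<beta>\<^sup>2" unfolding power_mult_distrib b2 by algebra
    then have "- ((\<beta> * y)\<^sup>2 + (c * x)^3 + c * (c * x)\<^sup>2) / \<beta>\<^sup>2 = x\<^sup>2 - y\<^sup>2 + x^3" using b by simp
    moreover have "\<beta> * y * (c * x) / (c * \<beta>) = x * y" using b assms by simp
    ultimately show ?thesis by (simp add: z G_def)
  qed
  show ?thesis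
    unfolding deltoid_pt_def A_equivalent_def
  proof (intro exI conjI ballI)
    show "(0, 0) \<in> (UNIV :: plane set)" "G 0 0 c ` UNIV \<subseteq> UNIV" by simp_all
    show "(snd (0 :: real, 0 :: real) / c, fst (0 :: real, 0 :: real) / \<beta>) = (0, 0)" by simp
    show "(- fst (G 0 0 c (0, 0)) / \<beta>\<^sup>2, snd (G 0 0 c (0, 0)) / (c * \<beta>)) = deltoid_germ (0, 0)" by (simp add: G_def)
  qed (rule s t e)+
qed

text \<open>The changes of coordinates are found on opposite sides of an equation
  \<open>f \<circ> h = T \<circ> g \<circ> \<sigma>\<close>, both sides being normalised on a common
  auxiliary source. The resulting change of source is \<open>\<sigma> \<circ> h'\<close>, that of
  the target \<open>T'\<close>.\<close>

lemma A_equivalent_localI: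
  assumes h: "diffeo M1 N1 h h'" "q \<in> M1" "h q = p" and \<sigma>: "diffeo M2 N2 \<sigma> \<sigma>'" "q \<in> M2"
    and T: "diffeo M3 N3 T T'"
    and eq: "\<And>z. z \<in> M1 \<Longrightarrow> z \<in> M2 \<Longrightarrow> g (\<sigma> z) \<in> M3 \<and> f (h z) = T (g (\<sigma> z))"
  shows "A_equivalent f p g (\<sigma> q)"
proof -
  define B where "B = M1 \<inter> M2"
  have B: "open B" "q \<in> B" "B \<subseteq> M1" "B \<subseteq> M2"
    using diffeo_open(1)[OF h(1)] diffeo_open(1)[OF \<sigma>(1)] h(2) \<sigma>(2) by (auto simp: B_def)
  have 1: "diffeo (h ` B) (\<sigma> ` B) (\<sigma> \<circ> h') (h \<circ> \<sigma>')"
    by (rule diffeo_compose[OF diffeo_sym[OF diffeo_subset[OF h(1) B(1,3)]] diffeo_subset[OF \<sigma>(1) B(1,4)]])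
  note 2 = diffeo_sym[OF T]
  have hh: "h' (h z) = z" "\<sigma>' (\<sigma> z) = z" "g (\<sigma> z) \<in> M3" "f (h z) = T (g (\<sigma> z))" if "z \<in> B" for z
  proof -
    have z: "z \<in> M1" "z \<in> M2" using that B by auto
    show "h' (h z) = z" "\<sigma>' (\<sigma> z) = z" "g (\<sigma> z) \<in> M3" "f (h z) = T (g (\<sigma> z))"
      using diffeo_apply(2)[OF h(1) z(1)] diffeo_apply(2)[OF \<sigma>(1) z(2)] eq[OF z] by auto
  qed
  show ?thesis
    unfolding A_equivalent_def
  proof (intro exI conjI ballI)
    show "diffeo (h ` B) (\<sigma> ` B) (\<sigma> \<circ> h') (h \<circ> \<sigma>')" by (rule 1)
    show "diffeo N3 M3 T' T" by (rule 2)
    show "p \<in> h ` B" using h(3) B(2) by blast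
    show "(\<sigma> \<circ> h') p = \<sigma> q" using hh(1)[OF B(2)] h(3) by simp
    show "f ` h ` B \<subseteq> N3"
    proof
      fix w assume "w \<in> f ` h ` B"
      then obtain z where "z \<in> B" "w = f (h z)" by blast
      then show "w \<in> N3" using hh(3,4)[of z] diffeo_apply(1)[OF T, of "g (\<sigma> z)"] by simp
    qed
    show "T' (f p) = g (\<sigma> q)" using hh[OF B(2)] h(3) diffeo_apply(2)[OF T] by metis
    fix z assume "z \<in> \<sigma> ` B"
    then obtain z0 where "z0 \<in> B" "z = \<sigma> z0" by blast
    then show "g z = T' (f ((h \<circ> \<sigma>') z))" using hh[of z0] diffeo_apply(2)[OF T] by simp
  qed
qed

text \<open>Off 0 the factor \<open>y\<close> can be cancelled, and continuity supplies the value at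
  0.\<close>

lemma continuous_cancel_factor:
  fixes f :: "real \<Rightarrow> 'b::real_normed_vector"
  assumes f: "continuous_on {-e<..<e} f" and z: "\<And>y. y \<in> {-e<..<e} \<Longrightarrow> y *\<^sub>R f y = 0" and y: "y \<in> {-e<..<e}"
  shows "f y = 0"
proof (cases "y = 0")
  case True
  have "isCont f 0" using f y True by (simp add: continuous_on_eq_continuous_at)
  then have "(f \<longlongrightarrow> f 0) (at 0)" by (simp add: isCont_def)
  moreover have "eventually (\<lambda>t. t \<in> {-e<..<e}) (at (0::real))"
    by (rule eventually_at_in_open') (use y True in auto)
  then have "eventually (\<lambda>t. f t = 0) (at 0)"
    using eventually_neq_at_within[of "0 :: real" 0 UNIV] by eventually_elim (use z in force)
  then have "(f \<longlongrightarrow> 0) (at 0)" by (simp add: tendsto_eventually)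
  ultimately show ?thesis using True LIM_unique by blast
next
  case False
  then show ?thesis using z[OF y] by simp
qed

lemma hadamard_division_fst:
  fixes f :: "real \<times> 'a::euclidean_space \<Rightarrow> 'b::euclidean_space"
  assumes "open A" "convex A" "smooth_on ({-e<..<e} \<times> A) f" "\<And>y. y \<in> A \<Longrightarrow> f (0, y) = 0"
  shows "\<exists>h. smooth_on ({-e<..<e} \<times> A) h \<and> (\<forall>x\<in>{-e<..<e}. \<forall>y\<in>A. f (x, y) = x *\<^sub>R h (x, y))"
proof -
  have o: "open (A \<times> {-e<..<e})" "open ({-e<..<e} \<times> A)" using assms(1) by (auto intro: open_Times)
  have S: "smooth_on (A \<times> {-e<..<e}) (\<lambda>z. f (snd z, fst z))"
    by (rule smooth_on_compose[OF o _ assms(3)]) (auto intro!: smooth_intros o)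
  have z: "f (snd (x, 0 :: real), fst (x, 0 :: real)) = 0" if "x \<in> A" for x using assms(4)[OF that] by simp
  obtain h where h: "smooth_on (A \<times> {-e<..<e}) h"
    "\<forall>x\<in>A. \<forall>y\<in>{-e<..<e}. f (snd (x, y), fst (x, y)) = y *\<^sub>R h (x, y)"
    using hadamard_division[OF assms(1,2) S z] by blast
  have "smooth_on ({-e<..<e} \<times> A) (\<lambda>z. h (snd z, fst z))"
    by (rule smooth_on_compose[OF o(2,1) _ h(1)]) (auto intro!: smooth_intros o)
  then show ?thesis using h(2) by (intro exI[of _ "\<lambda>z. h (snd z, fst z)"]) simp
qed

lemma smooth_on_slice:
  fixes f :: "real \<times> real \<Rightarrow> 'b::euclidean_space"
  assumes "smooth_on ({-e<..<e} \<times> {-e<..<e}) f" "e > 0"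
  shows "continuous_on {-e<..<e} (\<lambda>t. f (t, 0))" "continuous_on {-e<..<e} (\<lambda>t. f (0, t))"
  using assms(2) by (auto intro!: continuous_intros continuous_on_compose2[OF smooth_on_imp_continuous_on[OF assms(1)]])

text \<open>A map with the same critical set and the same restrictions to the critical branches as the sharksfin
  germ \<open>g\<close> differs from \<open>g\<close> by \<open>X Y (m, n)\<close>. The ansatz \<open>\<sigma> = id + X Y (p, q)\<close> turns \<open>g \<circ> \<sigma> = F\<close>
  into a system for \<open>(p, q)\<close> to which the implicit function theorem applies: vanishing of the Jacobian on
  the axes allows one to divide the two combinations decoupling it by \<open>X\<close> and by \<open>Y\<close>.\<close>

lemma sharksfin_source_change:
  fixes F :: "plane \<Rightarrow> plane"
  assumes O1: "open O1" "(0, 0) \<in> O1" and sF: "smooth_on O1 F"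
    and FX: "\<And>x. (x, 0) \<in> O1 \<Longrightarrow> F (x, 0) = (x\<^sup>2, x^3)" and FY: "\<And>y. (0, y) \<in> O1 \<Longrightarrow> F (0, y) = (y^3, y\<^sup>2)"
    and kX: "\<And>x. (x, 0) \<in> O1 \<Longrightarrow> \<exists>u. u \<noteq> 0 \<and> frechet_derivative F (at (x, 0)) u = 0"
    and kY: "\<And>y. (0, y) \<in> O1 \<Longrightarrow> \<exists>u. u \<noteq> 0 \<and> frechet_derivative F (at (0, y)) u = 0"
  obtains M M' \<sigma> \<sigma>' where "diffeo M M' \<sigma> \<sigma>'" "(0, 0) \<in> M" "M \<subseteq> O1" "\<sigma> (0, 0) = (0, 0)"
    "\<forall>z\<in>M. sharksfin_germ (\<sigma> z) = F z"
proof -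
  obtain e where e: "e > 0" "{-e<..<e} \<times> {-e<..<e} \<subseteq> O1"
  proof -
    obtain r where r: "r > 0" "ball (0, 0) r \<subseteq> O1" using O1 open_contains_ball by blast
    have "{-(r/2)<..<r/2} \<times> {-(r/2)<..<r/2} \<subseteq> O1"
    proof
      fix z assume z: "z \<in> {-(r/2)<..<r/2} \<times> {-(r/2)<..<r/2}"
      obtain x y where xy: "z = (x, y)" by (cases z)
      have "norm (x, y) \<le> norm x + norm y" by (rule norm_Pair_le)
      also have "\<dots> < r" using z by (auto simp: xy abs_if)
      finally have "z \<in> ball (0, 0) r" by (simp only: zero_prod_def[symmetric] mem_ball_0 xy)
      then show "z \<in> O1" using r(2) by blast
    qed
    then show thesis using that[of "r / 2"] r(1) by simp
  qed
  let ?I = "{-e<..<e}"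
  let ?Q = "?I \<times> ?I"
  have I: "open ?I" "convex ?I" "0 \<in> ?I" and Q: "open ?Q" using e(1) by (auto intro: open_Times)
  have sQ: "smooth_on ?Q F" by (rule smooth_on_subset[OF sF e(2)])
  \<comment> \<open>The difference to the sharksfin germ vanishes on both axes, so it can be divided
    by \<open>y\<close> and then by \<open>x\<close>; the quotient \<open>E\<close> has the
    components \<open>m\<close> and \<open>n\<close>.\<close>
  define D where "D z = F z - (fst z ^ 2 + snd z ^ 3, snd z ^ 2 + fst z ^ 3)" for z
  have D: "smooth_on ?Q D" unfolding D_def by (intro smooth_intros Q sQ)
  have inO: "(x, y) \<in> O1" if "x \<in> ?I" "y \<in> ?I" for x y using e(2) that by blast
  have Dz: "D (x, 0) = 0" if "x \<in> ?I" for x using FX[OF inO[OF that I(3)]] by (simp add: D_def zero_prod_def)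
  obtain D1 where D1: "smooth_on ?Q D1" "\<forall>x\<in>?I. \<forall>y\<in>?I. D (x, y) = y *\<^sub>R D1 (x, y)"
    using hadamard_division[OF I(1,2) D Dz] by blast
  have D10: "D1 (0, y) = 0" if "y \<in> ?I" for y
  proof (rule continuous_cancel_factor[OF smooth_on_slice(2)[OF D1(1) e(1)] _ that])
    show "y *\<^sub>R D1 (0, y) = 0" if "y \<in> ?I" for y
      using bspec[OF bspec[OF D1(2) I(3)] that] FY[OF inO[OF I(3) that]] by (simp add: D_def zero_prod_def)
  qed
  obtain E where E: "smooth_on ?Q E" "\<forall>x\<in>?I. \<forall>y\<in>?I. D1 (x, y) = x *\<^sub>R E (x, y)"
    using hadamard_division_fst[OF I(1,2) D1(1) D10] by blast
  define m where "m z = fst (E z)" for z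
  define n where "n z = snd (E z)" for z
  have m: "smooth_on ?Q m" and n: "smooth_on ?Q n" unfolding m_def n_def by (intro smooth_intros Q E(1))+
  have FE: "F (x, y) = (x\<^sup>2 + y^3 + x * y * m (x, y), y\<^sup>2 + x^3 + x * y * n (x, y))" if "x \<in> ?I" "y \<in> ?I" for x y
  proof -
    have "D (x, y) = (x * y) *\<^sub>R E (x, y)" using bspec[OF bspec[OF D1(2) that(1)] that(2)] bspec[OF bspec[OF E(2) that(1)] that(2)] by (simp add: mult.commute)
    then have "F (x, y) = (x\<^sup>2 + y^3, y\<^sup>2 + x^3) + (x * y) *\<^sub>R E (x, y)" by (simp add: D_def algebra_simps)
    then show ?thesis by (cases "E (x, y)") (simp add: m_def n_def)
  qed
  have DF: "frechet_derivative F (at (x, y)) v =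
      (2 * x * fst v + 3 * y\<^sup>2 * snd v + (x * snd v + y * fst v) * m (x, y),
       2 * y * snd v + 3 * x\<^sup>2 * fst v + (x * snd v + y * fst v) * n (x, y))"
    if xy: "x \<in> ?I" "y \<in> ?I" "x * y = 0" for x y v
  proof -
    have q: "(x, y) \<in> ?Q" using xy by simp
    note dm = smooth_on_imp_has_derivative[OF m q] and dn = smooth_on_imp_has_derivative[OF n q]
    have "((\<lambda>z. (fst z ^ 2 + snd z ^ 3 + fst z * snd z * m z, snd z ^ 2 + fst z ^ 3 + fst z * snd z * n z)) has_derivative
      (\<lambda>v. (2 * x * fst v + 3 * y\<^sup>2 * snd v + (x * snd v + y * fst v) * m (x, y),
       2 * y * snd v + 3 * x\<^sup>2 * fst v + (x * snd v + y * fst v) * n (x, y)))) (at (x, y))"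
      by (rule has_derivative_eq_rhs, (rule derivative_intros dm dn refl)+)
        (use xy(3) in \<open>auto simp: fun_eq_iff algebra_simps\<close>)
    then have "(F has_derivative
      (\<lambda>v. (2 * x * fst v + 3 * y\<^sup>2 * snd v + (x * snd v + y * fst v) * m (x, y),
       2 * y * snd v + 3 * x\<^sup>2 * fst v + (x * snd v + y * fst v) * n (x, y)))) (at (x, y))"
      by (rule has_derivative_transform_within_open[OF _ Q q]) (use FE in auto)
    from frechet_derivative_eqI[OF this] show ?thesis by simp
  qed
  \<comment> \<open>After cancelling \<open>x\<close>, a kernel vector at \<open>(x, 0)\<close>
    makes the rows \<open>(2, m)\<close> and \<open>(3 * x, n)\<close> dependent; this is their
    determinant.\<close>
  have cX: "2 * n (x, 0) - 3 * x * m (x, 0) = 0" if x: "x \<in> ?I" for x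
  proof (rule continuous_cancel_factor[OF _ _ x])
    show "continuous_on ?I (\<lambda>x. 2 * n (x, 0) - 3 * x * m (x, 0))"
      by (intro continuous_intros smooth_on_slice[OF m e(1)] smooth_on_slice[OF n e(1)])
    fix x assume x: "x \<in> ?I"
    obtain u where u: "u \<noteq> 0" "frechet_derivative F (at (x, 0)) u = 0" using kX[OF inO[OF x I(3)]] by blast
    obtain h k where hk: "u = (h, k)" by (cases u)
    have hk0: "x * (2 * h + k * m (x, 0)) = 0" "x * (3 * x * h + k * n (x, 0)) = 0"
      using u(2) DF[OF x I(3), of u] by (simp_all add: hk zero_prod_def algebra_simps power2_eq_square)
    show "x *\<^sub>R (2 * n (x, 0) - 3 * x * m (x, 0)) = 0"
    proof (cases "x = 0")
      case False
      then have 1: "2 * h + k * m (x, 0) = 0" "3 * x * h + k * n (x, 0) = 0"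
        using hk0 by simp_all
      then have "k * (2 * n (x, 0) - 3 * x * m (x, 0)) = 0" by algebra
      moreover have "k \<noteq> 0" using 1 u(1) by (auto simp: hk zero_prod_def)
      ultimately show ?thesis by simp
    qed simp
  qed
  have cY: "2 * m (0, y) - 3 * y * n (0, y) = 0" if y: "y \<in> ?I" for y
  proof (rule continuous_cancel_factor[OF _ _ y])
    show "continuous_on ?I (\<lambda>y. 2 * m (0, y) - 3 * y * n (0, y))"
      by (intro continuous_intros smooth_on_slice[OF m e(1)] smooth_on_slice[OF n e(1)])
    fix y assume y: "y \<in> ?I"
    obtain u where u: "u \<noteq> 0" "frechet_derivative F (at (0, y)) u = 0" using kY[OF inO[OF I(3) y]] by blast
    obtain h k where hk: "u = (h, k)" by (cases u)
    have hk0: "y * (2 * k + h * n (0, y)) = 0" "y * (3 * y * k + h * m (0, y)) = 0"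
      using u(2) DF[OF I(3) y, of u] by (simp_all add: hk zero_prod_def algebra_simps power2_eq_square)
    show "y *\<^sub>R (2 * m (0, y) - 3 * y * n (0, y)) = 0"
    proof (cases "y = 0")
      case False
      then have 1: "2 * k + h * n (0, y) = 0" "3 * y * k + h * m (0, y) = 0"
        using hk0 by simp_all
      then have "h * (2 * m (0, y) - 3 * y * n (0, y)) = 0" by algebra
      moreover have "h \<noteq> 0" using 1 u(1) by (auto simp: hk zero_prod_def)
      ultimately show ?thesis by simp
    qed simp
  qed
  have sP: "smooth_on ?Q (\<lambda>z. m z - 3/2 * snd z * n z)" "smooth_on ?Q (\<lambda>z. n z - 3/2 * fst z * m z)"
    by (intro smooth_intros Q m n)+
  have z0: "m (0, y) - 3/2 * snd (0 :: real, y) * n (0, y) = 0" if "y \<in> ?I" for y using cY[OF that] by simp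
  have z1: "n (x, 0) - 3/2 * fst (x, 0 :: real) * m (x, 0) = 0" if "x \<in> ?I" for x using cX[OF that] by simp
  obtain P where P0: "smooth_on ?Q P"
    "\<forall>x\<in>?I. \<forall>y\<in>?I. m (x, y) - 3/2 * snd (x, y) * n (x, y) = x *\<^sub>R P (x, y)"
    using hadamard_division_fst[OF I(1,2) sP(1) z0] by blast
  obtain R where R0: "smooth_on ?Q R"
    "\<forall>x\<in>?I. \<forall>y\<in>?I. n (x, y) - 3/2 * fst (x, y) * m (x, y) = y *\<^sub>R R (x, y)"
    using hadamard_division[OF I(1,2) sP(2) z1] by blast
  note P = P0[unfolded fst_conv snd_conv real_scaleR_def] and R = R0[unfolded fst_conv snd_conv real_scaleR_def]
  \<comment> \<open>With the ansatz for \<open>\<sigma>\<close>, equating components and cancelling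
    \<open>x * y\<close> leaves \<open>u = 0\<close> and \<open>w = 0\<close> for the
    \<open>u\<close>, \<open>w\<close> defined below. In \<open>u - 3/2 * y * w\<close> the term
    \<open>3 * y^2 * q\<close> cancels, so that it becomes \<open>x\<close> times
    \<open>K x y p q - P\<close>. Exchanging the variables gives the second equation, with
    \<open>R\<close>.\<close>
  define K where "K x y p q = 2 * p + y * p\<^sup>2 + 3/2 * y\<^sup>2 * q\<^sup>2 + x * y\<^sup>2 * q^3 - 9/2 * x * y * p
    - 9/2 * x * y\<^sup>2 * p\<^sup>2 - 3/2 * x * y^3 * p^3" for x y p q :: real
  \<comment> \<open>Carrying \<open>(x, y)\<close> along turns the implicit system into the
    inversion of a map of four variables; its derivative at \<open>z0\<close> is triangular with
    diagonal entries 1, 1, 2, 2.\<close>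
  define \<Phi> where "\<Phi> z = (fst z, fst (snd z),
      K (fst z) (fst (snd z)) (fst (snd (snd z))) (snd (snd (snd z))) - P (fst z, fst (snd z)),
      K (fst (snd z)) (fst z) (snd (snd (snd z))) (fst (snd (snd z))) - R (fst z, fst (snd z)))"
    for z :: "real \<times> real \<times> real \<times> real"
  define W where "W = ?I \<times> ?I \<times> (UNIV :: real set) \<times> (UNIV :: real set)"
  have W: "open W" unfolding W_def by (intro open_Times open_greaterThanLessThan open_UNIV)
  have sW: "smooth_on W \<Phi>"
    unfolding \<Phi>_def K_def
    by (intro smooth_intros W smooth_on_compose[OF W Q _ P(1)] smooth_on_compose[OF W Q _ R(1)])
      (auto simp: W_def)
  define z0 where "z0 = (0 :: real, 0 :: real, P (0, 0) / 2, R (0, 0) / 2)"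
  have z0: "z0 \<in> W" using e(1) by (simp add: z0_def W_def)
  have q0: "(0, 0) \<in> ?Q" using e(1) by simp
  obtain M N g where g: "diffeo M N \<Phi> g" "z0 \<in> M" "M \<subseteq> W"
  proof (rule smooth_inverse_function[OF W sW z0])
    fix v assume v: "frechet_derivative \<Phi> (at z0) v = 0"
    let ?P' = "frechet_derivative P (at (0, 0))" and ?R' = "frechet_derivative R (at (0, 0))"
    have dP: "((\<lambda>z :: real \<times> real \<times> real \<times> real. P (fst z, fst (snd z))) has_derivative (\<lambda>v. ?P' (fst v, fst (snd v)))) (at z0)"
      by (rule has_derivative_compose[where g = P and f = "\<lambda>z. (fst z, fst (snd z))"])
        (use smooth_on_imp_has_derivative[OF P(1) q0] in \<open>auto intro!: derivative_eq_intros simp: z0_def\<close>)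
    have dR: "((\<lambda>z :: real \<times> real \<times> real \<times> real. R (fst z, fst (snd z))) has_derivative (\<lambda>v. ?R' (fst v, fst (snd v)))) (at z0)"
      by (rule has_derivative_compose[where g = R and f = "\<lambda>z. (fst z, fst (snd z))"])
        (use smooth_on_imp_has_derivative[OF R(1) q0] in \<open>auto intro!: derivative_eq_intros simp: z0_def\<close>)
    have "\<exists>a b. (\<Phi> has_derivative (\<lambda>v. (fst v, fst (snd v),
        2 * fst (snd (snd v)) + a * fst (snd v) - ?P' (fst v, fst (snd v)),
        2 * snd (snd (snd v)) + b * fst v - ?R' (fst v, fst (snd v))))) (at z0)"
      unfolding \<Phi>_def K_def
      by (intro exI, rule has_derivative_eq_rhs, (rule derivative_intros dP dR refl)+)
        (auto simp: fun_eq_iff z0_def mult.commute)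
    then obtain a b where "(\<Phi> has_derivative (\<lambda>v. (fst v, fst (snd v),
        2 * fst (snd (snd v)) + a * fst (snd v) - ?P' (fst v, fst (snd v)),
        2 * snd (snd (snd v)) + b * fst v - ?R' (fst v, fst (snd v))))) (at z0)" by blast
    from frechet_derivative_eqI[OF this] v
    have "(fst v, fst (snd v), 2 * fst (snd (snd v)) + a * fst (snd v) - ?P' (fst v, fst (snd v)),
        2 * snd (snd (snd v)) + b * fst v - ?R' (fst v, fst (snd v))) = (0, 0, 0, 0)"
      by (simp only: zero_prod_def)
    then have 1: "fst v = 0" "fst (snd v) = 0" "2 * fst (snd (snd v)) + a * fst (snd v) - ?P' (fst v, fst (snd v)) = 0"
      "2 * snd (snd (snd v)) + b * fst v - ?R' (fst v, fst (snd v)) = 0" unfolding prod.inject by blast+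
    have "?P' (0, 0) = 0" "?R' (0, 0) = 0"
      using linear_0[OF has_derivative_linear[OF smooth_on_imp_has_derivative[OF P(1) q0]]]
        linear_0[OF has_derivative_linear[OF smooth_on_imp_has_derivative[OF R(1) q0]]]
      by (simp_all add: zero_prod_def)
    then show "v = 0" using 1 by (simp add: prod_eq_iff)
  qed
  \<comment> \<open>The bound \<open>1/3\<close> keeps \<open>1 - 9/4 * x * y\<close> away from 0,
    so that \<open>u = 3/2 * y * w\<close> and \<open>w = 3/2 * x * u\<close> leave only
    \<open>u = w = 0\<close>.\<close>
  define L where "L = (\<lambda>z :: plane. (fst z, snd z, 0 :: real, 0 :: real)) -` N \<inter> ({-1/3<..<1/3} \<times> {-1/3<..<1/3}) \<inter> ?Q"
  have cL: "continuous_on UNIV (\<lambda>z :: plane. (fst z, snd z, 0 :: real, 0 :: real))" by (intro continuous_intros)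
  have L: "open L"
    unfolding L_def by (intro open_Int open_vimage[OF _ cL] diffeo_open(2)[OF g(1)] Q open_Times open_greaterThanLessThan)
  have \<Phi>0: "\<Phi> z0 = (0, 0, 0, 0)" by (simp add: \<Phi>_def z0_def K_def)
  have L0: "(0, 0) \<in> L" using diffeo_apply(1)[OF g(1,2)] e(1) by (simp add: L_def \<Phi>0)
  define G4 where "G4 z = g (fst z, snd z, 0, 0)" for z :: plane
  have sG4: "smooth_on L G4"
    unfolding G4_def
  proof (rule smooth_on_compose[OF L diffeo_open(2)[OF g(1)], where f = "\<lambda>z. (fst z, snd z, 0, 0)"])
    show "smooth_on L (\<lambda>z. (fst z, snd z, 0, 0))" by (intro smooth_intros L)
    show "smooth_on N g" using g(1) by (simp add: diffeo_def)
  qed (auto simp: L_def)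
  define p where "p z = fst (snd (snd (G4 z)))" for z
  define q where "q z = snd (snd (snd (G4 z)))" for z
  have pq: "K x y (p (x, y)) (q (x, y)) = P (x, y)" "K y x (q (x, y)) (p (x, y)) = R (x, y)"
    if "(x, y) \<in> L" for x y
  proof -
    have "(x, y, 0, 0) \<in> N" using that by (simp add: L_def)
    from diffeo_apply(2)[OF diffeo_sym[OF g(1)] this]
    have e: "\<Phi> (G4 (x, y)) = (x, y, 0, 0)" by (simp add: G4_def)
    then have "fst (G4 (x, y)) = x" "fst (snd (G4 (x, y))) = y" by (simp_all add: \<Phi>_def)
    then show "K x y (p (x, y)) (q (x, y)) = P (x, y)" "K y x (q (x, y)) (p (x, y)) = R (x, y)"
      using e by (simp_all add: \<Phi>_def p_def q_def)
  qed
  define \<sigma> where "\<sigma> z = (fst z + fst z * snd z * p z, snd z + fst z * snd z * q z)" for z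
  have sp: "smooth_on L p" "smooth_on L q" unfolding p_def q_def by (intro smooth_intros L sG4)+
  have s\<sigma>: "smooth_on L \<sigma>" unfolding \<sigma>_def by (intro smooth_intros L sp)
  have key: "sharksfin_germ (\<sigma> z) = F z" if z: "z \<in> L" for z
  proof -
    obtain x y where xy: "z = (x, y)" by (cases z)
    have I': "x \<in> ?I" "y \<in> ?I" and sm: "\<bar>x\<bar> < 1/3" "\<bar>y\<bar> < 1/3" using z by (auto simp: L_def xy)
    define A where "A = p (x, y)"
    define B where "B = q (x, y)"
    define u where "u = 2 * x * A + x * y * A\<^sup>2 + 3 * y\<^sup>2 * B + 3 * x * y\<^sup>2 * B\<^sup>2 + x\<^sup>2 * y\<^sup>2 * B^3 - m (x, y)"
    define w where "w = 2 * y * B + x * y * B\<^sup>2 + 3 * x\<^sup>2 * A + 3 * x\<^sup>2 * y * A\<^sup>2 + x\<^sup>2 * y\<^sup>2 * A^3 - n (x, y)"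
    have k: "K x y A B = P (x, y)" "K y x B A = R (x, y)" using pq z by (simp_all add: xy A_def B_def)
    have "x * K x y A B = m (x, y) - 3/2 * y * n (x, y)" "y * K y x B A = n (x, y) - 3/2 * x * m (x, y)"
      unfolding k using bspec[OF bspec[OF P(2) I'(1)] I'(2)] bspec[OF bspec[OF R(2) I'(1)] I'(2)] by simp_all
    then have uw: "u = 3/2 * y * w" "w = 3/2 * x * u" unfolding u_def w_def K_def by algebra+
    then have "u * (1 - 9/4 * (x * y)) = 0" by algebra
    moreover have "\<bar>x * y\<bar> \<le> 1/3 * (1/3)" unfolding abs_mult using sm by (intro mult_mono) auto
    then have "1 - 9/4 * (x * y) \<noteq> 0" by (auto simp: abs_le_iff)
    ultimately have "u = 0" by simp
    then have "w = 0" using uw(2) by simp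
    have "(x + x * y * A)\<^sup>2 + (y + x * y * B)^3 = x\<^sup>2 + y^3 + x * y * m (x, y) + x * y * u"
      "(y + x * y * B)\<^sup>2 + (x + x * y * A)^3 = y\<^sup>2 + x^3 + x * y * n (x, y) + x * y * w"
      unfolding u_def w_def by algebra+
    then show ?thesis using FE[OF I'] \<open>u = 0\<close> \<open>w = 0\<close> by (simp add: \<sigma>_def xy A_def B_def)
  qed
  note dp = smooth_on_imp_has_derivative[OF sp(1) L0] and dq = smooth_on_imp_has_derivative[OF sp(2) L0]
  have "(\<sigma> has_derivative (\<lambda>v. v)) (at (0, 0))"
    unfolding \<sigma>_def
    by (rule has_derivative_eq_rhs, (rule derivative_intros dp dq refl)+) (auto simp: fun_eq_iff)
  from frechet_derivative_eqI[OF this]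
  obtain M' N' \<sigma>' where "diffeo M' N' \<sigma> \<sigma>'" "(0, 0) \<in> M'" "M' \<subseteq> L"
    by (rule_tac smooth_inverse_function[OF L s\<sigma> L0]) auto
  moreover have "L \<subseteq> O1" using e(2) by (auto simp: L_def)
  moreover have "\<sigma> (0, 0) = (0, 0)" by (simp add: \<sigma>_def)
  ultimately show thesis using key that by blast
qed

section \<open>The standard swallowtail\<close>

definition standard_swallowtail :: "space set" where
  "standard_swallowtail = {(3 * u^4 + u\<^sup>2 * v, 4 * u^3 + 2 * u * v, v) | u v. True}"

text \<open>The swallowtail is the set of quartics \<open>t\<^sup>4 + z t\<^sup>2 - y t + x\<close> having a real double root.\<close>

lemma standard_swallowtail_iff:
  "(x, y, z) \<in> standard_swallowtail \<longleftrightarrow>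
    (\<exists>u. u^4 + z * u\<^sup>2 - y * u + x = 0 \<and> 4 * u^3 + 2 * z * u - y = 0)"
proof
  assume "(x, y, z) \<in> standard_swallowtail"
  then obtain u where u: "x = 3 * u^4 + u\<^sup>2 * z" "y = 4 * u^3 + 2 * u * z" by (auto simp: standard_swallowtail_def)
  have "u^4 + z * u\<^sup>2 - y * u + x = 0 \<and> 4 * u^3 + 2 * z * u - y = 0" unfolding u by (rule conjI; algebra)
  then show "\<exists>u. u^4 + z * u\<^sup>2 - y * u + x = 0 \<and> 4 * u^3 + 2 * z * u - y = 0" by blast
next
  assume "\<exists>u. u^4 + z * u\<^sup>2 - y * u + x = 0 \<and> 4 * u^3 + 2 * z * u - y = 0"
  then obtain u where u: "u^4 + z * u\<^sup>2 - y * u + x = 0" "4 * u^3 + 2 * z * u - y = 0" by blast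
  then have "y = 4 * u^3 + 2 * u * z" "x = 3 * u^4 + u\<^sup>2 * z" by algebra+
  then show "(x, y, z) \<in> standard_swallowtail" by (auto simp: standard_swallowtail_def)
qed

lemma germ_diffeomorphicI:
  assumes "diffeo M N \<psi> g" "0 \<in> M" "\<psi> 0 = p" "\<forall>y\<in>M. \<psi> y \<in> S \<longleftrightarrow> y \<in> T"
  shows "germ_diffeomorphic S p T 0"
proof -
  have "g ` (S \<inter> N) = T \<inter> M"
  proof (intro equalityI subsetI)
    fix y assume "y \<in> g ` (S \<inter> N)"
    then obtain w where w: "w \<in> S" "w \<in> N" "y = g w" by blast
    have gw: "g w \<in> M" "\<psi> (g w) = w" using diffeo_apply[OF diffeo_sym[OF assms(1)] w(2)] by blast+
    have "g w \<in> T" using bspec[OF assms(4) gw(1)] gw(2) w(1) by simp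
    then show "y \<in> T \<inter> M" using gw(1) w(3) by simp
  next
    fix y assume "y \<in> T \<inter> M"
    then have "\<psi> y \<in> S \<inter> N" "g (\<psi> y) = y" using diffeo_apply[OF assms(1), of y] assms(4) by blast+
    then show "y \<in> g ` (S \<inter> N)" by (rule rev_image_eqI[OF _ sym])
  qed
  moreover have "p \<in> N" "g p = 0" using diffeo_apply[OF assms(1,2)] assms(3) by auto
  ultimately show ?thesis unfolding germ_diffeomorphic_def using diffeo_sym[OF assms(1)] by blast
qed

lemma germ_diffeomorphic_mem:
  assumes "germ_diffeomorphic S p T q" "q \<in> T"
  shows "p \<in> S"
proof -
  obtain W W' \<phi> \<psi> where d: "diffeo W W' \<phi> \<psi>" "p \<in> W" "\<phi> p = q" "\<phi> ` (S \<inter> W) = T \<inter> W'"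
    using assms(1) unfolding germ_diffeomorphic_def by blast
  then have "q \<in> \<phi> ` (S \<inter> W)" using diffeo_apply(1)[OF d(1,2)] assms(2) by blast
  then obtain p' where p': "p' \<in> S" "p' \<in> W" "\<phi> p' = \<phi> p" using d(3) by auto
  then have "p' = p" using diffeo_apply(2)[OF d(1,2)] diffeo_apply(2)[OF d(1) p'(2)] by simp
  then show ?thesis using p' by simp
qed

lemma cuspidal_edge_subset: "p \<in> cuspidal_edge S \<Longrightarrow> p \<in> S"
proof -
  have "(0 :: space) \<in> standard_cuspidal_edge"
    unfolding standard_cuspidal_edge_def zero_prod_def by force
  then show "p \<in> cuspidal_edge S \<Longrightarrow> p \<in> S"
    unfolding cuspidal_edge_iff using germ_diffeomorphic_mem by blast
qed

lemma double_point_curve_subset: "p \<in> double_point_curve S \<Longrightarrow> p \<in> S"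
  unfolding double_point_curve_def mem_Collect_eq
  by (erule germ_diffeomorphic_mem) (simp add: zero_prod_def)

text \<open>At this point the quartic is \<open>(t - u)^3 (t + 3 u)\<close>. Nearby quartics split
  off a simple root \<open>r\<close> close to \<open>- 3 u\<close>, and the remaining cubic is
  \<open>s^3 - 3 P s + 2 Q\<close> in the variable \<open>s = t + r / 3\<close>. While
  \<open>r\<close> is no root of the cubic, a double root of the quartic is one of the cubic, and
  the cubic has the double root \<open>T\<close> iff \<open>P = T^2\<close> and
  \<open>Q = T^3\<close>.\<close>

lemma standard_swallowtail_cuspidal_edge:
  assumes u: "u \<noteq> 0"
  shows "(- 3 * u^4, - 8 * u^3, - 6 * u\<^sup>2) \<in> cuspidal_edge standard_swallowtail"
proof -
  define r where "r w = - 3 * u + snd (snd w)" for w :: space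
  \<comment> \<open>\<open>b\<close> and \<open>c\<close> are the lower coefficients of the cubic
    \<open>t^3 + r t^2 + b t + c\<close>; its second coefficient is \<open>r\<close> because the
    quartic has no cubic term.\<close>
  define b where "b w = r w ^ 2 / 3 - 3 * fst w" for w :: space
  define c where "c w = r w ^ 3 / 27 - fst w * r w + 2 * fst (snd w)" for w :: space
  define \<psi> where "\<psi> w = (- r w * c w, r w * b w - c w, b w - r w ^ 2)" for w
  have s\<psi>: "smooth_on S \<psi>" if "open S" for S
    unfolding \<psi>_def b_def c_def r_def by (intro smooth_intros that) auto
  \<comment> \<open>The cubic does not vanish at \<open>t = r\<close>, where
    \<open>t + r / 3 = 4/3 * r\<close>.\<close>
  define S where "S = {w :: space. (4/3 * r w)^3 - 3 * fst w * (4/3 * r w) + 2 * fst (snd w) \<noteq> 0}"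
  have S: "open S" unfolding S_def r_def by (intro open_Collect_neq continuous_intros)
  have S0: "0 \<in> S" using u by (simp add: S_def r_def)
  have d: "(\<psi> has_derivative (\<lambda>v. (4 * u^3 * snd (snd v) + 9 * u\<^sup>2 * fst v + 6 * u * fst (snd v),
      8 * u\<^sup>2 * snd (snd v) + 6 * u * fst v - 2 * fst (snd v), 4 * u * snd (snd v) - 3 * fst v))) (at 0)"
    unfolding \<psi>_def b_def c_def r_def
    by (auto intro!: derivative_eq_intros simp: fun_eq_iff power2_eq_square power3_eq_cube field_simps)
  obtain M N g where g: "diffeo M N \<psi> g" "0 \<in> M" "M \<subseteq> S"
  proof (rule smooth_inverse_function[OF S s\<psi>[OF S] S0])
    fix v assume "frechet_derivative \<psi> (at 0) v = 0"
    then have e: "4 * u^3 * snd (snd v) + 9 * u\<^sup>2 * fst v + 6 * u * fst (snd v) = 0"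
      "8 * u\<^sup>2 * snd (snd v) + 6 * u * fst v - 2 * fst (snd v) = 0" "4 * u * snd (snd v) - 3 * fst v = 0"
      unfolding frechet_derivative_eqI[OF d] by (simp_all add: zero_prod_def)
    obtain P Q Z where v: "v = (P, Q, Z)" by (cases v)
    have "64 * u^3 * Z = 0" using e unfolding v fst_conv snd_conv by algebra
    then have Z: "Z = 0" using u by simp
    then have "P = 0" using e(3) unfolding v by simp
    then have "Q = 0" using e(2) Z unfolding v by simp
    then show "v = 0" using v Z \<open>P = 0\<close> by (simp add: zero_prod_def)
  qed
  have "germ_diffeomorphic standard_swallowtail (- 3 * u^4, - 8 * u^3, - 6 * u\<^sup>2) standard_cuspidal_edge 0"
  proof (rule germ_diffeomorphicI[OF g(1,2)])
    show "\<psi> 0 = (- 3 * u^4, - 8 * u^3, - 6 * u\<^sup>2)"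
      by (simp add: \<psi>_def b_def c_def r_def field_simps power2_eq_square power3_eq_cube power4_eq_xxxx)
    show "\<forall>w\<in>M. \<psi> w \<in> standard_swallowtail \<longleftrightarrow> w \<in> standard_cuspidal_edge"
    proof
      fix w assume "w \<in> M"
      obtain P Q Z where w: "w = (P, Q, Z)" by (cases w)
      obtain R where R: "R = r w" by blast
      have n: "(4/3 * R)^3 - 3 * P * (4/3 * R) + 2 * Q \<noteq> 0" using \<open>w \<in> M\<close> g(3) by (auto simp: S_def w R)
      have q: "t^4 + (b w - (r w)\<^sup>2) * t\<^sup>2 - (r w * b w - c w) * t + (- r w * c w) =
          (t - R) * ((t + R/3)^3 - 3 * P * (t + R/3) + 2 * Q)"
        "4 * t^3 + 2 * (b w - (r w)\<^sup>2) * t - (r w * b w - c w) =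
          ((t + R/3)^3 - 3 * P * (t + R/3) + 2 * Q) + (t - R) * (3 * (t + R/3)\<^sup>2 - 3 * P)" for t
        unfolding b_def c_def R[symmetric] by (simp_all add: w field_simps power2_eq_square power3_eq_cube power4_eq_xxxx)
      have "w \<in> standard_cuspidal_edge \<longleftrightarrow> (\<exists>T. P = T\<^sup>2 \<and> Q = T^3)"
        by (auto simp: standard_cuspidal_edge_def w)
      also have "\<dots> \<longleftrightarrow> \<psi> w \<in> standard_swallowtail"
        unfolding \<psi>_def standard_swallowtail_iff q
      proof
        assume "\<exists>T. P = T\<^sup>2 \<and> Q = T^3"
        then obtain T where T: "P = T\<^sup>2" "Q = T^3" by blast
        have "(T - R/3 + R/3)^3 - 3 * P * (T - R/3 + R/3) + 2 * Q = 0" "3 * (T - R/3 + R/3)\<^sup>2 - 3 * P = 0"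
          unfolding T by (simp_all add: power2_eq_square power3_eq_cube)
        then show "\<exists>u. (u - R) * ((u + R/3)^3 - 3 * P * (u + R/3) + 2 * Q) = 0 \<and>
            (u + R/3)^3 - 3 * P * (u + R/3) + 2 * Q + (u - R) * (3 * (u + R/3)\<^sup>2 - 3 * P) = 0"
          by (intro exI[of _ "T - R/3"]) simp
      next
        assume "\<exists>u. (u - R) * ((u + R/3)^3 - 3 * P * (u + R/3) + 2 * Q) = 0 \<and>
            (u + R/3)^3 - 3 * P * (u + R/3) + 2 * Q + (u - R) * (3 * (u + R/3)\<^sup>2 - 3 * P) = 0"
        then obtain t where t: "(t - R) * ((t + R/3)^3 - 3 * P * (t + R/3) + 2 * Q) = 0"
            "(t + R/3)^3 - 3 * P * (t + R/3) + 2 * Q + (t - R) * (3 * (t + R/3)\<^sup>2 - 3 * P) = 0" by blast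
        have tR: "t - R \<noteq> 0"
        proof
          assume "t - R = 0"
          then have "t + R/3 = 4/3 * R" by simp
          then have "(4/3 * R)^3 - 3 * P * (4/3 * R) + 2 * Q = 0" using t(2) \<open>t - R = 0\<close> by simp
          then show False using n by contradiction
        qed
        then have 1: "(t + R/3)^3 - 3 * P * (t + R/3) + 2 * Q = 0" using t(1) by simp
        then have 2: "P = (t + R/3)\<^sup>2" using t(2) tR by simp
        have "Q = (t + R/3)^3" using 1 unfolding 2 by (simp add: power2_eq_square power3_eq_cube)
        then show "\<exists>T. P = T\<^sup>2 \<and> Q = T^3" using 2 by blast
      qed
      finally show "\<psi> w \<in> standard_swallowtail \<longleftrightarrow> w \<in> standard_cuspidal_edge" by blast
    qed
  qed
  then show ?thesis by (simp only: cuspidal_edge_iff)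
qed

text \<open>Nearby quartics are \<open>((t + r)^2 - X) ((t - r)^2 - Y)\<close>, with double roots
  \<open>- r\<close> and \<open>r\<close> for \<open>X = Y = 0\<close>. While \<open>X\<close> and
  \<open>Y\<close> are below \<open>r^2\<close> the two factors have no common root, so a double
  root requires \<open>X = 0\<close> or \<open>Y = 0\<close>.\<close>

lemma standard_swallowtail_double_point:
  assumes p: "p > 0"
  shows "(p^4, 0, - 2 * p\<^sup>2) \<in> double_point_curve standard_swallowtail"
proof -
  define r where "r w = p + snd (snd w)" for w :: space
  define \<psi> where "\<psi> w = ((r w ^ 2 - fst w) * (r w ^ 2 - fst (snd w)), 2 * r w * (fst (snd w) - fst w),
    - 2 * r w ^ 2 - fst w - fst (snd w))" for w
  have s\<psi>: "smooth_on S \<psi>" if "open S" for S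
    unfolding \<psi>_def r_def by (intro smooth_intros that)
  define S where "S = {w :: space. r w > 0 \<and> fst w < r w ^ 2 \<and> fst (snd w) < r w ^ 2}"
  have S: "open S" unfolding S_def r_def by (intro open_Collect_conj open_Collect_less continuous_intros)
  have S0: "0 \<in> S" using p by (simp add: S_def r_def)
  have d: "(\<psi> has_derivative (\<lambda>v. (4 * p^3 * snd (snd v) - p\<^sup>2 * fst v - p\<^sup>2 * fst (snd v),
      2 * p * (fst (snd v) - fst v), - 4 * p * snd (snd v) - fst v - fst (snd v)))) (at 0)"
    unfolding \<psi>_def r_def
    by (auto intro!: derivative_eq_intros simp: fun_eq_iff power2_eq_square power3_eq_cube field_simps)
  obtain M N g where g: "diffeo M N \<psi> g" "0 \<in> M" "M \<subseteq> S"
  proof (rule smooth_inverse_function[OF S s\<psi>[OF S] S0])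
    fix v assume "frechet_derivative \<psi> (at 0) v = 0"
    then have e: "4 * p^3 * snd (snd v) - p\<^sup>2 * fst v - p\<^sup>2 * fst (snd v) = 0"
      "p * (fst (snd v) - fst v) = 0" "- 4 * p * snd (snd v) - fst v - fst (snd v) = 0"
      unfolding frechet_derivative_eqI[OF d] by (simp_all add: zero_prod_def)
    obtain P Q Z where v: "v = (P, Q, Z)" by (cases v)
    have "8 * p^3 * Z = 0" using e unfolding v fst_conv snd_conv by algebra
    then have Z: "Z = 0" using p by simp
    then have "P = 0" "Q = 0" using e(2,3) p unfolding v by auto
    then show "v = 0" using v Z by (simp add: zero_prod_def)
  qed
  show ?thesis
    unfolding double_point_curve_def mem_Collect_eq
  proof (rule germ_diffeomorphicI[OF g(1,2)])
    show "\<psi> 0 = (p^4, 0, - 2 * p\<^sup>2)" by (simp add: \<psi>_def r_def)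
    show "\<forall>w\<in>M. \<psi> w \<in> standard_swallowtail \<longleftrightarrow> w \<in> {(x, y, z). x * y = 0}"
    proof
      fix w assume "w \<in> M"
      obtain X Y Z where w: "w = (X, Y, Z)" by (cases w)
      obtain R where R: "R = r w" by blast
      have n: "R > 0" "X < R\<^sup>2" "Y < R\<^sup>2" using \<open>w \<in> M\<close> g(3) by (auto simp: S_def w R)
      have q: "t^4 + (- 2 * (r w)\<^sup>2 - fst w - fst (snd w)) * t\<^sup>2 - 2 * r w * (fst (snd w) - fst w) * t
          + ((r w)\<^sup>2 - fst w) * ((r w)\<^sup>2 - fst (snd w)) = ((t + R)\<^sup>2 - X) * ((t - R)\<^sup>2 - Y)"
        "4 * t^3 + 2 * (- 2 * (r w)\<^sup>2 - fst w - fst (snd w)) * t - 2 * r w * (fst (snd w) - fst w) =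
          2 * (t + R) * ((t - R)\<^sup>2 - Y) + ((t + R)\<^sup>2 - X) * (2 * (t - R))" for t
        unfolding R[symmetric] unfolding w fst_conv snd_conv by algebra+
      have "\<psi> w \<in> standard_swallowtail \<longleftrightarrow> X = 0 \<or> Y = 0"
        unfolding \<psi>_def standard_swallowtail_iff q
      proof
        assume "\<exists>u. ((u + R)\<^sup>2 - X) * ((u - R)\<^sup>2 - Y) = 0 \<and>
            2 * (u + R) * ((u - R)\<^sup>2 - Y) + ((u + R)\<^sup>2 - X) * (2 * (u - R)) = 0"
        then obtain t where t: "((t + R)\<^sup>2 - X) * ((t - R)\<^sup>2 - Y) = 0"
            "2 * (t + R) * ((t - R)\<^sup>2 - Y) + ((t + R)\<^sup>2 - X) * (2 * (t - R)) = 0" by blast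
        have "\<not> ((t + R)\<^sup>2 - X = 0 \<and> (t - R)\<^sup>2 - Y = 0)"
        proof
          assume "(t + R)\<^sup>2 - X = 0 \<and> (t - R)\<^sup>2 - Y = 0"
          then have "(t + R)\<^sup>2 < R\<^sup>2" "(t - R)\<^sup>2 < R\<^sup>2" using n by auto
          then have "t * (t + 2 * R) < 0" "t * (t - 2 * R) < 0" by (simp_all add: power2_eq_square algebra_simps)
          then have "t * (t + 2 * R) + t * (t - 2 * R) < 0" by simp
          moreover have "t * (t + 2 * R) + t * (t - 2 * R) = 2 * t\<^sup>2" by (simp add: algebra_simps power2_eq_square)
          moreover have "t\<^sup>2 \<ge> 0" by simp
          ultimately show False by linarith
        qed
        then consider "(t + R)\<^sup>2 - X = 0" "(t - R)\<^sup>2 - Y \<noteq> 0" | "(t - R)\<^sup>2 - Y = 0" "(t + R)\<^sup>2 - X \<noteq> 0" using t(1) by auto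
        then show "X = 0 \<or> Y = 0" using t(2) by cases auto
      next
        assume "X = 0 \<or> Y = 0"
        then show "\<exists>u. ((u + R)\<^sup>2 - X) * ((u - R)\<^sup>2 - Y) = 0 \<and>
            2 * (u + R) * ((u - R)\<^sup>2 - Y) + ((u + R)\<^sup>2 - X) * (2 * (u - R)) = 0"
        proof
          assume "X = 0"
          then show ?thesis by (intro exI[of _ "- R"]) simp
        next
          assume "Y = 0"
          then show ?thesis by (intro exI[of _ R]) simp
        qed
      qed
      then show "\<psi> w \<in> standard_swallowtail \<longleftrightarrow> w \<in> {(x, y, z). x * y = 0}" by (simp add: w)
    qed
  qed
qed

section \<open>Velocities in the standard swallowtail\<close>

lemma curve_inI:
  assumes "\<gamma> 0 = p" "(\<gamma> has_derivative (\<lambda>t. t *\<^sub>R w)) (at 0)" "\<And>t. \<gamma> t \<in> S"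
  shows "curve_in S p w"
  unfolding curve_in_def using assms by (intro exI[of _ \<gamma>]) simp

abbreviation "swallowtail_map u v \<equiv> (3 * u^4 + u\<^sup>2 * v, 4 * u^3 + 2 * u * v, v) :: space"

lemma swallowtail_map_curves:
  "curve_in standard_swallowtail (swallowtail_map u v) (2 * u * (6 * u\<^sup>2 + v), 2 * (6 * u\<^sup>2 + v), 0)"
  "curve_in standard_swallowtail (swallowtail_map u v) (u\<^sup>2, 2 * u, 1)"
proof -
  have m: "swallowtail_map u v \<in> standard_swallowtail" for u v
    unfolding standard_swallowtail_def by blast
  show "curve_in standard_swallowtail (swallowtail_map u v) (2 * u * (6 * u\<^sup>2 + v), 2 * (6 * u\<^sup>2 + v), 0)"
  proof (rule curve_inI[of "\<lambda>t. swallowtail_map (u + t) v"])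
    show "((\<lambda>t. swallowtail_map (u + t) v) has_derivative
        (\<lambda>t. t *\<^sub>R (2 * u * (6 * u\<^sup>2 + v), 2 * (6 * u\<^sup>2 + v), 0))) (at 0)"
      by (auto intro!: derivative_eq_intros simp: fun_eq_iff algebra_simps power2_eq_square power3_eq_cube)
  qed (simp, rule m)
  show "curve_in standard_swallowtail (swallowtail_map u v) (u\<^sup>2, 2 * u, 1)"
  proof (rule curve_inI[of "\<lambda>t. swallowtail_map u (v + t)"])
    show "((\<lambda>t. swallowtail_map u (v + t)) has_derivative (\<lambda>t. t *\<^sub>R (u\<^sup>2, 2 * u, 1))) (at 0)"
      by (auto intro!: derivative_eq_intros simp: fun_eq_iff algebra_simps)
  qed (simp, rule m)
qed

text \<open>On the section \<open>v = 0\<close> the second coordinate \<open>4 u^3\<close> is taken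
  as time. The first coordinate is then \<open>3/4 * t\<close> times the cube root
  \<open>c t\<close>, which is continuous and vanishes at 0, so its derivative is 0.\<close>

lemma swallowtail_origin_curve: "curve_in standard_swallowtail 0 (0, 1, 0)"
proof -
  define c where "c t = root 3 (t / 4)" for t
  have c3: "c t ^ 3 = t / 4" for t by (simp add: c_def odd_real_root_pow)
  let ?\<gamma> = "\<lambda>t. swallowtail_map (c t) 0"
  show ?thesis
  proof (rule curve_inI[of ?\<gamma>])
    show "?\<gamma> 0 = 0" by (simp add: c_def zero_prod_def)
    show "?\<gamma> t \<in> standard_swallowtail" for t unfolding standard_swallowtail_def by blast
    have "c t ^ 4 = c t ^ 3 * c t" for t by (simp add: power4_eq_xxxx power3_eq_cube)
    then have e: "?\<gamma> t = (3/4 * (t * c t), t, 0)" for t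
      using c3[of t] by simp
    have "isCont c 0" unfolding c_def by (intro continuous_intros) auto
    then have "((\<lambda>t. t *\<^sub>R c t) has_derivative (\<lambda>h. h *\<^sub>R c 0)) (at 0)"
      by (intro has_derivative_vanishing_scaleR has_derivative_ident) auto
    then have dc: "((\<lambda>t. t * c t) has_derivative (\<lambda>h. 0)) (at 0)" by (simp add: c_def)
    have "((\<lambda>t. (3/4 * (t * c t), t, 0 :: real)) has_derivative (\<lambda>h. (3/4 * 0, h, 0))) (at 0)"
      by (intro has_derivative_Pair has_derivative_mult_right dc has_derivative_ident has_derivative_const)
    then show "(?\<gamma> has_derivative (\<lambda>t. t *\<^sub>R (0, 1, 0))) (at 0)"
      unfolding e by simp
  qed
qed

text \<open>For \<open>v \<noteq> - 6 u^2\<close> the partial derivatives of the parametrization are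
  independent velocities, and at the origin \<open>(0, 0, 1)\<close> and \<open>(0, 1, 0)\<close>
  are.\<close>

lemma standard_swallowtail_cuspidal_edgeD:
  assumes "p \<in> cuspidal_edge standard_swallowtail"
  shows "\<exists>u. u \<noteq> 0 \<and> p = (- 3 * u^4, - 8 * u^3, - 6 * u\<^sup>2)"
proof -
  obtain u v where p: "p = swallowtail_map u v"
    using cuspidal_edge_subset[OF assms] by (auto simp: standard_swallowtail_def)
  note dep = curves_in_cuspidal_edge_dependent[OF assms]
  obtain r s where rs: "(r, s) \<noteq> (0, 0)" "r *\<^sub>R (2 * u * (6 * u\<^sup>2 + v), 2 * (6 * u\<^sup>2 + v), 0) + s *\<^sub>R (u\<^sup>2, 2 * u, 1) = (0 :: space)"
    using dep[OF swallowtail_map_curves[of u v, folded p]] by (elim exE conjE) (rule that)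
  have s: "s = 0" "r * (12 * u\<^sup>2 + 2 * v) + s * (2 * u) = 0" using rs(2) by (auto simp: zero_prod_def)
  have "r \<noteq> 0" using rs(1) s(1) by auto
  then have v: "v = - 6 * u\<^sup>2" using s by auto
  have "u \<noteq> 0"
  proof
    assume "u = 0"
    then have p0: "p = 0" using p v by (simp add: zero_prod_def)
    have "swallowtail_map 0 0 = 0" by (simp add: zero_prod_def)
    then have c: "curve_in standard_swallowtail p (0\<^sup>2, 2 * 0, 1)" "curve_in standard_swallowtail p (0, 1, 0)"
      using swallowtail_map_curves(2)[of 0 0] swallowtail_origin_curve unfolding p0 by simp_all
    then obtain r s where "(r, s) \<noteq> (0 :: real, 0 :: real)" "r *\<^sub>R (0\<^sup>2, 2 * 0, 1) + s *\<^sub>R (0, 1, 0) = (0 :: space)"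
      using dep[OF c] by (elim exE conjE) (rule that)
    then show False by (simp add: zero_prod_def)
  qed
  then show ?thesis using p v by (intro exI[of _ u]) (simp add: algebra_simps power2_eq_square power3_eq_cube power4_eq_xxxx)
qed

lemma closed_if_closed_Int_cball:
  fixes S :: "'a::euclidean_space set"
  assumes "\<And>R. closed (S \<inter> cball 0 R)"
  shows "closed S"
  unfolding closed_sequential_limits
proof (intro allI impI, elim conjE)
  fix f l assume f: "\<forall>n. f n \<in> S" "f \<longlonglongrightarrow> l"
  then obtain R where "\<And>n. norm (f n) \<le> R" using convergent_imp_Bseq[of f] by (auto simp: convergent_def Bseq_def)
  then have "\<forall>n. f n \<in> S \<inter> cball 0 R" using f(1) by simp
  then show "l \<in> S" using assms[of R] f(2) unfolding closed_sequential_limits by blast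
qed

text \<open>The parametrization is proper, as \<open>3 u^4\<close> dominates \<open>u^2 v\<close>
  for large \<open>u\<close>; this makes the image closed.\<close>

lemma swallowtail_map_bound:
  assumes "norm (swallowtail_map u v) \<le> R"
  shows "\<bar>v\<bar> \<le> R" "\<bar>u\<bar> \<le> R + 1"
proof -
  have 1: "norm (3 * u^4 + u\<^sup>2 * v) \<le> R" "norm v \<le> R"
    using order_trans[OF norm_fst_le assms] order_trans[OF norm_snd_le order_trans[OF norm_snd_le assms]] by simp_all
  then show v: "\<bar>v\<bar> \<le> R" by simp
  show "\<bar>u\<bar> \<le> R + 1"
  proof (rule ccontr)
    assume "\<not> \<bar>u\<bar> \<le> R + 1"
    then have u: "\<bar>u\<bar> > R + 1" by simp
    have R: "R \<ge> 0" using v by simp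
    have u2: "u\<^sup>2 \<ge> R + 1"
    proof -
      have "(R + 1) * 1 \<le> \<bar>u\<bar> * \<bar>u\<bar>" using u R by (intro mult_mono) auto
      then show ?thesis by (simp add: power2_eq_square abs_mult_self_eq)
    qed
    have "u\<^sup>2 * v \<ge> - (u\<^sup>2 * R)"
    proof -
      have "u\<^sup>2 * (- v) \<le> u\<^sup>2 * R" using v by (intro mult_left_mono) auto
      then show ?thesis by simp
    qed
    moreover have "u^4 \<ge> u\<^sup>2 * (R + 1)"
      using mult_left_mono[OF u2, of "u\<^sup>2"] by (simp add: power2_eq_square power4_eq_xxxx mult.assoc)
    moreover have "3 * u^4 + u\<^sup>2 * v \<le> R" using 1(1) by simp
    moreover have "0 \<le> u^4" by simp
    moreover have "u\<^sup>2 * (R + 1) = u\<^sup>2 * R + u\<^sup>2" by algebra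
    ultimately show False using u2 R by linarith
  qed
qed

lemma continuous_on_swallowtail_map: "continuous_on A (\<lambda>(u, v). swallowtail_map u v)"
  unfolding case_prod_beta by (intro continuous_intros)

lemma closed_standard_swallowtail: "closed standard_swallowtail"
proof (rule closed_if_closed_Int_cball)
  fix R :: real
  let ?K = "{- (R + 1)..R + 1} \<times> {- R..R}"
  have "compact ((\<lambda>(u, v). swallowtail_map u v) ` ?K)"
    by (intro compact_continuous_image continuous_on_swallowtail_map compact_Times compact_Icc)
  then have "closed ((\<lambda>(u, v). swallowtail_map u v) ` ?K \<inter> cball 0 R)"
    by (intro closed_Int compact_imp_closed closed_cball)
  moreover have "standard_swallowtail \<inter> cball 0 R = (\<lambda>(u, v). swallowtail_map u v) ` ?K \<inter> cball 0 R"
  proof (intro equalityI subsetI)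
    fix w assume w: "w \<in> standard_swallowtail \<inter> cball 0 R"
    then obtain u v where uv: "w = swallowtail_map u v" by (auto simp: standard_swallowtail_def)
    then have "norm (swallowtail_map u v) \<le> R" using w by simp
    from swallowtail_map_bound[OF this] have "(u, v) \<in> ?K" by (auto simp: abs_le_iff)
    then show "w \<in> (\<lambda>(u, v). swallowtail_map u v) ` ?K \<inter> cball 0 R" using uv w by (auto intro!: image_eqI[of _ _ "(u, v)"])
  qed (auto simp: standard_swallowtail_def)
  ultimately show "closed (standard_swallowtail \<inter> cball 0 R)" by simp
qed

text \<open>At a point with a unique double root \<open>u\<close>, where the quartic is \<open>(t - u)\<^sup>2\<close> times a non-vanishing
  quadratic, the value of the quartic at \<open>u\<close> is an affine function with a local extremum on the surface.\<close>

lemma swallowtail_extremum: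
  assumes n: "6 * u\<^sup>2 + v \<noteq> 0" "v \<noteq> - 2 * u\<^sup>2" and c: "curve_in standard_swallowtail (swallowtail_map u v) (w1, w2, w3)"
  shows "w1 - u * w2 + u\<^sup>2 * w3 = 0"
proof -
  let ?P = "\<lambda>(u, v). swallowtail_map u v"
  \<comment> \<open>The quartic with double root \<open>s\<close> and last coordinate
    \<open>t\<close> has the value \<open>(u - s)^2 (u^2 + 2 u s + t + 3 s^2)\<close> at
    \<open>u\<close>. The factor \<open>6 u^2 + v\<close> normalises the sign, making
    \<open>h\<close> positive at \<open>(u, v)\<close>.\<close>
  define h where "h = (\<lambda>(s, t). (u\<^sup>2 + 2 * u * s + t + 3 * s\<^sup>2) * (6 * u\<^sup>2 + v) :: real)"
  define R where "R = norm (swallowtail_map u v) + 1"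
  \<comment> \<open>The parameters with the wrong sign. The image of this compact set is closed, and
    it misses the point, whose only other possible parameter \<open>s = - u\<close> would need
    \<open>v = - 2 u^2\<close>.\<close>
  define K where "K = {z. h z \<le> 0} \<inter> ({- (R + 1)..R + 1} \<times> {- R..R})"
  have "continuous_on UNIV h" unfolding h_def case_prod_beta by (intro continuous_intros)
  then have "closed {z. h z \<le> 0}" by (intro closed_Collect_le continuous_on_const)
  then have "compact K" unfolding K_def by (intro closed_Int_compact compact_Times compact_Icc)
  then have "closed (?P ` K)" by (intro compact_imp_closed compact_continuous_image continuous_on_swallowtail_map)
  moreover have "swallowtail_map u v \<notin> ?P ` K"
  proof
    assume "swallowtail_map u v \<in> ?P ` K"
    then obtain s where s: "(s, v) \<in> K" "3 * u^4 + u\<^sup>2 * v = 3 * s^4 + s\<^sup>2 * v" "4 * u^3 + 2 * u * v = 4 * s^3 + 2 * s * v" by auto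
    have "h (u, v) = (6 * u\<^sup>2 + v)\<^sup>2" unfolding h_def prod.case by algebra
    then have "h (u, v) > 0" using n(1) by simp
    then have su: "s - u \<noteq> 0" using s(1) by (auto simp: K_def)
    have "(s - u) * (2 * (s\<^sup>2 + s * u + u\<^sup>2) + v) = 0" using s(3) by algebra
    then have v: "v = - 2 * (s\<^sup>2 + s * u + u\<^sup>2)" using su by simp
    have "(s - u)^3 * (s + u) = 0" using s(2) unfolding v by algebra
    then have "s = - u" using su by simp
    then have "v = - 2 * u\<^sup>2" using v by (simp add: power2_eq_square)
    then show False using n(2) by contradiction
  qed
  ultimately have op: "open (- (?P ` K) \<inter> ball 0 R)" "swallowtail_map u v \<in> - (?P ` K) \<inter> ball 0 R"
    by (auto simp: open_Compl R_def)
  obtain \<gamma> where \<gamma>: "\<gamma> 0 = swallowtail_map u v" "(\<gamma> has_derivative (\<lambda>t. t *\<^sub>R (w1, w2, w3))) (at 0)"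
    "eventually (\<lambda>t. \<gamma> t \<in> standard_swallowtail) (at (0 :: real))" using c unfolding curve_in_def by blast
  have "isCont \<gamma> 0" using \<gamma>(2) by (rule has_derivative_continuous)
  then have "\<gamma> \<midarrow>0\<rightarrow> swallowtail_map u v" using \<gamma>(1) by (simp add: isCont_def)
  from topological_tendstoD[OF this op]
  have ev: "eventually (\<lambda>t. \<gamma> t \<in> - (?P ` K) \<inter> ball 0 R) (at 0)" .
  define f where "f t = (6 * u\<^sup>2 + v) * (u^4 + snd (snd (\<gamma> t)) * u\<^sup>2 - fst (snd (\<gamma> t)) * u + fst (\<gamma> t))" for t
  have "(f has_derivative (\<lambda>t. t * ((6 * u\<^sup>2 + v) * (w1 - u * w2 + u\<^sup>2 * w3)))) (at 0)"
    unfolding f_def using \<gamma>(2) by (auto intro!: derivative_eq_intros simp: algebra_simps)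
  moreover have "f 0 = 0"
  proof -
    have "u^4 + v * u\<^sup>2 - (4 * u^3 + 2 * u * v) * u + (3 * u^4 + u\<^sup>2 * v) = 0" by algebra
    then show ?thesis by (simp add: f_def \<gamma>(1))
  qed
  moreover have "eventually (\<lambda>t. f t \<ge> 0) (at 0)"
    using \<gamma>(3) ev
  proof eventually_elim
    case (elim t)
    then obtain s z where sz: "\<gamma> t = swallowtail_map s z" by (auto simp: standard_swallowtail_def)
    have "norm (swallowtail_map s z) \<le> R" using elim(2) sz by simp
    from swallowtail_map_bound[OF this] have "(s, z) \<in> {- (R + 1)..R + 1} \<times> {- R..R}" by (auto simp: abs_le_iff)
    then have "\<not> h (s, z) \<le> 0" using elim(2) sz by (auto simp: K_def)
    moreover have "f t = (u - s)\<^sup>2 * h (s, z)" unfolding f_def sz h_def fst_conv snd_conv prod.case by algebra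
    ultimately show ?case by simp
  qed
  ultimately have "(6 * u\<^sup>2 + v) * (w1 - u * w2 + u\<^sup>2 * w3) = 0" by (rule nonneg_derivative_zero)
  then show ?thesis using n(1) by simp
qed

text \<open>A double root \<open>U t\<close> of the quartic of \<open>\<gamma> t\<close> tends to 0,
  and the first coordinate is \<open>3/4 * U t\<close> times the second minus
  \<open>1/2 * (U t)^2\<close> times the third. Hence it is small compared with
  \<open>t\<close>.\<close>

lemma swallowtail_origin_plane:
  assumes "curve_in standard_swallowtail 0 (w1, w2, w3)"
  shows "w1 = 0"
proof -
  obtain \<gamma> where \<gamma>: "\<gamma> 0 = 0" "(\<gamma> has_derivative (\<lambda>t. t *\<^sub>R (w1, w2, w3))) (at 0)"
    "eventually (\<lambda>t. \<gamma> t \<in> standard_swallowtail) (at (0 :: real))" using assms unfolding curve_in_def by blast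
  have D: "((\<lambda>t. L (\<gamma> t) / t) \<longlongrightarrow> L (w1, w2, w3)) (at 0)" if "bounded_linear L" for L :: "space \<Rightarrow> real"
  proof -
    interpret bounded_linear L by fact
    have "((\<lambda>t. L (\<gamma> t)) has_derivative (\<lambda>t. t * L (w1, w2, w3))) (at 0)"
      using has_derivative[OF \<gamma>(2)] by (simp only: scaleR) simp
    from has_derivative_times_imp_DERIV[OF this] show ?thesis using \<gamma>(1) by (simp add: DERIV_def zero)
  qed
  have D1: "((\<lambda>t. fst (\<gamma> t) / t) \<longlongrightarrow> w1) (at 0)" using D[OF bounded_linear_fst] by simp
  have D2: "((\<lambda>t. fst (snd (\<gamma> t)) / t) \<longlongrightarrow> w2) (at 0)"
    using D[OF bounded_linear_compose[OF bounded_linear_fst bounded_linear_snd]] by simp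
  have D3: "((\<lambda>t. snd (snd (\<gamma> t)) / t) \<longlongrightarrow> w3) (at 0)"
    using D[OF bounded_linear_compose[OF bounded_linear_snd bounded_linear_snd]] by simp
  define U where "U t = (SOME u. \<gamma> t = swallowtail_map u (snd (snd (\<gamma> t))))" for t
  have ev: "eventually (\<lambda>t. \<gamma> t = swallowtail_map (U t) (snd (snd (\<gamma> t)))) (at 0)"
    using \<gamma>(3)
  proof eventually_elim
    case (elim t)
    then have "\<exists>u. \<gamma> t = swallowtail_map u (snd (snd (\<gamma> t)))" by (auto simp: standard_swallowtail_def)
    then show ?case unfolding U_def by (rule someI_ex)
  qed
  have "isCont \<gamma> 0" using \<gamma>(2) by (rule has_derivative_continuous)
  then have g0: "\<gamma> \<midarrow>0\<rightarrow> 0" using \<gamma>(1) by (simp add: isCont_def)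
  have f0: "((\<lambda>t. fst (\<gamma> t)) \<longlongrightarrow> 0) (at 0)" "((\<lambda>t. snd (snd (\<gamma> t))) \<longlongrightarrow> 0) (at 0)"
    using tendsto_fst[OF g0] tendsto_snd[OF tendsto_snd[OF g0]] by simp_all
  have U0: "((\<lambda>t. U t) \<longlongrightarrow> 0) (at 0)"
  proof (rule tendstoI)
    fix e :: real assume e: "e > 0"
    have "eventually (\<lambda>t. \<bar>fst (\<gamma> t)\<bar> < e^4) (at 0)" "eventually (\<lambda>t. \<bar>snd (snd (\<gamma> t))\<bar> < e\<^sup>2) (at 0)"
      using tendstoD[OF f0(1), of "e^4"] tendstoD[OF f0(2), of "e\<^sup>2"] e by simp_all
    with ev show "eventually (\<lambda>t. dist (U t) 0 < e) (at 0)"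
    proof eventually_elim
      case (elim t)
      obtain u z where uz: "u = U t" "z = snd (snd (\<gamma> t))" by blast
      have x: "fst (\<gamma> t) = 3 * u^4 + u\<^sup>2 * z" using arg_cong[OF elim(1), of fst] by (simp add: uz)
      show ?case
      proof (rule ccontr)
        assume "\<not> dist (U t) 0 < e"
        then have "e \<le> \<bar>u\<bar>" by (simp add: uz)
        then have u2: "e\<^sup>2 \<le> u\<^sup>2" using e power_mono[of e "\<bar>u\<bar>" 2] by simp
        have "- (u\<^sup>2 * e\<^sup>2) \<le> u\<^sup>2 * z"
        proof -
          have "u\<^sup>2 * (- z) \<le> u\<^sup>2 * e\<^sup>2" using elim(3) uz by (intro mult_left_mono) auto
          then show ?thesis by simp
        qed
        moreover have "u\<^sup>2 * e\<^sup>2 \<le> u^4" using mult_left_mono[OF u2, of "u\<^sup>2"] by (simp add: power2_eq_square power4_eq_xxxx mult.assoc)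
        moreover have "e^4 \<le> u^4" using power_mono[OF u2, of 2] by (simp add: power_mult[symmetric])
        moreover have "3 * u^4 + u\<^sup>2 * z < e^4" using elim(2) x by simp
        moreover have "0 < e^4" using e by simp
        ultimately show False by linarith
      qed
    qed
  qed
  have "((\<lambda>t. 3/4 * U t * (fst (snd (\<gamma> t)) / t) - 1/2 * (U t)\<^sup>2 * (snd (snd (\<gamma> t)) / t)) \<longlongrightarrow>
      3/4 * 0 * w2 - 1/2 * 0\<^sup>2 * w3) (at 0)"
    by (intro tendsto_intros U0 D2 D3)
  moreover have "eventually (\<lambda>t. fst (\<gamma> t) / t = 3/4 * U t * (fst (snd (\<gamma> t)) / t) - 1/2 * (U t)\<^sup>2 * (snd (snd (\<gamma> t)) / t)) (at 0)"
    using ev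
  proof eventually_elim
    case (elim t)
    obtain u z where uz: "u = U t" "z = snd (snd (\<gamma> t))" by blast
    have x: "fst (\<gamma> t) = 3 * u^4 + u\<^sup>2 * z" and y: "fst (snd (\<gamma> t)) = 4 * u^3 + 2 * u * z"
      using arg_cong[OF elim, of fst] arg_cong[OF elim, of "\<lambda>w. fst (snd w)"] by (simp_all add: uz)
    have "3 * u^4 + u\<^sup>2 * z = 3/4 * u * (4 * u^3 + 2 * u * z) - 1/2 * u\<^sup>2 * z" by (simp add: field_simps power2_eq_square power3_eq_cube power4_eq_xxxx)
    then show ?case unfolding x y uz[symmetric] by (simp add: diff_divide_distrib)
  qed
  ultimately have "((\<lambda>t. fst (\<gamma> t) / t) \<longlongrightarrow> 0) (at 0)" by (simp add: tendsto_cong)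
  then show ?thesis using D1 LIM_unique by blast
qed

text \<open>At all other points the velocities satisfy one equation
  \<open>w1 - s * w2 + s^2 * w3 = 0\<close>, contrary to the spanning velocities of a crossing: by
  the extremum property at general points, by the single direction of the cuspidal edge for
  \<open>v = - 6 u^2\<close>, \<open>u \<noteq> 0\<close>, and with \<open>s = 0\<close> at the
  origin.\<close>

lemma standard_swallowtail_double_pointD:
  assumes "p \<in> double_point_curve standard_swallowtail"
  shows "\<exists>u>0. p = (u^4, 0, - 2 * u\<^sup>2)"
proof -
  let ?S = "standard_swallowtail"
  obtain u v where p: "p = swallowtail_map u v"
    using double_point_curve_subset[OF assms] by (auto simp: standard_swallowtail_def)
  obtain v1 v2 v3 where c: "curve_in ?S p v1" "curve_in ?S p v2" "curve_in ?S p v3"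
    and ind: "\<And>L :: space \<Rightarrow> real. linear L \<Longrightarrow> L v1 = 0 \<Longrightarrow> L v2 = 0 \<Longrightarrow> L v3 = 0 \<Longrightarrow> L = (\<lambda>x. 0)"
    using double_point_curve_curves[OF assms] by blast
  have not_plane: False if L: "\<And>w1 w2 w3. curve_in ?S p (w1, w2, w3) \<Longrightarrow> w1 - s * w2 + s\<^sup>2 * w3 = 0" for s
  proof -
    let ?L = "\<lambda>w :: space. fst w - s * fst (snd w) + s\<^sup>2 * snd (snd w)"
    have l: "linear ?L" by (rule linearI) (simp_all add: algebra_simps)
    have z: "?L w = 0" if "curve_in ?S p w" for w using L[of "fst w" "fst (snd w)" "snd (snd w)"] that by simp
    have "?L = (\<lambda>x. 0)" by (rule ind[OF l z[OF c(1)] z[OF c(2)] z[OF c(3)]])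
    then have "?L (1, 0, 0) = 0" by (rule fun_cong)
    then show False by simp
  qed
  have uv: "v = - 2 * u\<^sup>2"
  proof (rule ccontr)
    assume n: "v \<noteq> - 2 * u\<^sup>2"
    show False
    proof (cases "6 * u\<^sup>2 + v = 0")
      case False
      show False by (rule not_plane[of u]) (use swallowtail_extremum[OF False n] p in blast)
    next
      case True
      then have v: "v = - 6 * u\<^sup>2" by simp
      show False
      proof (cases "u = 0")
        case True
        then have "p = 0" using p v by (simp add: zero_prod_def)
        then show False using not_plane[of 0] swallowtail_origin_plane by simp
      next
        case False
        have eq: "swallowtail_map u v = (- 3 * u^4, - 8 * u^3, - 6 * u\<^sup>2)" unfolding v by (simp add: algebra_simps power2_eq_square power3_eq_cube power4_eq_xxxx)
        have ce: "p \<in> cuspidal_edge ?S" unfolding p eq by (rule standard_swallowtail_cuspidal_edge[OF False])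
        obtain a where a: "\<And>w. curve_in ?S p w \<Longrightarrow> \<exists>k. w = k *\<^sub>R (u\<^sup>2, 2 * u, 1)"
        proof -
          have "\<exists>k. w = k *\<^sub>R (u\<^sup>2, 2 * u, 1)" if cw: "curve_in ?S p w" for w
          proof -
            obtain r s where rs: "(r, s) \<noteq> (0, 0)" "r *\<^sub>R w + s *\<^sub>R (u\<^sup>2, 2 * u, 1) = 0"
              using curves_in_cuspidal_edge_dependent[OF ce cw swallowtail_map_curves(2)[of u v, folded p]] by (elim exE conjE) (rule that)
            have "r \<noteq> 0" using rs by (auto simp: zero_prod_def)
            then have "w = (- s / r) *\<^sub>R (u\<^sup>2, 2 * u, 1)"
              using rs(2) by (cases w) (auto simp: zero_prod_def field_simps)
            then show ?thesis by blast
          qed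
          then show thesis using that by blast
        qed
        show False
        proof (rule not_plane[of u])
          fix w1 w2 w3 assume "curve_in ?S p (w1, w2, w3)"
          then obtain k where "(w1, w2, w3) = k *\<^sub>R (u\<^sup>2, 2 * u, 1)" using a by blast
          then have "w1 = k * u\<^sup>2" "w2 = k * (2 * u)" "w3 = k" by simp_all
          then show "w1 - u * w2 + u\<^sup>2 * w3 = 0" by algebra
        qed
      qed
    qed
  qed
  have "u \<noteq> 0"
  proof
    assume "u = 0"
    then have "p = 0" using p uv by (simp add: zero_prod_def)
    then show False using not_plane[of 0] swallowtail_origin_plane by simp
  qed
  moreover have "p = (\<bar>u\<bar>^4, 0, - 2 * \<bar>u\<bar>\<^sup>2)"
    unfolding p uv by (simp add: algebra_simps power2_eq_square power3_eq_cube power4_eq_xxxx)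
  ultimately show ?thesis by (intro exI[of _ "\<bar>u\<bar>"]) simp
qed

section \<open>The bifurcation diagram\<close>

lemma bl_surface_sharksfin: "c \<ge> 0 \<Longrightarrow> bl_surface (sqrt c) c = (0, 0, c)"
  by (simp add: bl_surface_def)

lemma corank_one_stable_germ:
  assumes "jac (G a b c) (x, y) = 0" "(a, b) \<noteq> (0, 0)" "\<And>r. (a, b, c) \<noteq> bl_surface r c"
    "\<And>r. r \<noteq> 0 \<Longrightarrow> (a, b, c) \<noteq> sw_surface r c" "\<not> (b = 0 \<and> c = 0)"
  shows "fold_pt (G a b c) (x, y) \<or> cusp_pt (G a b c) (x, y)"
proof (cases "(x, y) = (0, 0)")
  case True
  then show ?thesis using assms(2,5) by (auto simp: fold_pt_G_origin cusp_pt_G_origin)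
next
  case False
  have l: "2 * x\<^sup>2 + a * x - 3 * y^3 - 2 * c * y\<^sup>2 - b * y = 0" using assms(1) by (simp add: jac_G_apply)
  have "\<not> (4 * x + a = 0 \<and> 9 * y\<^sup>2 + 4 * c * y + b = 0)"
    using critical_point_param[OF False l] assms(3) by metis
  moreover have "\<not> (4 * x\<^sup>2 + a * x + 9 * y^3 + 4 * c * y\<^sup>2 + b * y = 0 \<and>
      8 * x\<^sup>2 + a * x - 27 * y^3 - 8 * c * y\<^sup>2 - b * y = 0)"
    using triple_contact_param[OF False l] assms(4) by metis
  ultimately show ?thesis
    unfolding fold_pt_G[OF False] cusp_pt_G[OF False] using l by blast
qed

lemma stable_singletonD: "stable_singularity f {p} \<Longrightarrow> fold_pt f p \<or> cusp_pt f p"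
  unfolding stable_singularity_def double_fold_def by (metis doubleton_eq_iff insert_absorb2 singleton_insert_inj_eq')

lemma stable_pairD: "stable_singularity f {p, q} \<Longrightarrow> p \<noteq> q \<Longrightarrow> fold_pt f p"
  unfolding stable_singularity_def double_fold_def by (metis doubleton_eq_iff insert_absorb2)

text \<open>The range of a singular matrix is at most a line, so its vectors are parallel to both
  columns \<open>(A, p)\<close> and \<open>(B, x)\<close>.\<close>

lemma range_cross_product:
  assumes "A * x - p * B = (0::real)" "v \<in> range (\<lambda>w. (A * fst w + B * snd w, p * fst w + x * snd w))"
  shows "A * snd v = p * fst v" "B * snd v = x * fst v"
proof -
  obtain h k where v: "v = (A * h + B * k, p * h + x * k)" using assms(2) by auto
  show "A * snd v = p * fst v" "B * snd v = x * fst v" unfolding v using assms(1) by (simp_all) algebra+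
qed

lemma double_fold_G:
  assumes pq: "(x1, p) \<noteq> (x2, q)" and im: "G a b c (x1, p) = G a b c (x2, q)"
    and f: "fold_pt (G a b c) (x1, p)" "fold_pt (G a b c) (x2, q)" and n: "(a, b) \<noteq> (0, 0)"
  shows "double_fold (G a b c) (x1, p) (x2, q)"
proof -
  have "range (frechet_derivative (G a b c) (at (x1, p))) \<noteq> range (frechet_derivative (G a b c) (at (x2, q)))"
  proof
    assume eq: "range (frechet_derivative (G a b c) (at (x1, p))) = range (frechet_derivative (G a b c) (at (x2, q)))"
    let ?A = "\<lambda>x. 2 * x + a" and ?B = "\<lambda>y. 3 * y\<^sup>2 + 2 * c * y + b"
    have D: "frechet_derivative (G a b c) (at (x, y)) = (\<lambda>w. (?A x * fst w + ?B y * snd w, y * fst w + x * snd w))" for x y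
      by (simp add: fun_eq_iff frechet_derivative_G)
    note l = fold_pt_singular[OF f(1)] fold_pt_singular[OF f(2)]
    have d: "?A x * x - y * ?B y = 0" if "2 * x\<^sup>2 + a * x - 3 * y^3 - 2 * c * y\<^sup>2 - b * y = 0" for x y
      using that by algebra
    have "(?A x2, q) \<in> range (\<lambda>w. (?A x1 * fst w + ?B p * snd w, p * fst w + x1 * snd w))"
      "(?B q, x2) \<in> range (\<lambda>w. (?A x1 * fst w + ?B p * snd w, p * fst w + x1 * snd w))"
      using eq unfolding D by (auto intro: range_eqI[of _ _ "(1, 0)"] range_eqI[of _ _ "(0, 1)"])
    from range_cross_product[OF d[OF l(1)] this(1)] range_cross_product[OF d[OF l(1)] this(2)]
    have t: "?A x1 * q = p * ?A x2" "?B p * q = x1 * ?A x2" "?A x1 * x2 = p * ?B q" "?B p * x2 = x1 * ?B q" by simp_all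
    show False
    proof (rule no_tangent_double_fold[OF pq n l G_eqD[OF im]])
      show "(x1, p) = (0, 0) \<Longrightarrow> a * b \<noteq> 0" using f(1) fold_pt_G_origin by metis
      show "(x2, q) = (0, 0) \<Longrightarrow> a * b \<noteq> 0" using f(2) fold_pt_G_origin by metis
    qed (use t in \<open>simp_all add: mult.commute\<close>)
  qed
  then show ?thesis using assms by (simp add: double_fold_def)
qed

lemma nonfold_pair_cf:
  assumes n: "(a, b) \<noteq> (0, 0)" and pq: "(x1, p) \<noteq> (x2, q)" and im: "G a b c (x1, p) = G a b c (x2, q)"
    and j: "jac (G a b c) (x1, p) = 0" "jac (G a b c) (x2, q) = 0" and nf: "\<not> fold_pt (G a b c) (x1, p)"
  shows "\<exists>s. (a, b, c) = cf_surface s c"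
proof -
  have l: "2 * x1\<^sup>2 + a * x1 - 3 * p^3 - 2 * c * p\<^sup>2 - b * p = 0" "2 * x2\<^sup>2 + a * x2 - 3 * q^3 - 2 * c * q\<^sup>2 - b * q = 0"
    using j by (simp_all add: jac_G_apply)
  show ?thesis
  proof (cases "(x1, p) = (0, 0)")
    case True
    then have ab: "a * b = 0" using nf fold_pt_G_origin by auto
    have xq: "(x2, q) \<noteq> (0, 0)" using pq True by simp
    have v: "0 = x2 * q" and u: "0 = x2\<^sup>2 + q^3 + a * x2 + b * q + c * q\<^sup>2"
      using G_eqD[OF im] True by simp_all
    from origin_contact_pair[OF xq n ab l(2) v u] show ?thesis by blast
  next
    case False
    then have "4 * x1\<^sup>2 + a * x1 + 9 * p^3 + 4 * c * p\<^sup>2 + b * p = 0" using nf l(1) fold_pt_G[OF False] by blast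
    from cusp_contact_pair_nonzero[OF False pq l(1) this l(2) G_eqD[OF im]] show ?thesis by blast
  qed
qed

text \<open>Off the strata all singular points are folds or cusps, two in one fibre are both folds
  and cross transversely, and three never meet. The points \<open>(0, 0, c)\<close> with
  \<open>c \<ge> 0\<close> lie on the first surface; the rest of that axis is the last case.\<close>

lemma unstable_on_strata:
  assumes "multi_singularity (G a b c) S" "\<not> stable_singularity (G a b c) S"
  shows "(\<exists>r. (a, b, c) = bl_surface r c) \<or> (\<exists>r. r \<noteq> 0 \<and> (a, b, c) = sw_surface r c) \<or> (b = 0 \<and> c = 0) \<or>
    (\<exists>s. (a, b, c) = cf_surface s c) \<or> (a = 0 \<and> b = 0 \<and> c < 0)"
proof (rule ccontr)
  assume c: "\<not> ?thesis"
  let ?f = "G a b c"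
  have n: "(a, b) \<noteq> (0, 0)"
  proof
    assume "(a, b) = (0, 0)"
    then show False using c bl_surface_sharksfin[of c, symmetric] by (cases "c \<ge> 0") auto
  qed
  have S: "S \<noteq> {}" "\<And>p. p \<in> S \<Longrightarrow> jac ?f p = 0" "\<And>p q. p \<in> S \<Longrightarrow> q \<in> S \<Longrightarrow> ?f p = ?f q"
    using assms(1) unfolding multi_singularity_def by blast+
  have fc: "fold_pt ?f p \<or> cusp_pt ?f p" if "p \<in> S" for p
    using corank_one_stable_germ[of a b c "fst p" "snd p"] S(2)[OF that] n c unfolding prod.collapse by blast
  have ff: "fold_pt ?f p" if "p \<in> S" "q \<in> S" "p \<noteq> q" for p q
    using nonfold_pair_cf[OF n, of "fst p" "snd p" "fst q" "snd q" c] S(2)[OF that(1)] S(2)[OF that(2)]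
      S(3)[OF that(1,2)] that(3) c unfolding prod.collapse by blast
  obtain p where p: "p \<in> S" using S(1) by blast
  show False
  proof (cases "S = {p}")
    case True
    then show False using assms(2) fc[OF p] unfolding stable_singularity_def by blast
  next
    case False
    then obtain q where q: "q \<in> S" "p \<noteq> q" using p by blast
    show False
    proof (cases "S = {p, q}")
      case True
      have "double_fold ?f p q"
        using double_fold_G[of "fst p" "snd p" "fst q" "snd q" a b c] S(3)[OF p q(1)] ff[OF p q] ff[OF q(1) p q(2)[symmetric]] q(2) n
        unfolding prod.collapse by blast
      then show False using assms(2) True unfolding stable_singularity_def by blast
    next
      case False
      then obtain r where r: "r \<in> S" "r \<noteq> p" "r \<noteq> q" using p q by blast
      obtain x1 y1 x2 y2 x3 y3 where e: "p = (x1, y1)" "q = (x2, y2)" "r = (x3, y3)" by (cases p; cases q; cases r)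
      show False
      proof (rule no_triple_fold[OF _ n, of x1 y1 x2 y2 x3 y3 c "snd (?f p)" "fst (?f p)"])
        show "distinct [(x1, y1), (x2, y2), (x3, y3)]" using q(2) r(2,3) unfolding e by auto
        fix x y assume h: "(x, y) \<in> {(x1, y1), (x2, y2), (x3, y3)}"
        then have "(x, y) \<in> S" using p q(1) r(1) unfolding e by blast
        then show "2 * x\<^sup>2 + a * x - 3 * y^3 - 2 * c * y\<^sup>2 - b * y = 0"
          using S(2)[of "(x, y)"] by (simp add: jac_G_apply)
        have "?f p = ?f (x, y)" by (rule S(3)[OF p \<open>(x, y) \<in> S\<close>])
        then show "x * y = snd (?f p) \<and> x\<^sup>2 + y^3 + a * x + b * y + c * y\<^sup>2 = fst (?f p)"
          by (simp add: G_def)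
      qed
    qed
  qed
qed

section \<open>Instability on the whole surfaces\<close>

lemma bifurcation_diagram_iff:
  "(a, b, c) \<in> bifurcation_diagram U \<longleftrightarrow>
    (\<exists>S\<subseteq>U. multi_singularity (G a b c) S \<and> \<not> stable_singularity (G a b c) S)"
  by (simp add: bifurcation_diagram_def)

lemma unstable_singleton:
  assumes "p \<in> U" "jac (G a b c) p = 0" "\<not> fold_pt (G a b c) p" "\<not> cusp_pt (G a b c) p"
  shows "(a, b, c) \<in> bifurcation_diagram U"
proof -
  have "multi_singularity (G a b c) {p}" using assms(2) by (simp add: multi_singularity_def)
  moreover have "\<not> stable_singularity (G a b c) {p}" using stable_singletonD assms(3,4) by blast
  ultimately show ?thesis unfolding bifurcation_diagram_iff using assms(1) by (intro exI[of _ "{p}"]) simp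
qed

lemma unstable_pair:
  assumes "p \<in> U" "q \<in> U" "p \<noteq> q" "G a b c p = G a b c q" "jac (G a b c) p = 0" "jac (G a b c) q = 0" "\<not> fold_pt (G a b c) p"
  shows "(a, b, c) \<in> bifurcation_diagram U"
proof -
  have "multi_singularity (G a b c) {p, q}" using assms(4-6) by (auto simp: multi_singularity_def)
  moreover have "\<not> stable_singularity (G a b c) {p, q}" using stable_pairD assms(3,7) by blast
  ultimately show ?thesis unfolding bifurcation_diagram_iff using assms(1,2) by (intro exI[of _ "{p, q}"]) simp
qed

text \<open>The inclusion from right to left has to treat also the parameters at which the named
  types degenerate: the germ at the origin may have corank two, or the two points of a cusp+fold may
  merge into one that is neither fold nor cusp.\<close>

lemma bifurcation_diagram_eq:
  assumes conf: "confines U V"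
  shows "bifurcation_diagram U \<inter> V =
    ({bl_surface r c | r c. True} \<union> ({sw_surface r c | r c. r \<noteq> 0} \<union> {(a, 0, 0) | a. True}) \<union>
     {cf_surface s c | s c. True} \<union> {(0, 0, c) | c. c < 0}) \<inter> V"
proof (intro equalityI subsetI)
  fix w assume w0: "w \<in> bifurcation_diagram U \<inter> V"
  obtain a b c where w: "w = (a, b, c)" by (cases w)
  obtain S where "multi_singularity (G a b c) S" "\<not> stable_singularity (G a b c) S"
    using w0 unfolding w Int_iff bifurcation_diagram_iff by (elim conjE exE)
  from unstable_on_strata[OF this] w0
  show "w \<in> ({bl_surface r c | r c. True} \<union> ({sw_surface r c | r c. r \<noteq> 0} \<union> {(a, 0, 0) | a. True}) \<union>
     {cf_surface s c | s c. True} \<union> {(0, 0, c) | c. c < 0}) \<inter> V" unfolding w by auto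
next
  fix w assume w0: "w \<in> ({bl_surface r c | r c. True} \<union> ({sw_surface r c | r c. r \<noteq> 0} \<union> {(a, 0, 0) | a. True}) \<union>
     {cf_surface s c | s c. True} \<union> {(0, 0, c) | c. c < 0}) \<inter> V"
  obtain a b c where w: "w = (a, b, c)" by (cases w)
  have V: "(a, b, c) \<in> V" using w0 w by simp
  have corank2: "(a, b, c) \<in> bifurcation_diagram U" if "a = 0" "b = 0"
    by (rule unstable_singleton[OF origin_confined[OF conf]])
      (use that in \<open>auto simp: jac_G_apply fold_pt_G_origin cusp_pt_G_origin\<close>)
  have "(\<exists>r. (a, b, c) = bl_surface r c) \<or> (\<exists>r. r \<noteq> 0 \<and> (a, b, c) = sw_surface r c) \<or> (b = 0 \<and> c = 0) \<or>
    (\<exists>s. (a, b, c) = cf_surface s c) \<or> (a = 0 \<and> b = 0 \<and> c < 0)"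
    using w0 unfolding w by (auto simp: bl_surface_def sw_surface_def cf_surface_def)
  then consider r where "(a, b, c) = bl_surface r c" | r where "r \<noteq> 0" "(a, b, c) = sw_surface r c" | "b = 0" "c = 0" "a \<noteq> 0"
    | s where "(a, b, c) = cf_surface s c" | "a = 0" "b = 0" by blast
  then have "(a, b, c) \<in> bifurcation_diagram U"
  proof cases
    case (1 r)
    define y where "y = (r\<^sup>2 - c) / 3"
    define x where "x = - y * r"
    note P = bl_surface_point[OF 1 y_def x_def]
    have U: "(x, y) \<in> U" using confined[OF conf V P(1)] P(3) by blast
    show ?thesis
    proof (cases "y = 0")
      case True
      then show ?thesis using 1 corank2 by (auto simp: bl_surface_def y_def)
    next
      case False
      then have n: "(x, y) \<noteq> (0, 0)" by simp
      have "4 * x\<^sup>2 + a * x + 9 * y^3 + 4 * c * y\<^sup>2 + b * y = x * (4 * x + a) + y * (9 * y\<^sup>2 + 4 * c * y + b)" by algebra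
      then have "\<not> fold_pt (G a b c) (x, y)" "\<not> cusp_pt (G a b c) (x, y)"
        unfolding fold_pt_G[OF n] cusp_pt_G[OF n] P(2,3) using P(2,3) by simp_all
      then show ?thesis using unstable_singleton[OF U] P(1) by (simp add: jac_G_apply)
    qed
  next
    case (2 r)
    define y where "y = (r\<^sup>2 - c) / 4"
    define x where "x = y * r"
    note P = sw_surface_point[OF 2(2,1) y_def x_def]
    have U: "(x, y) \<in> U" using confined[OF conf V P(1)] P(7) by blast
    show ?thesis
    proof (cases "y = 0")
      case True
      then show ?thesis using 2 corank2 by (auto simp: sw_surface_def y_def)
    next
      case False
      then have n: "(x, y) \<noteq> (0, 0)" by simp
      have "\<not> fold_pt (G a b c) (x, y)" "\<not> cusp_pt (G a b c) (x, y)"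
        unfolding fold_pt_G[OF n] cusp_pt_G[OF n] P(2,3) by simp_all
      then show ?thesis using unstable_singleton[OF U] P(1) by (simp add: jac_G_apply)
    qed
  next
    case 3
    show ?thesis
      by (rule unstable_singleton[OF origin_confined[OF conf]])
        (use 3 in \<open>auto simp: jac_G_apply fold_pt_G_origin cusp_pt_G_origin\<close>)
  next
    case (4 s)
    define q where "q = - (c - 3 * s\<^sup>2) / 2"
    note P = cf_surface_points[OF 4 q_def]
    have U: "(s * q, - s\<^sup>2) \<in> U" "(- (s^3), q) \<in> U" using cf_points_confined[OF conf V 4 q_def] by auto
    have j: "jac (G a b c) (s * q, - s\<^sup>2) = 0" "jac (G a b c) (- (s^3), q) = 0"
      unfolding jac_G_apply by (rule P(2), rule P(7))
    have nf: "\<not> fold_pt (G a b c) (s * q, - s\<^sup>2)"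
    proof (cases "s = 0")
      case True
      then have "a = 0" using 4 by (simp add: cf_surface_def)
      then show ?thesis using True by (simp add: fold_pt_G_origin)
    next
      case False
      then have n: "(s * q, - s\<^sup>2) \<noteq> (0, 0)" by simp
      show ?thesis unfolding fold_pt_G[OF n] P(3) by simp
    qed
    show ?thesis
    proof (cases "c = 5 * s\<^sup>2")
      case False
      then have "(s * q, - s\<^sup>2) \<noteq> (- (s^3), q)" using P(11) by blast
      from unstable_pair[OF U this P(1) j nf] show ?thesis .
    next
      case True
      show ?thesis
      proof (cases "s = 0")
        case True
        then show ?thesis using 4 \<open>c = 5 * s\<^sup>2\<close> corank2 by (auto simp: cf_surface_def)
      next
        case False
        then have n: "(s * q, - s\<^sup>2) \<noteq> (0, 0)" by simp
        have "\<not> cusp_pt (G a b c) (s * q, - s\<^sup>2)" unfolding cusp_pt_G[OF n] P(4) using True by simp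
        from unstable_singleton[OF U(1) j(1) nf this] show ?thesis .
      qed
    qed
  next
    case 5
    then show ?thesis using corank2 by blast
  qed
  then show "w \<in> bifurcation_diagram U \<inter> V" using V w by simp
qed

section \<open>Coordinates adapted to the branches of the sharksfin\<close>

lemma smooth_on_poly [smooth_intros]:
  fixes f :: "'a::euclidean_space \<Rightarrow> real"
  shows "open S \<Longrightarrow> smooth_on S f \<Longrightarrow> smooth_on S (\<lambda>z. poly p (f z))"
  unfolding poly_altdef by (intro smooth_intros)

text \<open>The functions of \<open>(s\<^sup>2, s\<^sup>3)\<close> are those whose Taylor expansion lacks the linear term.\<close>

lemma cusp_expansion:
  fixes p :: "real poly"
  assumes "coeff p 0 = 0" "coeff p 1 = 0"
  obtains \<phi> :: "plane \<Rightarrow> real" where "smooth_on UNIV \<phi>"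
    "\<And>s. poly p s = coeff p 2 * s\<^sup>2 + coeff p 3 * s^3 + coeff p 5 * s^5 + s^4 * \<phi> (s\<^sup>2, s^3)"
proof -
  \<comment> \<open>The exponents 2 and 3 generate all exponents except 1; an odd exponent from 3 on
    takes one factor \<open>s^3\<close>.\<close>
  define \<psi> where "\<psi> k z = (if even k then fst z ^ (k div 2) else snd z * fst z ^ ((k - 3) div 2))" for k and z :: plane
  have \<psi>: "\<psi> k (s\<^sup>2, s^3) = s ^ k" if "k \<noteq> 1" for k s
  proof (cases "even k")
    case True
    then show ?thesis by (simp add: \<psi>_def power_mult[symmetric])
  next
    case False
    then have "k = 3 + 2 * ((k - 3) div 2)" using that by presburger
    then have "s ^ k = s^3 * (s\<^sup>2) ^ ((k - 3) div 2)" by (metis power_add power_mult)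
    then show ?thesis using False by (simp add: \<psi>_def)
  qed
  define N where "N = degree p + 6"
  \<comment> \<open>With the factor \<open>s^4\<close> taken out, exponent 5 would leave
    \<open>s^1\<close>; hence the separate term in \<open>s^5\<close> and the start at 6.\<close>
  define J where "J = {6..N}"
  define \<phi> where "\<phi> z = coeff p 4 + (\<Sum>n\<in>J. coeff p n * \<psi> (n - 4) z)" for z
  have "smooth_on UNIV (\<psi> k)" for k
    unfolding \<psi>_def by (cases "even k") (auto intro!: smooth_intros)
  then have s: "smooth_on UNIV \<phi>" unfolding \<phi>_def by (intro smooth_intros open_UNIV)
  have "poly p s = coeff p 2 * s\<^sup>2 + coeff p 3 * s^3 + coeff p 5 * s^5 + s^4 * \<phi> (s\<^sup>2, s^3)" for s
  proof -
    have "poly p s = (\<Sum>n\<le>N. coeff p n * s ^ n)"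
      unfolding poly_altdef by (rule sum.mono_neutral_left) (auto simp: N_def coeff_eq_0)
    also have "{..N} = {0, 1, 2, 3, 4, 5} \<union> J" by (auto simp: N_def J_def)
    also have "(\<Sum>n\<in>{0, 1, 2, 3, 4, 5} \<union> J. coeff p n * s ^ n) =
        (\<Sum>n\<in>{0, 1, 2, 3, 4, 5}. coeff p n * s ^ n) + (\<Sum>n\<in>J. coeff p n * s ^ n)"
      by (rule sum.union_disjoint) (auto simp: J_def)
    also have "(\<Sum>n\<in>J. coeff p n * s ^ n) = s^4 * (\<Sum>n\<in>J. coeff p n * \<psi> (n - 4) (s\<^sup>2, s^3))"
      unfolding sum_distrib_left
    proof (rule sum.cong[OF refl])
      fix n assume "n \<in> J"
      then have "n = 4 + (n - 4)" "n - 4 \<noteq> 1" by (auto simp: J_def)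
      then show "coeff p n * s ^ n = s^4 * (coeff p n * \<psi> (n - 4) (s\<^sup>2, s^3))"
        by (metis \<psi> mult.left_commute power_add)
    qed
    also have "(\<Sum>n\<in>{0, 1, 2, 3, 4, 5}. coeff p n * s ^ n) =
        coeff p 2 * s\<^sup>2 + coeff p 3 * s^3 + coeff p 4 * s^4 + coeff p 5 * s^5"
      using assms by simp
    finally show ?thesis by (simp add: \<phi>_def algebra_simps)
  qed
  then show thesis using s that by blast
qed

text \<open>The critical branches of \<open>G 0 0 c\<close> are \<open>x = \<plusminus> y sqrt (c + 3 y / 2)\<close>. In the scaling \<open>c = 1 / 6\<close> up to
  constant factors they are rationally parametrized by \<open>y = \<zeta>\<close> with \<open>1 + 6 \<zeta> = \<rho>\<^sup>2\<close>, and the coefficients of \<open>\<rho>\<close> are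
  chosen such that the branches of critical values agree with the cusps \<open>(s\<^sup>2, s\<^sup>3)\<close> and \<open>(s\<^sup>3, s\<^sup>2)\<close>
  up to a diffeomorphism: the coefficient of \<open>s\<^sup>5\<close> of \<open>\<zeta>\<^sup>2 \<rho>\<close> has to vanish.\<close>

definition rho_poly :: "real poly" where
  "rho_poly = [:1, 3, - 21/2, - 837/44:]"

definition zeta_poly :: "real poly" where
  "zeta_poly = smult (1/6) (rho_poly * rho_poly - 1)"

definition sum_poly :: "real poly" where
  "sum_poly = smult 2 (zeta_poly * zeta_poly * (1 + smult 5 zeta_poly))"

definition diff_poly :: "real poly" where
  "diff_poly = zeta_poly * zeta_poly * rho_poly"

text \<open>The coefficient \<open>- 21/2\<close> of \<open>rho_poly\<close> produces both
  \<open>2 s^2 + 2 s^3\<close> in \<open>sum_poly\<close> and \<open>s^2 - s^3\<close> in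
  \<open>diff_poly\<close>, the values of the linear map \<open>(2 (X + Y), X - Y)\<close> on the
  cusp \<open>(s^2, s^3)\<close>. The coefficient \<open>- 837/44\<close> removes \<open>s^5\<close>
  from \<open>diff_poly\<close>.\<close>

lemma branch_poly_coeffs:
  "coeff sum_poly 0 = 0" "coeff sum_poly 1 = 0" "coeff sum_poly 2 = 2" "coeff sum_poly 3 = 2"
  "coeff diff_poly 0 = 0" "coeff diff_poly 1 = 0" "coeff diff_poly 2 = 1" "coeff diff_poly 3 = - 1" "coeff diff_poly 5 = 0"
  "coeff zeta_poly 0 = 0" "coeff zeta_poly 1 = 1" "coeff (zeta_poly * rho_poly) 1 = 1"
  unfolding sum_poly_def diff_poly_def zeta_poly_def rho_poly_def
  by (simp_all add: eval_nat_numeral one_pCons)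

lemma rho_square: "(poly rho_poly s)\<^sup>2 = 1 + 6 * poly zeta_poly s"
  by (simp add: zeta_poly_def power2_eq_square field_simps)

text \<open>\<open>h\<close> takes the axes to the two critical branches, and \<open>T\<close> takes
  the cusps \<open>(s^2, s^3)\<close> and \<open>(s^3, s^2)\<close> to their critical values. So
  \<open>F\<close>, the germ preceded by \<open>h\<close> and followed by the inverse of
  \<open>T\<close>, agrees with the sharksfin germ on the axes and is singular there, as the change
  of source requires.\<close>

lemma sharksfin_pt_G:
  assumes c: "c > 0"
  shows "sharksfin_pt (G 0 0 c) (0, 0)"
proof -
  define k where "k = sqrt c"
  have k: "k > 0" "k\<^sup>2 = c" using c by (simp_all add: k_def)
  let ?f = "G 0 0 c"
  let ?z = "poly zeta_poly" and ?r = "poly rho_poly"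
  obtain \<phi>u :: "plane \<Rightarrow> real" where \<phi>u: "smooth_on UNIV \<phi>u"
    "\<And>s. poly sum_poly s = 2 * s\<^sup>2 + 2 * s^3 + coeff sum_poly 5 * s^5 + s^4 * \<phi>u (s\<^sup>2, s^3)"
    using cusp_expansion[OF branch_poly_coeffs(1,2)] unfolding branch_poly_coeffs by blast
  obtain \<phi>v :: "plane \<Rightarrow> real" where \<phi>v: "smooth_on UNIV \<phi>v"
    "\<And>s. poly diff_poly s = 1 * s\<^sup>2 + - 1 * s^3 + 0 * s^5 + s^4 * \<phi>v (s\<^sup>2, s^3)"
    using cusp_expansion[OF branch_poly_coeffs(5,6)] unfolding branch_poly_coeffs by blast
  define \<gamma> where "\<gamma> = coeff sum_poly 5"
  define w where "w z = (snd z, fst z)" for z :: plane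
  have sw: "smooth_on UNIV (\<lambda>z. \<phi> (w z))" if "smooth_on UNIV \<phi>" for \<phi> :: "plane \<Rightarrow> real"
    unfolding w_def by (rule smooth_on_compose[OF open_UNIV open_UNIV _ that]) (auto intro!: smooth_intros)
  \<comment> \<open>The quotient of \<open>X^2 - Y^3\<close> by \<open>1 - X Y\<close> is
    \<open>s^4\<close> on the cusp \<open>(s^2, s^3)\<close> and 0 on \<open>(s^3, s^2)\<close>, so
    each correction acts on one branch only. On both cusps \<open>X Y = s^5\<close>: the term
    \<open>\<gamma> X Y\<close> takes the same value on both, as the first component needs, whereas
    the second component changes sign between the branches; this is why \<open>diff_poly\<close>
    must have no \<open>s^5\<close>.\<close>
  define T where "T z = (16 * c^3 * (2 * (fst z + snd z) + \<gamma> * (fst z * snd z) +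
        ((fst z ^ 2 - snd z ^ 3) * \<phi>u z + (snd z ^ 2 - fst z ^ 3) * \<phi>u (w z)) / (1 - fst z * snd z)),
      16 * c\<^sup>2 * k * (fst z - snd z +
        ((fst z ^ 2 - snd z ^ 3) * \<phi>v z - (snd z ^ 2 - fst z ^ 3) * \<phi>v (w z)) / (1 - fst z * snd z)))"
    for z :: plane
  define B where "B = {z :: plane. fst z * snd z < 1}"
  have oB: "open B" unfolding B_def by (intro open_Collect_less continuous_intros)
  have B0: "(0, 0) \<in> B" by (simp add: B_def)
  have sT: "smooth_on B T"
    unfolding T_def
    by (intro smooth_intros oB smooth_on_subset[OF \<phi>u(1)] smooth_on_subset[OF \<phi>v(1)]
        smooth_on_subset[OF sw[OF \<phi>u(1)]] smooth_on_subset[OF sw[OF \<phi>v(1)]]) (auto simp: B_def)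
  have dT: "(T has_derivative (\<lambda>v. (16 * c^3 * (2 * (fst v + snd v)), 16 * c\<^sup>2 * k * (fst v - snd v)))) (at (0, 0))"
  proof -
    note d = smooth_on_imp_has_derivative[OF \<phi>u(1) UNIV_I] smooth_on_imp_has_derivative[OF \<phi>v(1) UNIV_I]
      smooth_on_imp_has_derivative[OF sw[OF \<phi>u(1)] UNIV_I] smooth_on_imp_has_derivative[OF sw[OF \<phi>v(1)] UNIV_I]
    show ?thesis
      unfolding T_def
      by (rule has_derivative_eq_rhs, (rule derivative_intros d refl | simp)+)
  qed
  obtain M3 N3 T' where T': "diffeo M3 N3 T T'" "(0, 0) \<in> M3" "M3 \<subseteq> B"
  proof (rule smooth_inverse_function[OF oB sT B0])
    fix v assume "frechet_derivative T (at (0, 0)) v = 0"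
    then have "fst v + snd v = 0" "fst v - snd v = 0"
      unfolding frechet_derivative_eqI[OF dT] using c k(1) by (auto simp: zero_prod_def)
    then show "v = 0" by (simp add: prod_eq_iff)
  qed
  \<comment> \<open>For \<open>y = 4 * c * \<zeta>\<close> one has
    \<open>c + 3/2 * y = c * \<rho>^2\<close>, so the critical branches are
    \<open>x = \<plusminus> 4 c k \<zeta> \<rho>\<close>. Difference and sum of functions of one
    variable send each axis to one branch.\<close>
  define h where "h z = (4 * c * k * (poly (zeta_poly * rho_poly) (fst z) - poly (zeta_poly * rho_poly) (snd z)),
      4 * c * (?z (fst z) + ?z (snd z)))" for z :: plane
  have sh: "smooth_on UNIV h" unfolding h_def by (intro smooth_intros open_UNIV)
  have dh: "(h has_derivative (\<lambda>v. (4 * c * k * (fst v - snd v), 4 * c * (fst v + snd v)))) (at (0, 0))"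
  proof -
    have dp: "((\<lambda>z. poly p (f z)) has_derivative (\<lambda>v. coeff p 1 * f' v)) (at (0, 0))"
      if "(f has_derivative f') (at (0, 0))" "f (0, 0) = 0" for p and f f' :: "plane \<Rightarrow> real"
    proof -
      have "poly (pderiv p) 0 = coeff p 1" by (simp add: poly_0_coeff_0 coeff_pderiv)
      then have "(poly p has_derivative times (coeff p 1)) (at (f (0, 0)))"
        using poly_DERIV[of p 0] that(2) by (simp add: has_field_derivative_def)
      from has_derivative_compose[OF that(1) this] show ?thesis .
    qed
    have d1: "((\<lambda>z. fst z) has_derivative (\<lambda>v. fst v)) (at (0 :: real, 0 :: real))"
      and d2: "((\<lambda>z. snd z) has_derivative (\<lambda>v. snd v)) (at (0 :: real, 0 :: real))"
      by (auto intro!: derivative_eq_intros)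
    note d = dp[OF d1, simplified] dp[OF d2, simplified]
    show ?thesis
      unfolding h_def
      by (rule has_derivative_eq_rhs, (rule has_derivative_Pair has_derivative_mult_right has_derivative_diff
            has_derivative_add d refl)+)
        (simp add: fun_eq_iff branch_poly_coeffs[unfolded One_nat_def])
  qed
  obtain M1 N1 h' where h': "diffeo M1 N1 h h'" "(0, 0) \<in> M1"
  proof (rule smooth_inverse_function[OF open_UNIV sh UNIV_I])
    fix v assume "frechet_derivative h (at (0, 0)) v = 0"
    then have "fst v - snd v = 0" "fst v + snd v = 0"
      unfolding frechet_derivative_eqI[OF dh] using c k(1) by (auto simp: zero_prod_def)
    then show "v = 0" by (simp add: prod_eq_iff)
  qed
  have h0: "h (0, 0) = (0, 0)" by (simp add: h_def poly_0_coeff_0 branch_poly_coeffs)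
  have T0: "T (0, 0) = (0, 0)" by (simp add: T_def)
  have f0: "?f (0, 0) = (0, 0)" by (simp add: G_def)
  have z0: "?z 0 = 0" by (simp add: poly_0_coeff_0 branch_poly_coeffs)
  have fh: "?f (4 * c * k * (e * (?z s * ?r s)), 4 * c * ?z s) = (16 * c^3 * poly sum_poly s, e * (16 * c\<^sup>2 * k * poly diff_poly s))"
    if e: "e\<^sup>2 = 1" for e s
  proof -
    have *: "(4 * c * k * (e * (z * r)))\<^sup>2 + (4 * c * z)^3 + c * (4 * c * z)\<^sup>2 = 16 * c^3 * (2 * (z * z * (1 + 5 * z)))"
      if "r\<^sup>2 = 1 + 6 * z" for z r
    proof -
      have "(4 * c * k * (e * (z * r)))\<^sup>2 = 16 * c\<^sup>2 * k\<^sup>2 * e\<^sup>2 * z\<^sup>2 * r\<^sup>2" by algebra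
      also have "\<dots> = 16 * c^3 * z\<^sup>2 * (1 + 6 * z)" unfolding e k(2) that by algebra
      finally show ?thesis by algebra
    qed
    have "4 * c * k * (e * (z * r)) * (4 * c * z) = e * (16 * c\<^sup>2 * k * (z * z * r))" for z r by algebra
    then show ?thesis using *[OF rho_square[of s]] by (simp add: G_def sum_poly_def diff_poly_def)
  qed
  have hX: "h (s, 0) = (4 * c * k * (1 * (?z s * ?r s)), 4 * c * ?z s)"
    and hY: "h (0, s) = (4 * c * k * (- 1 * (?z s * ?r s)), 4 * c * ?z s)" for s
    by (simp_all add: h_def z0)
  have TX: "T (s\<^sup>2, s^3) = (16 * c^3 * poly sum_poly s, 16 * c\<^sup>2 * k * poly diff_poly s)"
    and TY: "T (s^3, s\<^sup>2) = (16 * c^3 * poly sum_poly s, - 1 * (16 * c\<^sup>2 * k * poly diff_poly s))"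
    if "(s\<^sup>2, s^3) \<in> B" for s
  proof -
    have n: "1 - s^5 \<noteq> 0" using that by (simp add: B_def power_add[symmetric])
    have p: "s\<^sup>2 * s^3 = s^5" "s^3 * s\<^sup>2 = s^5" "(s\<^sup>2)\<^sup>2 - (s^3)^3 = s^4 * (1 - s^5)" "(s^3)\<^sup>2 - (s\<^sup>2)^3 = 0"
      by algebra+
    show "T (s\<^sup>2, s^3) = (16 * c^3 * poly sum_poly s, 16 * c\<^sup>2 * k * poly diff_poly s)"
      unfolding T_def fst_conv snd_conv p \<phi>u(2) \<phi>v(2) using n by (simp add: \<gamma>_def)
    show "T (s^3, s\<^sup>2) = (16 * c^3 * poly sum_poly s, - 1 * (16 * c\<^sup>2 * k * poly diff_poly s))"
    proof -
      have q: "(0 * a + s^4 * (1 - s^5) * b) / (1 - s^5) = s^4 * b"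
        "(0 * a - s^4 * (1 - s^5) * b) / (1 - s^5) = - (s^4 * b)" for a b
        using n by simp_all
      show ?thesis
        unfolding T_def w_def fst_conv snd_conv p \<phi>u(2) \<phi>v(2) q by (simp add: \<gamma>_def algebra_simps)
    qed
  qed
  define O1 where "O1 = M1 \<inter> {z. ?f (h z) \<in> N3} \<inter> {z. (fst z ^ 2, fst z ^ 3) \<in> M3} \<inter> {z. (snd z ^ 3, snd z ^ 2) \<in> M3}
     \<inter> {z. fst z < 1 \<and> snd z < 1}"
  have sf: "smooth_on UNIV (\<lambda>z. ?f (h z))"
  proof (rule smooth_on_compose[OF open_UNIV open_UNIV sh])
    show "smooth_on UNIV ?f" unfolding G_def case_prod_beta by (intro smooth_intros open_UNIV)
  qed simp
  have vim: "open {z. g z \<in> A}" if "continuous_on UNIV g" "open A" for g :: "plane \<Rightarrow> plane" and A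
    using open_vimage[OF that(2,1)] by (simp add: vimage_def)
  have O1: "open O1"
    unfolding O1_def
    by (intro open_Int diffeo_open[OF h'(1)] vim diffeo_open[OF T'(1)] smooth_on_imp_continuous_on[OF sf]
        continuous_intros open_Collect_conj open_Collect_less)
  have O10: "(0, 0) \<in> O1"
    using h'(2) T'(2) diffeo_apply(1)[OF T'(1,2)] by (simp add: O1_def h0 f0 T0)
  define F where "F z = T' (?f (h z))" for z
  have sT': "smooth_on N3 T'" using T'(1) by (simp add: diffeo_def)
  have sF: "smooth_on O1 F"
    unfolding F_def
    by (rule smooth_on_compose[OF O1 diffeo_open(2)[OF T'(1)] smooth_on_subset[OF sf] sT']) (auto simp: O1_def)
  have FX: "F (s, 0) = (s\<^sup>2, s^3)" if "(s, 0) \<in> O1" for s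
  proof -
    have m: "(s\<^sup>2, s^3) \<in> M3" using that by (simp add: O1_def)
    have "?f (h (s, 0)) = T (s\<^sup>2, s^3)" using TX[of s] m T'(3) fh[of 1 s] by (simp only: hX) auto
    then show ?thesis using diffeo_apply(2)[OF T'(1) m] by (simp add: F_def)
  qed
  have FY: "F (0, s) = (s^3, s\<^sup>2)" if "(0, s) \<in> O1" for s
  proof -
    have m: "(s^3, s\<^sup>2) \<in> M3" using that by (simp add: O1_def)
    then have "(s\<^sup>2, s^3) \<in> B" using T'(3) by (auto simp: B_def mult.commute)
    then have "?f (h (0, s)) = T (s^3, s\<^sup>2)" using TY[of s] fh[of "- 1" s] by (simp only: hY) auto
    then show ?thesis using diffeo_apply(2)[OF T'(1) m] by (simp add: F_def)
  qed
  \<comment> \<open>A kernel vector at a critical point, pulled back by \<open>h\<close>, is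
    annihilated by the derivative of \<open>F\<close>; \<open>e\<close> is the sign of the
    branch.\<close>
  have ker: "\<exists>u. u \<noteq> 0 \<and> frechet_derivative F (at z) u = 0"
    if z: "z \<in> O1" and hz: "h z = (4 * c * k * (e * (?z s * ?r s)), 4 * c * ?z s)" "e\<^sup>2 = 1" for z e s
  proof -
    have zM: "z \<in> M1" "?f (h z) \<in> N3" using z by (auto simp: O1_def)
    obtain x y where xy: "h z = (x, y)" by fastforce
    have l: "2 * x * x - 3 * y^3 - 2 * c * y\<^sup>2 = 0"
    proof -
      obtain t r where tr: "t = ?z s" "r = ?r s" by blast
      then have r: "r\<^sup>2 = 1 + 6 * t" by (simp add: rho_square)
      have "x * x = 16 * c\<^sup>2 * k\<^sup>2 * e\<^sup>2 * t\<^sup>2 * r\<^sup>2" "y = 4 * c * t"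
        using hz(1) xy by (simp_all add: tr power2_eq_square)
      then show ?thesis unfolding k(2) hz(2) r by algebra
    qed
    have "\<exists>v. v \<noteq> 0 \<and> frechet_derivative ?f (at (x, y)) v = 0"
    proof (cases "(x, y) = (0, 0)")
      case True
      then show ?thesis by (intro exI[of _ "(1, 0)"]) (simp add: frechet_derivative_G zero_prod_def)
    next
      case False
      have "2 * x * x + (3 * y\<^sup>2 + 2 * c * y) * - y = 0" using l by algebra
      then show ?thesis using False by (intro exI[of _ "(x, - y)"]) (auto simp: frechet_derivative_G zero_prod_def)
    qed
    then obtain v where v: "v \<noteq> 0" "frechet_derivative ?f (at (h z)) v = 0" unfolding xy by blast
    define u where "u = frechet_derivative h' (at (h z)) v"
    note hN = diffeo_apply(1)[OF h'(1) zM(1)] and hh = diffeo_apply(2)[OF h'(1) zM(1)]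
    have u: "u \<noteq> 0" unfolding u_def by (rule diffeo_derivative_nonzero[OF diffeo_sym[OF h'(1)] hN v(1)])
    have hu: "frechet_derivative h (at z) u = v"
      using diffeo_derivative_inverse[OF diffeo_sym[OF h'(1)] hN, of v] by (simp add: u_def hh)
    have D1: "(h has_derivative frechet_derivative h (at z)) (at z)" by (rule smooth_on_imp_has_derivative[OF sh UNIV_I])
    have D2: "(?f has_derivative frechet_derivative ?f (at (h z))) (at (h z))"
      using G_differentiable by (simp add: frechet_derivative_works)
    note D3 = smooth_on_imp_has_derivative[OF sT' zM(2)]
    have "(F has_derivative (\<lambda>v. frechet_derivative T' (at (?f (h z))) (frechet_derivative ?f (at (h z)) (frechet_derivative h (at z) v)))) (at z)"
      unfolding F_def by (rule has_derivative_compose[OF has_derivative_compose[OF D1 D2] D3])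
    from frechet_derivative_eqI[OF this] have "frechet_derivative F (at z) u = 0"
      using v(2) linear_0[OF has_derivative_linear[OF D3]] by (simp add: hu)
    then show ?thesis using u by blast
  qed
  have kX: "\<exists>u. u \<noteq> 0 \<and> frechet_derivative F (at (s, 0)) u = 0" if "(s, 0) \<in> O1" for s
    by (rule ker[OF that hX]) simp
  have kY: "\<exists>u. u \<noteq> 0 \<and> frechet_derivative F (at (0, s)) u = 0" if "(0, s) \<in> O1" for s
    by (rule ker[OF that hY]) simp
  obtain M2 N2 \<sigma> \<sigma>' where \<sigma>: "diffeo M2 N2 \<sigma> \<sigma>'" "(0, 0) \<in> M2" "M2 \<subseteq> O1" "\<sigma> (0, 0) = (0, 0)"
    "\<forall>z\<in>M2. sharksfin_germ (\<sigma> z) = F z"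
    by (rule sharksfin_source_change[OF O1 O10 sF FX FY kX kY])
  have "A_equivalent ?f (0, 0) sharksfin_germ (\<sigma> (0, 0))"
  proof (rule A_equivalent_localI[OF h'(1,2) h0 \<sigma>(1,2) T'(1)])
    fix z assume "z \<in> M1" "z \<in> M2"
    then have "?f (h z) \<in> N3" using \<sigma>(3) by (auto simp: O1_def)
    then show "sharksfin_germ (\<sigma> z) \<in> M3 \<and> ?f (h z) = T (sharksfin_germ (\<sigma> z))"
      unfolding bspec[OF \<sigma>(5) \<open>z \<in> M2\<close>] F_def using diffeo_apply[OF diffeo_sym[OF T'(1)]] by simp
  qed
  then show ?thesis unfolding sharksfin_pt_def \<sigma>(4) .
qed

section \<open>The three surfaces\<close>

lemma standard_swallowtailE:
  assumes "w \<in> standard_swallowtail"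
  obtains u v where "w = swallowtail_map u v"
  using assms by (auto simp: standard_swallowtail_def)

lemma standard_swallowtailI: "swallowtail_map u v \<in> standard_swallowtail"
  unfolding standard_swallowtail_def by blast

definition beaks_lips_surface :: "space set" where
  "beaks_lips_surface = {bl_surface r c | r c. True}"

definition cusp_fold_surface :: "space set" where
  "cusp_fold_surface = {cf_surface s c | s c. True}"

text \<open>The a-axis is added by hand: it lies in the closure of the parametrized part but not in
  that part.\<close>

definition swallowtail_surface :: "space set" where
  "swallowtail_surface = {sw_surface r c | r c. r \<noteq> 0} \<union> {(a, 0, 0) | a. True}"

text \<open>Read off from \<open>bl_surface\<close>: \<open>3 a = 4 r^3 + 2 r (- 2 c)\<close> is the
  second coordinate of the standard swallowtail for \<open>u = r\<close>, \<open>v = - 2 c\<close>,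
  and \<open>c^2 - 3 b = 3 r^4 + r^2 (- 2 c)\<close> is then the first.\<close>

abbreviation "beaks_lips_chart \<equiv> (\<lambda>w. ((snd (snd w))\<^sup>2 - 3 * fst (snd w), 3 * fst w, - 2 * snd (snd w))) :: space \<Rightarrow> space"

text \<open>Found in the same way, with \<open>u = s\<close> and
  \<open>v = - 6/5 * c\<close>.\<close>

abbreviation "cusp_fold_chart \<equiv>
  (\<lambda>w. ((snd (snd w))\<^sup>2 / 5 - 4/5 * fst (snd w), - 8/5 * fst w, - 6/5 * snd (snd w))) :: space \<Rightarrow> space"

lemma diffeo_beaks_lips_chart:
  "diffeo UNIV UNIV beaks_lips_chart (\<lambda>w. (1/3 * fst (snd w), (snd (snd w))\<^sup>2 / 12 - 1/3 * fst w, - 1/2 * snd (snd w)))"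
  by (intro diffeo_UNIVI smooth_intros open_UNIV) (auto simp: power2_eq_square field_simps)

lemma diffeo_cusp_fold_chart:
  "diffeo UNIV UNIV cusp_fold_chart
    (\<lambda>w. (- 5/8 * fst (snd w), 25/144 * (snd (snd w))\<^sup>2 - 5/4 * fst w, - 5/6 * snd (snd w)))"
  by (intro diffeo_UNIVI smooth_intros open_UNIV) (auto simp: power2_eq_square field_simps)

lemma beaks_lips_surface_eq: "beaks_lips_surface = beaks_lips_chart -` standard_swallowtail"
proof -
  have 0: "beaks_lips_chart (bl_surface r c) = (3 * r^4 + r\<^sup>2 * (- 2 * c), 4 * r^3 + 2 * r * (- 2 * c), - 2 * c)" for r c
    by (simp add: bl_surface_def field_simps power2_eq_square power3_eq_cube power4_eq_xxxx)
  have *: "beaks_lips_chart (bl_surface r (- 1/2 * c)) = swallowtail_map r c" for r c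
    unfolding 0 by simp
  have inj: "w = w'" if "beaks_lips_chart w = beaks_lips_chart w'" for w w'
    using that by (cases w; cases w') auto
  show ?thesis
  proof (intro equalityI subsetI)
    fix w assume "w \<in> beaks_lips_surface"
    then obtain r c where w: "w = bl_surface r c" by (auto simp: beaks_lips_surface_def)
    then have "beaks_lips_chart w = swallowtail_map r (- 2 * c)" unfolding w 0 by simp
    then show "w \<in> beaks_lips_chart -` standard_swallowtail" using standard_swallowtailI by (simp only: vimage_def mem_Collect_eq)
  next
    fix w assume "w \<in> beaks_lips_chart -` standard_swallowtail"
    then have "beaks_lips_chart w \<in> standard_swallowtail" by (simp only: vimage_def mem_Collect_eq)
    then obtain r c where "beaks_lips_chart w = swallowtail_map r c" by (rule standard_swallowtailE)
    then have "w = bl_surface r (- 1/2 * c)" unfolding *[of r c, symmetric] by (rule inj)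
    then show "w \<in> beaks_lips_surface" unfolding beaks_lips_surface_def by blast
  qed
qed

lemma cusp_fold_surface_eq: "cusp_fold_surface = cusp_fold_chart -` standard_swallowtail"
proof -
  have 0: "cusp_fold_chart (cf_surface r c) = (3 * r^4 + r\<^sup>2 * (- 6/5 * c), 4 * r^3 + 2 * r * (- 6/5 * c), - 6/5 * c)" for r c
    by (simp add: cf_surface_def field_simps power2_eq_square power3_eq_cube power4_eq_xxxx)
  have *: "cusp_fold_chart (cf_surface r (- 5/6 * c)) = swallowtail_map r c" for r c
    unfolding 0 by simp
  have inj: "w = w'" if "cusp_fold_chart w = cusp_fold_chart w'" for w w'
    using that by (cases w; cases w') auto
  show ?thesis
  proof (intro equalityI subsetI)
    fix w assume "w \<in> cusp_fold_surface"
    then obtain r c where w: "w = cf_surface r c" by (auto simp: cusp_fold_surface_def)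
    then have "cusp_fold_chart w = swallowtail_map r (- 6/5 * c)" unfolding w 0 by simp
    then show "w \<in> cusp_fold_chart -` standard_swallowtail" using standard_swallowtailI by (simp only: vimage_def mem_Collect_eq)
  next
    fix w assume "w \<in> cusp_fold_chart -` standard_swallowtail"
    then have "cusp_fold_chart w \<in> standard_swallowtail" by (simp only: vimage_def mem_Collect_eq)
    then obtain r c where "cusp_fold_chart w = swallowtail_map r c" by (rule standard_swallowtailE)
    then have "w = cf_surface r (- 5/6 * c)" unfolding *[of r c, symmetric] by (rule inj)
    then show "w \<in> cusp_fold_surface" unfolding cusp_fold_surface_def by blast
  qed
qed

lemma closed_beaks_lips_surface: "closed beaks_lips_surface"
  unfolding beaks_lips_surface_eq by (intro closed_vimage closed_standard_swallowtail continuous_intros)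

lemma closed_cusp_fold_surface: "closed cusp_fold_surface"
  unfolding cusp_fold_surface_eq by (intro closed_vimage closed_standard_swallowtail continuous_intros) auto

lemma germ_diffeomorphic_refl: "germ_diffeomorphic S p S p"
proof -
  have "diffeo UNIV UNIV (\<lambda>x :: space. x) (\<lambda>x. x)" by (intro diffeo_UNIVI smooth_intros open_UNIV) auto
  then show ?thesis unfolding germ_diffeomorphic_def by (intro exI[of _ UNIV] exI[of _ "\<lambda>x. x"]) simp
qed

lemma has_A3_singularity_iff: "has_A3_singularity S p \<longleftrightarrow> germ_diffeomorphic S p standard_swallowtail 0"
  by (simp add: has_A3_singularity_def standard_swallowtail_def)

lemma beaks_lips_surface_A3: "has_A3_singularity beaks_lips_surface (0, 0, 0)"
  unfolding has_A3_singularity_iff beaks_lips_surface_eq germ_diffeomorphic_preimage_iff[OF diffeo_beaks_lips_chart]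
  using germ_diffeomorphic_refl[of standard_swallowtail 0] by (simp add: zero_prod_def)

lemma cusp_fold_surface_A3: "has_A3_singularity cusp_fold_surface (0, 0, 0)"
  unfolding has_A3_singularity_iff cusp_fold_surface_eq germ_diffeomorphic_preimage_iff[OF diffeo_cusp_fold_chart]
  using germ_diffeomorphic_refl[of standard_swallowtail 0] by (simp add: zero_prod_def)

lemma cuspidal_edge_standard_swallowtail:
  "cuspidal_edge standard_swallowtail = {(- 3 * u^4, - 8 * u^3, - 6 * u\<^sup>2) | u. u \<noteq> 0}"
  using standard_swallowtail_cuspidal_edgeD standard_swallowtail_cuspidal_edge by blast

lemma double_point_curve_standard_swallowtail:
  "double_point_curve standard_swallowtail = {(u^4, 0, - 2 * u\<^sup>2) | u. u > 0}"
  using standard_swallowtail_double_pointD standard_swallowtail_double_point by blast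

lemma cuspidal_edge_beaks_lips_surface:
  "cuspidal_edge beaks_lips_surface = {bl_surface r c | r c. r \<noteq> 0 \<and> 3 * r\<^sup>2 = c}"
proof -
  have *: "beaks_lips_chart (a, b, c) = (- 3 * u^4, - 8 * u^3, - 6 * u\<^sup>2) \<longleftrightarrow> c = 3 * u\<^sup>2 \<and> (a, b, c) = bl_surface u c" for a b c u
  proof -
    have "c\<^sup>2 - 3 * b = - 3 * u^4 \<longleftrightarrow> b = 4 * u^4" if "c = 3 * u\<^sup>2"
      unfolding that by (auto simp: power2_eq_square power4_eq_xxxx)
    moreover have "bl_surface u (3 * u\<^sup>2) = (- 8/3 * u^3, 4 * u^4, 3 * u\<^sup>2)"
      by (simp add: bl_surface_def field_simps power2_eq_square power3_eq_cube power4_eq_xxxx)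
    ultimately show ?thesis by auto
  qed
  have "w \<in> cuspidal_edge beaks_lips_surface \<longleftrightarrow> w \<in> {bl_surface r c | r c. r \<noteq> 0 \<and> 3 * r\<^sup>2 = c}" for w
  proof -
    obtain a b c where w: "w = (a, b, c)" by (cases w)
    have "w \<in> cuspidal_edge beaks_lips_surface \<longleftrightarrow> beaks_lips_chart w \<in> cuspidal_edge standard_swallowtail"
      unfolding cuspidal_edge_def beaks_lips_surface_eq mem_Collect_eq germ_diffeomorphic_preimage_iff[OF diffeo_beaks_lips_chart] ..
    also have "\<dots> \<longleftrightarrow> (\<exists>u. beaks_lips_chart (a, b, c) = (- 3 * u^4, - 8 * u^3, - 6 * u\<^sup>2) \<and> u \<noteq> 0)"
      unfolding cuspidal_edge_standard_swallowtail w by simp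
    also have "\<dots> \<longleftrightarrow> w \<in> {bl_surface r c | r c. r \<noteq> 0 \<and> 3 * r\<^sup>2 = c}"
      proof
      assume "\<exists>u. beaks_lips_chart (a, b, c) = (- 3 * u^4, - 8 * u^3, - 6 * u\<^sup>2) \<and> u \<noteq> 0"
      then obtain u where "c = 3 * u\<^sup>2" "w = bl_surface u c" "u \<noteq> 0" unfolding * w by blast
      then show "w \<in> {bl_surface r c | r c. r \<noteq> 0 \<and> 3 * r\<^sup>2 = c}" by auto
    next
      assume "w \<in> {bl_surface r c | r c. r \<noteq> 0 \<and> 3 * r\<^sup>2 = c}"
      then obtain u where u: "w = bl_surface u (3 * u\<^sup>2)" "u \<noteq> 0" by blast
      moreover from u have "c = 3 * u\<^sup>2" by (simp add: w bl_surface_def)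
      ultimately show "\<exists>u. beaks_lips_chart (a, b, c) = (- 3 * u^4, - 8 * u^3, - 6 * u\<^sup>2) \<and> u \<noteq> 0"
        unfolding * w by blast
    qed
    finally show ?thesis .
  qed
  then show ?thesis by blast
qed

lemma double_point_curve_beaks_lips_surface:
  "double_point_curve beaks_lips_surface = {(0, 0, c) | c. c > 0}"
proof -
  have *: "beaks_lips_chart (a, b, c) = (u^4, 0, - 2 * u\<^sup>2) \<longleftrightarrow> a = 0 \<and> b = 0 \<and> c = u\<^sup>2" for a b c u
  proof -
    have "c\<^sup>2 - 3 * b = u^4 \<longleftrightarrow> b = 0" if "c = u\<^sup>2"
      unfolding that by (auto simp: power2_eq_square power4_eq_xxxx)
    then show ?thesis by auto
  qed
  have "w \<in> double_point_curve beaks_lips_surface \<longleftrightarrow> w \<in> {(0, 0, c) | c. c > 0}" for w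
  proof -
    obtain a b c where w: "w = (a, b, c)" by (cases w)
    have "w \<in> double_point_curve beaks_lips_surface \<longleftrightarrow> beaks_lips_chart w \<in> double_point_curve standard_swallowtail"
      unfolding double_point_curve_def beaks_lips_surface_eq mem_Collect_eq germ_diffeomorphic_preimage_iff[OF diffeo_beaks_lips_chart] ..
    also have "\<dots> \<longleftrightarrow> (\<exists>u>0. beaks_lips_chart (a, b, c) = (u^4, 0, - 2 * u\<^sup>2))"
      unfolding double_point_curve_standard_swallowtail w by auto
    also have "\<dots> \<longleftrightarrow> a = 0 \<and> b = 0 \<and> (\<exists>u>0. c = u\<^sup>2)" unfolding * by blast
    also have "(\<exists>u>0. c = u\<^sup>2) \<longleftrightarrow> c > 0" 
      by (auto intro: exI[of _ "sqrt c"])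
    finally show ?thesis unfolding w by simp
  qed
  then show ?thesis by blast
qed

lemma cuspidal_edge_cusp_fold_surface:
  "cuspidal_edge cusp_fold_surface = {sw_surface r c | r c. r \<noteq> 0 \<and> 5 * r\<^sup>2 = c}"
proof -
  have sw: "sw_surface u (5 * u\<^sup>2) = (5 * u^3, 10 * u^4, 5 * u\<^sup>2)" if "u \<noteq> 0" for u
    using that by (simp add: sw_surface_def field_simps power2_eq_square power3_eq_cube power4_eq_xxxx)
  have *: "cusp_fold_chart (a, b, c) = (- 3 * u^4, - 8 * u^3, - 6 * u\<^sup>2) \<longleftrightarrow> (a, b, c) = (5 * u^3, 10 * u^4, 5 * u\<^sup>2)" for a b c u
  proof -
    have "c\<^sup>2 / 5 - 4/5 * b = - 3 * u^4 \<longleftrightarrow> b = 10 * u^4" if "c = 5 * u\<^sup>2"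
      unfolding that by (auto simp: power2_eq_square power4_eq_xxxx)
    then show ?thesis by auto
  qed
  have "w \<in> cuspidal_edge cusp_fold_surface \<longleftrightarrow> w \<in> {sw_surface r c | r c. r \<noteq> 0 \<and> 5 * r\<^sup>2 = c}" for w
  proof -
    obtain a b c where w: "w = (a, b, c)" by (cases w)
    have "w \<in> cuspidal_edge cusp_fold_surface \<longleftrightarrow> cusp_fold_chart w \<in> cuspidal_edge standard_swallowtail"
      unfolding cuspidal_edge_def cusp_fold_surface_eq mem_Collect_eq germ_diffeomorphic_preimage_iff[OF diffeo_cusp_fold_chart] ..
    also have "\<dots> \<longleftrightarrow> (\<exists>u. cusp_fold_chart (a, b, c) = (- 3 * u^4, - 8 * u^3, - 6 * u\<^sup>2) \<and> u \<noteq> 0)"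
      unfolding cuspidal_edge_standard_swallowtail w by simp
    also have "\<dots> \<longleftrightarrow> (\<exists>u. w = sw_surface u (5 * u\<^sup>2) \<and> u \<noteq> 0)"
      unfolding * w using sw by metis
    finally show ?thesis by blast
  qed
  then show ?thesis by blast
qed

section \<open>The parametrizations\<close>

lemma beaks_lips_param_eq: "beaks_lips_param = beaks_lips_surface"
proof (intro equalityI subsetI)
  fix w assume "w \<in> beaks_lips_param"
  then obtain \<epsilon> y c where e: "\<epsilon> \<in> {1, -1}" "c + 3 * y \<ge> 0" and w: "w = (\<epsilon> * (4 * y * sqrt (c + 3*y)), - y * (4*c + 9*y), c)"
    unfolding beaks_lips_param_def by blast
  define r where "r = \<epsilon> * sqrt (c + 3 * y)"
  have "r\<^sup>2 = c + 3 * y" using e by (auto simp: r_def power_mult_distrib)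
  then have "(r\<^sup>2 - c) / 3 = y" by simp
  then have "w = bl_surface r c" unfolding w bl_surface_def by (simp add: r_def)
  then show "w \<in> beaks_lips_surface" unfolding beaks_lips_surface_def by blast
next
  fix w assume "w \<in> beaks_lips_surface"
  then obtain r c where w: "w = bl_surface r c" by (auto simp: beaks_lips_surface_def)
  define y where "y = (r\<^sup>2 - c) / 3"
  define \<epsilon> :: real where "\<epsilon> = (if r \<ge> 0 then 1 else -1)"
  have y: "c + 3 * y = r\<^sup>2" by (simp add: y_def field_simps)
  have r: "r = \<epsilon> * sqrt (c + 3 * y)" unfolding y by (simp add: \<epsilon>_def)
  have "w = (4 * y * r, - y * (4*c + 9*y), c)" unfolding w bl_surface_def y_def by simp
  also have "\<dots> = (\<epsilon> * (4 * y * sqrt (c + 3*y)), - y * (4*c + 9*y), c)" by (subst r) simp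
  finally show "w \<in> beaks_lips_param" unfolding beaks_lips_param_def using y
    by (intro CollectI exI[of _ \<epsilon>] exI[of _ y] exI[of _ c]) (auto simp: \<epsilon>_def)
qed

lemma swallowtail_param_eq: "swallowtail_param = {sw_surface r c | r c. r \<noteq> 0}"
proof (intro equalityI subsetI)
  fix w assume "w \<in> swallowtail_param"
  then obtain \<epsilon> y c where e: "\<epsilon> \<in> {1, -1}" "c + 4 * y > 0"
    and w: "w = (\<epsilon> * (y * (4*c + 15*y) * (c + 4*y) powr (-1/2)), - 2 * y * (2*c + 5*y), c)"
    unfolding swallowtail_param_def by blast
  \<comment> \<open>The sign is reversed because \<open>sw_surface\<close> satisfies
    \<open>a * r = - y (4 c + 15 y)\<close>.\<close>
  define r where "r = - \<epsilon> * sqrt (c + 4 * y)"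
  have r2: "r\<^sup>2 = c + 4 * y" using e by (auto simp: r_def power_mult_distrib)
  have r0: "r \<noteq> 0" using e by (auto simp: r_def)
  have "\<epsilon> * (c + 4*y) powr (-1/2) = - 1 / r"
    using e by (auto simp: r_def powr_minus_divide powr_half_sqrt)
  then have "y * (4*c + 15*y) * (\<epsilon> * (c + 4*y) powr (-1/2)) = - (y * (4*c + 15*y)) / r" by simp
  then have "\<epsilon> * (y * (4*c + 15*y) * (c + 4*y) powr (-1/2)) = - (y * (4*c + 15*y)) / r" by (simp only: mult_ac)
  moreover have "(r\<^sup>2 - c) / 4 = y" using r2 by simp
  ultimately have "w = sw_surface r c" unfolding w sw_surface_def by simp
  then show "w \<in> {sw_surface r c | r c. r \<noteq> 0}" using r0 by blast
next
  fix w assume "w \<in> {sw_surface r c | r c. r \<noteq> 0}"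
  then obtain r c where w: "w = sw_surface r c" and r0: "r \<noteq> 0" by auto
  define y where "y = (r\<^sup>2 - c) / 4"
  define \<epsilon> :: real where "\<epsilon> = (if r \<ge> 0 then -1 else 1)"
  have y: "c + 4 * y = r\<^sup>2" by (simp add: y_def field_simps)
  have r: "\<epsilon> * (c + 4*y) powr (-1/2) = - 1 / r" unfolding y using r0
    by (auto simp: \<epsilon>_def powr_minus_divide powr_half_sqrt)
  have "w = (y * (4*c + 15*y) * (- 1 / r), - 2 * y * (2*c + 5*y), c)" unfolding w sw_surface_def y_def[symmetric] by simp
  also have "\<dots> = (\<epsilon> * (y * (4*c + 15*y) * (c + 4*y) powr (-1/2)), - 2 * y * (2*c + 5*y), c)"
    unfolding r[symmetric] by simp
  finally show "w \<in> swallowtail_param" unfolding swallowtail_param_def using y r0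
    by (intro CollectI exI[of _ \<epsilon>] exI[of _ y] exI[of _ c]) (auto simp: \<epsilon>_def)
qed

lemma cusp_fold_param_eq: "cusp_fold_param = {cf_surface s c | s c. s \<noteq> 0}"
proof (intro equalityI subsetI)
  fix w assume "w \<in> cusp_fold_param"
  then obtain \<epsilon> y c where e: "\<epsilon> \<in> {1, -1}" "y < 0"
    and w: "w = (\<epsilon> * (1/2 * sqrt (- y) * (3*c + 5*y)), 1/4 * (c^2 - 6*c*y - 15*y^2), c)"
    unfolding cusp_fold_param_def by blast
  define s where "s = \<epsilon> * sqrt (- y)"
  have s2: "s\<^sup>2 = - y" using e by (auto simp: s_def power_mult_distrib)
  then have s4: "s^4 = y\<^sup>2" by (metis power2_minus power2_eq_square power4_eq_xxxx mult.assoc)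
  have s0: "s \<noteq> 0" using e by (auto simp: s_def)
  have "w = cf_surface s c" unfolding w cf_surface_def s2 s4 by (simp add: s_def)
  then show "w \<in> {cf_surface s c | s c. s \<noteq> 0}" using s0 by blast
next
  fix w assume "w \<in> {cf_surface s c | s c. s \<noteq> 0}"
  then obtain s c where w: "w = cf_surface s c" and s0: "s \<noteq> 0" by auto
  define y where "y = - s\<^sup>2"
  define \<epsilon> :: real where "\<epsilon> = (if s \<ge> 0 then 1 else -1)"
  have s: "\<epsilon> * sqrt (- y) = s" by (simp add: \<epsilon>_def y_def)
  have "w = (1/2 * s * (3*c + 5*y), 1/4 * (c^2 - 6*c*y - 15*y^2), c)"
    unfolding w cf_surface_def y_def by (simp add: power2_eq_square power4_eq_xxxx)
  also have "\<dots> = (\<epsilon> * (1/2 * sqrt (- y) * (3*c + 5*y)), 1/4 * (c^2 - 6*c*y - 15*y^2), c)"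
    unfolding s[symmetric] by simp
  finally show "w \<in> cusp_fold_param" unfolding cusp_fold_param_def using s0
    by (intro CollectI exI[of _ \<epsilon>] exI[of _ y] exI[of _ c]) (auto simp: \<epsilon>_def y_def)
qed

lemma powr_three_halves:
  assumes "k > 0"
  shows "(k * r\<^sup>2) powr (3/2) = k * sqrt k * \<bar>r\<bar>^3"
proof (cases "r = 0")
  case False
  have "(k * r\<^sup>2) powr (3/2) = (k * r\<^sup>2) powr 1 * (k * r\<^sup>2) powr (1/2)" unfolding powr_add[symmetric] by simp
  also have "\<dots> = k * r\<^sup>2 * (sqrt k * \<bar>r\<bar>)" using assms False by (simp add: powr_half_sqrt real_sqrt_mult)
  also have "\<dots> = k * sqrt k * \<bar>r\<bar>^3" by (cases "r \<ge> 0") (simp_all add: power2_eq_square power3_eq_cube)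
  finally show ?thesis .
qed simp

text \<open>Setting \<open>c = k * r^2\<close> with \<open>r\<close> of sign
  \<open>\<epsilon>\<close> joins the two signed halves into one polynomial curve.\<close>

lemma cuspidal_curve_eq:
  fixes k l m :: real
  assumes "k > 0"
  shows "{(\<epsilon> * (m * c powr (3/2)), l * c\<^sup>2, c) | \<epsilon> c. \<epsilon> \<in> {1, -1} \<and> c > 0} =
    {(m * (k * sqrt k) * r^3, l * k\<^sup>2 * r^4, k * r\<^sup>2) | r. r \<noteq> 0}"
proof (intro equalityI subsetI)
  fix w assume "w \<in> {(\<epsilon> * (m * c powr (3/2)), l * c\<^sup>2, c) | \<epsilon> c. \<epsilon> \<in> {1, -1} \<and> c > 0}"
  then obtain \<epsilon> c where w: "w = (\<epsilon> * (m * c powr (3/2)), l * c\<^sup>2, c)" "\<epsilon> \<in> {1, -1}" "c > 0" by blast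
  define r where "r = \<epsilon> * sqrt (c / k)"
  have c: "c = k * r\<^sup>2" using w assms by (auto simp: r_def power_mult_distrib)
  have r3: "\<epsilon> * \<bar>r\<bar>^3 = r^3" using w assms by (auto simp: r_def)
  have "w = (m * (k * sqrt k) * (\<epsilon> * \<bar>r\<bar>^3), l * (k * r\<^sup>2)\<^sup>2, k * r\<^sup>2)"
    unfolding w c powr_three_halves[OF assms] by simp
  then have "w = (m * (k * sqrt k) * r^3, l * k\<^sup>2 * r^4, k * r\<^sup>2)"
    unfolding r3 by (simp add: power2_eq_square power4_eq_xxxx)
  moreover have "r \<noteq> 0" using w assms by (auto simp: r_def)
  ultimately show "w \<in> {(m * (k * sqrt k) * r^3, l * k\<^sup>2 * r^4, k * r\<^sup>2) | r. r \<noteq> 0}" by blast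
next
  fix w assume "w \<in> {(m * (k * sqrt k) * r^3, l * k\<^sup>2 * r^4, k * r\<^sup>2) | r. r \<noteq> 0}"
  then obtain r where w: "w = (m * (k * sqrt k) * r^3, l * k\<^sup>2 * r^4, k * r\<^sup>2)" "r \<noteq> 0" by blast
  define \<epsilon> :: real where "\<epsilon> = (if r \<ge> 0 then 1 else -1)"
  have r3: "r^3 = \<epsilon> * \<bar>r\<bar>^3" by (auto simp: \<epsilon>_def)
  have "w = (\<epsilon> * (m * (k * r\<^sup>2) powr (3/2)), l * (k * r\<^sup>2)\<^sup>2, k * r\<^sup>2)"
    unfolding w r3 powr_three_halves[OF assms] by (simp add: power2_eq_square power4_eq_xxxx)
  moreover have "\<epsilon> \<in> {1, -1}" "k * r\<^sup>2 > 0" using w assms by (auto simp: \<epsilon>_def)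
  ultimately show "w \<in> {(\<epsilon> * (m * c powr (3/2)), l * c\<^sup>2, c) | \<epsilon> c. \<epsilon> \<in> {1, -1} \<and> c > 0}" by blast
qed

text \<open>For \<open>c = 3 r^2\<close> the first coordinate of \<open>bl_surface\<close> is
  \<open>- 8/3 * r^3\<close>, hence the reflection of \<open>r\<close>; the constant agrees because
  \<open>8 / (9 * sqrt 3) * (3 * sqrt 3) = 8/3\<close>.\<close>

lemma goose_param_eq:
  "{(\<epsilon> * (8 / (9 * sqrt 3) * c powr (3/2)), 4/9 * c^2, c) | \<epsilon> c. \<epsilon> \<in> {1, -1} \<and> c > 0} =
    {bl_surface r c | r c. r \<noteq> 0 \<and> 3 * r\<^sup>2 = c}"
proof -
  have "bl_surface (- r) (3 * r\<^sup>2) = (8 / (9 * sqrt 3) * (3 * sqrt 3) * r^3, 4/9 * 3\<^sup>2 * r^4, 3 * r\<^sup>2)" for r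
    by (simp add: bl_surface_def field_simps power2_eq_square power3_eq_cube power4_eq_xxxx)
  then have "{(8 / (9 * sqrt 3) * (3 * sqrt 3) * r^3, 4/9 * 3\<^sup>2 * r^4, 3 * r\<^sup>2) | r. r \<noteq> 0} =
      {bl_surface (- r) (3 * r\<^sup>2) | r. r \<noteq> 0}" by simp
  also have "\<dots> = {bl_surface r c | r c. r \<noteq> 0 \<and> 3 * r\<^sup>2 = c}"
  proof (intro equalityI subsetI)
    fix w assume "w \<in> {bl_surface (- r) (3 * r\<^sup>2) | r. r \<noteq> 0}"
    then obtain r where "w = bl_surface (- r) (3 * r\<^sup>2)" "r \<noteq> 0" by blast
    then show "w \<in> {bl_surface r c | r c. r \<noteq> 0 \<and> 3 * r\<^sup>2 = c}"
      by (intro CollectI exI[of _ "- r"] exI[of _ "3 * r\<^sup>2"]) simp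
  next
    fix w assume "w \<in> {bl_surface r c | r c. r \<noteq> 0 \<and> 3 * r\<^sup>2 = c}"
    then obtain r where "w = bl_surface r (3 * r\<^sup>2)" "r \<noteq> 0" by blast
    then show "w \<in> {bl_surface (- r) (3 * r\<^sup>2) | r. r \<noteq> 0}" by (intro CollectI exI[of _ "- r"]) simp
  qed
  finally show ?thesis using cuspidal_curve_eq[of 3 "8 / (9 * sqrt 3)" "4/9"] by simp
qed

lemma butterfly_param_eq:
  "{(\<epsilon> * (1 / sqrt 5 * c powr (3/2)), 2/5 * c^2, c) | \<epsilon> c. \<epsilon> \<in> {1, -1} \<and> c > 0} =
    {sw_surface r c | r c. r \<noteq> 0 \<and> 5 * r\<^sup>2 = c}"
proof -
  have sw: "sw_surface r (5 * r\<^sup>2) = (1 / sqrt 5 * (5 * sqrt 5) * r^3, 2/5 * 5\<^sup>2 * r^4, 5 * r\<^sup>2)" if "r \<noteq> 0" for r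
    using that by (simp add: sw_surface_def field_simps power2_eq_square power3_eq_cube power4_eq_xxxx)
  have "{(1 / sqrt 5 * (5 * sqrt 5) * r^3, 2/5 * 5\<^sup>2 * r^4, 5 * r\<^sup>2) | r. r \<noteq> 0} = {sw_surface r c | r c. r \<noteq> 0 \<and> 5 * r\<^sup>2 = c}"
    using sw by (metis (lifting))
  then show ?thesis using cuspidal_curve_eq[of 5 "1 / sqrt 5" "2/5"] by simp
qed

section \<open>Closures of the strata\<close>

lemma tendsto_in_closure:
  assumes "(f \<longlongrightarrow> l) F" "F \<noteq> bot" "eventually (\<lambda>t. f t \<in> S) F"
  shows "l \<in> closure S"
proof (rule Lim_in_closed_set[OF closed_closure _ assms(2,1)])
  show "eventually (\<lambda>t. f t \<in> closure S) F"
    using assms(3) closure_subset by (auto elim!: eventually_mono)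
qed

lemma isCont_in_closure:
  fixes f :: "real \<Rightarrow> 'a::topological_space"
  assumes "isCont f x" "eventually (\<lambda>t. f t \<in> S) (at x)"
  shows "f x \<in> closure S"
  using assms by (intro tendsto_in_closure[of f _ "at x"]) (auto simp: isCont_def)

text \<open>Needed because the loci are known inside \<open>V\<close> only, while their closures are
  taken in the whole space.\<close>

lemma closure_Int_open_cong:
  assumes "open V" "L \<inter> V = X \<inter> V"
  shows "closure L \<inter> V = closure X \<inter> V"
proof -
  have "closure L \<inter> V \<subseteq> closure X" if "L \<inter> V = X \<inter> V" for L X
  proof -
    have "closure L \<inter> V \<subseteq> closure (V \<inter> L)" using open_Int_closure_subset[OF assms(1)] by blast
    also have "\<dots> \<subseteq> closure X" using that by (intro closure_mono) blast
    finally show ?thesis .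
  qed
  from this[OF assms(2)] this[OF assms(2)[symmetric]] show ?thesis by blast
qed

text \<open>For fixed \<open>r\<close> only two values of \<open>c\<close> are left out, and the map
  is continuous in \<open>c\<close>.\<close>

lemma closure_beaks_lips:
  "closure {bl_surface r c | r c. r\<^sup>2 \<noteq> c \<and> 3 * r\<^sup>2 \<noteq> c} = beaks_lips_surface" (is "closure ?X = _")
proof
  show "closure ?X \<subseteq> beaks_lips_surface"
    by (intro closure_minimal closed_beaks_lips_surface) (auto simp: beaks_lips_surface_def)
  show "beaks_lips_surface \<subseteq> closure ?X"
  proof
    fix w assume "w \<in> beaks_lips_surface"
    then obtain r c where w: "w = bl_surface r c" by (auto simp: beaks_lips_surface_def)
    have "isCont (bl_surface r) c" unfolding bl_surface_def by (intro continuous_intros) auto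
    moreover have "eventually (\<lambda>t. bl_surface r t \<in> ?X) (at c)"
      using eventually_neq_at_within[of "r\<^sup>2" c UNIV] eventually_neq_at_within[of "3 * r\<^sup>2" c UNIV]
    proof eventually_elim
      case (elim t)
      then show ?case by blast
    qed
    ultimately show "w \<in> closure ?X" unfolding w by (rule isCont_in_closure)
  qed
qed

lemma closure_cusp_fold_param: "closure cusp_fold_param = cusp_fold_surface"
proof
  show "closure cusp_fold_param \<subseteq> cusp_fold_surface"
    unfolding cusp_fold_param_eq by (intro closure_minimal closed_cusp_fold_surface) (auto simp: cusp_fold_surface_def)
  show "cusp_fold_surface \<subseteq> closure cusp_fold_param"
  proof
    fix w assume "w \<in> cusp_fold_surface"
    then obtain s c where w: "w = cf_surface s c" by (auto simp: cusp_fold_surface_def)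
    have "isCont (\<lambda>t. cf_surface t c) s" unfolding cf_surface_def by (intro continuous_intros) auto
    moreover have "eventually (\<lambda>t. cf_surface t c \<in> cusp_fold_param) (at s)"
      using eventually_neq_at_within[of 0 s UNIV]
    proof eventually_elim
      case (elim t)
      then show ?case unfolding cusp_fold_param_eq by blast
    qed
    ultimately show "w \<in> closure cusp_fold_param" unfolding w by (rule isCont_in_closure)
  qed
qed

lemma closure_cusp_fold:
  "closure {cf_surface s c | s c. c \<noteq> 5 * s\<^sup>2 \<and> c \<noteq> 7 * s\<^sup>2} = cusp_fold_surface" (is "closure ?X = _")
proof
  show "closure ?X \<subseteq> cusp_fold_surface"
    by (intro closure_minimal closed_cusp_fold_surface) (auto simp: cusp_fold_surface_def)
  show "cusp_fold_surface \<subseteq> closure ?X"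
  proof
    fix w assume "w \<in> cusp_fold_surface"
    then obtain s c where w: "w = cf_surface s c" by (auto simp: cusp_fold_surface_def)
    have "isCont (cf_surface s) c" unfolding cf_surface_def by (intro continuous_intros) auto
    moreover have "eventually (\<lambda>t. cf_surface s t \<in> ?X) (at c)"
      using eventually_neq_at_within[of "5 * s\<^sup>2" c UNIV] eventually_neq_at_within[of "7 * s\<^sup>2" c UNIV]
    proof eventually_elim
      case (elim t)
      then show ?case by blast
    qed
    ultimately show "w \<in> closure ?X" unfolding w by (rule isCont_in_closure)
  qed
qed

text \<open>Clearing the denominator \<open>r\<close> adds exactly the \<open>a\<close>-axis to the parametrized part.\<close>

lemma swallowtail_surface_iff:
  "(a, b, c) \<in> swallowtail_surface \<longleftrightarrow>
    (\<exists>r. b = - 2 * ((r\<^sup>2 - c) / 4) * (2 * c + 5 * ((r\<^sup>2 - c) / 4)) \<and>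
         a * r = - ((r\<^sup>2 - c) / 4) * (4 * c + 15 * ((r\<^sup>2 - c) / 4)))" (is "_ \<longleftrightarrow> (\<exists>r. ?P r)")
proof
  assume "(a, b, c) \<in> swallowtail_surface"
  then consider r where "r \<noteq> 0" "(a, b, c) = sw_surface r c" | "b = 0" "c = 0"
    by (auto simp: swallowtail_surface_def sw_surface_def)
  then show "\<exists>r. ?P r"
  proof cases
    case 1
    then show ?thesis by (intro exI[of _ r]) (simp add: sw_surface_def)
  next
    case 2
    then show ?thesis by (intro exI[of _ 0]) simp
  qed
next
  assume "\<exists>r. ?P r"
  then obtain r where r: "?P r" by blast
  show "(a, b, c) \<in> swallowtail_surface"
  proof (cases "r = 0")
    case True
    then have "c * c = 0" using r by (simp add: field_simps)
    then have "b = 0" "c = 0" using r True by auto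
    then show ?thesis by (simp add: swallowtail_surface_def)
  next
    case False
    have "a = - ((r\<^sup>2 - c) / 4) * (4 * c + 15 * ((r\<^sup>2 - c) / 4)) / r"
      unfolding conjunct2[OF r, symmetric] using False by simp
    then have "(a, b, c) = sw_surface r c" using r by (simp add: sw_surface_def)
    then show ?thesis using False unfolding swallowtail_surface_def by blast
  qed
qed

text \<open>With the denominator cleared, the equations define a closed set of pairs
  \<open>(w, r)\<close> whose projection is the surface. Over a ball of radius \<open>R\<close> the
  quadratic equation for \<open>p = (r^2 - c) / 4\<close> bounds \<open>p\<close>, hence
  \<open>r\<close>, so the projected set is compact.\<close>

lemma closed_swallowtail_surface: "closed swallowtail_surface"
proof (rule closed_if_closed_Int_cball)
  fix R :: real
  define K where "K = {z :: space \<times> real. fst (snd (fst z)) =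
      - 2 * (((snd z)\<^sup>2 - snd (snd (fst z))) / 4) * (2 * snd (snd (fst z)) + 5 * (((snd z)\<^sup>2 - snd (snd (fst z))) / 4))} \<inter>
    {z. fst (fst z) * snd z =
      - (((snd z)\<^sup>2 - snd (snd (fst z))) / 4) * (4 * snd (snd (fst z)) + 15 * (((snd z)\<^sup>2 - snd (snd (fst z))) / 4))}"
  have K: "closed K" unfolding K_def by (intro closed_Int closed_Collect_eq continuous_intros) auto
  let ?B = "cball (0 :: space) R \<times> {- (5 * R + 5)..5 * R + 5}"
  have "compact (?B \<inter> K)" by (intro compact_Int_closed compact_Times K) auto
  then have "compact (fst ` (?B \<inter> K))" by (intro compact_continuous_image continuous_intros)
  also have "fst ` (?B \<inter> K) = swallowtail_surface \<inter> cball 0 R"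
  proof (intro equalityI subsetI)
    fix w assume "w \<in> fst ` (?B \<inter> K)"
    then obtain r where r: "w \<in> cball 0 R" "(w, r) \<in> K" by auto
    obtain a b c where w: "w = (a, b, c)" by (cases w)
    show "w \<in> swallowtail_surface \<inter> cball 0 R"
      using r unfolding w K_def by (auto simp: swallowtail_surface_iff intro!: exI[of _ r])
  next
    fix w assume wS: "w \<in> swallowtail_surface \<inter> cball 0 R"
    obtain a b c where w: "w = (a, b, c)" by (cases w)
    obtain r where r: "b = - 2 * ((r\<^sup>2 - c) / 4) * (2 * c + 5 * ((r\<^sup>2 - c) / 4))"
      "a * r = - ((r\<^sup>2 - c) / 4) * (4 * c + 15 * ((r\<^sup>2 - c) / 4))"
      using wS unfolding w Int_iff swallowtail_surface_iff by blast
    have n: "norm w \<le> R" using wS by simp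
    have "\<bar>b\<bar> \<le> norm w" "\<bar>c\<bar> \<le> norm w"
      using norm_fst_le[of b c] norm_snd_le[of c b] norm_snd_le[of "(b, c)" a] unfolding w by auto
    then have bc: "\<bar>b\<bar> \<le> R" "\<bar>c\<bar> \<le> R" "0 \<le> R" using n by auto
    define p where "p = (r\<^sup>2 - c) / 4"
    have p: "10 * p\<^sup>2 = - b - 4 * c * p" using r(1) unfolding p_def[symmetric] by (simp add: algebra_simps power2_eq_square)
    have "\<bar>p\<bar> \<le> R + 1"
    proof (rule ccontr)
      assume "\<not> \<bar>p\<bar> \<le> R + 1"
      then have p1: "\<bar>p\<bar> > R + 1" by simp
      have "10 * (\<bar>p\<bar> * \<bar>p\<bar>) = - b - 4 * c * p" using p by (simp add: power2_eq_square)
      also have "\<dots> \<le> R + 4 * (R * \<bar>p\<bar>)"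
      proof -
        have "\<bar>c * p\<bar> \<le> R * \<bar>p\<bar>" unfolding abs_mult using bc by (intro mult_right_mono) auto
        then show ?thesis using bc by (auto simp: abs_le_iff)
      qed
      finally have 1: "10 * (\<bar>p\<bar> * \<bar>p\<bar>) \<le> R + 4 * (R * \<bar>p\<bar>)" .
      have 2: "(R + 1) * \<bar>p\<bar> \<le> \<bar>p\<bar> * \<bar>p\<bar>" using p1 by (intro mult_right_mono) auto
      have 3: "R * \<bar>p\<bar> \<ge> 0" using bc by simp
      have "(R + 1) * \<bar>p\<bar> = R * \<bar>p\<bar> + \<bar>p\<bar>" by (simp add: algebra_simps)
      then show False using 1 2 3 p1 bc by linarith
    qed
    moreover have "r\<^sup>2 = c + 4 * p" by (simp add: p_def field_simps)
    ultimately have "r\<^sup>2 \<le> 5 * R + 4" using bc by (auto simp: abs_le_iff)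
    also have "\<dots> \<le> (5 * R + 5)\<^sup>2"
    proof -
      have "(5 * R + 5) * 1 \<le> (5 * R + 5) * (5 * R + 5)" using bc by (intro mult_left_mono) auto
      then show ?thesis by (simp add: power2_eq_square)
    qed
    finally have "\<bar>r\<bar> \<le> 5 * R + 5" using bc by (simp add: abs_le_square_iff[symmetric])
    then have "(w, r) \<in> ?B" using n by (simp add: abs_le_iff)
    moreover have "(w, r) \<in> K" unfolding K_def w Int_iff mem_Collect_eq fst_conv snd_conv using r by blast
    ultimately have "(w, r) \<in> ?B \<inter> K" by blast
    then show "w \<in> fst ` (?B \<inter> K)" by force
  qed
  finally show "closed (swallowtail_surface \<inter> cball 0 R)" by (rule compact_imp_closed)
qed

text \<open>A parametrization by \<open>m = (r\<^sup>2 - c) / 4\<close> and \<open>\<rho> = m\<^sup>2 / r\<close>, smooth along the \<open>a\<close>-axis \<open>m = 0\<close>.\<close>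

abbreviation "swallowtail_axis_chart \<rho> m \<equiv>
  (\<rho> - 4 * m^3 / \<rho>, 6 * m\<^sup>2 - 4 * m * (m\<^sup>2 / \<rho>)\<^sup>2, (m\<^sup>2 / \<rho>)\<^sup>2 - 4 * m) :: space"

lemma swallowtail_axis_chart:
  assumes "\<rho> \<noteq> 0" "m \<noteq> 0"
  shows "swallowtail_axis_chart \<rho> m = sw_surface (m\<^sup>2 / \<rho>) ((m\<^sup>2 / \<rho>)\<^sup>2 - 4 * m)"
proof -
  define r where "r = m\<^sup>2 / \<rho>"
  have r: "r \<noteq> 0" "\<rho> = m\<^sup>2 / r" using assms by (auto simp: r_def)
  have "\<rho> - 4 * m^3 / \<rho> = - m * (4 * (r\<^sup>2 - 4 * m) + 15 * m) / r"
    using r(1) assms(2) unfolding r(2) by (simp add: field_simps power2_eq_square power3_eq_cube)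
  moreover have "(r\<^sup>2 - (r\<^sup>2 - 4 * m)) / 4 = m" by simp
  moreover have "6 * m\<^sup>2 - 4 * m * r\<^sup>2 = - 2 * m * (2 * (r\<^sup>2 - 4 * m) + 5 * m)" by (simp add: algebra_simps power2_eq_square)
  ultimately show ?thesis unfolding sw_surface_def r_def[symmetric] by simp
qed

text \<open>Points with \<open>r \<noteq> 0\<close> are limits in the variable \<open>c\<close>. A
  point \<open>(a, 0, 0)\<close> with \<open>a \<noteq> 0\<close> is the limit of the chart with
  \<open>\<rho> = a\<close> as \<open>m\<close> tends to 0, and the origin is a limit of such
  points.\<close>

lemma closure_swallowtail_generic:
  "closure {sw_surface r c | r c. r \<noteq> 0 \<and> r\<^sup>2 \<noteq> c \<and> 5 * r\<^sup>2 \<noteq> c} = swallowtail_surface" (is "closure ?X = _")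
proof
  show "closure ?X \<subseteq> swallowtail_surface"
    by (intro closure_minimal closed_swallowtail_surface) (auto simp: swallowtail_surface_def)
  have gen: "sw_surface r c \<in> closure ?X" if r: "r \<noteq> 0" for r c
  proof -
    have "isCont (sw_surface r) c" unfolding sw_surface_def using r by (intro continuous_intros) auto
    moreover have "eventually (\<lambda>t. sw_surface r t \<in> ?X) (at c)"
      using eventually_neq_at_within[of "r\<^sup>2" c UNIV] eventually_neq_at_within[of "5 * r\<^sup>2" c UNIV]
    proof eventually_elim
      case (elim t)
      then show ?case using r by blast
    qed
    ultimately show ?thesis by (rule isCont_in_closure)
  qed
  have gena: "(a, 0, 0) \<in> closure ?X" if a: "a \<noteq> 0" for a
  proof -
    have "isCont (swallowtail_axis_chart a) 0" using a by (intro continuous_intros) auto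
    moreover have "eventually (\<lambda>m. swallowtail_axis_chart a m \<in> closure ?X) (at 0)"
      using eventually_neq_at_within[of 0 0 UNIV]
    proof eventually_elim
      case (elim m)
      then show ?case unfolding swallowtail_axis_chart[OF a elim] using a by (intro gen) simp
    qed
    ultimately have "swallowtail_axis_chart a 0 \<in> closure (closure ?X)" by (rule isCont_in_closure)
    then show ?thesis by simp
  qed
  have gen0: "(0, 0, 0) \<in> closure ?X"
  proof -
    have "isCont (\<lambda>t :: real. (t, 0 :: real, 0 :: real)) 0" by (intro continuous_intros)
    moreover have "eventually (\<lambda>t :: real. (t, 0, 0) \<in> closure ?X) (at 0)"
      using eventually_neq_at_within[of 0 0 UNIV] by (rule eventually_mono) (rule gena)
    ultimately have "(0, 0, 0) \<in> closure (closure ?X)" by (rule isCont_in_closure)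
    then show ?thesis by simp
  qed
  show "swallowtail_surface \<subseteq> closure ?X"
  proof
    fix w assume "w \<in> swallowtail_surface"
    then consider r c where "w = sw_surface r c" "r \<noteq> 0" | a where "w = (a, 0, 0)"
      unfolding swallowtail_surface_def by blast
    then show "w \<in> closure ?X"
    proof cases
      case (1 r c)
      show ?thesis unfolding 1(1) by (rule gen[OF 1(2)])
    next
      case (2 a)
      show ?thesis unfolding 2 by (cases "a = 0") (use gen0 gena in simp_all)
    qed
  qed
qed

lemma closure_swallowtail:
  "closure ({sw_surface r c | r c. r \<noteq> 0 \<and> r\<^sup>2 \<noteq> c \<and> 5 * r\<^sup>2 \<noteq> c} \<union> {(a, 0, 0) | a. a \<noteq> 0}) = swallowtail_surface"
  (is "closure (?X \<union> ?Y) = _")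
proof
  show "closure (?X \<union> ?Y) \<subseteq> swallowtail_surface"
    by (intro closure_minimal closed_swallowtail_surface) (auto simp: swallowtail_surface_def)
  show "swallowtail_surface \<subseteq> closure (?X \<union> ?Y)"
    unfolding closure_swallowtail_generic[symmetric] by (intro closure_mono) blast
qed

lemma closure_swallowtail_param: "closure swallowtail_param = swallowtail_surface"
proof
  show "closure swallowtail_param \<subseteq> swallowtail_surface"
    unfolding swallowtail_param_eq by (intro closure_minimal closed_swallowtail_surface) (auto simp: swallowtail_surface_def)
  show "swallowtail_surface \<subseteq> closure swallowtail_param"
    unfolding closure_swallowtail_generic[symmetric] swallowtail_param_eq by (intro closure_mono) blast
qed

section \<open>The special curves on the surfaces\<close>

text \<open>Removing parameters amounts to removing points only if no removed point has another
  admissible parameter. On the goose curve \<open>b\<close>, as a quadratic in \<open>y\<close>, has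
  a double root, so \<open>y\<close> is unique; on the axis \<open>a = b = 0\<close> only excluded
  parameters occur.\<close>

lemma beaks_lips_strata:
  "{bl_surface r c | r c. r\<^sup>2 \<noteq> c \<and> 3 * r\<^sup>2 \<noteq> c} =
    beaks_lips_surface - ({(0, 0, c) | c. c > 0} \<union> {bl_surface r c | r c. r \<noteq> 0 \<and> 3 * r\<^sup>2 = c} \<union> {(0, 0, 0)})"
  (is "?X = _ - (?A \<union> ?B \<union> _)")
proof (intro equalityI subsetI)
  fix w assume "w \<in> ?X"
  then obtain r c where w: "w = bl_surface r c" and n: "r\<^sup>2 \<noteq> c" "3 * r\<^sup>2 \<noteq> c" by blast
  have 0: "w \<noteq> (0, 0, d)" for d
  proof
    assume "w = (0, 0, d)"
    then have "r = 0" "c + 3 * r\<^sup>2 = 0" using n(1) by (auto simp: w bl_surface_def field_simps)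
    then show False using n by auto
  qed
  moreover have "w \<notin> ?B"
  proof
    assume "w \<in> ?B"
    then obtain t where t: "w = bl_surface t (3 * t\<^sup>2)" by blast
    then have c: "c = 3 * t\<^sup>2" by (simp add: w bl_surface_def)
    define y z where "y = (r\<^sup>2 - c) / 3" and "z = (t\<^sup>2 - c) / 3"
    have "- y * (4 * c + 9 * y) = - z * (4 * c + 9 * z)"
      using t unfolding w c[symmetric] bl_surface_def y_def[symmetric] z_def[symmetric] by simp
    moreover have "9 * z = - 2 * c" by (simp add: z_def c)
    ultimately have "9 * (y - z)\<^sup>2 = 0" by algebra
    then have "y = z" by simp
    then show False using n(2) c by (simp add: y_def z_def)
  qed
  moreover have "w \<in> beaks_lips_surface" unfolding w beaks_lips_surface_def by blast
  ultimately show "w \<in> beaks_lips_surface - (?A \<union> ?B \<union> {(0, 0, 0)})" by blast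
next
  fix w assume w0: "w \<in> beaks_lips_surface - (?A \<union> ?B \<union> {(0, 0, 0)})"
  then obtain r c where w: "w = bl_surface r c" by (auto simp: beaks_lips_surface_def)
  have "r\<^sup>2 \<noteq> c"
  proof
    assume "r\<^sup>2 = c"
    then have "w = (0, 0, c)" "c \<ge> 0" by (auto simp: w bl_surface_def)
    then show False using w0 by (cases "c = 0") auto
  qed
  moreover have "3 * r\<^sup>2 \<noteq> c"
  proof
    assume c: "3 * r\<^sup>2 = c"
    then have "r = 0" using w0 w by blast
    then have "w = (0, 0, 0)" using c by (simp add: w bl_surface_def)
    then show False using w0 by blast
  qed
  ultimately show "w \<in> ?X" using w by blast
qed

text \<open>As for beaks/lips, \<open>b\<close> as a quadratic in \<open>y\<close> has a double root
  on the butterfly curve, so no generic parameter reaches it. The a-axis without the origin belongs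
  to the stratum.\<close>

lemma swallowtail_strata:
  "{sw_surface r c | r c. r \<noteq> 0 \<and> r\<^sup>2 \<noteq> c \<and> 5 * r\<^sup>2 \<noteq> c} \<union> {(a, 0, 0) | a. a \<noteq> 0} =
    swallowtail_surface - ({(0, 0, c) | c. c > 0} \<union> {sw_surface r c | r c. r \<noteq> 0 \<and> 5 * r\<^sup>2 = c} \<union> {(0, 0, 0)})"
  (is "?X \<union> ?Y = _ - (?A \<union> ?B \<union> _)")
proof (intro equalityI subsetI)
  fix w assume "w \<in> ?X \<union> ?Y"
  then consider r c where "w = sw_surface r c" "r \<noteq> 0" "r\<^sup>2 \<noteq> c" "5 * r\<^sup>2 \<noteq> c" | a where "w = (a, 0, 0)" "a \<noteq> 0" by blast
  then show "w \<in> swallowtail_surface - (?A \<union> ?B \<union> {(0, 0, 0)})"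
  proof cases
    case (1 r c)
    have 0: "w \<noteq> (0, 0, d)" for d
    proof
      assume "w = (0, 0, d)"
      define y where "y = (r\<^sup>2 - c) / 4"
      have "y \<noteq> 0" using 1(3) by (simp add: y_def)
      then have "4 * c + 15 * y = 0" "2 * c + 5 * y = 0"
        using \<open>w = (0, 0, d)\<close> 1(2) unfolding 1(1) sw_surface_def y_def[symmetric] by auto
      then show False using \<open>y \<noteq> 0\<close> by simp
    qed
    moreover have "w \<notin> ?B"
    proof
      assume "w \<in> ?B"
      then obtain t where t: "w = sw_surface t (5 * t\<^sup>2)" by blast
      then have c: "c = 5 * t\<^sup>2" by (simp add: 1(1) sw_surface_def)
      define y z where "y = (r\<^sup>2 - c) / 4" and "z = (t\<^sup>2 - c) / 4"
      have "- 2 * y * (2 * c + 5 * y) = - 2 * z * (2 * c + 5 * z)"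
        using t unfolding 1(1) c[symmetric] sw_surface_def y_def[symmetric] z_def[symmetric] by simp
      moreover have "5 * z = - c" by (simp add: z_def c)
      ultimately have "10 * (y - z)\<^sup>2 = 0" by algebra
      then have "y = z" by simp
      then show False using 1(4) c by (simp add: y_def z_def)
    qed
    moreover have "w \<in> swallowtail_surface" unfolding 1(1) swallowtail_surface_def using 1(2) by blast
    ultimately show ?thesis by blast
  next
    case (2 a)
    have "w \<notin> ?B" using 2 by (auto simp: sw_surface_def)
    then show ?thesis using 2 by (auto simp: swallowtail_surface_def)
  qed
next
  fix w assume w0: "w \<in> swallowtail_surface - (?A \<union> ?B \<union> {(0, 0, 0)})"
  then consider r c where "w = sw_surface r c" "r \<noteq> 0" | a where "w = (a, 0, 0)"
    unfolding swallowtail_surface_def by blast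
  then show "w \<in> ?X \<union> ?Y"
  proof cases
    case (1 r c)
    have "r\<^sup>2 \<noteq> c"
    proof
      assume "r\<^sup>2 = c"
      then have "w = (0, 0, c)" "c > 0" using 1(2) by (auto simp: 1(1) sw_surface_def)
      then show False using w0 by blast
    qed
    moreover have "5 * r\<^sup>2 \<noteq> c" using w0 1 by blast
    ultimately show ?thesis using 1 by blast
  next
    case (2 a)
    then show ?thesis using w0 by (cases "a = 0") auto
  qed
qed

lemma butterfly_curve_point:
  "r \<noteq> 0 \<Longrightarrow> sw_surface r (5 * r\<^sup>2) = (5 * r^3, 10 * r^4, 5 * r\<^sup>2)"
  by (simp add: sw_surface_def field_simps power2_eq_square power3_eq_cube power4_eq_xxxx)

lemma butterfly_curve_eq:
  "{sw_surface r c | r c. r \<noteq> 0 \<and> 5 * r\<^sup>2 = c} = {cf_surface s c | s c. s \<noteq> 0 \<and> c = 5 * s\<^sup>2}"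
proof -
  have "cf_surface r (5 * r\<^sup>2) = (5 * r^3, 10 * r^4, 5 * r\<^sup>2)" for r
    by (simp add: cf_surface_def field_simps power2_eq_square power3_eq_cube power4_eq_xxxx)
  then have e: "sw_surface r (5 * r\<^sup>2) = cf_surface r (5 * r\<^sup>2)" if "r \<noteq> 0" for r
    using butterfly_curve_point[OF that] by simp
  show ?thesis
  proof (intro equalityI subsetI)
    fix w assume "w \<in> {sw_surface r c | r c. r \<noteq> 0 \<and> 5 * r\<^sup>2 = c}"
    then obtain r where "w = sw_surface r (5 * r\<^sup>2)" "r \<noteq> 0" by blast
    then have "w = cf_surface r (5 * r\<^sup>2)" "r \<noteq> 0" using e by simp_all
    then show "w \<in> {cf_surface s c | s c. s \<noteq> 0 \<and> c = 5 * s\<^sup>2}" by blast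
  next
    fix w assume "w \<in> {cf_surface s c | s c. s \<noteq> 0 \<and> c = 5 * s\<^sup>2}"
    then obtain r where "w = cf_surface r (5 * r\<^sup>2)" "r \<noteq> 0" by blast
    then have "w = sw_surface r (5 * r\<^sup>2)" "r \<noteq> 0" using e by simp_all
    then show "w \<in> {sw_surface r c | r c. r \<noteq> 0 \<and> 5 * r\<^sup>2 = c}" by blast
  qed
qed

text \<open>On the butterfly curve \<open>b\<close>, as a quadratic in \<open>s^2\<close>, has a
  double root. On the curve \<open>c = 7 t^2\<close> it has a second root
  \<open>s^2 = 9/5 * t^2\<close>, which the first coordinate excludes.\<close>

lemma cusp_fold_strata:
  "{cf_surface s c | s c. c \<noteq> 5 * s\<^sup>2 \<and> c \<noteq> 7 * s\<^sup>2} =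
    cusp_fold_surface - ({sw_surface r c | r c. r \<noteq> 0 \<and> 5 * r\<^sup>2 = c} \<union> {cf_surface s c | s c. s \<noteq> 0 \<and> c = 7 * s\<^sup>2} \<union> {(0, 0, 0)})"
  (is "?X = _ - (_ \<union> ?B \<union> _)")
  unfolding butterfly_curve_eq
proof (intro equalityI subsetI)
  fix w assume "w \<in> ?X"
  then obtain s c where w: "w = cf_surface s c" and n: "c \<noteq> 5 * s\<^sup>2" "c \<noteq> 7 * s\<^sup>2" by blast
  have "w \<noteq> (0, 0, 0)"
  proof
    assume "w = (0, 0, 0)"
    then have "c = 0" "s = 0 \<or> 3 * c = 5 * s\<^sup>2" by (auto simp: w cf_surface_def)
    then show False using n by auto
  qed
  moreover have "w \<notin> {cf_surface s c | s c. s \<noteq> 0 \<and> c = 5 * s\<^sup>2}"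
  proof
    assume "w \<in> {cf_surface s c | s c. s \<noteq> 0 \<and> c = 5 * s\<^sup>2}"
    then obtain t where t: "w = cf_surface t (5 * t\<^sup>2)" by blast
    then have c: "c = 5 * t\<^sup>2" by (simp add: w cf_surface_def)
    have "6 * c * s\<^sup>2 - 15 * s^4 = 6 * c * t\<^sup>2 - 15 * t^4"
      using t unfolding w c[symmetric] by (simp add: cf_surface_def)
    then have "15 * (s\<^sup>2 - t\<^sup>2)\<^sup>2 = 0" unfolding c by algebra
    then show False using n(1) c by simp
  qed
  moreover have "w \<notin> ?B"
  proof
    assume "w \<in> ?B"
    then obtain t where t: "w = cf_surface t (7 * t\<^sup>2)" "t \<noteq> 0" by blast
    then have c: "c = 7 * t\<^sup>2" by (simp add: w cf_surface_def)
    have "6 * c * s\<^sup>2 - 15 * s^4 = 6 * c * t\<^sup>2 - 15 * t^4" "s * (3 * c - 5 * s\<^sup>2) = t * (3 * c - 5 * t\<^sup>2)"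
      using t(1) unfolding w c[symmetric] by (simp_all add: cf_surface_def)
    then have e: "3 * (s\<^sup>2 - t\<^sup>2) * (5 * s\<^sup>2 - 9 * t\<^sup>2) = 0" "s\<^sup>2 * (3 * c - 5 * s\<^sup>2)\<^sup>2 = t\<^sup>2 * (3 * c - 5 * t\<^sup>2)\<^sup>2"
      unfolding c by algebra+
    have "s\<^sup>2 \<noteq> t\<^sup>2" using n(2) c by simp
    then have s2: "s\<^sup>2 = 9/5 * t\<^sup>2" using e(1) by simp
    have "(t\<^sup>2)^3 = 0" using e(2) unfolding c s2 by (simp add: power2_eq_square power3_eq_cube)
    then show False using t(2) by simp
  qed
  moreover have "w \<in> cusp_fold_surface" unfolding w cusp_fold_surface_def by blast
  ultimately show "w \<in> cusp_fold_surface - ({cf_surface s c | s c. s \<noteq> 0 \<and> c = 5 * s\<^sup>2} \<union> ?B \<union> {(0, 0, 0)})" by blast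
next
  fix w assume w0: "w \<in> cusp_fold_surface - ({cf_surface s c | s c. s \<noteq> 0 \<and> c = 5 * s\<^sup>2} \<union> ?B \<union> {(0, 0, 0)})"
  then obtain s c where w: "w = cf_surface s c" by (auto simp: cusp_fold_surface_def)
  have "c \<noteq> 5 * s\<^sup>2 \<and> c \<noteq> 7 * s\<^sup>2"
  proof (rule ccontr)
    assume c: "\<not> (c \<noteq> 5 * s\<^sup>2 \<and> c \<noteq> 7 * s\<^sup>2)"
    then have "s = 0" using w0 w by blast
    then have "w = (0, 0, 0)" using c by (auto simp: w cf_surface_def)
    then show False using w0 by blast
  qed
  then show "w \<in> ?X" using w by blast
qed

section \<open>Separation of the three components near the origin\<close>

lemma beaks_lips_surface_axis: "(0, b, c) \<in> beaks_lips_surface \<Longrightarrow> b = 0 \<or> b = c\<^sup>2 / 3"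
  by (auto simp: beaks_lips_surface_def bl_surface_def power2_eq_square field_simps)

lemma beaks_lips_surface_axisI: "(0, c\<^sup>2 / 3, c) \<in> beaks_lips_surface"
proof -
  have "(0, c\<^sup>2 / 3, c) = bl_surface 0 c" by (simp add: bl_surface_def power2_eq_square field_simps)
  then show ?thesis unfolding beaks_lips_surface_def by blast
qed

lemma swallowtail_surface_axis:
  assumes "(0, b, c) \<in> swallowtail_surface"
  shows "b = 0 \<or> b = 16/45 * c\<^sup>2"
proof -
  obtain r where r: "b = - 2 * ((r\<^sup>2 - c) / 4) * (2 * c + 5 * ((r\<^sup>2 - c) / 4))"
      "0 * r = - ((r\<^sup>2 - c) / 4) * (4 * c + 15 * ((r\<^sup>2 - c) / 4))"
    using assms unfolding swallowtail_surface_iff by blast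
  have "r\<^sup>2 - c = 0 \<or> 4 * c + 15 * ((r\<^sup>2 - c) / 4) = 0" using r(2) by auto
  then consider "(r\<^sup>2 - c) / 4 = 0" | "(r\<^sup>2 - c) / 4 = - 4/15 * c" by (auto simp: field_simps)
  then show ?thesis
  proof cases
    case 1
    then show ?thesis using r(1) by simp
  next
    case 2
    show ?thesis using r(1) unfolding 2 by (simp add: power2_eq_square)
  qed
qed

lemma swallowtail_surface_axisI: "c < 0 \<Longrightarrow> (0, 16/45 * c\<^sup>2, c) \<in> swallowtail_surface"
  unfolding swallowtail_surface_iff
  by (intro exI[of _ "sqrt (- c / 15)"]) (simp add: power2_eq_square field_simps)

lemma sharksfin_in_swallowtail_surface:
  assumes "c \<ge> 0"
  shows "(0, 0, c) \<in> swallowtail_surface"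
  unfolding swallowtail_surface_iff using assms by (intro exI[of _ "sqrt c"]) simp

lemma cusp_fold_surface_le: "(a, b, c) \<in> cusp_fold_surface \<Longrightarrow> c \<le> 0 \<Longrightarrow> b \<le> c\<^sup>2 / 4"
proof -
  assume "(a, b, c) \<in> cusp_fold_surface" and c: "c \<le> 0"
  then obtain s where b: "b = 1/4 * (c\<^sup>2 + 6 * c * s\<^sup>2 - 15 * s^4)" by (auto simp: cusp_fold_surface_def cf_surface_def)
  have "c * s\<^sup>2 \<le> 0" using c by (simp add: mult_nonpos_nonneg)
  moreover have "0 \<le> s^4" by simp
  moreover have "b = c\<^sup>2 / 4 + 3/2 * (c * s\<^sup>2) - 15/4 * s^4" unfolding b by (simp add: field_simps)
  ultimately show "b \<le> c\<^sup>2 / 4" by linarith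
qed

lemma cusp_fold_surface_axisI: "(0, c\<^sup>2 / 4, c) \<in> cusp_fold_surface"
proof -
  have "(0, c\<^sup>2 / 4, c) = cf_surface 0 c" by (simp add: cf_surface_def)
  then show ?thesis unfolding cusp_fold_surface_def by blast
qed

text \<open>In the half-plane \<open>a = 0\<close>, \<open>c < 0\<close> the beaks/lips surface lies
  in \<open>b = 0\<close> or \<open>b = c^2 / 3\<close>, the swallowtail surface in
  \<open>b = 0\<close> or \<open>b = 16/45 * c^2\<close>, and the cusp+fold surface in
  \<open>b \<le> c^2 / 4\<close>. Test points on these parabolas show that no component is contained
  in the other two near the origin.\<close>

lemma surfaces_axis:
  assumes "c < 0"
  shows "(0, c\<^sup>2 / 3, c) \<in> beaks_lips_surface - (swallowtail_surface \<union> cusp_fold_surface)"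
    "(0, 16/45 * c\<^sup>2, c) \<in> swallowtail_surface - (beaks_lips_surface \<union> cusp_fold_surface)"
    "(0, c\<^sup>2 / 4, c) \<in> cusp_fold_surface - (beaks_lips_surface \<union> swallowtail_surface)"
proof -
  have c2: "c\<^sup>2 > 0" using assms by simp
  have cf: "(0, b, c) \<notin> cusp_fold_surface" if "b > c\<^sup>2 / 4" for b
    using cusp_fold_surface_le[of 0 b c] assms that by auto
  show "(0, c\<^sup>2 / 3, c) \<in> beaks_lips_surface - (swallowtail_surface \<union> cusp_fold_surface)"
    using beaks_lips_surface_axisI swallowtail_surface_axis[of "c\<^sup>2 / 3" c] cf[of "c\<^sup>2 / 3"] c2 by auto
  show "(0, 16/45 * c\<^sup>2, c) \<in> swallowtail_surface - (beaks_lips_surface \<union> cusp_fold_surface)"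
    using swallowtail_surface_axisI[OF assms] beaks_lips_surface_axis[of "16/45 * c\<^sup>2" c] cf[of "16/45 * c\<^sup>2"] c2 by auto
  show "(0, c\<^sup>2 / 4, c) \<in> cusp_fold_surface - (beaks_lips_surface \<union> swallowtail_surface)"
    using cusp_fold_surface_axisI beaks_lips_surface_axis[of "c\<^sup>2 / 4" c] swallowtail_surface_axis[of "c\<^sup>2 / 4" c] c2 by auto
qed

section \<open>The cuspidal edge of the swallowtail component\<close>

lemma has_derivative_triple:
  fixes f g h :: "real \<Rightarrow> real"
  assumes "(f has_field_derivative f') (at 0)" "(g has_field_derivative g') (at 0)" "(h has_field_derivative h') (at 0)"
  shows "((\<lambda>t. (f t, g t, h t)) has_derivative (\<lambda>t. t *\<^sub>R (f', g', h'))) (at 0)"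
  using has_derivative_Pair[OF assms(1)[unfolded has_field_derivative_def]
      has_derivative_Pair[OF assms(2)[unfolded has_field_derivative_def] assms(3)[unfolded has_field_derivative_def]]]
  by (simp add: mult.commute)

text \<open>The velocities in \<open>r\<close> and in \<open>c\<close>. Their third components are 0
  and 1, and the second component of the former vanishes only for \<open>5 r^2 = c\<close>; off the
  butterfly curve they are therefore independent.\<close>

lemma swallowtail_surface_curves:
  assumes r: "r \<noteq> 0"
  shows "\<exists>v. curve_in swallowtail_surface (sw_surface r c) (v, - (r / 2) * (5 * r\<^sup>2 - c), 0)"
    "\<exists>v w. curve_in swallowtail_surface (sw_surface r c) (v, w, 1)"
proof -
  define A B where "A s c = - ((s\<^sup>2 - c) / 4) * (4 * c + 15 * ((s\<^sup>2 - c) / 4)) / s"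
    and "B s c = - 2 * ((s\<^sup>2 - c) / 4) * (2 * c + 5 * ((s\<^sup>2 - c) / 4))" for s c :: real
  have sw: "sw_surface s c = (A s c, B s c, c)" for s c by (simp add: sw_surface_def A_def B_def)
  have "(\<lambda>t. A (r + t) c) differentiable (at 0)"
    unfolding A_def using r by (intro derivative_intros) auto
  then obtain v where v: "((\<lambda>t. A (r + t) c) has_field_derivative v) (at 0)" by (auto simp: real_differentiable_def)
  have "((\<lambda>t. B (r + t) c) has_field_derivative - (r / 2) * (5 * r\<^sup>2 - c)) (at 0)"
    unfolding B_def by (auto intro!: derivative_eq_intros simp: field_simps power2_eq_square)
  from has_derivative_triple[OF v this DERIV_const]
  have "((\<lambda>t. sw_surface (r + t) c) has_derivative (\<lambda>t. t *\<^sub>R (v, - (r / 2) * (5 * r\<^sup>2 - c), 0))) (at 0)"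
    unfolding sw .
  moreover have "eventually (\<lambda>t. sw_surface (r + t) c \<in> swallowtail_surface) (at 0)"
    using eventually_neq_at_within[of "- r" 0 UNIV]
  proof eventually_elim
    case (elim t)
    then have "r + t \<noteq> 0" by auto
    then show ?case unfolding swallowtail_surface_def by blast
  qed
  ultimately show "\<exists>v. curve_in swallowtail_surface (sw_surface r c) (v, - (r / 2) * (5 * r\<^sup>2 - c), 0)"
    unfolding curve_in_def by (intro exI[of _ v] exI[of _ "\<lambda>t. sw_surface (r + t) c"]) simp
  have "(\<lambda>t. A r (c + t)) differentiable (at 0)" "(\<lambda>t. B r (c + t)) differentiable (at 0)"
    unfolding A_def B_def using r by (intro derivative_intros; auto)+
  then obtain v w where vw: "((\<lambda>t. A r (c + t)) has_field_derivative v) (at 0)" "((\<lambda>t. B r (c + t)) has_field_derivative w) (at 0)"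
    by (auto simp: real_differentiable_def)
  have "((\<lambda>t. c + t) has_field_derivative 1) (at 0)" by (auto intro!: derivative_eq_intros)
  from has_derivative_triple[OF vw this]
  have "((\<lambda>t. sw_surface r (c + t)) has_derivative (\<lambda>t. t *\<^sub>R (v, w, 1))) (at 0)" unfolding sw .
  moreover have "sw_surface r (c + t) \<in> swallowtail_surface" for t using r unfolding swallowtail_surface_def by blast
  ultimately show "\<exists>v w. curve_in swallowtail_surface (sw_surface r c) (v, w, 1)"
    unfolding curve_in_def by (intro exI[of _ v] exI[of _ w] exI[of _ "\<lambda>t. sw_surface r (c + t)"]) simp
qed

lemma swallowtail_surface_axis_curve1: "curve_in swallowtail_surface (a, 0, 0) (1, 0, 0)"
proof -
  have "((\<lambda>t. a + t) has_field_derivative 1) (at 0)" by (auto intro!: derivative_eq_intros)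
  then have "((\<lambda>t. (a + t, 0, 0) :: space) has_derivative (\<lambda>t. t *\<^sub>R (1, 0, 0))) (at (0 :: real))"
    by (intro has_derivative_triple DERIV_const)
  then show ?thesis
    by (intro curve_inI[of "\<lambda>t. (a + t, 0, 0)"]) (simp_all add: swallowtail_surface_def)
qed

lemma swallowtail_surface_axis_curve2:
  assumes "a \<noteq> 0"
  shows "curve_in swallowtail_surface (a, 0, 0) (0, 0, - 4)"
proof (rule curve_inI[of "swallowtail_axis_chart a"])
  show "(swallowtail_axis_chart a has_derivative (\<lambda>t. t *\<^sub>R (0, 0, - 4))) (at 0)"
    using assms by (intro has_derivative_triple) (auto intro!: derivative_eq_intros)
  show "swallowtail_axis_chart a t \<in> swallowtail_surface" for t
  proof (cases "t = 0")
    case False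
    have "t\<^sup>2 / a \<noteq> 0" using assms False by simp
    then show ?thesis unfolding swallowtail_axis_chart[OF assms False] swallowtail_surface_def by blast
  qed (simp add: swallowtail_surface_def)
qed simp

text \<open>Glued from two arcs tangent to each other: the sharksfin half-axis for
  \<open>t \<ge> 0\<close> and \<open>(0, 16/45 * t^2, t)\<close> for \<open>t < 0\<close>. The
  factor \<open>t * min t 0\<close> is \<open>t^2\<close> on the negative side and 0 on the
  other.\<close>

lemma swallowtail_surface_origin_curve: "curve_in swallowtail_surface (0, 0, 0) (0, 0, 1)"
proof (rule curve_inI[of "\<lambda>t. (0, 16/45 * (t * min t 0), t)"])
  have "((\<lambda>t :: real. t *\<^sub>R min t 0) has_derivative (\<lambda>h. h *\<^sub>R min 0 0)) (at 0)"
    by (intro has_derivative_vanishing_scaleR has_derivative_ident continuous_intros) auto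
  then have "((\<lambda>t :: real. t * min t 0) has_field_derivative 0) (at 0)"
    by (simp add: has_field_derivative_def lambda_zero)
  then have "((\<lambda>t :: real. 16/45 * (t * min t 0)) has_field_derivative 16/45 * 0) (at 0)" by (rule DERIV_cmult)
  from has_derivative_triple[OF DERIV_const[of 0] this DERIV_ident]
  show "((\<lambda>t. (0, 16/45 * (t * min t 0), t) :: space) has_derivative (\<lambda>t. t *\<^sub>R (0, 0, 1))) (at (0 :: real))" by simp
  show "(0, 16/45 * (t * min t 0), t) \<in> swallowtail_surface" for t
  proof (cases "t < 0")
    case True
    then show ?thesis using swallowtail_surface_axisI[OF True] by (simp add: power2_eq_square)
  next
    case False
    then show ?thesis using sharksfin_in_swallowtail_surface[of t] by simp
  qed
qed simp

text \<open>Everywhere else there are two independent velocities: those in \<open>r\<close> and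
  \<open>c\<close> where \<open>r \<noteq> 0\<close>, and the directions of the a-axis and the
  c-axis at points \<open>(a, 0, 0)\<close>.\<close>

lemma cuspidal_edge_swallowtail_surfaceD:
  assumes "p \<in> cuspidal_edge swallowtail_surface"
  shows "p \<in> {sw_surface r c | r c. r \<noteq> 0 \<and> 5 * r\<^sup>2 = c}"
proof -
  note dep = curves_in_cuspidal_edge_dependent[OF assms]
  have "p \<in> swallowtail_surface" using cuspidal_edge_subset[OF assms] .
  then consider r c where "p = sw_surface r c" "r \<noteq> 0" | a where "p = (a, 0, 0)"
    unfolding swallowtail_surface_def by blast
  then show ?thesis
  proof cases
    case (1 r c)
    obtain u v w where c: "curve_in swallowtail_surface p (u, - (r / 2) * (5 * r\<^sup>2 - c), 0)" "curve_in swallowtail_surface p (v, w, 1)"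
      using swallowtail_surface_curves[OF 1(2), of c] unfolding 1(1)[symmetric] by blast
    obtain s t where "(s, t) \<noteq> (0, 0)" "s *\<^sub>R (u, - (r / 2) * (5 * r\<^sup>2 - c), 0) + t *\<^sub>R (v, w, 1) = (0 :: space)"
      using dep[OF c] by (elim exE conjE) (rule that)
    then have "5 * r\<^sup>2 = c" using 1(2) by (auto simp: zero_prod_def)
    then show ?thesis using 1 by blast
  next
    case (2 a)
    note c1 = swallowtail_surface_axis_curve1[of a, folded 2]
    show ?thesis
    proof (cases "a = 0")
      case True
      have c: "curve_in swallowtail_surface p (0, 0, 1)" using swallowtail_surface_origin_curve 2 True by simp
      obtain s t where "(s, t) \<noteq> (0, 0)" "s *\<^sub>R (1, 0, 0) + t *\<^sub>R (0, 0, 1) = (0 :: space)"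
        using dep[OF c1 c] by (elim exE conjE) (rule that)
      then show ?thesis by (simp add: zero_prod_def)
    next
      case False
      obtain s t where "(s, t) \<noteq> (0, 0)" "s *\<^sub>R (1, 0, 0) + t *\<^sub>R (0, 0, - 4) = (0 :: space)"
        using dep[OF c1 swallowtail_surface_axis_curve2[OF False, folded 2]] by (elim exE conjE) (rule that)
      then show ?thesis by (simp add: zero_prod_def)
    qed
  qed
qed

text \<open>For \<open>\<alpha> = c / 5\<close> put \<open>w = \<alpha> + (r\<^sup>2 - c) / 4\<close>. The equation for \<open>b\<close> becomes \<open>w\<^sup>2 = X\<close> with
  \<open>X = (2/5 * c\<^sup>2 - b) / 10\<close>, and \<open>a = 5 (\<alpha> - w) (\<alpha> + 3 w) / r\<close> with \<open>r\<^sup>2 = \<alpha> + 4 w\<close>. The linear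
  Taylor coefficient of \<open>a\<close> in \<open>w\<close> vanishes, so \<open>a = E (w\<^sup>2) + w\<^sup>3 * O (w\<^sup>2)\<close> with \<open>O 0 \<noteq> 0\<close>,
  where \<open>E\<close> and \<open>O\<close> are found by separating the even and odd part of
  \<open>1 / sqrt (\<alpha> + 4 w) = sqrt (\<alpha> - 4 w) / sqrt (\<alpha>\<^sup>2 - 16 w\<^sup>2)\<close>.\<close>

definition edge_D :: "real \<Rightarrow> real \<Rightarrow> real" where "edge_D \<alpha> X = sqrt (\<alpha>\<^sup>2 - 16 * X)"

text \<open>With \<open>X = w^2\<close>, \<open>edge_D\<close> is the product of
  \<open>sqrt (\<alpha> + 4 w)\<close> and \<open>sqrt (\<alpha> - 4 w)\<close>, and this is half
  their sum, the even part of \<open>sqrt (\<alpha> + 4 w)\<close>. The odd part is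
  \<open>2 * w / edge_e \<alpha> X\<close>.\<close>

definition edge_e :: "real \<Rightarrow> real \<Rightarrow> real" where "edge_e \<alpha> X = sqrt ((\<alpha> + edge_D \<alpha> X) / 2)"

definition edge_even :: "real \<Rightarrow> real \<Rightarrow> real" where
  "edge_even \<alpha> X = 5 / edge_D \<alpha> X * ((\<alpha>\<^sup>2 - 3 * X) * edge_e \<alpha> X - 4 * \<alpha> * X / edge_e \<alpha> X)"

definition edge_odd :: "real \<Rightarrow> real \<Rightarrow> real" where
  "edge_odd \<alpha> X = 5 * (6 - 16 * \<alpha> / (\<alpha> + edge_D \<alpha> X)) / (edge_e \<alpha> X * edge_D \<alpha> X)"

text \<open>The second condition makes the radicand of \<open>edge_D\<close> positive; the third
  makes \<open>edge_odd\<close> negative, so that it can be divided by.\<close>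

definition edge_region :: "real \<Rightarrow> real \<Rightarrow> bool" where
  "edge_region \<alpha> X \<longleftrightarrow> \<alpha> > 0 \<and> 16 * X < \<alpha>\<^sup>2 \<and> - \<alpha>\<^sup>2 < 9 * X"

lemma edge_regionD:
  assumes "edge_region \<alpha> X"
  shows "edge_D \<alpha> X > 0" "(edge_D \<alpha> X)\<^sup>2 = \<alpha>\<^sup>2 - 16 * X" "edge_e \<alpha> X > 0"
    "(edge_e \<alpha> X)\<^sup>2 = (\<alpha> + edge_D \<alpha> X) / 2" "edge_odd \<alpha> X < 0"
proof -
  note r = assms[unfolded edge_region_def]
  show D: "edge_D \<alpha> X > 0" "(edge_D \<alpha> X)\<^sup>2 = \<alpha>\<^sup>2 - 16 * X" using r by (simp_all add: edge_D_def)
  show e: "edge_e \<alpha> X > 0" "(edge_e \<alpha> X)\<^sup>2 = (\<alpha> + edge_D \<alpha> X) / 2" using r D by (simp_all add: edge_e_def)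
  have "(3 * edge_D \<alpha> X)\<^sup>2 < (5 * \<alpha>)\<^sup>2" using r unfolding power_mult_distrib D(2) by simp
  then have "3 * edge_D \<alpha> X < 5 * \<alpha>" by (rule power2_less_imp_less) (use r in simp)
  then have "6 - 16 * \<alpha> / (\<alpha> + edge_D \<alpha> X) < 0" using r D(1) by (simp add: field_simps)
  then show "edge_odd \<alpha> X < 0" unfolding edge_odd_def using D(1) e(1) by (simp add: divide_less_0_iff)
qed

lemma edge_expansion:
  assumes "edge_region \<alpha> (w\<^sup>2)"
  shows "\<alpha> + 4 * w > 0" "(\<alpha> - w) * (\<alpha> + 3 * w) > 0"
    "5 * (\<alpha> - w) * (\<alpha> + 3 * w) / sqrt (\<alpha> + 4 * w) = edge_even \<alpha> (w\<^sup>2) + w^3 * edge_odd \<alpha> (w\<^sup>2)"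
proof -
  define D e where "D = edge_D \<alpha> (w\<^sup>2)" and "e = edge_e \<alpha> (w\<^sup>2)"
  note r = assms[unfolded edge_region_def]
  note P = edge_regionD[OF assms, folded D_def e_def]
  have "(4 * w)\<^sup>2 < \<alpha>\<^sup>2" using r by (simp add: power_mult_distrib)
  then have w: "\<bar>4 * w\<bar> < \<alpha>" using r by (metis abs_of_pos abs_less_iff less_le_not_le linorder_not_le power2_abs power2_less_imp_less)
  then show p: "\<alpha> + 4 * w > 0" by auto
  show "(\<alpha> - w) * (\<alpha> + 3 * w) > 0" using w by (intro mult_pos_pos) auto
  define s where "s = sqrt (\<alpha> + 4 * w)"
  have s: "s > 0" "s\<^sup>2 = \<alpha> + 4 * w" using p by (simp_all add: s_def)
  have "(e + 2 * w / e)\<^sup>2 = e\<^sup>2 + 4 * w + 4 * w\<^sup>2 / e\<^sup>2" using P(3) by (simp add: power2_eq_square field_simps)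
  also have k2: "4 * w\<^sup>2 / e\<^sup>2 = (\<alpha> - D) / 2"
  proof -
    have "8 * w\<^sup>2 = (\<alpha> - D) * (\<alpha> + D) / 2" using P(2) by (simp add: algebra_simps power2_eq_square)
    then show ?thesis unfolding P(4) using P(1) r by (simp add: field_simps)
  qed
  also have "e\<^sup>2 + 4 * w + (\<alpha> - D) / 2 = s\<^sup>2" unfolding P(4) s(2) by (simp add: field_simps)
  finally have ss: "(e + 2 * w / e)\<^sup>2 = s\<^sup>2" .
  \<comment> \<open>Positivity selects the root \<open>s\<close> from the equation of
    squares.\<close>
  have "e * (e + 2 * w / e) = (\<alpha> + D) / 2 + 2 * w" using P(3,4) by (simp add: field_simps power2_eq_square)
  also have "\<dots> = ((\<alpha> + 4 * w) + D) / 2" by (simp add: field_simps)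
  also have "\<dots> > 0" using add_pos_pos[OF p P(1)] by (rule divide_pos_pos) simp
  finally have "e + 2 * w / e > 0" using P(3) by (simp add: zero_less_mult_iff)
  then have se: "s = e + 2 * w / e" using ss s(1) by (simp add: power2_eq_iff)
  have "s * (e - 2 * w / e) = e\<^sup>2 - 4 * w\<^sup>2 / e\<^sup>2" unfolding se using P(3) by (simp add: field_simps power2_eq_square)
  also have "\<dots> = D" unfolding k2 unfolding P(4) by (simp add: field_simps)
  finally have inv: "1 / s = (e - 2 * w / e) / D" using s(1) P(1) by (simp add: field_simps)
  have k: "6 - 16 * \<alpha> / (\<alpha> + D) = 6 - 8 * \<alpha> / e\<^sup>2" unfolding P(4) by simp
  have o: "edge_odd \<alpha> (w\<^sup>2) = 5 * (6 - 8 * \<alpha> / e\<^sup>2) / (e * D)"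
    unfolding edge_odd_def D_def[symmetric] e_def[symmetric] k ..
  \<comment> \<open>\<open>e^2\<close> is a root of \<open>z^2 - \<alpha> z + 4 w^2\<close>. This
    relation turns the odd part, which carries a visible factor \<open>w\<close> only, into a
    multiple of \<open>w^3\<close>.\<close>
  have q: "e^4 - \<alpha> * e\<^sup>2 + 4 * w\<^sup>2 = 0"
  proof -
    have "e^4 = ((\<alpha> + D) / 2)\<^sup>2" unfolding P(4)[symmetric] by (simp add: power_mult[symmetric])
    then show ?thesis unfolding P(4) using P(2) by (simp add: field_simps power2_eq_square)
  qed
  have w2: "w\<^sup>2 * (6 - 8 * \<alpha> / e\<^sup>2) = 2 * \<alpha> * e\<^sup>2 - 2 * (\<alpha>\<^sup>2 - 3 * w\<^sup>2)"
  proof -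
    have "w\<^sup>2 * (6 * e\<^sup>2 - 8 * \<alpha>) = (2 * \<alpha> * e\<^sup>2 - 2 * (\<alpha>\<^sup>2 - 3 * w\<^sup>2)) * e\<^sup>2" using q by algebra
    then show ?thesis using P(3) by (simp add: field_simps)
  qed
  have "w^3 * (5 * k / (e * D)) = 5 * w * (w\<^sup>2 * k) / (e * D)" for k
    by (simp add: power2_eq_square power3_eq_cube)
  then have odd: "w^3 * edge_odd \<alpha> (w\<^sup>2) = 5 * w * (2 * \<alpha> * e\<^sup>2 - 2 * (\<alpha>\<^sup>2 - 3 * w\<^sup>2)) / (e * D)"
    unfolding o w2[symmetric] .
  have "5 * (\<alpha> - w) * (\<alpha> + 3 * w) / s = 5 * (\<alpha> - w) * (\<alpha> + 3 * w) * ((e - 2 * w / e) / D)"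
    unfolding inv[symmetric] by simp
  also have "\<dots> = 5 / D * ((\<alpha>\<^sup>2 - 3 * w\<^sup>2) * e - 4 * \<alpha> * w\<^sup>2 / e) + 5 * w * (2 * \<alpha> * e\<^sup>2 - 2 * (\<alpha>\<^sup>2 - 3 * w\<^sup>2)) / (e * D)"
    using P(1,3) by (simp add: field_simps power2_eq_square)
  finally show "5 * (\<alpha> - w) * (\<alpha> + 3 * w) / sqrt (\<alpha> + 4 * w) = edge_even \<alpha> (w\<^sup>2) + w^3 * edge_odd \<alpha> (w\<^sup>2)"
    unfolding odd edge_even_def D_def[symmetric] e_def[symmetric] s_def[symmetric] .
qed

lemma smooth_on_edge:
  fixes f g :: "space \<Rightarrow> real"
  assumes "open S" "smooth_on S f" "smooth_on S g" "\<And>x. x \<in> S \<Longrightarrow> edge_region (f x) (g x)"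
  shows "smooth_on S (\<lambda>x. edge_even (f x) (g x))" "smooth_on S (\<lambda>x. edge_odd (f x) (g x))"
proof -
  have pos: "f x > 0" "(f x)\<^sup>2 - 16 * g x > 0" "edge_D (f x) (g x) > 0" "edge_e (f x) (g x) > 0" if "x \<in> S" for x
    using assms(4)[OF that] edge_regionD[OF assms(4)[OF that]] by (auto simp: edge_region_def)
  have D: "smooth_on S (\<lambda>x. edge_D (f x) (g x))"
    unfolding edge_D_def using pos by (intro smooth_intros assms)
  have e: "smooth_on S (\<lambda>x. edge_e (f x) (g x))"
    unfolding edge_e_def using pos D by (intro smooth_intros assms) (auto intro: add_pos_pos)
  show "smooth_on S (\<lambda>x. edge_even (f x) (g x))"
    unfolding edge_even_def using pos by (intro smooth_intros assms D e) (auto simp: less_imp_neq[THEN not_sym])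
  show "smooth_on S (\<lambda>x. edge_odd (f x) (g x))"
    unfolding edge_odd_def using pos
    by (intro smooth_intros assms D e) (auto simp: less_imp_neq[THEN not_sym] add_pos_pos)
qed

lemma diffeoI:
  assumes "open M" "open N" "smooth_on M \<phi>" "smooth_on N \<psi>"
    "\<And>x. x \<in> M \<Longrightarrow> \<phi> x \<in> N \<and> \<psi> (\<phi> x) = x" "\<And>y. y \<in> N \<Longrightarrow> \<psi> y \<in> M \<and> \<phi> (\<psi> y) = y"
  shows "diffeo M N \<phi> \<psi>"
proof -
  have "homeomorphism M N \<phi> \<psi>"
    using assms smooth_on_imp_continuous_on[OF assms(3)] smooth_on_imp_continuous_on[OF assms(4)]
    by (intro homeomorphismI) auto
  then show ?thesis using assms by (simp add: diffeo_def)
qed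

text \<open>The model coordinates are \<open>P = w^2\<close>, \<open>Q = w^3\<close> and a shift of
  \<open>c\<close>. The coordinate \<open>b\<close> determines \<open>P\<close>, and
  \<open>\<epsilon> * a\<close>, being the even part plus \<open>Q\<close> times the odd factor, can
  be solved for \<open>Q\<close> because that factor does not vanish; so \<open>\<psi>\<close> has
  the explicit inverse \<open>\<phi>\<close>.\<close>

lemma swallowtail_surface_cuspidal_edge:
  assumes r0: "r0 \<noteq> 0"
  shows "(5 * r0^3, 10 * r0^4, 5 * r0\<^sup>2) \<in> cuspidal_edge swallowtail_surface"
proof -
  define \<epsilon> where "\<epsilon> = sgn r0"
  have \<epsilon>: "\<epsilon> = 1 \<or> \<epsilon> = -1" "\<epsilon> * \<epsilon> = 1" "\<epsilon> * \<bar>r0\<bar> = r0" using r0 by (auto simp: \<epsilon>_def sgn_if)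
  define \<alpha> where "\<alpha> z = r0\<^sup>2 + z / 5" for z
  define \<psi> where "\<psi> w = (\<epsilon> * (edge_even (\<alpha> (snd (snd w))) (fst w) + fst (snd w) * edge_odd (\<alpha> (snd (snd w))) (fst w)),
    10 * (\<alpha> (snd (snd w)))\<^sup>2 - 10 * fst w, 5 * \<alpha> (snd (snd w)))" for w :: space
  define X where "X w = ((snd (snd w) / 5)\<^sup>2 - fst (snd w) / 10)" for w :: space
  define \<phi> where "\<phi> w = (X w, (\<epsilon> * fst w - edge_even (snd (snd w) / 5) (X w)) / edge_odd (snd (snd w) / 5) (X w),
    snd (snd w) - 5 * r0\<^sup>2)" for w :: space
  define M where "M = {w :: space. edge_region (\<alpha> (snd (snd w))) (fst w)}"
  define N where "N = {w :: space. edge_region (snd (snd w) / 5) (X w)}"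
  have oM: "open M" unfolding M_def edge_region_def \<alpha>_def
    by (intro open_Collect_conj open_Collect_less continuous_intros) auto
  have oN: "open N" unfolding N_def edge_region_def X_def
    by (intro open_Collect_conj open_Collect_less continuous_intros) auto
  have MD: "edge_region (\<alpha> (snd (snd w))) (fst w)" if "w \<in> M" for w using that by (simp add: M_def)
  have ND: "edge_region (snd (snd w) / 5) (X w)" if "w \<in> N" for w using that by (simp add: N_def)
  have sX: "smooth_on N X" unfolding X_def by (intro smooth_intros oN) simp_all
  have s\<alpha>: "smooth_on M (\<lambda>w. \<alpha> (snd (snd w)))" unfolding \<alpha>_def by (intro smooth_intros oM) simp_all
  have f1: "smooth_on M (\<lambda>w. fst w)" by (intro smooth_intros oM)
  have f2: "smooth_on N (\<lambda>w. snd (snd w) / 5)" by (intro smooth_intros oN) simp_all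
  note sM = smooth_on_edge[OF oM s\<alpha> f1 MD]
  note sN = smooth_on_edge[OF oN f2 sX ND]
  have "smooth_on M \<psi>" unfolding \<psi>_def by (intro smooth_intros oM sM s\<alpha>)
  moreover have "smooth_on N \<phi>" unfolding \<phi>_def
    by (intro smooth_intros oN sN sX) (use edge_regionD(5)[OF ND] in \<open>auto simp: less_imp_neq\<close>)
  moreover have "\<psi> w \<in> N \<and> \<phi> (\<psi> w) = w" if "w \<in> M" for w
  proof -
    have X: "X (\<psi> w) = fst w" by (simp add: X_def \<psi>_def diff_divide_distrib)
    have a: "snd (snd (\<psi> w)) / 5 = \<alpha> (snd (snd w))" by (simp add: \<psi>_def)
    have "edge_odd (\<alpha> (snd (snd w))) (fst w) \<noteq> 0" using edge_regionD(5)[OF MD[OF that]] by simp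
    moreover have "\<epsilon> * fst (\<psi> w) = edge_even (\<alpha> (snd (snd w))) (fst w) + fst (snd w) * edge_odd (\<alpha> (snd (snd w))) (fst w)"
      using \<epsilon>(2) by (simp add: \<psi>_def mult.assoc[symmetric])
    moreover have "snd (snd (\<psi> w)) - 5 * r0\<^sup>2 = snd (snd w)" by (simp add: \<psi>_def \<alpha>_def)
    ultimately have "\<phi> (\<psi> w) = w" unfolding \<phi>_def X a by (simp add: prod_eq_iff)
    then show ?thesis using that by (simp add: M_def N_def X a)
  qed
  moreover have "\<phi> w \<in> M \<and> \<psi> (\<phi> w) = w" if "w \<in> N" for w
  proof -
    have a: "\<alpha> (snd (snd (\<phi> w))) = snd (snd w) / 5" by (simp add: \<phi>_def \<alpha>_def field_simps)
    have X: "fst (\<phi> w) = X w" by (simp add: \<phi>_def)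
    have "fst (snd (\<phi> w)) * edge_odd (snd (snd w) / 5) (X w) = \<epsilon> * fst w - edge_even (snd (snd w) / 5) (X w)"
      using edge_regionD(5)[OF ND[OF that]] by (simp add: \<phi>_def)
    then have "\<psi> (\<phi> w) = (\<epsilon> * (\<epsilon> * fst w), 10 * (snd (snd w) / 5)\<^sup>2 - 10 * X w, 5 * (snd (snd w) / 5))"
      unfolding \<psi>_def a X by simp
    also have "\<dots> = w" using \<epsilon>(2) by (simp add: X_def prod_eq_iff mult.assoc[symmetric])
    finally show ?thesis using that by (simp add: M_def N_def X a)
  qed
  ultimately have d: "diffeo M N \<psi> \<phi>" by (intro diffeoI oM oN) auto
  have base: "edge_region (r0\<^sup>2) 0" using r0 by (simp add: edge_region_def)
  \<comment> \<open>\<open>\<epsilon> * a > 0\<close> forces \<open>r\<close> to have the sign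
    \<open>\<epsilon>\<close> of \<open>r0\<close>, which selects one of the two roots of
    \<open>r^2 = \<alpha> + 4 w\<close>.\<close>
  define M' where "M' = N \<inter> {w. \<epsilon> * fst w > 0}"
  have oM': "open M'" unfolding M'_def by (intro open_Int oN open_Collect_less continuous_intros)
  note d' = diffeo_sym[OF diffeo_subset[OF diffeo_sym[OF d] oM']]
  have M'N: "M' \<subseteq> N" by (auto simp: M'_def)
  have even0: "edge_even (r0\<^sup>2) 0 = 5 * \<bar>r0\<bar>^3"
  proof -
    have "edge_even (r0\<^sup>2) 0 = 5 * r0\<^sup>2 * r0\<^sup>2 / \<bar>r0\<bar>"
      using edge_expansion(3)[of "r0\<^sup>2" 0] base by simp
    also have "\<dots> = 5 * (\<bar>r0\<bar>\<^sup>2 * \<bar>r0\<bar>\<^sup>2) / \<bar>r0\<bar>" by (simp only: power2_abs mult.assoc)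
    also have "\<dots> = 5 * \<bar>r0\<bar>^3"
      using r0 by (simp only: power2_eq_square power3_eq_cube) (simp del: abs_mult_self_eq)
    finally show ?thesis .
  qed
  have \<psi>0: "\<psi> 0 = (5 * r0^3, 10 * r0^4, 5 * r0\<^sup>2)"
  proof -
    have "\<epsilon> * (5 * \<bar>r0\<bar>^3) = 5 * r0^3" using \<epsilon>(1,3) by auto
    then show ?thesis by (simp add: \<psi>_def \<alpha>_def even0 power_mult[symmetric])
  qed
  have "0 \<in> M" using base by (simp add: M_def \<alpha>_def)
  then have N0: "\<psi> 0 \<in> N" "\<phi> (\<psi> 0) = 0" using diffeo_apply[OF d] by blast+
  have "\<epsilon> * fst (\<psi> 0) > 0" using \<epsilon>(1,3) r0 unfolding \<psi>0 by (auto simp: zero_less_mult_iff)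
  then have "\<psi> 0 \<in> M'" using N0 by (simp add: M'_def)
  then have M0: "0 \<in> \<phi> ` M'" using N0(2) by (metis imageI)
  show ?thesis unfolding cuspidal_edge_iff
  proof (rule germ_diffeomorphicI[OF d'[OF M'N] M0 \<psi>0])
    show "\<forall>w\<in>\<phi> ` M'. \<psi> w \<in> swallowtail_surface \<longleftrightarrow> w \<in> standard_cuspidal_edge"
    proof
      fix v assume "v \<in> \<phi> ` M'"
      then have v: "v \<in> M" "\<epsilon> * fst (\<psi> v) > 0" 
        using diffeo_apply[OF diffeo_sym[OF d]] by (auto simp: M'_def)
      obtain P Q Z where vv: "v = (P, Q, Z)" by (cases v)
      define A where "A = \<alpha> Z"
      have reg: "edge_region A P" using MD[OF v(1)] by (simp add: vv A_def)
      then have A: "A > 0" by (simp add: edge_region_def)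
      obtain a where a: "a = \<epsilon> * (edge_even A P + Q * edge_odd A P)" by blast
      have \<psi>v: "\<psi> v = (a, 10 * A\<^sup>2 - 10 * P, 5 * A)" by (simp add: \<psi>_def vv A_def a)
      have a0: "\<epsilon> * a > 0" using v(2) by (simp add: \<psi>v)
      have \<epsilon>a: "\<epsilon> * a = edge_even A P + Q * edge_odd A P" unfolding a using \<epsilon>(2) by (simp add: mult.assoc[symmetric])
      have "\<psi> v \<in> swallowtail_surface \<longleftrightarrow> (\<exists>w. w\<^sup>2 = P \<and> w^3 = Q)"
        unfolding \<psi>v swallowtail_surface_iff
      proof
        assume "\<exists>r. 10 * A\<^sup>2 - 10 * P = - 2 * ((r\<^sup>2 - 5 * A) / 4) * (2 * (5 * A) + 5 * ((r\<^sup>2 - 5 * A) / 4)) \<and>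
          a * r = - ((r\<^sup>2 - 5 * A) / 4) * (4 * (5 * A) + 15 * ((r\<^sup>2 - 5 * A) / 4))"
        then obtain r where r: "10 * A\<^sup>2 - 10 * P = - 2 * ((r\<^sup>2 - 5 * A) / 4) * (2 * (5 * A) + 5 * ((r\<^sup>2 - 5 * A) / 4))"
          "a * r = - ((r\<^sup>2 - 5 * A) / 4) * (4 * (5 * A) + 15 * ((r\<^sup>2 - 5 * A) / 4))" by blast
        define w where "w = A + (r\<^sup>2 - 5 * A) / 4"
        have p: "(r\<^sup>2 - 5 * A) / 4 = w - A" by (simp add: w_def)
        have r2: "r\<^sup>2 = A + 4 * w" by (simp add: w_def field_simps)
        have w2: "w\<^sup>2 = P" using r(1) unfolding p by (simp add: algebra_simps power2_eq_square)
        note ee = edge_expansion[OF reg[folded w2]]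
        have ar: "a * r = 5 * ((A - w) * (A + 3 * w))" using r(2) unfolding p by (simp add: algebra_simps)
        then have "a * r > 0" using ee(2) by simp
        then have "(\<epsilon> * a) * (\<epsilon> * r) > 0" using \<epsilon>(1) by auto
        then have "\<epsilon> * r > 0" using a0 by (simp add: zero_less_mult_iff)
        then have rs: "\<epsilon> * r = sqrt (A + 4 * w)" using \<epsilon>(1) unfolding r2[symmetric] by auto
        have "(\<epsilon> * a) * (\<epsilon> * r) = 5 * (A - w) * (A + 3 * w)" using ar \<epsilon>(1) by auto
        then have "\<epsilon> * a = 5 * (A - w) * (A + 3 * w) / sqrt (A + 4 * w)" unfolding rs using ee(1) by (simp add: field_simps)
        then have "Q * edge_odd A P = w^3 * edge_odd A P" unfolding ee(3) \<epsilon>a w2 by simp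
        then have "w^3 = Q" using edge_regionD(5)[OF reg] by simp
        then show "\<exists>w. w\<^sup>2 = P \<and> w^3 = Q" using w2 by blast
      next
        assume "\<exists>w. w\<^sup>2 = P \<and> w^3 = Q"
        then obtain w where w: "w\<^sup>2 = P" "w^3 = Q" by blast
        note ee = edge_expansion[OF reg[folded w(1)]]
        define r where "r = \<epsilon> * sqrt (A + 4 * w)"
        have r2: "r\<^sup>2 = A + 4 * w" using ee(1) \<epsilon>(1) by (auto simp: r_def power_mult_distrib)
        have p: "(r\<^sup>2 - 5 * A) / 4 = w - A" unfolding r2 by simp
        have "\<epsilon> * a = 5 * (A - w) * (A + 3 * w) / sqrt (A + 4 * w)" unfolding ee(3) \<epsilon>a using w by simp
        then have "\<epsilon> * a * sqrt (A + 4 * w) = 5 * (A - w) * (A + 3 * w)" using ee(1) by (simp add: field_simps)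
        then have ar: "a * r = 5 * (A - w) * (A + 3 * w)" unfolding r_def by (simp add: mult_ac)
        show "\<exists>r. 10 * A\<^sup>2 - 10 * P = - 2 * ((r\<^sup>2 - 5 * A) / 4) * (2 * (5 * A) + 5 * ((r\<^sup>2 - 5 * A) / 4)) \<and>
          a * r = - ((r\<^sup>2 - 5 * A) / 4) * (4 * (5 * A) + 15 * ((r\<^sup>2 - 5 * A) / 4))"
          by (intro exI[of _ r], unfold p ar w(1)[symmetric]) (simp add: algebra_simps power2_eq_square)
      qed
      also have "\<dots> \<longleftrightarrow> v \<in> standard_cuspidal_edge" unfolding vv standard_cuspidal_edge_def by auto
      finally show "\<psi> v \<in> swallowtail_surface \<longleftrightarrow> v \<in> standard_cuspidal_edge" .
    qed
  qed
qed

section \<open>Local transfer to the loci and conclusion\<close>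

lemma sharksfin_locus_eq:
  assumes "(0, 0) \<in> U"
  shows "sharksfin_locus U = {(0, 0, c) | c. c > 0}"
proof (intro equalityI subsetI)
  fix w assume "w \<in> sharksfin_locus U"
  then obtain a b c x y where "w = (a, b, c)" "sharksfin_pt (G a b c) (x, y)" by (rule locusE)
  then show "w \<in> {(0, 0, c) | c. c > 0}" using sharksfin_pt_imp[of a b c "(x, y)"] by simp
next
  fix w :: space assume "w \<in> {(0, 0, c) | c. c > 0}"
  then show "w \<in> sharksfin_locus U" using sharksfin_pt_G assms by (auto simp: locus_def)
qed

lemma deltoid_locus_eq:
  assumes "(0, 0) \<in> U"
  shows "deltoid_locus U = {(0, 0, c) | c. c < 0}"
proof (intro equalityI subsetI)
  fix w assume "w \<in> deltoid_locus U"
  then obtain a b c x y where "w = (a, b, c)" "deltoid_pt (G a b c) (x, y)" by (rule locusE)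
  then show "w \<in> {(0, 0, c) | c. c < 0}" using deltoid_pt_imp[of a b c "(x, y)"] by simp
next
  fix w :: space assume "w \<in> {(0, 0, c) | c. c < 0}"
  then show "w \<in> deltoid_locus U" using deltoid_pt_G assms by (auto simp: locus_def)
qed

lemma cuspidal_edge_local:
  assumes "open V" "S \<inter> V = S' \<inter> V"
  shows "cuspidal_edge S \<inter> V = cuspidal_edge S' \<inter> V"
proof (intro set_eqI)
  fix p show "p \<in> cuspidal_edge S \<inter> V \<longleftrightarrow> p \<in> cuspidal_edge S' \<inter> V"
    using germ_diffeomorphic_cong[OF assms(1) _ assms(2), of p] unfolding cuspidal_edge_def Int_iff mem_Collect_eq by blast
qed

lemma double_point_curve_local:
  assumes "open V" "S \<inter> V = S' \<inter> V"
  shows "double_point_curve S \<inter> V = double_point_curve S' \<inter> V"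
proof (intro set_eqI)
  fix p show "p \<in> double_point_curve S \<inter> V \<longleftrightarrow> p \<in> double_point_curve S' \<inter> V"
    using germ_diffeomorphic_cong[OF assms(1) _ assms(2), of p] unfolding double_point_curve_def Int_iff mem_Collect_eq by blast
qed

lemma cuspidal_edge_swallowtail_surface:
  "cuspidal_edge swallowtail_surface = {sw_surface r c | r c. r \<noteq> 0 \<and> 5 * r\<^sup>2 = c}"
proof (intro equalityI subsetI)
  fix p assume "p \<in> cuspidal_edge swallowtail_surface"
  then show "p \<in> {sw_surface r c | r c. r \<noteq> 0 \<and> 5 * r\<^sup>2 = c}" by (rule cuspidal_edge_swallowtail_surfaceD)
next
  fix p assume "p \<in> {sw_surface r c | r c. r \<noteq> 0 \<and> 5 * r\<^sup>2 = c}"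
  then obtain r where "p = sw_surface r (5 * r\<^sup>2)" "r \<noteq> 0" by blast
  then show "p \<in> cuspidal_edge swallowtail_surface"
    using swallowtail_surface_cuspidal_edge butterfly_curve_point by simp
qed

text \<open>The parabolic arcs \<open>(0, k * c^2, c)\<close>, \<open>c < 0\<close>, end at the
  origin and enter \<open>V\<close>, where each locus closure coincides with its surface.\<close>

lemma origin_in_closure_Diff:
  fixes V :: "space set"
  assumes V: "open V" "(0, 0, 0) \<in> V"
    and eq: "S \<inter> V = T \<inter> V" "S' \<inter> V = T' \<inter> V" "S'' \<inter> V = T'' \<inter> V"
    and mem: "\<And>c. c < 0 \<Longrightarrow> (0, k * c\<^sup>2, c) \<in> T - (T' \<union> T'')"
  shows "(0, 0, 0) \<in> closure (S - (S' \<union> S''))"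
proof -
  let ?f = "\<lambda>c. (0, k * c\<^sup>2, c) :: space"
  have "(?f \<longlongrightarrow> ?f 0) (at_left 0)" by (intro tendsto_intros)
  then have l: "(?f \<longlongrightarrow> (0, 0, 0)) (at_left 0)" by simp
  have "eventually (\<lambda>c. ?f c \<in> V) (at_left 0)" by (rule topological_tendstoD[OF l V])
  moreover have "eventually (\<lambda>c :: real. c < 0) (at_left 0)" by (simp add: eventually_at_filter)
  ultimately have "eventually (\<lambda>c. ?f c \<in> S - (S' \<union> S'')) (at_left 0)"
  proof eventually_elim
    case (elim c)
    then show ?case using mem[OF elim(2)] eq by blast
  qed
  then show ?thesis by (intro tendsto_in_closure[OF l]) auto
qed

theorem theorem3p1:
  fixes U :: "plane set"
  assumes "open U" and "(0, 0) \<in> U"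
  defines "S_bl \<equiv> closure (beaks_lips_locus U)"
    and "S_sw \<equiv> closure (swallowtail_locus U)"
    and "S_cf \<equiv> closure (cusp_fold_locus U)"
  shows "\<exists>V::space set. open V \<and> (0, 0, 0) \<in> V \<and>
    \<comment> \<open>the bifurcation diagram and its three components\<close>
    bifurcation_diagram U \<inter> V = (S_bl \<union> S_sw \<union> S_cf \<union> deltoid_locus U) \<inter> V \<and>
    (0, 0, 0) \<in> closure (S_bl - (S_sw \<union> S_cf)) \<and>
    (0, 0, 0) \<in> closure (S_sw - (S_bl \<union> S_cf)) \<and>
    (0, 0, 0) \<in> closure (S_cf - (S_bl \<union> S_sw)) \<and>
    \<comment> \<open>sharksfin\<close>
    sharksfin_locus U \<inter> V = {(0, 0, c) | c. c > 0} \<inter> V \<and>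
    \<comment> \<open>deltoid\<close>
    deltoid_locus U \<inter> V = {(0, 0, c) | c. c < 0} \<inter> V \<and>
    \<comment> \<open>beaks/lips\<close>
    S_bl \<inter> V = beaks_lips_param \<inter> V \<and>
    beaks_lips_locus U \<inter> V =
      (beaks_lips_param - (sharksfin_locus U \<union> goose_locus U \<union> {(0, 0, 0)})) \<inter> V \<and>
    has_A3_singularity S_bl (0, 0, 0) \<and>
    double_point_curve S_bl \<inter> V = sharksfin_locus U \<inter> V \<and>
    \<comment> \<open>goose\<close>
    goose_locus U \<inter> V = cuspidal_edge S_bl \<inter> V \<and>
    goose_locus U \<inter> V =
      {(\<epsilon> * (8 / (9 * sqrt 3) * c powr (3/2)), 4/9 * c^2, c) | \<epsilon> c. \<epsilon> \<in> {1, -1} \<and> c > 0} \<inter> V \<and>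
    \<comment> \<open>swallowtail\<close>
    S_sw \<inter> V = closure swallowtail_param \<inter> V \<and>
    swallowtail_locus U \<inter> V =
      (closure swallowtail_param - (sharksfin_locus U \<union> butterfly_locus U \<union> {(0, 0, 0)})) \<inter> V \<and>
    {(a, 0, 0) | a. True} \<inter> V \<subseteq> S_sw \<and>
    sharksfin_locus U \<inter> V \<subseteq> S_sw \<and>
    \<comment> \<open>butterfly\<close>
    butterfly_locus U \<inter> V = cuspidal_edge S_sw \<inter> V \<and>
    butterfly_locus U \<inter> V =
      {(\<epsilon> * (1 / sqrt 5 * c powr (3/2)), 2/5 * c^2, c) | \<epsilon> c. \<epsilon> \<in> {1, -1} \<and> c > 0} \<inter> V \<and>
    \<comment> \<open>cusp+fold\<close>
    S_cf \<inter> V = closure cusp_fold_param \<inter> V \<and>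
    cusp_fold_locus U \<inter> V =
      (closure cusp_fold_param - (butterfly_locus U \<union> beaks_fold_locus U \<union> {(0, 0, 0)})) \<inter> V \<and>
    has_A3_singularity S_cf (0, 0, 0) \<and>
    cuspidal_edge S_cf \<inter> V = butterfly_locus U \<inter> V"
proof -
  \<comment> \<open>Inside this neighbourhood each locus is the trace of a fixed surface or curve.
    The claims hold for these globally and pass to \<open>V\<close> because closures and set germs
    are local.\<close>
  obtain V where conf: "confines U V" using confines_exists[OF assms(1,2)] .
  have V: "open V" "(0, 0, 0) \<in> V" using conf by (simp_all add: confines_def)
  note sf = sharksfin_locus_eq[OF assms(2)] and dl = deltoid_locus_eq[OF assms(2)]
  note gs = goose_locus_eq[OF conf] and bt = butterfly_locus_eq[OF conf] and bf = beaks_fold_locus_eq[OF conf]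
  have bl: "S_bl \<inter> V = beaks_lips_surface \<inter> V"
    using closure_Int_open_cong[OF V(1) beaks_lips_locus_eq[OF conf]] unfolding assms(3) closure_beaks_lips .
  have sw: "S_sw \<inter> V = swallowtail_surface \<inter> V"
    using closure_Int_open_cong[OF V(1) swallowtail_locus_eq[OF conf]] unfolding assms(4) closure_swallowtail .
  have cf: "S_cf \<inter> V = cusp_fold_surface \<inter> V"
    using closure_Int_open_cong[OF V(1) cusp_fold_locus_eq[OF conf]] unfolding assms(5) closure_cusp_fold .
  have strata: "L \<inter> V = (S - (A \<union> B' \<union> Z)) \<inter> V" if "L \<inter> V = X \<inter> V" "X = S - (A \<union> B \<union> Z)" "B' \<inter> V = B \<inter> V"
    for L X S A B B' Z :: "space set"
    using that by blast
  show ?thesis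
  proof (intro exI[of _ V] conjI)
    show "bifurcation_diagram U \<inter> V = (S_bl \<union> S_sw \<union> S_cf \<union> deltoid_locus U) \<inter> V"
      unfolding bifurcation_diagram_eq[OF conf] Int_Un_distrib2 bl sw cf dl beaks_lips_surface_def
        swallowtail_surface_def cusp_fold_surface_def ..
    show "(0, 0, 0) \<in> closure (S_bl - (S_sw \<union> S_cf))"
      by (rule origin_in_closure_Diff[OF V bl sw cf, of "1/3"]) (use surfaces_axis(1) in simp)
    show "(0, 0, 0) \<in> closure (S_sw - (S_bl \<union> S_cf))"
      by (rule origin_in_closure_Diff[OF V sw bl cf surfaces_axis(2)])
    show "(0, 0, 0) \<in> closure (S_cf - (S_bl \<union> S_sw))"
      by (rule origin_in_closure_Diff[OF V cf bl sw, of "1/4"]) (use surfaces_axis(3) in simp)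
    show "S_bl \<inter> V = beaks_lips_param \<inter> V" unfolding bl beaks_lips_param_eq ..
    show "beaks_lips_locus U \<inter> V = (beaks_lips_param - (sharksfin_locus U \<union> goose_locus U \<union> {(0, 0, 0)})) \<inter> V"
      unfolding beaks_lips_param_eq sf by (rule strata[OF beaks_lips_locus_eq[OF conf] beaks_lips_strata gs])
    show "has_A3_singularity S_bl (0, 0, 0)"
      using beaks_lips_surface_A3 unfolding has_A3_singularity_iff germ_diffeomorphic_cong[OF V bl] .
    show "double_point_curve S_bl \<inter> V = sharksfin_locus U \<inter> V"
      unfolding double_point_curve_local[OF V(1) bl] double_point_curve_beaks_lips_surface sf ..
    show "goose_locus U \<inter> V = cuspidal_edge S_bl \<inter> V"
      unfolding cuspidal_edge_local[OF V(1) bl] cuspidal_edge_beaks_lips_surface gs ..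
    show "goose_locus U \<inter> V =
        {(\<epsilon> * (8 / (9 * sqrt 3) * c powr (3/2)), 4/9 * c^2, c) | \<epsilon> c. \<epsilon> \<in> {1, -1} \<and> c > 0} \<inter> V"
      unfolding goose_param_eq gs ..
    show "S_sw \<inter> V = closure swallowtail_param \<inter> V" unfolding closure_swallowtail_param sw ..
    show "swallowtail_locus U \<inter> V =
        (closure swallowtail_param - (sharksfin_locus U \<union> butterfly_locus U \<union> {(0, 0, 0)})) \<inter> V"
      unfolding closure_swallowtail_param sf by (rule strata[OF swallowtail_locus_eq[OF conf] swallowtail_strata bt])
    have "{(a, 0, 0) | a. True} \<subseteq> swallowtail_surface" unfolding swallowtail_surface_def by blast
    then show "{(a, 0, 0) | a. True} \<inter> V \<subseteq> S_sw" using sw by blast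
    have "sharksfin_locus U \<subseteq> swallowtail_surface"
      unfolding sf using sharksfin_in_swallowtail_surface by auto
    then show "sharksfin_locus U \<inter> V \<subseteq> S_sw" using sw by blast
    show "butterfly_locus U \<inter> V = cuspidal_edge S_sw \<inter> V"
      unfolding cuspidal_edge_local[OF V(1) sw] cuspidal_edge_swallowtail_surface bt ..
    show "butterfly_locus U \<inter> V =
        {(\<epsilon> * (1 / sqrt 5 * c powr (3/2)), 2/5 * c^2, c) | \<epsilon> c. \<epsilon> \<in> {1, -1} \<and> c > 0} \<inter> V"
      unfolding butterfly_param_eq bt ..
    show "S_cf \<inter> V = closure cusp_fold_param \<inter> V" unfolding closure_cusp_fold_param cf ..
    have "butterfly_locus U \<inter> V \<union> beaks_fold_locus U \<inter> V =
        {sw_surface r c | r c. r \<noteq> 0 \<and> 5 * r\<^sup>2 = c} \<inter> V \<union> {cf_surface s c | s c. s \<noteq> 0 \<and> c = 7 * s\<^sup>2} \<inter> V"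
      unfolding bt bf ..
    then show "cusp_fold_locus U \<inter> V =
        (closure cusp_fold_param - (butterfly_locus U \<union> beaks_fold_locus U \<union> {(0, 0, 0)})) \<inter> V"
      unfolding closure_cusp_fold_param cusp_fold_locus_eq[OF conf] cusp_fold_strata by blast
    show "has_A3_singularity S_cf (0, 0, 0)"
      using cusp_fold_surface_A3 unfolding has_A3_singularity_iff germ_diffeomorphic_cong[OF V cf] .
    show "cuspidal_edge S_cf \<inter> V = butterfly_locus U \<inter> V"
      unfolding cuspidal_edge_local[OF V(1) cf] cuspidal_edge_cusp_fold_surface bt ..
  qed (use V sf dl in simp_all)
qed

end
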